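(* Let $L=L_K(E)$ be the Leavitt path algebra of an arbitrary graph $E$ over an arbitrary field $K$, and let $I$ be a proper ideal of $L$. Then $I$ is completely irreducible if and only if exactly one of the following conditions holds. (1) $I=I(H,S)$ is a graded ideal (for some admissible pair $(H,S)$), the graph $E\backslash(H,S)$ satisfies condition (L), and $(E\backslash(H,S))^0$ is downward directed and satisfies the strong CSP. (In this case $I$ is prime.) (2) $I=P^n$ for some non-graded prime ideal $P$ of $L$ and some positive integer $n$.
   Context: A graph $E=(E^0,E^1,r,s)$ is a directed graph: a nonempty set $E^0$ of vertices, a set $E^1$ of edges, and range and source maps $r,s:E^1\to E^0$ (no finiteness or countability assumptions). A vertex $v$ is regular if $s^{-1}(v)$ is finite and nonempty, and an infinite emitter if $s^{-1}(v)$ is infinite. For a field $K$, the Leavitt path algebra $L_K(E)$ is the (associative, not necessarily unital) $K$-algebra generated by $\{v\mid v\in E^0\}\cup\{e,e^*\mid e\in E^1\}$ subject to: $vw=\delta_{v,w}v$ for $v,w\in E^0$; $s(e)e=er(e)=e$ and $r(e)e^*=e^*s(e)=e^*$ for $e\in E^1$; $e^*f=\delta_{e,f}r(e)$ for $e,f\in E^1$; and $v=\sum_{e\in s^{-1}(v)}ee^*$ for every regular $v\in E^0$. A path is a finite sequence $\mu=e_1\cdots e_n$ of edges with $r(e_i)=s(e_{i+1})$; $s(\mu)=s(e_1)$, $r(\mu)=r(e_n)$, $|\mu|=n$; vertices are paths of length $0$; $\mu^*=e_n^*\cdots e_1^*$. $L$ is $\mathbb Z$-graded with $L_n$ the $K$-span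 of the elements $\mu\nu^*$ with $\mu,\nu$ paths and $|\mu|-|\nu|=n$; an ideal $I$ is graded if $I=\bigoplus_n(I\cap L_n)$. A cycle is a closed path $e_1\cdots e_n$ ($n\ge1$, $r(e_n)=s(e_1)$) with $s(e_i)\neq s(e_j)$ for $i\ne j$. An exit for $e_1\cdots e_n$ is an edge $f\notin\{e_1,\dots,e_n\}$ with $s(f)=s(e_i)$ for some $i$. A graph satisfies condition (L) if every cycle in it has an exit. Write $u\ge v$ if there is a path (possibly of length $0$) from $u$ to $v$. A set $X$ of vertices is downward directed if it is nonempty and for all $u,v\in X$ there is $w\in X$ with $u\ge w$ and $v\ge w$; hereditary if $u\in X$ and $u\ge v$ imply $v\in X$; saturated if for every regular vertex $v$, $r(s^{-1}(v))\subseteq X$ implies $v\in X$. For $H\subseteq E^0$ hereditary and saturated, the set $B_H$ of breaking vertices consists of the infinite emitters $v\in E^0\setminus H$ with $0<|s^{-1}(v)\cap r^{-1}(E^0\setminus H)|<\aleph_0$; for $v\in B_H$ put $v^H=v-\sum_{s(e)=v,\,r(e)\notin H}ee^*$. An admissible pair is $(H,S)$ with $H$ hereditary saturated and $S\subseteq B_H$; $I(H,S)$ is the ideal of $L$ generated by $H\cup\{v^H\mid v\in S\}$. The quotient graph $E\backslash(H,S)$ has vertex set $(E^0\setminus H)\cup\{v'\mid v\in B_H\setminus S\}$ and edge set $\{e\in E^1\mid r(e)\notin H\}\cup\{e'\mid e\in E^1,\ r(e)\in B_H\setminus S\}$ (the $v'$, $e'$ being new symbols), with $r,s$ as in $E$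 on the old edges and $s(e')=s(e)$, $r(e')=r(e)'$. A nonempty set $X$ of vertices of a graph $F$ satisfies the countable separation property (CSP) with respect to a countable subset $T\subseteq X$ if for every $u\in X$ there is $v\in T$ with $u\ge v$. $X$ satisfies the strong CSP if it satisfies the CSP with respect to some countable $T\subseteq X$ that is contained in every nonempty hereditary saturated subset of $X$ (hereditary and saturated as subsets of $F^0$). For $X=(E\backslash(H,S))^0$ the graph $F$ is $E\backslash(H,S)$. "Ideal" means two-sided ideal; products of ideals consist of finite sums of products. A prime ideal is a proper ideal $P$ such that $IJ\subseteq P$ implies $I\subseteq P$ or $J\subseteq P$ for all ideals $I,J$. A proper ideal $I$ is completely irreducible if it is not the intersection of any set of ideals properly containing $I$. *)

theory Defs
  imports
    "HOL-Library.Poly_Mapping"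
    "HOL-Library.Countable_Set"
    "HOL-Algebra.QuotRing"
    "HOL-Algebra.Ideal_Product"
    "HOL-Algebra.Module"
    "Graph_Theory.Arc_Walk"
begin

section \<open>Directed graphs\<close>

text \<open>
  A graph \<open>(E\<^sup>0, E\<^sup>1, r, s)\<close> is a \<^typ>\<open>('v, 'e) pre_digraph\<close> satisfying \<^locale>\<open>wf_digraph\<close>:
  source is \<^const>\<open>tail\<close>, range is \<^const>\<open>head\<close>, and no finiteness is imposed. A path from \<open>u\<close>
  to \<open>v\<close> is a list of edges \<open>p\<close> with \<open>pre_digraph.awalk E u p v\<close>; for \<open>p = []\<close> it is the
  vertex \<open>u = v\<close>.
\<close>

definition regular_vertex :: "('v, 'e) pre_digraph \<Rightarrow> 'v \<Rightarrow> bool" where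
  "regular_vertex E v \<longleftrightarrow> v \<in> verts E \<and> finite (out_arcs E v) \<and> out_arcs E v \<noteq> {}"

definition infinite_emitter :: "('v, 'e) pre_digraph \<Rightarrow> 'v \<Rightarrow> bool" where
  "infinite_emitter E v \<longleftrightarrow> v \<in> verts E \<and> infinite (out_arcs E v)"

definition vertex_ge :: "('v, 'e) pre_digraph \<Rightarrow> 'v \<Rightarrow> 'v \<Rightarrow> bool" where
  "vertex_ge E u v \<longleftrightarrow> (\<exists>p. pre_digraph.awalk E u p v)"

definition exit_of :: "('v, 'e) pre_digraph \<Rightarrow> 'e list \<Rightarrow> 'e \<Rightarrow> bool" where
  "exit_of E p f \<longleftrightarrow> f \<in> arcs E \<and> f \<notin> set p \<and> (\<exists>e\<in>set p. tail E f = tail E e)"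

text \<open>
  \<^const>\<open>pre_digraph.cycle\<close> asks that the ranges of the edges of a nonempty closed walk be
  distinct; up to a cyclic shift these are its sources.
\<close>

definition condition_L :: "('v, 'e) pre_digraph \<Rightarrow> bool" where
  "condition_L E \<longleftrightarrow> (\<forall>p. pre_digraph.cycle E p \<longrightarrow> (\<exists>f. exit_of E p f))"

definition downward_directed :: "('v, 'e) pre_digraph \<Rightarrow> 'v set \<Rightarrow> bool" where
  "downward_directed E X \<longleftrightarrow>
     X \<noteq> {} \<and> (\<forall>u\<in>X. \<forall>v\<in>X. \<exists>w\<in>X. vertex_ge E u w \<and> vertex_ge E v w)"

definition hereditary :: "('v, 'e) pre_digraph \<Rightarrow> 'v set \<Rightarrow> bool" where
  "hereditary E X \<longleftrightarrow> X \<subseteq> verts E \<and> (\<forall>u v. u \<in> X \<and> vertex_ge E u v \<longrightarrow> v \<in> X)"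

definition saturated :: "('v, 'e) pre_digraph \<Rightarrow> 'v set \<Rightarrow> bool" where
  "saturated E X \<longleftrightarrow>
     X \<subseteq> verts E \<and> (\<forall>v. regular_vertex E v \<and> head E ` out_arcs E v \<subseteq> X \<longrightarrow> v \<in> X)"

definition CSP_wrt :: "('v, 'e) pre_digraph \<Rightarrow> 'v set \<Rightarrow> 'v set \<Rightarrow> bool" where
  "CSP_wrt E X T \<longleftrightarrow> T \<subseteq> X \<and> countable T \<and> (\<forall>u\<in>X. \<exists>v\<in>T. vertex_ge E u v)"

definition strong_CSP :: "('v, 'e) pre_digraph \<Rightarrow> 'v set \<Rightarrow> bool" where
  "strong_CSP E X \<longleftrightarrow> X \<noteq> {} \<and>
     (\<exists>T. CSP_wrt E X T \<and>
        (\<forall>Y. Y \<noteq> {} \<and> Y \<subseteq> X \<and> hereditary E Y \<and> saturated E Y \<longrightarrow> T \<subseteq> Y))"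

definition breaking_vertices :: "('v, 'e) pre_digraph \<Rightarrow> 'v set \<Rightarrow> 'v set" where
  "breaking_vertices E H =
     {v \<in> verts E - H. infinite_emitter E v \<and>
        finite {e \<in> out_arcs E v. head E e \<notin> H} \<and> {e \<in> out_arcs E v. head E e \<notin> H} \<noteq> {}}"

definition admissible_pair :: "('v, 'e) pre_digraph \<Rightarrow> 'v set \<Rightarrow> 'v set \<Rightarrow> bool" where
  "admissible_pair E H S \<longleftrightarrow> hereditary E H \<and> saturated E H \<and> S \<subseteq> breaking_vertices E H"

text \<open>\<open>Inl\<close> tags the old vertices and edges, \<open>Inr\<close> the new symbols \<open>v'\<close> and \<open>e'\<close>.\<close>

definition quotient_graph ::
  "('v, 'e) pre_digraph \<Rightarrow> 'v set \<Rightarrow> 'v set \<Rightarrow> ('v + 'v, 'e + 'e) pre_digraph" where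
  "quotient_graph E H S =
     \<lparr> verts = Inl ` (verts E - H) \<union> Inr ` (breaking_vertices E H - S),
       arcs = Inl ` {e \<in> arcs E. head E e \<notin> H}
            \<union> Inr ` {e \<in> arcs E. head E e \<in> breaking_vertices E H - S},
       tail = case_sum (\<lambda>e. Inl (tail E e)) (\<lambda>e. Inl (tail E e)),
       head = case_sum (\<lambda>e. Inl (head E e)) (\<lambda>e. Inr (head E e)) \<rparr>"

section \<open>Ideals of rings without unit\<close>

text \<open>
  The library's \<^const>\<open>ideal\<close> requires the ambient ring to be unital, which a Leavitt path
  algebra need not be; the field \<open>one\<close> of the record is never used below.
\<close>

definition two_sided_ideal :: "('a, 'm) ring_scheme \<Rightarrow> 'a set \<Rightarrow> bool" where
  "two_sided_ideal R I \<longleftrightarrow> additive_subgroup I R \<and>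
     (\<forall>a\<in>I. \<forall>x\<in>carrier R. x \<otimes>\<^bsub>R\<^esub> a \<in> I \<and> a \<otimes>\<^bsub>R\<^esub> x \<in> I)"

definition proper_ideal :: "('a, 'm) ring_scheme \<Rightarrow> 'a set \<Rightarrow> bool" where
  "proper_ideal R I \<longleftrightarrow> two_sided_ideal R I \<and> I \<noteq> carrier R"

definition generated_ideal :: "('a, 'm) ring_scheme \<Rightarrow> 'a set \<Rightarrow> 'a set" where
  "generated_ideal R X = \<Inter>{I. two_sided_ideal R I \<and> X \<subseteq> I}"

definition prime_ideal :: "('a, 'm) ring_scheme \<Rightarrow> 'a set \<Rightarrow> bool" where
  "prime_ideal R P \<longleftrightarrow> proper_ideal R P \<and>
     (\<forall>I J. two_sided_ideal R I \<and> two_sided_ideal R J \<and> ideal_prod R I J \<subseteq> P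
        \<longrightarrow> I \<subseteq> P \<or> J \<subseteq> P)"

text \<open>\<open>carrier R \<inter> \<Inter>\<J>\<close> makes the intersection of the empty set of ideals the whole ring.\<close>

definition completely_irreducible :: "('a, 'm) ring_scheme \<Rightarrow> 'a set \<Rightarrow> bool" where
  "completely_irreducible R I \<longleftrightarrow> proper_ideal R I \<and>
     (\<forall>\<J>. (\<forall>J\<in>\<J>. two_sided_ideal R J \<and> I \<subset> J) \<longrightarrow> carrier R \<inter> \<Inter>\<J> \<noteq> I)"

primrec ideal_power :: "('a, 'm) ring_scheme \<Rightarrow> 'a set \<Rightarrow> nat \<Rightarrow> 'a set" where
  "ideal_power R P 0 = carrier R"
| "ideal_power R P (Suc n) = (if n = 0 then P else ideal_prod R (ideal_power R P n) P)"

section \<open>Leavitt path algebras\<close>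

datatype ('v, 'e) lpa_gen = Vtx 'v | Edg 'e | Ghost 'e

text \<open>
  Words form a monoid under concatenation, so \<open>'a list \<Rightarrow>\<^sub>0 'k\<close>, with its convolution product, is
  the free unital algebra over \<open>'a\<close>; \<open>1\<close> is the empty word.
\<close>

instantiation list :: (type) monoid_add
begin

definition zero_list :: "'a list" where "zero_list = []"

definition plus_list :: "'a list \<Rightarrow> 'a list \<Rightarrow> 'a list" where "plus_list = (@)"

instance by standard (simp_all add: zero_list_def plus_list_def)

end

type_synonym ('v, 'e, 'k) lpa_free = "('v, 'e) lpa_gen list \<Rightarrow>\<^sub>0 'k"

type_synonym ('v, 'e, 'k) lpa_elem = "('v, 'e, 'k) lpa_free set"

definition lpa_gens :: "('v, 'e) pre_digraph \<Rightarrow> ('v, 'e) lpa_gen set" where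
  "lpa_gens E = Vtx ` verts E \<union> Edg ` arcs E \<union> Ghost ` arcs E"

definition gen :: "('v, 'e) lpa_gen \<Rightarrow> ('v, 'e, 'k::field) lpa_free" where
  "gen g = Poly_Mapping.single [g] 1"

definition scale :: "'k::field \<Rightarrow> ('v, 'e, 'k) lpa_free \<Rightarrow> ('v, 'e, 'k) lpa_free" where
  "scale c x = Poly_Mapping.single 0 c * x"

text \<open>
  The free non-unital algebra on the generators belonging to \<open>E\<close>: combinations of nonempty words.
  Its \<open>one\<close> field is a dummy.
\<close>

definition free_alg :: "('v, 'e) pre_digraph \<Rightarrow> ('v, 'e, 'k::field) lpa_free ring" where
  "free_alg E =
     \<lparr> carrier = {x. Poly_Mapping.keys x \<subseteq> lists (lpa_gens E) - {[]}},
       mult = (*), one = undefined, zero = 0, add = (+) \<rparr>"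

text \<open>Each defining relation \<open>a = b\<close> is recorded as the element \<open>a - b\<close>.\<close>

definition lpa_relations :: "('v, 'e) pre_digraph \<Rightarrow> ('v, 'e, 'k::field) lpa_free set" where
  "lpa_relations E =
     {gen (Vtx v) * gen (Vtx w) - (if v = w then gen (Vtx v) else 0) | v w.
        v \<in> verts E \<and> w \<in> verts E}
   \<union> {gen (Vtx (tail E e)) * gen (Edg e) - gen (Edg e) | e. e \<in> arcs E}
   \<union> {gen (Edg e) * gen (Vtx (head E e)) - gen (Edg e) | e. e \<in> arcs E}
   \<union> {gen (Vtx (head E e)) * gen (Ghost e) - gen (Ghost e) | e. e \<in> arcs E}
   \<union> {gen (Ghost e) * gen (Vtx (tail E e)) - gen (Ghost e) | e. e \<in> arcs E}
   \<union> {gen (Ghost e) * gen (Edg f) - (if e = f then gen (Vtx (head E e)) else 0) | e f.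
        e \<in> arcs E \<and> f \<in> arcs E}
   \<union> {gen (Vtx v) - (\<Sum>e\<in>out_arcs E v. gen (Edg e) * gen (Ghost e)) | v. regular_vertex E v}"

text \<open>The algebra ideal (in particular a \<open>K\<close>-subspace) generated by the relations.\<close>

inductive_set lpa_rel_ideal :: "('v, 'e) pre_digraph \<Rightarrow> ('v, 'e, 'k::field) lpa_free set"
  for E :: "('v, 'e) pre_digraph" where
  rel: "x \<in> lpa_relations E \<Longrightarrow> x \<in> lpa_rel_ideal E"
| zero: "0 \<in> lpa_rel_ideal E"
| add: "x \<in> lpa_rel_ideal E \<Longrightarrow> y \<in> lpa_rel_ideal E \<Longrightarrow> x + y \<in> lpa_rel_ideal E"
| scale: "x \<in> lpa_rel_ideal E \<Longrightarrow> scale c x \<in> lpa_rel_ideal E"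
| mult_left: "x \<in> lpa_rel_ideal E \<Longrightarrow> a \<in> carrier (free_alg E) \<Longrightarrow> a * x \<in> lpa_rel_ideal E"
| mult_right: "x \<in> lpa_rel_ideal E \<Longrightarrow> a \<in> carrier (free_alg E) \<Longrightarrow> x * a \<in> lpa_rel_ideal E"

definition lpa_class ::
  "('v, 'e) pre_digraph \<Rightarrow> ('v, 'e, 'k::field) lpa_free \<Rightarrow> ('v, 'e, 'k) lpa_elem" where
  "lpa_class E x = lpa_rel_ideal E +>\<^bsub>free_alg E\<^esub> x"

text \<open>
  \<open>L\<^sub>K(E)\<close> for the field \<open>K = 'k\<close>: the operations of \<open>free_alg E Quot lpa_rel_ideal E\<close> together
  with scalar multiplication.
\<close>

definition LPA :: "('v, 'e) pre_digraph \<Rightarrow> ('k::field, ('v, 'e, 'k) lpa_elem) module" where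
  "LPA E =
     \<lparr> carrier = carrier (free_alg E Quot lpa_rel_ideal E),
       mult = mult (free_alg E Quot lpa_rel_ideal E),
       one = undefined,
       zero = zero (free_alg E Quot lpa_rel_ideal E),
       add = add (free_alg E Quot lpa_rel_ideal E),
       smult = (\<lambda>c X. \<Union>x\<in>X. lpa_class E (scale c x)) \<rparr>"

definition lpa_vertex :: "('v, 'e) pre_digraph \<Rightarrow> 'v \<Rightarrow> ('v, 'e, 'k::field) lpa_elem" where
  "lpa_vertex E v = lpa_class E (gen (Vtx v))"

definition lpa_edge :: "('v, 'e) pre_digraph \<Rightarrow> 'e \<Rightarrow> ('v, 'e, 'k::field) lpa_elem" where
  "lpa_edge E e = lpa_class E (gen (Edg e))"

definition lpa_ghost :: "('v, 'e) pre_digraph \<Rightarrow> 'e \<Rightarrow> ('v, 'e, 'k::field) lpa_elem" where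
  "lpa_ghost E e = lpa_class E (gen (Ghost e))"

text \<open>
  The elements \<open>\<mu>\<close> and \<open>\<mu>\<^sup>*\<close> for the path \<open>\<mu>\<close> with source \<open>u\<close> and edge list \<open>p\<close>; the leading
  factor \<open>u\<close> is absorbed by \<open>s(e)e = e\<close>, the trailing one by \<open>e\<^sup>*s(e) = e\<^sup>*\<close>.
\<close>

definition path_elem ::
  "('v, 'e) pre_digraph \<Rightarrow> 'v \<Rightarrow> 'e list \<Rightarrow> ('v, 'e, 'k::field) lpa_elem" where
  "path_elem E u p = foldl (\<lambda>x e. x \<otimes>\<^bsub>LPA E\<^esub> lpa_edge E e) (lpa_vertex E u) p"

definition ghost_path_elem ::
  "('v, 'e) pre_digraph \<Rightarrow> 'v \<Rightarrow> 'e list \<Rightarrow> ('v, 'e, 'k::field) lpa_elem" where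
  "ghost_path_elem E u p = foldl (\<lambda>x e. lpa_ghost E e \<otimes>\<^bsub>LPA E\<^esub> x) (lpa_vertex E u) p"

inductive_set linear_span :: "('k, 'a, 'm) module_scheme \<Rightarrow> 'a set \<Rightarrow> 'a set"
  for M :: "('k, 'a, 'm) module_scheme" and X :: "'a set" where
  zero: "\<zero>\<^bsub>M\<^esub> \<in> linear_span M X"
| step: "x \<in> X \<Longrightarrow> y \<in> linear_span M X \<Longrightarrow> c \<odot>\<^bsub>M\<^esub> x \<oplus>\<^bsub>M\<^esub> y \<in> linear_span M X"

definition lpa_component ::
  "('v, 'e) pre_digraph \<Rightarrow> int \<Rightarrow> ('v, 'e, 'k::field) lpa_elem set" where
  "lpa_component E n =
     linear_span (LPA E)
       {path_elem E u p \<otimes>\<^bsub>LPA E\<^esub> ghost_path_elem E w q | u p w q.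
          (\<exists>v. pre_digraph.awalk E u p v) \<and> (\<exists>v. pre_digraph.awalk E w q v) \<and>
          int (length p) - int (length q) = n}"

text \<open>
  \<open>I = \<Oplus>\<^sub>n (I \<inter> L\<^sub>n)\<close> as an internal direct sum: each element of \<open>I\<close> has exactly one
  decomposition into components in \<open>I \<inter> L\<^sub>n\<close>, almost all of them zero.
\<close>

definition graded_ideal ::
  "('v, 'e) pre_digraph \<Rightarrow> ('v, 'e, 'k::field) lpa_elem set \<Rightarrow> bool" where
  "graded_ideal E I \<longleftrightarrow> two_sided_ideal (LPA E) I \<and>
     (\<forall>x\<in>I. \<exists>!y :: int \<Rightarrow> ('v, 'e, 'k) lpa_elem.
        (\<forall>n. y n \<in> I \<inter> lpa_component E n) \<and>
        finite {n. y n \<noteq> \<zero>\<^bsub>LPA E\<^esub>} \<and>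
        x = finsum (LPA E) y {n. y n \<noteq> \<zero>\<^bsub>LPA E\<^esub>})"

definition breaking_elem ::
  "('v, 'e) pre_digraph \<Rightarrow> 'v set \<Rightarrow> 'v \<Rightarrow> ('v, 'e, 'k::field) lpa_elem" where
  "breaking_elem E H v =
     lpa_vertex E v \<ominus>\<^bsub>LPA E\<^esub>
       finsum (LPA E) (\<lambda>e. lpa_edge E e \<otimes>\<^bsub>LPA E\<^esub> lpa_ghost E e)
         {e \<in> out_arcs E v. head E e \<notin> H}"

definition admissible_ideal ::
  "('v, 'e) pre_digraph \<Rightarrow> 'v set \<Rightarrow> 'v set \<Rightarrow> ('v, 'e, 'k::field) lpa_elem set" where
  "admissible_ideal E H S =
     generated_ideal (LPA E) (lpa_vertex E ` H \<union> breaking_elem E H ` S)"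

section \<open>The two conditions\<close>

definition graded_condition ::
  "('v, 'e) pre_digraph \<Rightarrow> ('v, 'e, 'k::field) lpa_elem set \<Rightarrow> bool" where
  "graded_condition E I \<longleftrightarrow> graded_ideal E I \<and>
     (\<exists>H S. admissible_pair E H S \<and> I = admissible_ideal E H S \<and>
        condition_L (quotient_graph E H S) \<and>
        downward_directed (quotient_graph E H S) (verts (quotient_graph E H S)) \<and>
        strong_CSP (quotient_graph E H S) (verts (quotient_graph E H S)))"

definition prime_power_condition ::
  "('v, 'e) pre_digraph \<Rightarrow> ('v, 'e, 'k::field) lpa_elem set \<Rightarrow> bool" where
  "prime_power_condition E I \<longleftrightarrow>
     (\<exists>P n. prime_ideal (LPA E) P \<and> \<not> graded_ideal E P \<and> 0 < n \<and>
        I = ideal_power (LPA E) P n)"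

end

theory Submission
  imports Defs "HOL-Library.Sublist" "HOL-Computational_Algebra.Computational_Algebra"
begin

text \<open>
  Let \<open>J\<close> be an ideal and \<open>(H, S)\<close> the pair of its vertices and of its breaking vertices. Modulo \<open>J\<close>, the
  generators of \<open>L\<close> give a Cuntz--Krieger family of \<open>F = E\(H,S)\<close> with nonzero vertices, and every
  element outside \<open>J\<close> generates modulo \<open>J\<close> a vertex or a nonzero polynomial in a cycle without exits. An
  ideal is completely irreducible iff there is a smallest ideal properly above it.

  If \<open>F\<close> satisfies condition (L), then \<open>J = I(H,S)\<close>, and the smallest ideal above \<open>J\<close> contains a vertex
  \<open>u\<close>. So \<open>u\<close> lies in every nonempty hereditary saturated set, and the vertices reached from \<open>u\<close>
  through regular vertices witness the strong CSP; conversely a witness of the strong CSP generates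
  the smallest ideal above \<open>I(H,S)\<close>.

  Otherwise \<open>F\<close> has a cycle \<open>c\<close> without exits, based at \<open>w\<close>, and the corner at \<open>w\<close> is a quotient of
  \<open>K[X, 1/X]\<close> via \<open>X \<mapsto> c\<close>. If \<open>J\<close> is prime or completely irreducible, every vertex reaches \<open>w\<close>,
  so that the ideals containing \<open>J\<close> but no vertex of \<open>F\<close> are determined by their traces on the corner.
  The trace of \<open>J\<close> is generated by a power \<open>f\<^sup>n\<close> of an irreducible polynomial when \<open>J\<close> is completely
  irreducible, and \<open>f(c)\<close> then generates over \<open>J\<close> a non-graded prime ideal with \<open>n\<close>-th power \<open>J\<close>.
\<close>

section \<open>Closed walks without exits\<close>

text \<open>\<open>L\<close> has no unit in general, and an ideal of it is a priori only an additive
  subgroup absorbing products. All calculations therefore take place in the free unital algebra on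
  all generator symbols, modulo ideals \<open>J\<close> of that algebra; local units make both kinds
  of ideals correspond. Keeping \<open>J\<close> a parameter, instead of forming quotients, lets one
  family of vertices, edges and cycle polynomials serve I(H,S), \<open>J\<close>, the prime
  \<open>P\<close> and its powers at once. Two points are not formal. The relations could collapse,
  so that I(H,S), or the ideal generated over it by a hereditary saturated set \<open>Y\<close>,
  would contain further vertices; a representation on functions of boundary paths avoiding
  \<open>Y\<close> rules this out. And an infinite emitter has no summation relation; there the
  reduction picks an edge that annihilates all ghost terms. The prime \<open>P\<close> of the second
  case is not graded, because a graded ideal containing a nonzero polynomial in \<open>c\<close>
  contains its leading term and hence \<open>w\<close>. The power \<open>P^n\<close> contains
  I(H,S), because the generators of I(H,S) are idempotents of \<open>L\<close>.\<close>

context wf_digraph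
begin

lemma awalk_append: "awalk u (p @ q) v \<longleftrightarrow> (\<exists>x. awalk u p x \<and> awalk x q v)"
proof
  assume "awalk u (p @ q) v"
  then show "\<exists>x. awalk u p x \<and> awalk x q v" by auto
next
  assume "\<exists>x. awalk u p x \<and> awalk x q v"
  then show "awalk u (p @ q) v" using awalk_appendI by blast
qed

lemma awalk_end_unique: "awalk u p v \<Longrightarrow> awalk u p w \<Longrightarrow> v = w"
  using awalk_ends by blast

lemma awalk_start_unique: "awalk u p v \<Longrightarrow> awalk w p v \<Longrightarrow> u = w"
  by (cases p) (auto simp: awalk_simps)

lemma awalk_verts_map_tail: "awalk u p v \<Longrightarrow> awalk_verts u p = map (tail G) p @ [v]"
  by (induction p arbitrary: u) (auto simp: awalk_simps)

lemma awalk_set_arcs: "awalk u p v \<Longrightarrow> e \<in> set p \<Longrightarrow> e \<in> arcs G"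
  by (auto simp: awalk_def)

lemma vertex_ge_refl: "v \<in> verts G \<Longrightarrow> vertex_ge G v v"
  unfolding vertex_ge_def using awalk_Nil_iff by blast

lemma vertex_ge_trans: "vertex_ge G u v \<Longrightarrow> vertex_ge G v w \<Longrightarrow> vertex_ge G u w"
  unfolding vertex_ge_def using awalk_append by blast

lemma vertex_ge_arc: "e \<in> arcs G \<Longrightarrow> vertex_ge G (tail G e) (head G e)"
  unfolding vertex_ge_def using arc_implies_awalk by blast

lemma vertex_ge_verts: "vertex_ge G u v \<Longrightarrow> u \<in> verts G \<and> v \<in> verts G"
  unfolding vertex_ge_def using awalk_hd_in_verts awalk_last_in_verts by blast

lemma hereditary_arcI:
  assumes "X \<subseteq> verts G" "\<And>e. e \<in> arcs G \<Longrightarrow> tail G e \<in> X \<Longrightarrow> head G e \<in> X"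
  shows "hereditary G X"
proof -
  have "awalk u p v \<Longrightarrow> u \<in> X \<Longrightarrow> v \<in> X" for u p v
    by (induction p arbitrary: u) (auto simp: awalk_simps assms(2))
  then show ?thesis using assms(1) unfolding hereditary_def vertex_ge_def by blast
qed

lemma hereditary_arcD: "hereditary G X \<Longrightarrow> e \<in> arcs G \<Longrightarrow> tail G e \<in> X \<Longrightarrow> head G e \<in> X"
  unfolding hereditary_def using vertex_ge_arc by blast

text \<open>The vertices on cycles without exits, phrased with arbitrary closed walks: if the
  condition fails at \<open>v\<close>, there is either no closed walk at \<open>v\<close> or one
  with an exit, which is what \<open>escaping_path\<close> consumes. \<open>rigidE\<close> recovers
  the cycle.\<close>

definition rigid :: "'a \<Rightarrow> bool" where
  "rigid v \<longleftrightarrow> (\<exists>c. c \<noteq> [] \<and> awalk v c v) \<and> (\<forall>c f. c \<noteq> [] \<and> awalk v c v \<longrightarrow> \<not> exit_of G c f)"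

text \<open>
  The path \<open>\<delta>\<close> is \<open>c\<^sup>m c\<^sub>1 f\<close>, where \<open>f\<close> is an exit of the closed path \<open>c\<close> and \<open>m\<close> is large:
  if \<open>\<delta>\<close> were a prefix of \<open>\<gamma>\<delta>\<close>, then its last edge \<open>f\<close> would recur at an earlier position.
\<close>
lemma escaping_path:
  assumes v: "v \<in> verts G" "\<not> rigid v" and fin: "finite \<Gamma>"
    and cl: "\<And>\<gamma>. \<gamma> \<in> \<Gamma> \<Longrightarrow> \<gamma> \<noteq> [] \<and> awalk v \<gamma> v"
  obtains \<delta> u where "awalk v \<delta> u" "\<And>\<gamma>. \<gamma> \<in> \<Gamma> \<Longrightarrow> \<not> prefix \<delta> (\<gamma> @ \<delta>)"
proof (cases "\<exists>c. c \<noteq> [] \<and> awalk v c v")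
  case False
  then have "\<Gamma> = {}" using cl by blast
  then show ?thesis using that[of "[]" v] v awalk_Nil_iff by auto
next
  case True
  then obtain c f where c: "c \<noteq> []" "awalk v c v" and ex: "exit_of G c f"
    using v unfolding rigid_def by blast
  from ex obtain e where f: "f \<in> arcs G" "f \<notin> set c" and e: "e \<in> set c" "tail G f = tail G e"
    unfolding exit_of_def by blast
  obtain c1 c2 where split: "c = c1 @ e # c2" using e(1) by (meson split_list)
  define m where "m = Max (insert 0 (length ` \<Gamma>))"
  define \<beta> where "\<beta> = concat (replicate m c) @ c1"
  have wm: "awalk v (concat (replicate n c)) v" for n
    by (induction n) (use v c awalk_append in \<open>auto simp: awalk_Nil_iff simp del: awalk_append_iff\<close>)
  have c1: "awalk v c1 (tail G e)"
    using c(2) unfolding split awalk_append by (auto simp: awalk_simps)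
  have w\<beta>: "awalk v \<beta> (tail G e)"
    unfolding \<beta>_def awalk_append using wm c1 by blast
  have w: "awalk v (\<beta> @ [f]) (head G f)"
    unfolding awalk_append using w\<beta> f e by (intro exI[of _ "tail G e"]) (auto simp: awalk_simps)
  have set\<beta>: "set \<beta> \<subseteq> set c" unfolding \<beta>_def split by auto
  have "length (concat (replicate n c)) \<ge> n" for n
  proof (induction n)
    case (Suc n)
    moreover have "0 < length c" using c(1) by simp
    ultimately show ?case by (simp only: replicate_Suc concat.simps length_append)
  qed simp
  then have len\<beta>: "m \<le> length \<beta>" unfolding \<beta>_def by (simp add: trans_le_add1)
  have "\<not> prefix (\<beta> @ [f]) (\<gamma> @ \<beta> @ [f])" if "\<gamma> \<in> \<Gamma>" for \<gamma>
  proof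
    assume "prefix (\<beta> @ [f]) (\<gamma> @ \<beta> @ [f])"
    then obtain zs where zs: "\<gamma> @ \<beta> @ [f] = (\<beta> @ [f]) @ zs" unfolding prefix_def by blast
    have l1: "length \<gamma> \<le> length \<beta>"
      using that fin len\<beta> unfolding m_def by (meson Max_ge finite_imageI finite_insert imageI insertI2 le_trans)
    have l2: "0 < length \<gamma>" using cl[OF that] by simp
    have "(\<gamma> @ \<beta> @ [f]) ! length \<beta> = \<beta> ! (length \<beta> - length \<gamma>)"
    proof -
      have "length \<beta> - length \<gamma> < length \<beta>" using l1 l2 by linarith
      then show ?thesis using l1 by (auto simp: nth_append)
    qed
    moreover have "((\<beta> @ [f]) @ zs) ! length \<beta> = f" by (simp add: nth_append)
    ultimately have "f = \<beta> ! (length \<beta> - length \<gamma>)" using zs by simp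
    then have "f \<in> set \<beta>" using l1 l2 by (metis diff_less le_less_trans less_le_trans nth_mem)
    then show False using set\<beta> f(2) by blast
  qed
  then show ?thesis using w that by blast
qed

text \<open>Cutting out the detour between two edges with the same source leaves a shorter nonempty
  closed walk.\<close>

lemma shortest_closed_distinct_tails:
  assumes c: "awalk w c w" and min: "\<And>c'. c' \<noteq> [] \<Longrightarrow> awalk w c' w \<Longrightarrow> length c \<le> length c'"
  shows "distinct (map (tail G) c)"
proof (rule ccontr)
  assume "\<not> ?thesis"
  then obtain xs ys zs y where "map (tail G) c = xs @ [y] @ ys @ [y] @ zs"
    using not_distinct_decomp by blast
  then obtain a e b f d where split: "c = a @ e # b @ f # d" and ef: "tail G e = tail G f"
    by (auto simp: map_eq_append_conv map_eq_Cons_conv append_eq_map_conv Cons_eq_map_conv)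
  have "awalk w a (tail G e)"
    using c unfolding split awalk_append by (auto simp: awalk_simps)
  moreover have "awalk (tail G f) (f # d) w"
    using c unfolding split append_Cons[symmetric] awalk_append append_assoc[symmetric]
    by (auto simp: awalk_simps)
  ultimately have "awalk w (a @ f # d) w" unfolding awalk_append using ef by auto
  from min[OF _ this] show False unfolding split by simp
qed

text \<open>An edge leaving a source of \<open>c\<close> is no exit, hence lies on \<open>c\<close>,
  and its range is again a source of \<open>c\<close>; so a walk from \<open>w\<close> never leaves
  the edges of \<open>c\<close>.\<close>

lemma no_exit_walk_subset:
  assumes c: "awalk w c w" "c \<noteq> []" and ne: "\<And>f. \<not> exit_of G c f" and d: "awalk w d x"
  shows "set d \<subseteq> set c"
proof -
  have heads: "head G e \<in> tail G ` set c" if e: "e \<in> set c" for e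
  proof -
    obtain a b where ab: "c = a @ e # b" using e by (meson split_list)
    have b: "awalk (head G e) b w" using c(1) unfolding ab awalk_append by (auto simp: awalk_simps)
    show ?thesis
    proof (cases b)
      case Nil
      then have "head G e = w" using b by (simp add: awalk_Nil_iff)
      then show ?thesis using c by (cases c) (auto simp: awalk_simps)
    next
      case (Cons f b')
      then show ?thesis using b ab by (auto simp: awalk_simps)
    qed
  qed
  have "awalk y d x \<Longrightarrow> y \<in> tail G ` set c \<Longrightarrow> set d \<subseteq> set c" for y
  proof (induction d arbitrary: y)
    case (Cons e d)
    then have e: "e \<in> arcs G" "tail G e \<in> tail G ` set c" "awalk (head G e) d x"
      by (auto simp: awalk_simps)
    then have "e \<in> set c" using ne[of e] unfolding exit_of_def by auto
    then show ?case using Cons.IH[OF e(3)] heads by auto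
  qed simp
  moreover have "w \<in> tail G ` set c" using c by (cases c) (auto simp: awalk_simps)
  ultimately show ?thesis using d by blast
qed

text \<open>\<open>c\<close> is a shortest nonempty closed walk at \<open>w\<close>. Its sources are
  distinct and it has no exit, so each of them emits exactly one edge. Walks from \<open>w\<close>
  are thereby forced along \<open>c\<close>, and the closed ones are its powers.\<close>

lemma rigidE:
  assumes "rigid w"
  obtains c where "c \<noteq> []" "awalk w c w" "\<And>e. e \<in> set c \<Longrightarrow> out_arcs G (tail G e) = {e}"
    "\<And>d x. awalk w d x \<Longrightarrow> set d \<subseteq> set c"
    "\<And>d x. awalk w d x \<Longrightarrow> \<exists>b. awalk x b w"
    "\<And>d. awalk w d w \<Longrightarrow> \<exists>n. d = concat (replicate n c)"
    "cycle c" "\<And>f. \<not> exit_of G c f"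
proof -
  define P where "P c \<longleftrightarrow> c \<noteq> [] \<and> awalk w c w" for c
  have "\<exists>c. P c" using assms unfolding rigid_def P_def by blast
  then obtain c where "P c" and min: "\<And>c'. P c' \<Longrightarrow> length c \<le> length c'"
    by (metis arg_min_nat_lemma[of P _ length])
  then have c: "c \<noteq> []" "awalk w c w" by (auto simp: P_def)
  have ne: "\<not> exit_of G c f" for f using assms c unfolding rigid_def by blast
  have dist: "distinct (map (tail G) c)"
    using shortest_closed_distinct_tails[OF c(2)] min unfolding P_def by blast
  have out: "out_arcs G (tail G e) = {e}" if e: "e \<in> set c" for e
  proof -
    have "f = e" if "f \<in> arcs G" "tail G f = tail G e" for f
    proof -
      have "f \<in> set c" using ne[of f] that e unfolding exit_of_def by auto
      then show ?thesis using dist e that by (auto simp: distinct_map inj_on_def)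
    qed
    then show ?thesis using awalk_set_arcs[OF c(2) e] by auto
  qed
  have sub: "set d \<subseteq> set c" if "awalk w d x" for d x
    using no_exit_walk_subset[OF c(2,1) ne that] .
  have ret: "\<exists>b. awalk x b w" if d: "awalk w d x" for d x
  proof (cases d rule: rev_cases)
    case Nil
    then show ?thesis using d c by (auto simp: awalk_simps)
  next
    case (snoc d' e)
    have "e \<in> set c" using sub[OF d] snoc by auto
    then obtain a b where ab: "c = a @ e # b" by (meson split_list)
    have "awalk (head G e) b w" using c(2) unfolding ab awalk_append by (auto simp: awalk_simps)
    moreover have "head G e = x" using d unfolding snoc awalk_append by (auto simp: awalk_simps)
    ultimately show ?thesis by blast
  qed
  \<comment> \<open>Two walks from the same vertex with edges on \<open>c\<close> agree for as long
    as both last.\<close>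
  have det: "\<lbrakk>awalk y a x; awalk y b z; set a \<subseteq> set c; set b \<subseteq> set c; length a \<le> length b\<rbrakk> \<Longrightarrow> prefix a b" for y a b x z
  proof (induction a arbitrary: y b)
    case (Cons e a)
    then obtain f b' where b: "b = f # b'" by (cases b) auto
    have "f \<in> out_arcs G (tail G e)" using Cons.prems unfolding b by (auto simp: awalk_simps)
    then have "f = e" using out[of e] Cons.prems(3) by auto
    then show ?case using Cons unfolding b by (auto simp: awalk_simps)
  qed simp
  have pow: "\<exists>n. d = concat (replicate n c)" if "awalk w d w" for d
    using that
  proof (induction "length d" arbitrary: d rule: less_induct)
    case less
    show ?case
    proof (cases "d = []")
      case True
      then show ?thesis by (intro exI[of _ 0]) simp
    next
      case False
      then have "length c \<le> length d" using min less.prems unfolding P_def by blast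
      then have "prefix c d" using det[OF c(2) less.prems] sub c(2) less.prems by blast
      then obtain d' where d': "d = c @ d'" unfolding prefix_def by blast
      then have "awalk w d' w" using less.prems c(2) unfolding d' awalk_append
        by (metis awalk_end_unique)
      then obtain n where "d' = concat (replicate n c)" using less.hyps[of d'] d' c(1) by auto
      then show ?thesis using d' by (intro exI[of _ "Suc n"]) simp
    qed
  qed
  \<comment> \<open>\<open>cycle\<close> asks for distinct ranges. For a closed walk these are the
    sources shifted by one place, so comparing multisets suffices to transfer distinctness.\<close>
  have "mset (tl (awalk_verts w c)) = mset (map (tail G) c)"
  proof -
    have "awalk_verts w c = map (tail G) c @ [w]" by (rule awalk_verts_map_tail[OF c(2)])
    moreover have "awalk_verts w c = w # tl (awalk_verts w c)"
      using c by (cases c) (auto simp: awalk_simps)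
    ultimately have "mset (w # tl (awalk_verts w c)) = mset (map (tail G) c @ [w])" by simp
    then show ?thesis by simp
  qed
  then have "distinct (tl (awalk_verts w c))" using dist mset_eq_imp_distinct_iff by blast
  then have "cycle c" unfolding cycle_def using c by blast
  then show thesis using that[of c] c out sub ret pow ne by blast
qed

text \<open>Condition (L) concerns cycles only, \<open>rigid\<close> all closed walks at a vertex.
  They match because, over a cycle without exits, an exit of a closed walk at \<open>w\<close> would
  be the only edge at its source and so lie on that walk.\<close>

lemma condition_L_iff: "condition_L G \<longleftrightarrow> (\<forall>w. \<not> rigid w)"
proof
  assume L: "condition_L G"
  show "\<forall>w. \<not> rigid w"
  proof (intro allI notI)
    fix w assume "rigid w"
    then obtain c where "cycle c" "\<And>f. \<not> exit_of G c f" by (rule rigidE) blast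
    then show False using L unfolding condition_L_def by blast
  qed
next
  assume nr: "\<forall>w. \<not> rigid w"
  show "condition_L G" unfolding condition_L_def
  proof (intro allI impI, rule ccontr)
    fix c assume "cycle c" and "\<nexists>f. exit_of G c f"
    then obtain w where c: "awalk w c w" "c \<noteq> []" "distinct (tl (awalk_verts w c))"
      and ne: "\<And>f. \<not> exit_of G c f" unfolding cycle_def by blast
    have "mset (tl (awalk_verts w c)) = mset (map (tail G) c)"
    proof -
      have "awalk_verts w c = map (tail G) c @ [w]" by (rule awalk_verts_map_tail[OF c(1)])
      moreover have "awalk_verts w c = w # tl (awalk_verts w c)"
        using c by (cases c) (auto simp: awalk_simps)
      ultimately have "mset (w # tl (awalk_verts w c)) = mset (map (tail G) c @ [w])" by simp
      then show ?thesis by simp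
    qed
    then have dist: "distinct (map (tail G) c)" using c(3) mset_eq_imp_distinct_iff by blast
    have "\<not> exit_of G d f" if d: "d \<noteq> []" "awalk w d w" for d f
    proof
      assume "exit_of G d f"
      then obtain e where e: "f \<in> arcs G" "f \<notin> set d" "e \<in> set d" "tail G f = tail G e"
        unfolding exit_of_def by blast
      have "e \<in> set c" using no_exit_walk_subset[OF c(1,2) ne d(2)] e by blast
      moreover from this have "f \<in> set c" using ne[of f] e unfolding exit_of_def by blast
      ultimately have "f = e" using dist e(4) by (auto simp: distinct_map inj_on_def)
      then show False using e by simp
    qed
    then have "rigid w" unfolding rigid_def using c by blast
    then show False using nr by blast
  qed
qed

end

section \<open>Cuntz--Krieger families modulo an ideal\<close>

definition idl :: "'a::ring_1 set \<Rightarrow> bool" where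
  "idl J \<longleftrightarrow> 0 \<in> J \<and> (\<forall>x\<in>J. \<forall>y\<in>J. x + y \<in> J) \<and> (\<forall>x\<in>J. \<forall>a. a * x \<in> J \<and> x * a \<in> J)"

lemma idlI:
  assumes "0 \<in> J" "\<And>x y. x \<in> J \<Longrightarrow> y \<in> J \<Longrightarrow> x + y \<in> J"
    "\<And>x a. x \<in> J \<Longrightarrow> a * x \<in> J" "\<And>x a. x \<in> J \<Longrightarrow> x * a \<in> J"
  shows "idl J"
  using assms unfolding idl_def by blast

lemma idl_zero: "idl J \<Longrightarrow> 0 \<in> J"
  and idl_add: "idl J \<Longrightarrow> x \<in> J \<Longrightarrow> y \<in> J \<Longrightarrow> x + y \<in> J"
  and idl_left: "idl J \<Longrightarrow> x \<in> J \<Longrightarrow> a * x \<in> J"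
  and idl_right: "idl J \<Longrightarrow> x \<in> J \<Longrightarrow> x * a \<in> J"
  unfolding idl_def by blast+

lemma idl_mid: "idl J \<Longrightarrow> x \<in> J \<Longrightarrow> a * x * b \<in> J"
  using idl_left idl_right by blast

lemma idl_uminus: "idl J \<Longrightarrow> x \<in> J \<Longrightarrow> - x \<in> J"
  using idl_left[of J x "-1"] by simp

lemma idl_diff: "idl J \<Longrightarrow> x \<in> J \<Longrightarrow> y \<in> J \<Longrightarrow> x - y \<in> J"
  using idl_add[of J x "- y"] idl_uminus by auto

lemma idl_sum: "idl J \<Longrightarrow> (\<And>i. i \<in> A \<Longrightarrow> f i \<in> J) \<Longrightarrow> sum f A \<in> J"
  by (induction A rule: infinite_finite_induct) (auto intro: idl_zero idl_add)

lemma idl_UNIV: "idl UNIV"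
  by (rule idlI) auto

lemma idl_Int: "(\<And>J. J \<in> \<J> \<Longrightarrow> idl J) \<Longrightarrow> idl (\<Inter>\<J>)"
  unfolding idl_def by auto

definition idl_gen :: "'a::ring_1 set \<Rightarrow> 'a set" where
  "idl_gen X = \<Inter>{J. idl J \<and> X \<subseteq> J}"

lemma idl_idl_gen: "idl (idl_gen X)"
  unfolding idl_gen_def by (rule idl_Int) simp

lemma idl_gen_superset: "X \<subseteq> idl_gen X"
  unfolding idl_gen_def by blast

lemma idl_gen_least: "idl J \<Longrightarrow> X \<subseteq> J \<Longrightarrow> idl_gen X \<subseteq> J"
  unfolding idl_gen_def by blast

text \<open>Induction over the ideal generated by \<open>J\<close> and one more element. This ideal
  is contained in \<open>N\<close>, the sums of an element of \<open>J\<close> and products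
  \<open>l * a * m\<close>, so an additive predicate needs checking on these two kinds only.\<close>

lemma idl_gen_insert:
  assumes J: "idl J" and x: "x \<in> idl_gen (insert a J)"
    and 0: "Q 0" and add: "\<And>y z. Q y \<Longrightarrow> Q z \<Longrightarrow> Q (y + z)"
    and base: "\<And>y. y \<in> J \<Longrightarrow> Q y" and step: "\<And>l m. Q (l * a * m)"
  shows "Q x"
proof -
  define N where "N = {x. \<exists>j\<in>J. \<exists>ps. x = j + (\<Sum>(l, m)\<leftarrow>ps. l * a * m)}"
  have "idl N"
  proof (rule idlI)
    show "0 \<in> N" unfolding N_def using idl_zero[OF J] by (auto intro!: exI[of _ "[]"] bexI[of _ 0])
  next
    fix x y assume "x \<in> N" "y \<in> N"
    then obtain j j' ps qs where "j \<in> J" "j' \<in> J" "x = j + (\<Sum>(l, m)\<leftarrow>ps. l * a * m)"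
      "y = j' + (\<Sum>(l, m)\<leftarrow>qs. l * a * m)" unfolding N_def by blast
    then have "x + y = (j + j') + (\<Sum>(l, m)\<leftarrow>ps @ qs. l * a * m)" "j + j' \<in> J"
      using idl_add[OF J] by (auto simp: algebra_simps)
    then show "x + y \<in> N" unfolding N_def by blast
  next
    fix x b assume "x \<in> N"
    then obtain j ps where x: "j \<in> J" "x = j + (\<Sum>(l, m)\<leftarrow>ps. l * a * m)" unfolding N_def by blast
    have "b * (\<Sum>(l, m)\<leftarrow>ps. l * a * m) = (\<Sum>(l, m)\<leftarrow>map (\<lambda>(l, m). (b * l, m)) ps. l * a * m)"
      by (induction ps) (auto simp: algebra_simps)
    then have "b * x = b * j + (\<Sum>(l, m)\<leftarrow>map (\<lambda>(l, m). (b * l, m)) ps. l * a * m)"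
      unfolding x(2) distrib_left by (rule arg_cong)
    then show "b * x \<in> N" unfolding N_def using idl_left[OF J x(1), of b] by blast
    have "(\<Sum>(l, m)\<leftarrow>ps. l * a * m) * b = (\<Sum>(l, m)\<leftarrow>map (\<lambda>(l, m). (l, m * b)) ps. l * a * m)"
      by (induction ps) (auto simp: algebra_simps)
    then have "x * b = j * b + (\<Sum>(l, m)\<leftarrow>map (\<lambda>(l, m). (l, m * b)) ps. l * a * m)"
      unfolding x(2) distrib_right by (rule arg_cong)
    then show "x * b \<in> N" unfolding N_def using idl_right[OF J x(1), of b] by blast
  qed
  moreover have "insert a J \<subseteq> N"
  proof -
    have "a = 0 + (\<Sum>(l, m)\<leftarrow>[(1, 1)]. l * a * m)" by simp
    then have "a \<in> N" unfolding N_def using idl_zero[OF J] by blast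
    moreover have "j = j + (\<Sum>(l, m)\<leftarrow>[]. l * a * m)" for j by simp
    then have "J \<subseteq> N" unfolding N_def by blast
    ultimately show ?thesis by blast
  qed
  ultimately have "x \<in> N" using idl_gen_least x by blast
  then obtain j ps where x: "j \<in> J" "x = j + (\<Sum>(l, m)\<leftarrow>ps. l * a * m)" unfolding N_def by blast
  have "Q (\<Sum>(l, m)\<leftarrow>ps. l * a * m)" by (induction ps) (auto intro: 0 add step)
  then show ?thesis unfolding x(2) using add base x(1) by blast
qed

text \<open>Congruences replace a quotient ring: later several ideals over the same elements are
  compared, each with its own relation.\<close>

locale ring_ideal =
  fixes J :: "'a::ring_1 set"
  assumes idl_J: "idl J"
begin

definition eqv :: "'a \<Rightarrow> 'a \<Rightarrow> bool" (infix \<open>\<approx>\<close> 50) where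
  "x \<approx> y \<longleftrightarrow> x - y \<in> J"

lemma eqv_refl [simp, intro]: "x \<approx> x"
  unfolding eqv_def using idl_zero[OF idl_J] by simp

lemma eqv_sym: "x \<approx> y \<Longrightarrow> y \<approx> x"
  unfolding eqv_def using idl_uminus[OF idl_J] by fastforce

lemma eqv_trans [trans]: "x \<approx> y \<Longrightarrow> y \<approx> z \<Longrightarrow> x \<approx> z"
  unfolding eqv_def using idl_add[OF idl_J, of "x - y" "y - z"] by simp

lemma eqv_eq_trans [trans]: "x \<approx> y \<Longrightarrow> y = z \<Longrightarrow> x \<approx> z" "x = y \<Longrightarrow> y \<approx> z \<Longrightarrow> x \<approx> z"
  by auto

lemma eqv_add: "x \<approx> y \<Longrightarrow> x' \<approx> y' \<Longrightarrow> x + x' \<approx> y + y'"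
  unfolding eqv_def using idl_add[OF idl_J, of "x - y" "x' - y'"] by (simp add: algebra_simps)

lemma eqv_diff: "x \<approx> y \<Longrightarrow> x' \<approx> y' \<Longrightarrow> x - x' \<approx> y - y'"
  unfolding eqv_def using idl_diff[OF idl_J, of "x - y" "x' - y'"] by (simp add: algebra_simps)

lemma eqv_left: "x \<approx> y \<Longrightarrow> a * x \<approx> a * y"
  unfolding eqv_def using idl_left[OF idl_J, of "x - y" a] by (simp add: algebra_simps)

lemma eqv_right: "x \<approx> y \<Longrightarrow> x * a \<approx> y * a"
  unfolding eqv_def using idl_right[OF idl_J, of "x - y" a] by (simp add: algebra_simps)

lemma eqv_mid: "x \<approx> y \<Longrightarrow> a * x * b \<approx> a * y * b"
  using eqv_left eqv_right by blast

lemma eqv_mult: "x \<approx> y \<Longrightarrow> x' \<approx> y' \<Longrightarrow> x * x' \<approx> y * y'"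
  using eqv_left eqv_right eqv_trans by blast

lemma eqv_sum: "(\<And>i. i \<in> A \<Longrightarrow> f i \<approx> g i) \<Longrightarrow> sum f A \<approx> sum g A"
  by (induction A rule: infinite_finite_induct) (auto intro: eqv_add)

lemma eqv_sum_list: "(\<And>i. i \<in> set xs \<Longrightarrow> f i \<approx> g i) \<Longrightarrow> sum_list (map f xs) \<approx> sum_list (map g xs)"
  by (induction xs) (auto intro: eqv_add)

lemma eqv_0_iff: "x \<approx> 0 \<longleftrightarrow> x \<in> J"
  unfolding eqv_def by simp

lemma eqv_mem: "x \<approx> y \<Longrightarrow> x \<in> J \<longleftrightarrow> y \<in> J"
  using eqv_sym eqv_trans eqv_0_iff by blast

lemma eqv_ideal_mem:
  assumes "x \<approx> y" "idl J'" "J \<subseteq> J'"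
  shows "x \<in> J' \<longleftrightarrow> y \<in> J'"
proof -
  have "x - y \<in> J'" using assms unfolding eqv_def by blast
  moreover have "x = (x - y) + y" "y = x - (x - y)" by simp_all
  ultimately show ?thesis using idl_add[OF assms(2)] idl_diff[OF assms(2)] by metis
qed

end

text \<open>The tuple \<open>(k, \<alpha>, v, \<beta>)\<close> encodes \<open>k\<close> times
  \<alpha> followed by the ghost of \<beta>. The common range \<open>v\<close> is recorded because
  both paths may be empty.\<close>

type_synonym ('k, 'v, 'e) path_term = "'k \<times> 'e list \<times> 'v \<times> 'e list"

text \<open>
  The algebra in question is \<open>C / J\<close> for ideals \<open>J \<subseteq> C\<close> of a unital ring, where \<open>x \<approx> y\<close> means
  \<open>x - y \<in> J\<close> and \<open>\<kappa>\<close> embeds the scalars into the unital ring.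
\<close>
locale ck_relations = wf_digraph G + ring_ideal J
  for G :: "('v, 'e) pre_digraph" and J :: "'a::ring_1 set" +
  fixes \<kappa> :: "'k::field \<Rightarrow> 'a" and p :: "'v \<Rightarrow> 'a" and s t :: "'e \<Rightarrow> 'a"
  assumes \<kappa>_add: "\<kappa> (a + b) = \<kappa> a + \<kappa> b" and \<kappa>_mult: "\<kappa> (a * b) = \<kappa> a * \<kappa> b"
    and \<kappa>_1 [simp]: "\<kappa> 1 = 1" and \<kappa>_central: "\<kappa> a * x = x * \<kappa> a"
    and p_idem: "v \<in> verts G \<Longrightarrow> p v * p v \<approx> p v"
    and p_orth: "v \<in> verts G \<Longrightarrow> w \<in> verts G \<Longrightarrow> v \<noteq> w \<Longrightarrow> p v * p w \<approx> 0"
    and p_s: "e \<in> arcs G \<Longrightarrow> p (tail G e) * s e \<approx> s e"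
    and s_p: "e \<in> arcs G \<Longrightarrow> s e * p (head G e) \<approx> s e"
    and p_t: "e \<in> arcs G \<Longrightarrow> p (head G e) * t e \<approx> t e"
    and t_p: "e \<in> arcs G \<Longrightarrow> t e * p (tail G e) \<approx> t e"
    and t_s: "e \<in> arcs G \<Longrightarrow> t e * s e \<approx> p (head G e)"
    and t_s_orth: "e \<in> arcs G \<Longrightarrow> f \<in> arcs G \<Longrightarrow> e \<noteq> f \<Longrightarrow> t e * s f \<approx> 0"
    and p_regular: "regular_vertex G v \<Longrightarrow> p v \<approx> (\<Sum>e\<in>out_arcs G v. s e * t e)"
begin

lemma \<kappa>_0 [simp]: "\<kappa> 0 = 0"
  using \<kappa>_add[of 0 0] by simp

lemma \<kappa>_cancel: "k \<noteq> 0 \<Longrightarrow> \<kappa> (1 / k) * (\<kappa> k * x) = x"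
  by (simp add: mult.assoc[symmetric] \<kappa>_mult[symmetric])

lemma \<kappa>_pull: "x * (\<kappa> k * y) = \<kappa> k * (x * y)"
  by (metis \<kappa>_central mult.assoc)

text \<open>The empty path gives the unit of the ambient ring and not a vertex; this is why the
  range vertex \<open>p v\<close> is kept next to \<open>S \<alpha>\<close> and
  \<open>T \<alpha>\<close> in the formulas below.\<close>

definition S :: "'e list \<Rightarrow> 'a" where "S \<alpha> = prod_list (map s \<alpha>)"
definition T :: "'e list \<Rightarrow> 'a" where "T \<alpha> = prod_list (rev (map t \<alpha>))"

lemma S_simps [simp]: "S [] = 1" "S (e # \<alpha>) = s e * S \<alpha>" "S (\<alpha> @ \<beta>) = S \<alpha> * S \<beta>"
  unfolding S_def by auto

lemma T_simps [simp]: "T [] = 1" "T (e # \<alpha>) = T \<alpha> * t e" "T (\<alpha> @ \<beta>) = T \<beta> * T \<alpha>"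
  unfolding T_def by auto

lemma p_S: "awalk u \<alpha> v \<Longrightarrow> p u * (S \<alpha> * p v) \<approx> S \<alpha> * p v"
proof (cases \<alpha>)
  case (Cons e \<alpha>')
  assume "awalk u \<alpha> v"
  then have "e \<in> arcs G" "u = tail G e" using Cons by (auto simp: awalk_simps)
  then have "(p u * s e) * (S \<alpha>' * p v) \<approx> s e * (S \<alpha>' * p v)" using p_s eqv_right by blast
  then show ?thesis using Cons by (simp add: mult.assoc)
qed (auto simp: awalk_simps intro: p_idem)

lemma p_S_orth:
  assumes "awalk u \<alpha> v" "w \<in> verts G" "w \<noteq> u"
  shows "p w * (S \<alpha> * p v) \<approx> 0"
proof -
  have u: "u \<in> verts G" using assms(1) by auto
  have "p w * (S \<alpha> * p v) \<approx> p w * (p u * (S \<alpha> * p v))"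
    using p_S[OF assms(1)] eqv_sym eqv_left by blast
  also have "p w * (p u * (S \<alpha> * p v)) = (p w * p u) * (S \<alpha> * p v)" by (simp add: mult.assoc)
  also have "\<dots> \<approx> 0 * (S \<alpha> * p v)" by (rule eqv_right[OF p_orth[OF assms(2) u assms(3)]])
  finally show ?thesis by simp
qed

lemma p_T: "awalk u \<alpha> v \<Longrightarrow> p v * T \<alpha> * p u \<approx> p v * T \<alpha>"
proof (cases \<alpha>)
  case (Cons e \<alpha>')
  assume "awalk u \<alpha> v"
  then have "e \<in> arcs G" "u = tail G e" using Cons by (auto simp: awalk_simps)
  then have "(p v * T \<alpha>') * (t e * p u) \<approx> (p v * T \<alpha>') * t e" using t_p eqv_left by blast
  then show ?thesis using Cons by (simp add: mult.assoc)
qed (auto simp: awalk_simps intro: p_idem)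

lemma p_T_orth:
  assumes "awalk u \<alpha> v" "w \<in> verts G" "w \<noteq> u"
  shows "p v * T \<alpha> * p w \<approx> 0"
proof -
  have u: "u \<in> verts G" using assms(1) by auto
  have "p v * T \<alpha> * p w \<approx> p v * T \<alpha> * p u * p w"
    using p_T[OF assms(1)] eqv_sym eqv_right by blast
  also have "p v * T \<alpha> * p u * p w = (p v * T \<alpha>) * (p u * p w)" by (simp add: mult.assoc)
  also have "\<dots> \<approx> (p v * T \<alpha>) * 0"
    by (rule eqv_left[OF p_orth[OF u assms(2)]]) (use assms(3) in simp)
  finally show ?thesis by simp
qed

text \<open>Equal first edges cancel, and a first differing pair gives 0. If \<alpha> is empty,
  being a prefix says nothing about where \<beta> starts, hence the additional walk
  condition.\<close>

lemma T_S_le: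
  "\<lbrakk>awalk u \<alpha> v; awalk u' \<beta> x; length \<alpha> \<le> length \<beta>\<rbrakk> \<Longrightarrow>
   p v * T \<alpha> * (S \<beta> * p x) \<approx> (if prefix \<alpha> \<beta> \<and> awalk v (drop (length \<alpha>) \<beta>) x then S (drop (length \<alpha>) \<beta>) * p x else 0)"
proof (induction \<alpha> arbitrary: u u' \<beta>)
  case Nil
  then have v: "v = u" "v \<in> verts G" by (auto simp: awalk_simps)
  show ?case
  proof (cases "awalk v \<beta> x")
    case True
    then show ?thesis using p_S by simp
  next
    case False
    then have "v \<noteq> u'" using Nil by blast
    then show ?thesis using p_S_orth[OF Nil(2) v(2)] False by simp
  qed
next
  case (Cons e \<alpha>)
  then obtain f \<beta>' where \<beta>: "\<beta> = f # \<beta>'" by (cases \<beta>) auto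
  have w: "awalk (head G e) \<alpha> v" "e \<in> arcs G" "awalk (head G f) \<beta>' x" "f \<in> arcs G"
    "length \<alpha> \<le> length \<beta>'"
    using Cons.prems unfolding \<beta> by (auto simp: awalk_simps)
  have eq: "p v * T (e # \<alpha>) * (S \<beta> * p x) = (p v * T \<alpha>) * ((t e * s f) * (S \<beta>' * p x))"
    unfolding \<beta> by (simp add: mult.assoc)
  show ?case
  proof (cases "e = f")
    case True
    have "(t e * s f) * (S \<beta>' * p x) \<approx> p (head G e) * (S \<beta>' * p x)"
      using t_s[OF w(2)] True eqv_right by blast
    also have "\<dots> \<approx> S \<beta>' * p x" using p_S[OF w(3)] True by simp
    finally have "p v * T (e # \<alpha>) * (S \<beta> * p x) \<approx> p v * T \<alpha> * (S \<beta>' * p x)"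
      unfolding eq by (rule eqv_left)
    also have "\<dots> \<approx> (if prefix (e # \<alpha>) \<beta> \<and> awalk v (drop (length (e # \<alpha>)) \<beta>) x
        then S (drop (length (e # \<alpha>)) \<beta>) * p x else 0)"
      using Cons.IH[OF w(1,3,5)] True unfolding \<beta> by (simp split del: if_split cong: if_cong)
    finally show ?thesis .
  next
    case False
    have "(t e * s f) * (S \<beta>' * p x) \<approx> 0 * (S \<beta>' * p x)"
      using t_s_orth[OF w(2,4) False] eqv_right by blast
    then have "(p v * T \<alpha>) * ((t e * s f) * (S \<beta>' * p x)) \<approx> (p v * T \<alpha>) * (0 * (S \<beta>' * p x))"
      by (rule eqv_left)
    then show ?thesis unfolding eq using False \<beta> by simp
  qed
qed

lemma T_S_self: "awalk u \<alpha> v \<Longrightarrow> p v * T \<alpha> * (S \<alpha> * p v) \<approx> p v"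
  using T_S_le[of u \<alpha> v u \<alpha> v] awalk_last_in_verts[of u \<alpha> v] by (simp add: awalk_Nil_iff)

text \<open>Each source on \<alpha> is regular with a single edge, so the summation relation there
  has one summand \<open>s e * t e\<close>, and the pairs are absorbed from the inside
  outwards.\<close>

lemma S_T_deterministic:
  "\<lbrakk>awalk u \<alpha> v; \<And>e. e \<in> set \<alpha> \<Longrightarrow> out_arcs G (tail G e) = {e}\<rbrakk> \<Longrightarrow> S \<alpha> * p v * T \<alpha> \<approx> p u"
proof (induction \<alpha> arbitrary: u)
  case (Cons e \<alpha>)
  then have w: "awalk (head G e) \<alpha> v" "e \<in> arcs G" "u = tail G e" by (auto simp: awalk_simps)
  have "s e * (S \<alpha> * p v * T \<alpha>) * t e \<approx> s e * p (head G e) * t e"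
    using Cons.IH[OF w(1)] Cons.prems(2) eqv_mid by simp
  also have "\<dots> \<approx> s e * t e" using s_p[OF w(2)] eqv_right by blast
  also have "\<dots> \<approx> p u"
  proof -
    have o: "out_arcs G u = {e}" using Cons.prems(2)[of e] w(3) by simp
    then have "regular_vertex G u" unfolding regular_vertex_def using w by auto
    from p_regular[OF this] show ?thesis using o eqv_sym by simp
  qed
  finally show ?case by (simp add: mult.assoc)
qed (auto simp: awalk_simps intro: p_idem)

subsection \<open>Reduction to vertices and to cycles without exits\<close>

text \<open>The two outcomes of the reduction. The second cannot be avoided in general: at a cycle
  without exits a nonzero polynomial in the cycle need not generate the vertex.\<close>

definition reducible :: "'a \<Rightarrow> bool" where
  "reducible x \<longleftrightarrow> (\<exists>a b. \<exists>u\<in>verts G. a * x * b \<approx> p u) \<or>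
     (\<exists>w a b. rigid w \<and> p w * (a * x * b) * p w \<notin> J)"

lemma reducible_mult:
  assumes "reducible (a * x * b)"
  shows "reducible x"
proof -
  have "c * (a * x * b) * d = (c * a) * x * (b * d)" for c d by (simp add: mult.assoc)
  then show ?thesis using assms unfolding reducible_def by metis
qed

lemma reducible_cong:
  assumes "x \<approx> y" "reducible x"
  shows "reducible y"
proof -
  have 1: "a * y * b \<approx> a * x * b" for a b using assms(1) eqv_sym eqv_mid by blast
  then have 2: "p w * (a * y * b) * p w \<in> J \<longleftrightarrow> p w * (a * x * b) * p w \<in> J" for w a b
    using eqv_mem eqv_mid by blast
  show ?thesis using assms(2) 1 eqv_trans unfolding reducible_def 2 by blast
qed

section \<open>Combinations of paths with a common range, without ghost edges\<close>

definition comb :: "'e list set \<Rightarrow> ('e list \<Rightarrow> 'k) \<Rightarrow> 'v \<Rightarrow> 'a" where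
  "comb Z k v = (\<Sum>\<alpha>\<in>Z. \<kappa> (k \<alpha>) * (S \<alpha> * p v))"

text \<open>What is left of the other paths of \<open>Z\<close> when \<alpha> is cancelled from the
  left: since all of them end at \<open>v\<close>, those that extend \<alpha> do so by a closed walk
  at \<open>v\<close>.\<close>

definition returns :: "'e list set \<Rightarrow> 'e list \<Rightarrow> 'v \<Rightarrow> 'e list set" where
  "returns Z \<alpha> v = {\<gamma>. \<gamma> \<noteq> [] \<and> \<alpha> @ \<gamma> \<in> Z \<and> awalk v \<gamma> v}"

text \<open>As \<alpha> has minimal length, \<open>T \<alpha>\<close> turns every path into 0 or
  into a path starting at \<open>v\<close>. The coefficient of \<alpha> becomes that of the vertex,
  and the remaining terms are closed walks.\<close>

lemma comb_leading:
  assumes fin: "finite Z" and walks: "\<And>\<alpha>. \<alpha> \<in> Z \<Longrightarrow> \<exists>u. awalk u \<alpha> v"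
    and \<alpha>: "\<alpha> \<in> Z" "\<And>\<beta>. \<beta> \<in> Z \<Longrightarrow> length \<alpha> \<le> length \<beta>"
  shows "p v * T \<alpha> * comb Z k v \<approx>
    \<kappa> (k \<alpha>) * p v + (\<Sum>\<gamma>\<in>returns Z \<alpha> v. \<kappa> (k (\<alpha> @ \<gamma>)) * (S \<gamma> * p v))"
    and "finite (returns Z \<alpha> v)"
proof -
  have \<Gamma>: "finite (returns Z \<alpha> v)"
  proof -
    have "(@) \<alpha> ` returns Z \<alpha> v \<subseteq> Z" unfolding returns_def by auto
    then show ?thesis using fin by (meson finite_imageD finite_subset inj_onI same_append_eq)
  qed
  then show "finite (returns Z \<alpha> v)" .
  obtain u where u: "awalk u \<alpha> v" using walks \<alpha>(1) by blast
  then have v: "v \<in> verts G" by auto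
  define W where "W = {\<beta> \<in> Z. prefix \<alpha> \<beta> \<and> awalk v (drop (length \<alpha>) \<beta>) v}"
  have "p v * T \<alpha> * comb Z k v = (\<Sum>\<beta>\<in>Z. \<kappa> (k \<beta>) * (p v * T \<alpha> * (S \<beta> * p v)))"
    unfolding comb_def sum_distrib_left by (simp only: \<kappa>_pull)
  also have "\<dots> \<approx> (\<Sum>\<beta>\<in>Z. \<kappa> (k \<beta>) * (if prefix \<alpha> \<beta> \<and> awalk v (drop (length \<alpha>) \<beta>) v
      then S (drop (length \<alpha>) \<beta>) * p v else 0))"
    using walks \<alpha>(2) by (intro eqv_sum eqv_left) (meson T_S_le u)
  also have "\<dots> = (\<Sum>\<beta>\<in>W. \<kappa> (k \<beta>) * (S (drop (length \<alpha>) \<beta>) * p v))"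
    unfolding W_def using fin by (subst sum.inter_filter) (auto intro: sum.cong)
  also have "W = (@) \<alpha> ` insert [] (returns Z \<alpha> v)"
    unfolding W_def returns_def using \<alpha>(1) v by (auto simp: prefix_def awalk_Nil_iff)
  also have "(\<Sum>\<beta>\<in>(@) \<alpha> ` insert [] (returns Z \<alpha> v). \<kappa> (k \<beta>) * (S (drop (length \<alpha>) \<beta>) * p v)) =
     (\<Sum>\<gamma>\<in>insert [] (returns Z \<alpha> v). \<kappa> (k (\<alpha> @ \<gamma>)) * (S \<gamma> * p v))"
    by (subst sum.reindex) (auto simp: inj_on_def)
  also have "\<dots> = \<kappa> (k \<alpha>) * p v + (\<Sum>\<gamma>\<in>returns Z \<alpha> v. \<kappa> (k (\<alpha> @ \<gamma>)) * (S \<gamma> * p v))"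
    using \<Gamma> by (subst sum.insert) (auto simp: returns_def)
  finally show "p v * T \<alpha> * comb Z k v \<approx>
    \<kappa> (k \<alpha>) * p v + (\<Sum>\<gamma>\<in>returns Z \<alpha> v. \<kappa> (k (\<alpha> @ \<gamma>)) * (S \<gamma> * p v))" .
qed

text \<open>Compression by \<delta> sends \<open>p v\<close> to \<open>p u\<close>, whereas a closed
  walk \<gamma> yields 0, because \<delta> is not a prefix of \<gamma>\<delta>.\<close>

lemma escape_kills:
  assumes \<delta>: "awalk v \<delta> u" and \<Gamma>: "\<And>\<gamma>. \<gamma> \<in> \<Gamma> \<Longrightarrow> awalk v \<gamma> v \<and> \<not> prefix \<delta> (\<gamma> @ \<delta>)"
  shows "p u * T \<delta> * (\<kappa> k * p v + (\<Sum>\<gamma>\<in>\<Gamma>. \<kappa> (f \<gamma>) * (S \<gamma> * p v))) * (S \<delta> * p u) \<approx> \<kappa> k * p u"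
proof -
  have pS: "p v * (S \<delta> * p u) \<approx> S \<delta> * p u" by (rule p_S[OF \<delta>])
  have 1: "p u * T \<delta> * (\<kappa> k * p v) * (S \<delta> * p u) \<approx> \<kappa> k * p u"
  proof -
    have "p u * T \<delta> * (\<kappa> k * p v) * (S \<delta> * p u) = \<kappa> k * (p u * T \<delta> * (p v * (S \<delta> * p u)))"
      by (metis \<kappa>_central mult.assoc)
    also have "\<dots> \<approx> \<kappa> k * (p u * T \<delta> * (S \<delta> * p u))" by (intro eqv_left pS)
    also have "\<dots> \<approx> \<kappa> k * p u" by (intro eqv_left T_S_self[OF \<delta>])
    finally show ?thesis .
  qed
  have 2: "p u * T \<delta> * (\<kappa> (f \<gamma>) * (S \<gamma> * p v)) * (S \<delta> * p u) \<approx> 0" if "\<gamma> \<in> \<Gamma>" for \<gamma>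
  proof -
    have w: "awalk v (\<gamma> @ \<delta>) u" using \<Gamma>[OF that] \<delta> awalk_append by blast
    have "p u * T \<delta> * (\<kappa> (f \<gamma>) * (S \<gamma> * p v)) * (S \<delta> * p u) =
      (\<kappa> (f \<gamma>) * p u * T \<delta> * S \<gamma>) * (p v * (S \<delta> * p u))"
      by (metis \<kappa>_central mult.assoc)
    also have "\<dots> \<approx> (\<kappa> (f \<gamma>) * p u * T \<delta> * S \<gamma>) * (S \<delta> * p u)" by (intro eqv_left pS)
    also have "\<dots> = \<kappa> (f \<gamma>) * (p u * T \<delta> * (S (\<gamma> @ \<delta>) * p u))" by (simp add: mult.assoc)
    also have "\<dots> \<approx> \<kappa> (f \<gamma>) * 0"
      using T_S_le[OF \<delta> w] \<Gamma>[OF that] by (intro eqv_left) auto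
    finally show ?thesis by simp
  qed
  have "p u * T \<delta> * (\<kappa> k * p v + (\<Sum>\<gamma>\<in>\<Gamma>. \<kappa> (f \<gamma>) * (S \<gamma> * p v))) * (S \<delta> * p u) =
    p u * T \<delta> * (\<kappa> k * p v) * (S \<delta> * p u) +
    (\<Sum>\<gamma>\<in>\<Gamma>. p u * T \<delta> * (\<kappa> (f \<gamma>) * (S \<gamma> * p v)) * (S \<delta> * p u))"
    by (simp add: distrib_left distrib_right sum_distrib_left sum_distrib_right)
  also have "\<dots> \<approx> \<kappa> k * p u + (\<Sum>\<gamma>\<in>\<Gamma>. 0)" by (intro eqv_add eqv_sum 1 2)
  finally show ?thesis by simp
qed

lemma reducible_unit:
  assumes "a * x * b \<approx> \<kappa> k * p u" "k \<noteq> 0" "u \<in> verts G"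
  shows "reducible x"
proof -
  have "(\<kappa> (1 / k) * a) * x * b = \<kappa> (1 / k) * (a * x * b)" by (simp add: mult.assoc)
  also have "\<dots> \<approx> \<kappa> (1 / k) * (\<kappa> k * p u)" by (rule eqv_left[OF assms(1)])
  also have "\<dots> = p u" by (rule \<kappa>_cancel[OF assms(2)])
  finally show ?thesis using assms(3) unfolding reducible_def by blast
qed

lemma obtain_shortest:
  assumes "finite Z" "Z \<noteq> {}"
  obtains \<alpha> where "\<alpha> \<in> Z" "\<And>\<beta>. \<beta> \<in> Z \<Longrightarrow> length \<alpha> \<le> length (\<beta> :: 'e list)"
  using assms arg_min_if_finite(1)[OF assms, of length] arg_min_least[OF assms, of _ length] by metis

text \<open>Used at cycles without exits, where no escaping path is at hand. If cancelling a
  shortest \<alpha> leads into \<open>J\<close>, then multiplying back by \<open>S \<alpha>\<close>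
  shows that the terms surviving the cancellation sum up to an element of \<open>J\<close>. They are
  dropped, \<alpha> among them, and the induction goes on.\<close>

lemma comb_corner:
  assumes "finite Z" "\<And>\<alpha>. \<alpha> \<in> Z \<Longrightarrow> \<exists>u. awalk u \<alpha> v" "v \<in> verts G" "comb Z k v \<notin> J"
  shows "\<exists>a. p v * (a * comb Z k v) \<notin> J"
  using assms
proof (induction "card Z" arbitrary: Z rule: less_induct)
  case less
  have "Z \<noteq> {}" using less.prems(4) idl_zero[OF idl_J] unfolding comb_def by auto
  then obtain \<alpha> where \<alpha>: "\<alpha> \<in> Z" "\<And>\<beta>. \<beta> \<in> Z \<Longrightarrow> length \<alpha> \<le> length \<beta>"
    using obtain_shortest less.prems(1) by blast
  obtain u where u: "awalk u \<alpha> v" using less.prems(2) \<alpha>(1) by blast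
  show ?case
  proof (cases "p v * (T \<alpha> * comb Z k v) \<in> J")
    case False
    then show ?thesis by blast
  next
    case True
    define W where "W = {\<beta> \<in> Z. prefix \<alpha> \<beta> \<and> awalk v (drop (length \<alpha>) \<beta>) v}"
    have "S \<alpha> * (p v * T \<alpha> * comb Z k v) = (\<Sum>\<beta>\<in>Z. \<kappa> (k \<beta>) * (S \<alpha> * (p v * T \<alpha> * (S \<beta> * p v))))"
      unfolding comb_def sum_distrib_left by (simp only: \<kappa>_pull)
    also have "\<dots> \<approx> (\<Sum>\<beta>\<in>Z. \<kappa> (k \<beta>) * (S \<alpha> * (if prefix \<alpha> \<beta> \<and> awalk v (drop (length \<alpha>) \<beta>) v
        then S (drop (length \<alpha>) \<beta>) * p v else 0)))"
      using less.prems(2) \<alpha>(2) by (intro eqv_sum eqv_left) (meson T_S_le u)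
    also have "\<dots> = (\<Sum>\<beta>\<in>W. \<kappa> (k \<beta>) * (S \<alpha> * (S (drop (length \<alpha>) \<beta>) * p v)))"
      unfolding W_def using less.prems(1) by (subst sum.inter_filter) (auto intro: sum.cong)
    also have "\<dots> = comb W k v"
      unfolding comb_def W_def by (rule sum.cong) (auto simp: prefix_def mult.assoc)
    finally have "comb W k v \<in> J"
      using eqv_mem idl_left[OF idl_J True, of "S \<alpha>"] by (simp add: mult.assoc)
    moreover have split: "comb Z k v = comb W k v + comb (Z - W) k v"
      unfolding comb_def using less.prems(1) by (subst sum.subset_diff[of W Z]) (auto simp: W_def add.commute)
    ultimately have "comb (Z - W) k v \<notin> J" using less.prems(4) idl_add[OF idl_J] by auto
    moreover have "card (Z - W) < card Z"
      using \<alpha>(1) less.prems(1,3) unfolding W_def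
      by (intro psubset_card_mono) (auto simp: awalk_Nil_iff)
    ultimately obtain a where a: "p v * (a * comb (Z - W) k v) \<notin> J"
      using less.hyps[of "Z - W"] less.prems by blast
    have "p v * (a * comb Z k v) = p v * (a * comb W k v) + p v * (a * comb (Z - W) k v)"
      unfolding split by (simp add: distrib_left)
    then have "p v * (a * comb Z k v) \<approx> p v * (a * comb (Z - W) k v)"
      unfolding eqv_def using idl_left[OF idl_J] \<open>comb W k v \<in> J\<close> by simp
    then show ?thesis using a eqv_mem by blast
  qed
qed

text \<open>Off the cycles without exits, an escaping path removes the closed walks left by
  \<open>comb_leading\<close>, and the nonzero leading coefficient yields a vertex.\<close>

lemma comb_reducible:
  assumes "finite Z" "\<And>\<alpha>. \<alpha> \<in> Z \<Longrightarrow> \<exists>u. awalk u \<alpha> v" "v \<in> verts G" "comb Z k v \<notin> J"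
    and k: "\<And>\<alpha>. \<alpha> \<in> Z \<Longrightarrow> k \<alpha> \<noteq> 0"
  shows "reducible (comb Z k v)"
proof (cases "rigid v")
  case True
  obtain a where a: "p v * (a * comb Z k v) \<notin> J" using comb_corner[OF assms(1-4)] by blast
  have "comb Z k v * p v \<approx> comb Z k v"
    unfolding comb_def sum_distrib_right using p_idem[OF assms(3)]
    by (auto intro!: eqv_sum eqv_left simp: mult.assoc)
  then have "p v * a * (comb Z k v * p v) \<approx> p v * a * comb Z k v" by (rule eqv_left)
  then have "p v * (a * comb Z k v * 1) * p v \<notin> J" using a eqv_mem by (simp add: mult.assoc)
  then show ?thesis using True unfolding reducible_def by blast
next
  case False
  have "Z \<noteq> {}" using assms(4) idl_zero[OF idl_J] unfolding comb_def by auto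
  then obtain \<alpha> where \<alpha>: "\<alpha> \<in> Z" "\<And>\<beta>. \<beta> \<in> Z \<Longrightarrow> length \<alpha> \<le> length \<beta>"
    using obtain_shortest assms(1) by blast
  note lead = comb_leading[OF assms(1,2) \<alpha>]
  obtain \<delta> u where \<delta>: "awalk v \<delta> u" "\<And>\<gamma>. \<gamma> \<in> returns Z \<alpha> v \<Longrightarrow> \<not> prefix \<delta> (\<gamma> @ \<delta>)"
    using escaping_path[OF assms(3) False, of "returns Z \<alpha> v"] lead(2) unfolding returns_def by blast
  have "(p u * T \<delta>) * (p v * T \<alpha> * comb Z k v) * (S \<delta> * p u) \<approx> (p u * T \<delta>) *
     (\<kappa> (k \<alpha>) * p v + (\<Sum>\<gamma>\<in>returns Z \<alpha> v. \<kappa> (k (\<alpha> @ \<gamma>)) * (S \<gamma> * p v))) * (S \<delta> * p u)"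
    by (intro eqv_mid lead(1))
  also have "\<dots> \<approx> \<kappa> (k \<alpha>) * p u"
    by (rule escape_kills[OF \<delta>(1)]) (use \<delta>(2) in \<open>auto simp: returns_def\<close>)
  finally have "(p u * T \<delta> * (p v * T \<alpha>)) * comb Z k v * (S \<delta> * p u) \<approx> \<kappa> (k \<alpha>) * p u"
    by (simp add: mult.assoc)
  then show ?thesis using reducible_unit k[OF \<alpha>(1)] \<delta>(1) by (meson awalk_last_in_verts)
qed


section \<open>Path terms with ghost edges\<close>

definition walk_term :: "'v \<Rightarrow> ('k, 'v, 'e) path_term \<Rightarrow> bool" where
  "walk_term u = (\<lambda>(k, \<alpha>, v, \<beta>). (\<exists>w. awalk w \<alpha> v) \<and> awalk u \<beta> v)"

definition term_val :: "('k, 'v, 'e) path_term \<Rightarrow> 'a" where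
  "term_val = (\<lambda>(k, \<alpha>, v, \<beta>). \<kappa> k * (S \<alpha> * (p v * T \<beta>)))"

definition eval :: "('k, 'v, 'e) path_term list \<Rightarrow> 'a" where
  "eval ts = sum_list (map term_val ts)"

definition ghost :: "('k, 'v, 'e) path_term \<Rightarrow> 'e list" where
  "ghost = (\<lambda>(k, \<alpha>, v, \<beta>). \<beta>)"

lemma eval_simps [simp]: "eval [] = 0" "eval (\<tau> # ts) = term_val \<tau> + eval ts"
  "eval (ts @ ts') = eval ts + eval ts'"
  unfolding eval_def by auto

lemma eval_partition: "eval ts = eval (filter Q ts) + eval (filter (\<lambda>\<tau>. \<not> Q \<tau>) ts)"
  by (induction ts) (auto simp: algebra_simps)

lemma eval_right: "eval ts * x = (\<Sum>\<tau>\<leftarrow>ts. term_val \<tau> * x)"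
  unfolding eval_def by (induction ts) (auto simp: distrib_right)

lemma term_val_p: "walk_term u \<tau> \<Longrightarrow> term_val \<tau> * p u \<approx> term_val \<tau>"
proof -
  assume a: "walk_term u \<tau>"
  obtain k \<alpha> v \<beta> where \<tau>: "\<tau> = (k, \<alpha>, v, \<beta>)" by (cases \<tau>)
  have "\<kappa> k * S \<alpha> * (p v * T \<beta> * p u) \<approx> \<kappa> k * S \<alpha> * (p v * T \<beta>)"
    using a \<tau> unfolding walk_term_def by (intro eqv_left p_T) auto
  then show ?thesis unfolding term_val_def \<tau> by (simp add: mult.assoc)
qed

lemma term_val_p_orth: "walk_term u \<tau> \<Longrightarrow> w \<in> verts G \<Longrightarrow> w \<noteq> u \<Longrightarrow> term_val \<tau> * p w \<approx> 0"
proof -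
  assume a: "walk_term u \<tau>" "w \<in> verts G" "w \<noteq> u"
  obtain k \<alpha> v \<beta> where \<tau>: "\<tau> = (k, \<alpha>, v, \<beta>)" by (cases \<tau>)
  have "\<kappa> k * S \<alpha> * (p v * T \<beta> * p w) \<approx> \<kappa> k * S \<alpha> * 0"
    using a \<tau> unfolding walk_term_def by (intro eqv_left p_T_orth) auto
  then show ?thesis unfolding term_val_def \<tau> by (simp add: mult.assoc)
qed

lemma eval_p: "(\<And>\<tau>. \<tau> \<in> set ts \<Longrightarrow> walk_term u \<tau>) \<Longrightarrow> eval ts * p u \<approx> eval ts"
  unfolding eval_right unfolding eval_def by (intro eqv_sum_list) (use term_val_p in auto)

text \<open>Right multiplication of a term by an edge: it lengthens \<alpha> if there is no ghost
  edge, and otherwise cancels the first edge of \<beta> or kills the term, hence a list with at most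
  one entry. The ghost length never grows, and it drops as soon as ghost edges are present.\<close>

definition term_shift :: "'e \<Rightarrow> ('k, 'v, 'e) path_term \<Rightarrow> ('k, 'v, 'e) path_term list" where
  "term_shift e = (\<lambda>(k, \<alpha>, v, \<beta>). case \<beta> of [] \<Rightarrow> [(k, \<alpha> @ [e], head G e, [])]
     | f # \<beta>' \<Rightarrow> if f = e then [(k, \<alpha>, v, \<beta>')] else [])"

lemma term_shift:
  assumes "walk_term (tail G e) \<tau>" "e \<in> arcs G"
  shows "term_val \<tau> * s e \<approx> eval (term_shift e \<tau>)"
    and "\<tau>' \<in> set (term_shift e \<tau>) \<Longrightarrow> walk_term (head G e) \<tau>'"
    and "(\<Sum>\<tau>'\<leftarrow>term_shift e \<tau>. length (ghost \<tau>')) \<le> length (ghost \<tau>)"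
    and "ghost \<tau> \<noteq> [] \<Longrightarrow> (\<Sum>\<tau>'\<leftarrow>term_shift e \<tau>. length (ghost \<tau>')) < length (ghost \<tau>)"
proof -
  obtain k \<alpha> v \<beta> where \<tau>: "\<tau> = (k, \<alpha>, v, \<beta>)" by (cases \<tau>)
  obtain w where w: "awalk w \<alpha> v" "awalk (tail G e) \<beta> v" using assms(1) unfolding \<tau> walk_term_def by auto
  show "(\<Sum>\<tau>'\<leftarrow>term_shift e \<tau>. length (ghost \<tau>')) \<le> length (ghost \<tau>)"
    "ghost \<tau> \<noteq> [] \<Longrightarrow> (\<Sum>\<tau>'\<leftarrow>term_shift e \<tau>. length (ghost \<tau>')) < length (ghost \<tau>)"
    unfolding \<tau> term_shift_def ghost_def by (auto split: list.splits)
  show "walk_term (head G e) \<tau>'" if "\<tau>' \<in> set (term_shift e \<tau>)"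
  proof (cases \<beta>)
    case Nil
    then have "v = tail G e" using w by (auto simp: awalk_simps)
    then have "awalk w (\<alpha> @ [e]) (head G e)"
      unfolding awalk_append using w(1) assms(2) by (auto simp: awalk_simps)
    then show ?thesis using that assms(2) unfolding \<tau> Nil term_shift_def walk_term_def
      by (auto simp: awalk_Nil_iff)
  next
    case (Cons f \<beta>')
    then show ?thesis using that w unfolding \<tau> Cons term_shift_def walk_term_def
      by (auto simp: awalk_simps split: if_splits)
  qed
  show "term_val \<tau> * s e \<approx> eval (term_shift e \<tau>)"
  proof (cases \<beta>)
    case Nil
    then have v: "v = tail G e" using w by (auto simp: awalk_simps)
    have "\<kappa> k * S \<alpha> * (p v * s e) \<approx> \<kappa> k * S \<alpha> * (s e * p (head G e))"
      using p_s[OF assms(2)] s_p[OF assms(2)] eqv_trans eqv_sym v by (intro eqv_left) blast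
    then show ?thesis unfolding \<tau> Nil by (simp add: term_shift_def term_val_def mult.assoc v awalk_simps)
  next
    case (Cons f \<beta>')
    have f: "awalk (head G f) \<beta>' v" "f \<in> arcs G" using w unfolding Cons by (auto simp: awalk_simps)
    have eq: "term_val \<tau> * s e = (\<kappa> k * S \<alpha> * p v * T \<beta>') * (t f * s e)"
      unfolding term_val_def \<tau> Cons by (simp add: mult.assoc)
    show ?thesis
    proof (cases "f = e")
      case True
      have "(\<kappa> k * S \<alpha> * p v * T \<beta>') * (t f * s e) \<approx> (\<kappa> k * S \<alpha> * p v * T \<beta>') * p (head G f)"
        using t_s[OF f(2)] True by (intro eqv_left) simp
      also have "\<dots> = (\<kappa> k * S \<alpha>) * (p v * T \<beta>' * p (head G f))" by (simp add: mult.assoc)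
      also have "\<dots> \<approx> (\<kappa> k * S \<alpha>) * (p v * T \<beta>')" by (intro eqv_left p_T[OF f(1)])
      finally show ?thesis unfolding eq unfolding \<tau> Cons term_shift_def term_val_def using True
        by (simp add: term_val_def mult.assoc)
    next
      case False
      have "(\<kappa> k * S \<alpha> * p v * T \<beta>') * (t f * s e) \<approx> (\<kappa> k * S \<alpha> * p v * T \<beta>') * 0"
        using t_s_orth[OF f(2) assms(2) False] by (intro eqv_left) simp
      then show ?thesis unfolding eq unfolding \<tau> Cons term_shift_def using False by simp
    qed
  qed
qed

definition shift :: "'e \<Rightarrow> ('k, 'v, 'e) path_term list \<Rightarrow> ('k, 'v, 'e) path_term list" where
  "shift e ts = concat (map (term_shift e) ts)"

lemma shift:
  assumes "\<And>\<tau>. \<tau> \<in> set ts \<Longrightarrow> walk_term (tail G e) \<tau>" "e \<in> arcs G"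
  shows "eval ts * s e \<approx> eval (shift e ts)"
    and "\<tau> \<in> set (shift e ts) \<Longrightarrow> walk_term (head G e) \<tau>"
    and "(\<Sum>\<tau>\<leftarrow>shift e ts. length (ghost \<tau>)) \<le> (\<Sum>\<tau>\<leftarrow>ts. length (ghost \<tau>))"
    and "\<exists>\<tau>\<in>set ts. ghost \<tau> \<noteq> [] \<Longrightarrow> (\<Sum>\<tau>\<leftarrow>shift e ts. length (ghost \<tau>)) < (\<Sum>\<tau>\<leftarrow>ts. length (ghost \<tau>))"
proof -
  show "walk_term (head G e) \<tau>" if \<tau>: "\<tau> \<in> set (shift e ts)"
  proof -
    obtain \<sigma> where "\<sigma> \<in> set ts" "\<tau> \<in> set (term_shift e \<sigma>)" using \<tau> unfolding shift_def by auto
    then show ?thesis using term_shift(2)[OF assms(1) assms(2)] by blast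
  qed
  show "eval ts * s e \<approx> eval (shift e ts)"
    using assms(1) unfolding shift_def
    by (induction ts) (auto simp: distrib_right intro!: eqv_add term_shift(1) assms(2))
  have le: "(\<Sum>\<tau>\<leftarrow>shift e ts. length (ghost \<tau>)) \<le> (\<Sum>\<tau>\<leftarrow>ts. length (ghost \<tau>))"
    if "\<And>\<tau>. \<tau> \<in> set ts \<Longrightarrow> walk_term (tail G e) \<tau>" for ts
    using that unfolding shift_def
    by (induction ts) (auto intro!: add_mono term_shift(3) assms(2))
  then show "(\<Sum>\<tau>\<leftarrow>shift e ts. length (ghost \<tau>)) \<le> (\<Sum>\<tau>\<leftarrow>ts. length (ghost \<tau>))"
    using assms(1) by blast
  show "\<exists>\<tau>\<in>set ts. ghost \<tau> \<noteq> [] \<Longrightarrow> (\<Sum>\<tau>\<leftarrow>shift e ts. length (ghost \<tau>)) < (\<Sum>\<tau>\<leftarrow>ts. length (ghost \<tau>))"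
    using assms(1)
  proof (induction ts)
    case (Cons \<tau> ts)
    note 1 = term_shift(3,4)[OF Cons.prems(2)[of \<tau>] assms(2)]
    have 2: "(\<Sum>\<tau>\<leftarrow>shift e ts. length (ghost \<tau>)) \<le> (\<Sum>\<tau>\<leftarrow>ts. length (ghost \<tau>))"
      using le Cons.prems(2) by simp
    show ?case
    proof (cases "ghost \<tau> = []")
      case True
      then have "(\<Sum>\<tau>\<leftarrow>shift e ts. length (ghost \<tau>)) < (\<Sum>\<tau>\<leftarrow>ts. length (ghost \<tau>))"
        using Cons by auto
      then show ?thesis using 1(1) by (simp add: shift_def)
    next
      case False
      then show ?thesis using 1(2) 2 by (simp add: shift_def)
    qed
  qed simp
qed

text \<open>Equal paths are merged and zero coefficients discarded, so that the coefficient of a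
  shortest path is invertible.\<close>

lemma eval_ghost_free:
  assumes "\<And>\<tau>. \<tau> \<in> set ts \<Longrightarrow> walk_term u \<tau> \<and> ghost \<tau> = []"
  shows "\<exists>Z k. finite Z \<and> (\<forall>\<alpha>\<in>Z. (\<exists>w. awalk w \<alpha> u) \<and> k \<alpha> \<noteq> 0) \<and> eval ts = comb Z k u"
proof -
  have "\<exists>Z k. finite Z \<and> (\<forall>\<alpha>\<in>Z. \<exists>w. awalk w \<alpha> u) \<and> eval ts = comb Z k u"
    using assms
  proof (induction ts)
    case Nil
    then show ?case by (intro exI[of _ "{}"]) (simp add: comb_def)
  next
    case (Cons \<tau> ts)
    then obtain Z k where Z: "finite Z" "\<forall>\<alpha>\<in>Z. \<exists>w. awalk w \<alpha> u" "eval ts = comb Z k u" by auto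
    obtain c \<alpha> v \<beta> where \<tau>: "\<tau> = (c, \<alpha>, v, \<beta>)" by (cases \<tau>)
    have \<alpha>: "\<exists>w. awalk w \<alpha> u" "v = u" "\<beta> = []"
      using Cons.prems[of \<tau>] unfolding \<tau> walk_term_def ghost_def by (auto simp: awalk_Nil_iff)
    define k' where "k' = (\<lambda>\<gamma>. (if \<gamma> \<in> Z then k \<gamma> else 0) + (if \<gamma> = \<alpha> then c else 0))"
    have "comb (insert \<alpha> Z) k' u = (\<Sum>\<gamma>\<in>insert \<alpha> Z. \<kappa> (if \<gamma> \<in> Z then k \<gamma> else 0) * (S \<gamma> * p u)) +
       (\<Sum>\<gamma>\<in>insert \<alpha> Z. \<kappa> (if \<gamma> = \<alpha> then c else 0) * (S \<gamma> * p u))"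
      unfolding comb_def k'_def \<kappa>_add distrib_right sum.distrib ..
    also have "(\<Sum>\<gamma>\<in>insert \<alpha> Z. \<kappa> (if \<gamma> \<in> Z then k \<gamma> else 0) * (S \<gamma> * p u)) = comb Z k u"
      unfolding comb_def using Z(1) by (intro sum.mono_neutral_cong_right) auto
    also have "(\<Sum>\<gamma>\<in>insert \<alpha> Z. \<kappa> (if \<gamma> = \<alpha> then c else 0) * (S \<gamma> * p u)) =
       (\<Sum>\<gamma>\<in>{\<alpha>}. \<kappa> c * (S \<gamma> * p u))"
      using Z(1) by (intro sum.mono_neutral_cong_right) auto
    finally have "eval (\<tau> # ts) = comb (insert \<alpha> Z) k' u"
      unfolding \<tau> Z(3)[symmetric] using \<alpha> by (simp add: term_val_def Z(3) add.commute)
    then show ?case using Z \<alpha> by (intro exI[of _ "insert \<alpha> Z"] exI[of _ k']) auto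
  qed
  then obtain Z k where Z: "finite Z" "\<forall>\<alpha>\<in>Z. \<exists>w. awalk w \<alpha> u" "eval ts = comb Z k u" by blast
  have "comb Z k u = comb {\<alpha> \<in> Z. k \<alpha> \<noteq> 0} k u"
    unfolding comb_def using Z(1) by (intro sum.mono_neutral_right) auto
  then show ?thesis using Z by (intro exI[of _ "{\<alpha> \<in> Z. k \<alpha> \<noteq> 0}"] exI[of _ k]) auto
qed

text \<open>Each term ends with the ghost of an edge in \<open>D\<close>, on which the sum of
  \<open>s e * t e\<close> over \<open>D\<close> acts as a right unit. Finitely many edges suffice
  even at an infinite emitter.\<close>

lemma eval_ghost_first_edges:
  assumes ts: "\<And>\<tau>. \<tau> \<in> set ts \<Longrightarrow> walk_term u \<tau> \<and> ghost \<tau> \<noteq> []"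
    and D: "finite D" "(hd \<circ> ghost) ` set ts \<subseteq> D" "D \<subseteq> arcs G"
  shows "eval ts \<approx> (\<Sum>e\<in>D. eval ts * s e * t e)"
  using ts D(2)
proof (induction ts)
  case (Cons \<tau> ts)
  obtain k \<alpha> v \<beta> where \<tau>: "\<tau> = (k, \<alpha>, v, \<beta>)" by (cases \<tau>)
  obtain f \<beta>' where \<beta>: "\<beta> = f # \<beta>'" using Cons.prems(1)[of \<tau>] unfolding \<tau> ghost_def by (cases \<beta>) auto
  have f: "f \<in> D" "f \<in> arcs G" using Cons.prems(2) D(3) unfolding \<tau> \<beta> ghost_def by auto
  have "(\<Sum>e\<in>D. term_val \<tau> * s e * t e) = (\<Sum>e\<in>D. \<kappa> k * S \<alpha> * p v * T \<beta>' * ((t f * s e) * t e))"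
    unfolding term_val_def \<tau> \<beta> by (simp add: mult.assoc)
  also have "\<dots> \<approx> (\<Sum>e\<in>D. \<kappa> k * S \<alpha> * p v * T \<beta>' * (if e = f then t f else 0))"
  proof (intro eqv_sum eqv_left)
    fix e assume e: "e \<in> D"
    show "t f * s e * t e \<approx> (if e = f then t f else 0)"
    proof (cases "e = f")
      case True
      have "t f * s e * t e \<approx> p (head G f) * t f" unfolding True by (intro eqv_right t_s f)
      also have "\<dots> \<approx> t f" by (rule p_t[OF f(2)])
      finally show ?thesis using True by simp
    next
      case False
      have "t f * s e * t e \<approx> 0 * t e" by (intro eqv_right t_s_orth f) (use e D False in auto)
      then show ?thesis using False by simp
    qed
  qed
  also have "\<dots> = term_val \<tau>"
    unfolding term_val_def \<tau> \<beta> using D(1) f(1)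
    by (simp add: mult.assoc if_distrib[of "\<lambda>x. _ * x"] sum.delta' cong: if_cong)
  finally have 1: "term_val \<tau> \<approx> (\<Sum>e\<in>D. term_val \<tau> * s e * t e)" by (rule eqv_sym)
  have "eval (\<tau> # ts) \<approx> (\<Sum>e\<in>D. term_val \<tau> * s e * t e) + (\<Sum>e\<in>D. eval ts * s e * t e)"
    unfolding eval_simps using Cons by (intro eqv_add 1) auto
  then show ?case by (simp add: distrib_right sum.distrib)
qed simp

text \<open>Induction on the total ghost length. At a regular vertex the summation relation gives an
  edge \<open>e\<close> with \<open>eval ts * s e\<close> outside \<open>J\<close>, and this
  shortens the ghosts. At an infinite emitter the same works when only ghost terms are present;
  otherwise an edge that meets none of them isolates the part without ghosts, and its leading
  coefficient survives.\<close>

lemma eval_reducible: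
  assumes "\<And>\<tau>. \<tau> \<in> set ts \<Longrightarrow> walk_term v \<tau>" "v \<in> verts G" "eval ts \<notin> J"
  shows "reducible (eval ts)"
  using assms
proof (induction "\<Sum>\<tau>\<leftarrow>ts. length (ghost \<tau>)" arbitrary: ts v rule: less_induct)
  case less
  have by_edges: "reducible (eval ts)"
    if D: "finite D" "D \<subseteq> out_arcs G v" and eq: "eval ts \<approx> (\<Sum>e\<in>D. eval ts * s e * t e)"
      and g: "\<exists>\<tau>\<in>set ts. ghost \<tau> \<noteq> []" for D
  proof -
    have "\<exists>e\<in>D. eval ts * s e \<notin> J"
    proof (rule ccontr)
      assume "\<not> ?thesis"
      then have "eval ts * s e * t e \<in> J" if "e \<in> D" for e using that idl_right[OF idl_J] by blast
      then have "(\<Sum>e\<in>D. eval ts * s e * t e) \<in> J" by (rule idl_sum[OF idl_J])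
      then show False using less.prems(3) eqv_mem[OF eq] by blast
    qed
    then obtain e where e: "e \<in> D" "eval ts * s e \<notin> J" by blast
    then have e': "e \<in> arcs G" "tail G e = v" using D by auto
    have w: "\<And>\<tau>. \<tau> \<in> set ts \<Longrightarrow> walk_term (tail G e) \<tau>" using less.prems(1) e' by simp
    note sh = shift[OF w e'(1), of ts]
    have "eval (shift e ts) \<notin> J" using sh(1) e(2) eqv_mem by blast
    then have "reducible (eval (shift e ts))"
      using less.hyps[OF sh(4)[OF _ g], of "head G e"] sh(2) e'(1) by (simp add: head_in_verts)
    then have "reducible (1 * eval ts * s e)" using reducible_cong[OF eqv_sym[OF sh(1)]] by simp
    then show ?thesis by (rule reducible_mult)
  qed
  show ?case
  proof (cases "\<exists>\<tau>\<in>set ts. ghost \<tau> \<noteq> []")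
    case False
    then obtain Z k where "finite Z" "\<forall>\<alpha>\<in>Z. (\<exists>w. awalk w \<alpha> v) \<and> k \<alpha> \<noteq> 0" "eval ts = comb Z k v"
      using eval_ghost_free[of ts v] less.prems(1) by blast
    then show ?thesis using comb_reducible[of Z v k] less.prems(2,3) by simp
  next
    case g: True
    define ts1 where "ts1 = filter (\<lambda>\<tau>. ghost \<tau> = []) ts"
    define ts2 where "ts2 = filter (\<lambda>\<tau>. ghost \<tau> \<noteq> []) ts"
    define D where "D = (hd \<circ> ghost) ` set ts2"
    have sum: "eval ts = eval ts1 + eval ts2" unfolding ts1_def ts2_def by (rule eval_partition)
    have ts2: "walk_term v \<tau> \<and> ghost \<tau> \<noteq> []" if "\<tau> \<in> set ts2" for \<tau>
      using that less.prems(1) unfolding ts2_def by auto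
    have D: "finite D" "D \<subseteq> out_arcs G v"
    proof -
      show "finite D" unfolding D_def by simp
      show "D \<subseteq> out_arcs G v"
      proof
        fix e assume "e \<in> D"
        then obtain \<tau> where \<tau>: "\<tau> \<in> set ts2" "e = hd (ghost \<tau>)" unfolding D_def by auto
        obtain k \<alpha> x \<beta> where \<tau>': "\<tau> = (k, \<alpha>, x, \<beta>)" by (cases \<tau>)
        show "e \<in> out_arcs G v" using ts2[OF \<tau>(1)] \<tau>(2) unfolding \<tau>' walk_term_def ghost_def
          by (cases \<beta>) (auto simp: awalk_simps)
      qed
    qed
    have Dne: "D \<noteq> {}" using g unfolding D_def ts2_def by auto
    have ghost_eq: "eval ts2 \<approx> (\<Sum>e\<in>D. eval ts2 * s e * t e)"
      by (rule eval_ghost_first_edges[OF ts2 D(1)]) (use D in \<open>auto simp: D_def\<close>)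
    show ?thesis
    proof (cases "finite (out_arcs G v)")
      case True
      then have "regular_vertex G v" using less.prems(2) Dne D unfolding regular_vertex_def by auto
      have "eval ts \<approx> eval ts * p v" using eval_p[OF less.prems(1)] eqv_sym by blast
      also have "\<dots> \<approx> eval ts * (\<Sum>e\<in>out_arcs G v. s e * t e)"
        by (intro eqv_left p_regular) fact
      also have "\<dots> = (\<Sum>e\<in>out_arcs G v. eval ts * s e * t e)"
        by (simp add: sum_distrib_left mult.assoc)
      finally show ?thesis by (rule by_edges[OF True subset_refl _ g])
    next
      case inf: False
      obtain Z k where Z: "finite Z" "\<forall>\<alpha>\<in>Z. (\<exists>w. awalk w \<alpha> v) \<and> k \<alpha> \<noteq> 0" "eval ts1 = comb Z k v"
        using eval_ghost_free[of ts1 v] less.prems(1) unfolding ts1_def by auto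
      show ?thesis
      proof (cases "Z = {}")
        case True
        then have "eval ts = eval ts2" using sum Z(3) by (simp add: comb_def)
        then show ?thesis using by_edges[OF D _ g] ghost_eq by simp
      next
        case False
        then obtain \<alpha> where \<alpha>: "\<alpha> \<in> Z" "\<And>\<beta>. \<beta> \<in> Z \<Longrightarrow> length \<alpha> \<le> length \<beta>"
          using obtain_shortest Z(1) by blast
        have walks: "\<And>\<alpha>. \<alpha> \<in> Z \<Longrightarrow> \<exists>w. awalk w \<alpha> v" using Z(2) by blast
        note lead = comb_leading[OF Z(1) walks \<alpha>]
        \<comment> \<open>An infinite emitter has an edge \<open>f\<close> that meets neither the ghost edges nor the returning paths.\<close>
        obtain f where f: "f \<in> out_arcs G v" "f \<notin> D \<union> hd ` returns Z \<alpha> v"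
        proof -
          have "infinite (out_arcs G v - (D \<union> hd ` returns Z \<alpha> v))"
            using inf D(1) lead(2) by (intro Diff_infinite_finite) auto
          then have "out_arcs G v - (D \<union> hd ` returns Z \<alpha> v) \<noteq> {}" by (metis finite.emptyI)
          then show thesis using that by blast
        qed
        then have fa: "f \<in> arcs G" "tail G f = v" by auto
        then have fw: "awalk v [f] (head G f)" using arc_implies_awalk by blast
        have "eval ts2 * s f \<approx> (\<Sum>e\<in>D. eval ts2 * s e * t e) * s f" by (intro eqv_right ghost_eq)
        also have "\<dots> = (\<Sum>e\<in>D. eval ts2 * s e * (t e * s f))"
          by (simp add: sum_distrib_right mult.assoc)
        also have "\<dots> \<approx> (\<Sum>e\<in>D. eval ts2 * s e * 0)"
          by (intro eqv_sum eqv_left t_s_orth fa) (use D f in auto)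
        finally have ts2f: "eval ts2 * s f \<approx> 0" by simp
        define a where "a = p (head G f) * T [f] * (p v * T \<alpha>)"
        have "a * eval ts * (S [f] * p (head G f)) =
           a * eval ts1 * (S [f] * p (head G f)) + a * (eval ts2 * s f) * p (head G f)"
          unfolding sum by (simp add: distrib_left distrib_right mult.assoc)
        also have "\<dots> \<approx> a * eval ts1 * (S [f] * p (head G f)) + a * 0 * p (head G f)"
          by (intro eqv_add eqv_refl eqv_mid ts2f)
        also have "\<dots> = p (head G f) * T [f] * (p v * T \<alpha> * comb Z k v) * (S [f] * p (head G f))"
          unfolding a_def Z(3) by (simp add: mult.assoc)
        also have "\<dots> \<approx> p (head G f) * T [f] *
           (\<kappa> (k \<alpha>) * p v + (\<Sum>\<gamma>\<in>returns Z \<alpha> v. \<kappa> (k (\<alpha> @ \<gamma>)) * (S \<gamma> * p v))) * (S [f] * p (head G f))"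
          by (intro eqv_mid lead(1))
        also have "\<dots> \<approx> \<kappa> (k \<alpha>) * p (head G f)"
        proof (rule escape_kills[OF fw])
          fix \<gamma> assume \<gamma>: "\<gamma> \<in> returns Z \<alpha> v"
          then show "awalk v \<gamma> v \<and> \<not> prefix [f] (\<gamma> @ [f])"
            using f(2) unfolding returns_def by (cases \<gamma>) (auto simp: image_iff)
        qed
        finally show ?thesis using reducible_unit Z(2) \<alpha>(1) head_in_verts[OF fa(1)] by blast
      qed
    qed
  qed
qed

lemma eval_some_source:
  assumes "\<And>\<tau>. \<tau> \<in> set ts \<Longrightarrow> \<exists>u. walk_term u \<tau>" "eval ts \<notin> J"
  shows "\<exists>u. eval (filter (walk_term u) ts) \<notin> J"
  using assms
proof (induction "length ts" arbitrary: ts rule: less_induct)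
  case less
  then obtain \<tau> ts' where ts: "ts = \<tau> # ts'" using idl_zero[OF idl_J] by (cases ts) auto
  then obtain u where u: "walk_term u \<tau>" using less.prems(1)[of \<tau>] by auto
  show ?case
  proof (cases "eval (filter (walk_term u) ts) \<in> J")
    case True
    define us where "us = filter (\<lambda>\<tau>. \<not> walk_term u \<tau>) ts"
    have "eval us \<notin> J"
      using less.prems(2) eval_partition[of ts "walk_term u"] idl_add[OF idl_J True] unfolding us_def by metis
    moreover have "length us < length ts" unfolding us_def ts using u by (simp add: le_imp_less_Suc)
    ultimately obtain w where w: "eval (filter (walk_term w) us) \<notin> J"
      using less.hyps[of us] less.prems(1) unfolding us_def by auto
    have "filter (walk_term w) us = (if w = u then [] else filter (walk_term w) ts)"
    proof -
      have "walk_term w \<tau> \<Longrightarrow> walk_term u \<tau> \<Longrightarrow> w = u" for \<tau>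
        unfolding walk_term_def by (auto split: prod.splits intro: awalk_start_unique)
      then show ?thesis unfolding us_def by (auto simp: filter_empty_conv intro!: filter_cong)
    qed
    then show ?thesis using w idl_zero[OF idl_J] by (auto split: if_splits)
  qed blast
qed

lemma eval_filter_source:
  assumes "\<And>\<tau>. \<tau> \<in> set ts \<Longrightarrow> \<exists>u. walk_term u \<tau>" "u \<in> verts G"
  shows "eval ts * p u \<approx> eval (filter (walk_term u) ts)"
  using assms(1)
proof (induction ts)
  case (Cons \<tau> ts)
  from Cons.prems[of \<tau>] obtain w where w: "walk_term w \<tau>" by auto
  have "term_val \<tau> * p u \<approx> (if walk_term u \<tau> then term_val \<tau> else 0)"
    using term_val_p term_val_p_orth[OF w assms(2)] w by (cases "u = w") auto
  then have "term_val \<tau> * p u + eval ts * p u \<approx>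
     (if walk_term u \<tau> then term_val \<tau> else 0) + eval (filter (walk_term u) ts)"
    using Cons by (intro eqv_add) auto
  then show ?case by (simp add: distrib_right split: if_splits)
qed simp

definition spanned :: "'a \<Rightarrow> bool" where
  "spanned x \<longleftrightarrow> (\<exists>ts. (\<forall>\<tau>\<in>set ts. \<exists>u. walk_term u \<tau>) \<and> x \<approx> eval ts)"

end

locale ck_family = ck_relations G J \<kappa> p s t
  for G :: "('v, 'e) pre_digraph" and J :: "'a::ring_1 set" and \<kappa> :: "'k::field \<Rightarrow> 'a"
    and C :: "'a set" and p and s t :: "'e \<Rightarrow> 'a" +
  assumes idl_C: "idl C" and J_sub_C: "J \<subseteq> C"
    and p_C: "v \<in> verts G \<Longrightarrow> p v \<in> C"
    and p_nonzero: "v \<in> verts G \<Longrightarrow> p v \<notin> J"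
    and span: "x \<in> C \<Longrightarrow> spanned x"
begin

lemma span_eval:
  assumes "x \<in> C"
  obtains ts where "\<And>\<tau>. \<tau> \<in> set ts \<Longrightarrow> \<exists>u. walk_term u \<tau>" "x \<approx> eval ts"
  using span[OF assms] that unfolding spanned_def by blast

text \<open>Multiplying by a vertex \<open>p u\<close> isolates the terms whose ghost path starts at
  \<open>u\<close>; one of these pieces lies outside \<open>J\<close>, and
  \<open>eval_reducible\<close> applies to it.\<close>

theorem reduction:
  assumes "x \<in> C" "x \<notin> J"
  shows "reducible x"
proof -
  obtain ts where ts: "\<And>\<tau>. \<tau> \<in> set ts \<Longrightarrow> \<exists>u. walk_term u \<tau>" "x \<approx> eval ts"
    using span_eval[OF assms(1)] by blast
  have "eval ts \<notin> J" using ts(2) assms(2) eqv_mem by blast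
  then obtain u where u: "eval (filter (walk_term u) ts) \<notin> J" using eval_some_source ts(1) by blast
  then have "filter (walk_term u) ts \<noteq> []" using idl_zero[OF idl_J] by auto
  then have uv: "u \<in> verts G"
    unfolding filter_empty_conv walk_term_def by (auto dest: awalk_hd_in_verts)
  have red: "reducible (eval (filter (walk_term u) ts))" by (rule eval_reducible[OF _ uv u]) auto
  have "x * p u \<approx> eval ts * p u" by (intro eqv_right ts(2))
  also have "\<dots> \<approx> eval (filter (walk_term u) ts)" by (rule eval_filter_source[OF ts(1) uv])
  finally have "eval (filter (walk_term u) ts) \<approx> 1 * x * p u" by (simp add: eqv_sym)
  from reducible_mult[OF reducible_cong[OF this red]] show ?thesis .
qed

end

section \<open>Ideals of polynomials over a field\<close>

lemma poly_ideal_principal: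
  fixes K :: "'k::field poly set"
  assumes "idl K"
  shows "\<exists>g. K = {q. g dvd q}"
proof (cases "K \<subseteq> {0}")
  case True
  then show ?thesis using idl_zero[OF assms] by (intro exI[of _ 0]) auto
next
  case False
  define R where "R g \<longleftrightarrow> g \<in> K \<and> g \<noteq> 0" for g
  have "\<exists>g. R g" using False unfolding R_def by auto
  then obtain g where g: "R g" and min: "\<And>h. R h \<Longrightarrow> degree g \<le> degree h"
    by (metis arg_min_nat_lemma[of R _ degree])
  have "g dvd q" if "q \<in> K" for q
  proof -
    have "q mod g = q - (q div g) * g" by (simp add: minus_div_mult_eq_mod)
    moreover have "q - (q div g) * g \<in> K"
      using idl_diff[OF assms that] idl_left[OF assms] g unfolding R_def by blast
    ultimately have "q mod g \<in> K" by simp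
    then have "q mod g = 0" using min[of "q mod g"] degree_mod_less[of g q] g unfolding R_def by fastforce
    then show ?thesis by (simp add: mod_eq_0_iff_dvd)
  qed
  moreover have "q \<in> K" if "g dvd q" for q
    using that idl_right[OF assms] g unfolding R_def dvd_def by blast
  ultimately show ?thesis by blast
qed

lemma poly_irreducible_degree: "irreducible (f :: 'k::field poly) \<Longrightarrow> 0 < degree f"
  by (metis irreducible_def is_unit_iff_degree neq0_conv)

text \<open>The generator of the ideal (h, f) divides the irreducible \<open>f\<close> and is not
  associated to it, so it is a unit. Multiplying two such identities raises the power of
  \<open>f\<close>.\<close>

lemma poly_bezout:
  fixes f h :: "'k::field poly"
  assumes f: "irreducible f" "\<not> f dvd h"
  shows "\<exists>a b. a * h + b * f ^ n = 1"
proof -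
  define K where "K = {x. \<exists>a b. x = a * h + b * f}"
  have "idl K"
  proof (rule idlI)
    show "0 \<in> K" unfolding K_def by (auto intro: exI[of _ 0])
    show "x + y \<in> K" if xy: "x \<in> K" "y \<in> K" for x y
    proof -
      obtain a b a' b' where "x = a * h + b * f" "y = a' * h + b' * f" using xy unfolding K_def by blast
      then have "x + y = (a + a') * h + (b + b') * f" by (simp add: algebra_simps)
      then show ?thesis unfolding K_def by blast
    qed
    show 1: "c * x \<in> K" if x: "x \<in> K" for x c
    proof -
      obtain a b where "x = a * h + b * f" using x unfolding K_def by blast
      then have "c * x = (c * a) * h + (c * b) * f" by (simp add: algebra_simps)
      then show ?thesis unfolding K_def by blast
    qed
    show "x * c \<in> K" if "x \<in> K" for x c using 1[OF that, of c] by (simp add: mult.commute)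
  qed
  then obtain d where d: "K = {q. d dvd q}" using poly_ideal_principal by blast
  have "h = 1 * h + 0 * f" "f = 0 * h + 1 * f" by simp_all
  then have "h \<in> K" "f \<in> K" unfolding K_def by blast+
  then have "d dvd h" "d dvd f" using d by auto
  then obtain e where e: "f = d * e" by (auto simp: dvd_def)
  then have "is_unit d \<or> is_unit e" using f(1) by (simp add: irreducible_def)
  moreover have "\<not> is_unit e"
  proof
    assume "is_unit e"
    then have "f dvd d" using e by simp
    then show False using \<open>d dvd h\<close> f(2) dvd_trans by blast
  qed
  ultimately have "1 \<in> K" using d by auto
  then obtain a b where ab: "a * h + b * f = 1" unfolding K_def by force
  show ?thesis
  proof (induction n)
    case 0
    show ?case by (intro exI[of _ 0] exI[of _ 1]) simp
  next
    case (Suc n)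
    then obtain a' b' where "a' * h + b' * f ^ n = 1" by blast
    then have "(a' * h + b' * f ^ n) * (a * h + b * f) = 1" using ab by simp
    then have "(a' * (a * h + b * f) + b' * f ^ n * a) * h + (b' * b) * f ^ Suc n = 1"
      by (simp add: algebra_simps)
    then show ?case by blast
  qed
qed

lemma poly_irreducible_split:
  fixes f q :: "'k::field poly"
  assumes f: "irreducible f" and "q \<noteq> 0"
  shows "\<exists>j h. q = f ^ j * h \<and> \<not> f dvd h"
  using assms(2)
proof (induction "degree q" arbitrary: q rule: less_induct)
  case less
  show ?case
  proof (cases "f dvd q")
    case False
    then show ?thesis by (intro exI[of _ 0] exI[of _ q]) simp
  next
    case True
    then obtain q' where q': "q = f * q'" by (auto simp: dvd_def)
    have "degree q' < degree q"
      using q' less.prems poly_irreducible_degree[OF f] by (auto simp: degree_mult_eq)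
    then obtain j h where "q' = f ^ j * h" "\<not> f dvd h" using less.hyps less.prems q' by fastforce
    then show ?thesis unfolding q' by (intro exI[of _ "Suc j"] exI[of _ h]) (simp add: mult.assoc)
  qed
qed

lemma poly_irreducible_factor:
  fixes g :: "'k::field poly"
  assumes "g \<noteq> 0" "\<not> is_unit g"
  shows "\<exists>f. irreducible f \<and> f dvd g"
proof -
  define R where "R d \<longleftrightarrow> d dvd g \<and> \<not> is_unit d" for d
  have "R g" using assms unfolding R_def by simp
  then obtain f where f: "R f" and min: "\<And>d. R d \<Longrightarrow> degree f \<le> degree d"
    by (metis arg_min_nat_lemma[of R _ degree])
  have f0: "f \<noteq> 0" using f assms(1) unfolding R_def by auto
  have "is_unit a \<or> is_unit b" if ab: "f = a * b" for a b
  proof (rule ccontr)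
    assume "\<not> ?thesis"
    then have n: "\<not> is_unit a" "\<not> is_unit b" by auto
    have "a dvd g" using f dvd_mult_left unfolding R_def ab by blast
    then have "R a" using n(1) unfolding R_def by blast
    then have "degree f \<le> degree a" by (rule min)
    then have "degree b = 0" using f0 unfolding ab by (simp add: degree_mult_eq)
    moreover have "b \<noteq> 0" using f0 ab by auto
    ultimately show False using n(2) is_unit_iff_degree by blast
  qed
  moreover have "\<not> is_unit f" using f unfolding R_def by blast
  ultimately have "irreducible f" using f0 by (intro irreducibleI)
  then show ?thesis using f unfolding R_def by blast
qed

lemma poly_ideal_prime_generator:
  fixes K :: "'k::field poly set"
  assumes K: "idl K" "1 \<notin> K" and prime: "\<And>q r. q * r \<in> K \<Longrightarrow> q \<in> K \<or> r \<in> K" and ne: "\<not> K \<subseteq> {0}"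
  shows "\<exists>f. irreducible f \<and> f \<in> K"
proof -
  obtain g where g: "K = {q. g dvd q}" using poly_ideal_principal[OF K(1)] by blast
  have "prime_elem g"
  proof (rule prime_elemI)
    show "g \<noteq> 0" using ne unfolding g by auto
    show "\<not> is_unit g" using K(2) unfolding g by simp
    show "g dvd q \<or> g dvd r" if "g dvd q * r" for q r using prime[of q r] that unfolding g by simp
  qed
  then have "irreducible g" by (rule prime_elem_imp_irreducible)
  then show ?thesis using g by auto
qed

text \<open>
  The ideals \<open>K\<close> with \<open>X q \<in> K \<Longrightarrow> q \<in> K\<close> are the traces on \<open>K[X]\<close> of the ideals of the ring of
  Laurent polynomials; this treats the subdirectly irreducible quotients of the latter.
\<close>
lemma monolithic_poly_ideal:
  fixes K :: "'k::field poly set"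
  assumes K: "idl K" "1 \<notin> K" and x: "\<And>n q. monom 1 n * q \<in> K \<Longrightarrow> q \<in> K" and q0: "q0 \<notin> K"
    and mono: "\<And>q. q \<notin> K \<Longrightarrow> \<exists>r n. monom 1 n * q0 - q * r \<in> K"
  shows "\<exists>f n. irreducible f \<and> 0 < n \<and> K = {q. f ^ n dvd q}"
proof -
  obtain g where g: "K = {q. g dvd q}" using poly_ideal_principal[OF K(1)] by blast
  have g0: "g \<noteq> 0"
  proof
    assume "g = 0"
    then have K0: "K = {0}" unfolding g by auto
    have q0': "q0 \<noteq> 0" using q0 K0 by simp
    \<comment> \<open>With \<open>K = 0\<close>, this \<open>q\<close> divides
      \<open>X^n * q0\<close> for some \<open>n\<close>. Since \<open>X * q0\<close> is congruent to
      -1 modulo \<open>q\<close>, a power of -1 is then divisible by \<open>q\<close>, so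
      \<open>q\<close> is a unit although its degree is positive.\<close>
    define q where "q = 1 + monom 1 1 * q0"
    have deg: "degree q = degree q0 + 1"
    proof -
      have "degree (monom 1 1 * q0) = degree q0 + 1"
        using q0' by (subst degree_mult_eq) (auto simp: degree_monom_eq monom_eq_0_iff)
      then show ?thesis unfolding q_def by (subst degree_add_eq_right) auto
    qed
    then have "q \<notin> K" using K0 by auto
    from mono[OF this] obtain r n where "monom 1 n * q0 - q * r \<in> K" by blast
    then have r: "monom 1 n * q0 = q * r" unfolding K0 by simp
    define y where "y = monom 1 1 * q0"
    have mp: "monom (1::'k) m = monom 1 1 ^ m" for m by (simp add: monom_altdef)
    have "y ^ Suc n = monom 1 n * q0 * (monom 1 1 * q0 ^ n)"
      unfolding y_def mp[of n] by (simp add: power_mult_distrib mult.commute mult.left_commute)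
    then have d1: "q dvd y ^ Suc n" using r by (simp add: mult.assoc)
    have "q dvd y ^ m - (-1) ^ m" for m
    proof (induction m)
      case (Suc m)
      have "y ^ Suc m - (-1) ^ Suc m = y * (y ^ m - (-1) ^ m) + (-1) ^ m * q"
        unfolding q_def y_def[symmetric] by (simp add: algebra_simps)
      then show ?case using Suc by simp
    qed simp
    then have "q dvd y ^ Suc n - (y ^ Suc n - (-1) ^ Suc n)" using d1 dvd_diff by blast
    then have "q dvd (-1) ^ Suc n" by (simp only: diff_diff_eq2 add_diff_cancel_left' diff_add_cancel add.commute)
    then have "q dvd (-1) ^ Suc n * (-1) ^ Suc n" by (rule dvd_mult2)
    moreover have "(-1) ^ Suc n * (-1) ^ Suc n = (1 :: 'k poly)"
      unfolding power_mult_distrib[symmetric] by simp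
    ultimately have "is_unit q" by simp
    moreover have "q \<noteq> 0" using \<open>q \<notin> K\<close> K0 by simp
    ultimately have "degree q = 0" using is_unit_iff_degree by blast
    then show False using deg by simp
  qed
  have "\<not> is_unit g" using K(2) unfolding g by simp
  then obtain f where f: "irreducible f" "f dvd g" using poly_irreducible_factor g0 by blast
  obtain n h where gh: "g = f ^ n * h" "\<not> f dvd h" using poly_irreducible_split[OF f(1) g0] by blast
  have n: "0 < n" using f(2) gh by (cases n) auto
  \<comment> \<open>Otherwise \<open>f^n\<close> and \<open>h\<close> are coprime and both outside
    \<open>K\<close>, so up to powers of \<open>X\<close> each of them divides \<open>q0\<close>
    modulo \<open>K\<close>; then so does their product \<open>g\<close>, and \<open>q0\<close>
    would lie in \<open>K\<close>.\<close>
  have "is_unit h"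
  proof (rule ccontr)
    assume hu: "\<not> is_unit h"
    have h0: "h \<noteq> 0" "f \<noteq> 0" using g0 gh n by auto
    have nK: "f ^ n \<notin> K" "h \<notin> K"
    proof -
      show "f ^ n \<notin> K"
      proof
        assume "f ^ n \<in> K"
        then have "f ^ n * h dvd f ^ n * 1" using g gh by simp
        then have "h dvd 1" using dvd_times_left_cancel_iff[OF power_not_zero[OF h0(2), of n]] by blast
        then show False using hu by simp
      qed
      show "h \<notin> K"
      proof
        assume "h \<in> K"
        then have "h * f ^ n dvd h * 1" using g gh by (simp add: mult.commute)
        then have "is_unit (f ^ n)" using dvd_times_left_cancel_iff[OF h0(1)] by blast
        then show False using f(1) n by (simp add: is_unit_power_iff irreducible_def)
      qed
    qed
    obtain r1 n1 where 1: "monom 1 n1 * q0 - f ^ n * r1 \<in> K" using mono nK by blast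
    obtain r2 n2 where 2: "monom 1 n2 * q0 - h * r2 \<in> K" using mono nK by blast
    obtain a b where ab: "a * h + b * f ^ n = 1" using poly_bezout[OF f(1) gh(2)] by blast
    have "monom 1 n1 * (monom 1 n2 * q0) = (a * h + b * f ^ n) * (monom 1 n1 * (monom 1 n2 * q0))"
      using ab by simp
    also have "\<dots> = (a * h * monom 1 n2) * (monom 1 n1 * q0 - f ^ n * r1)
      + (b * f ^ n * monom 1 n1) * (monom 1 n2 * q0 - h * r2)
      + (a * monom 1 n2 * r1 + b * monom 1 n1 * r2) * g"
      unfolding gh(1) by (simp add: algebra_simps)
    also have "\<dots> \<in> K"
      using idl_left[OF K(1) 1] idl_left[OF K(1) 2] g idl_add[OF K(1)] by simp
    finally have "monom 1 n2 * q0 \<in> K" by (rule x)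
    then show False using x q0 by blast
  qed
  then have "K = {q. f ^ n dvd q}" unfolding g gh(1) using mult_unit_dvd_iff[of h "f ^ n"] by auto
  then show ?thesis using f(1) n by blast
qed

text \<open>The part \<open>h\<close> of \<open>q\<close> prime to \<open>f\<close> is invertible
  modulo \<open>f^n\<close>, so \<open>q\<close> generates \<open>f^j\<close> modulo
  \<open>K\<close>, where \<open>j\<close> is the exponent of \<open>f\<close> in \<open>q\<close>;
  and \<open>j \<le> m\<close> because \<open>q\<close> is outside \<open>K\<close>.\<close>

lemma irreducible_power_ideal:
  fixes K :: "'k::field poly set"
  assumes K: "idl K" and f: "irreducible f" "f ^ n \<in> K" and q: "q \<notin> K" and m: "f ^ Suc m \<in> K"
  shows "\<exists>r. f ^ m - q * r \<in> K"
proof -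
  have "q \<noteq> 0" using q idl_zero[OF K] by auto
  then obtain j h where qj: "q = f ^ j * h" "\<not> f dvd h" using poly_irreducible_split[OF f(1)] by blast
  obtain a b where ab: "a * h + b * f ^ n = 1" using poly_bezout[OF f(1) qj(2)] by blast
  have fj: "f ^ j = a * q + (b * f ^ j) * f ^ n"
  proof -
    have "f ^ j = f ^ j * (a * h + b * f ^ n)" using ab by simp
    then show ?thesis unfolding qj(1) by (simp add: algebra_simps)
  qed
  have "j \<le> m"
  proof (rule ccontr)
    assume "\<not> j \<le> m"
    then have "f ^ j = f ^ (j - Suc m) * f ^ Suc m" by (simp only: power_add[symmetric]) simp
    then have "f ^ j \<in> K" using idl_left[OF K m] by metis
    then show False using q idl_right[OF K] unfolding qj(1) by blast
  qed
  then have "f ^ m = f ^ (m - j) * f ^ j" by (simp flip: power_add)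
  also have "\<dots> = q * (f ^ (m - j) * a) + (f ^ (m - j) * b * f ^ j) * f ^ n"
    by (subst fj) (simp add: algebra_simps)
  finally have "f ^ m - q * (f ^ (m - j) * a) = (f ^ (m - j) * b * f ^ j) * f ^ n" by simp
  then show ?thesis using idl_left[OF K f(2)] by metis
qed

section \<open>The corner at a cycle without exits\<close>

text \<open>The relations and the spanning property pass to larger ideals; what has to be secured
  each time is that no vertex falls into \<open>J'\<close>.\<close>

lemma (in ck_family) enlarge:
  assumes "idl J'" "J \<subseteq> J'" "J' \<subseteq> C" "\<And>v. v \<in> verts G \<Longrightarrow> p v \<notin> J'"
  shows "ck_family G J' \<kappa> C p s t"
proof -
  interpret R': ring_ideal J' by unfold_locales (rule assms)
  have le: "x \<approx> y \<Longrightarrow> R'.eqv x y" for x y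
    using assms(2) unfolding eqv_def R'.eqv_def by blast
  interpret A: ck_relations G J' \<kappa> p s t
    by unfold_locales
      (rule le \<kappa>_add \<kappa>_mult \<kappa>_1 \<kappa>_central;
       simp add: p_idem p_orth p_s s_p p_t t_p t_s t_s_orth p_regular)+
  have "A.spanned x" if "x \<in> C" for x
    using span[OF that] le unfolding spanned_def A.spanned_def by blast
  then show ?thesis
    by unfold_locales (use idl_C assms(3,4) p_C in auto)
qed

text \<open>If \<open>p w * x * p u\<close> is nonzero, some term of \<open>x\<close> starts at
  \<open>w\<close> and ends with the ghost of a path from \<open>u\<close>; the common range of the
  two paths is the required vertex.\<close>

lemma (in ck_family) connected_of_corner:
  assumes "x \<in> C" "u \<in> verts G" "w \<in> verts G" "p w * x * p u \<notin> J"
  shows "\<exists>v. vertex_ge G w v \<and> vertex_ge G u v"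
proof (rule ccontr)
  assume neg: "\<not> ?thesis"
  obtain ts where ts: "\<And>\<tau>. \<tau> \<in> set ts \<Longrightarrow> \<exists>u. walk_term u \<tau>" "x \<approx> eval ts"
    using span_eval[OF assms(1)] by blast
  have trm: "p w * (term_val \<tau> * p u) \<in> J" if w\<tau>: "walk_term u' \<tau>" for \<tau> u'
  proof -
    obtain k \<alpha> v \<beta> where \<tau>: "\<tau> = (k, \<alpha>, v, \<beta>)" by (cases \<tau>)
    obtain w' where w': "awalk w' \<alpha> v" "awalk u' \<beta> v" using w\<tau> unfolding \<tau> walk_term_def by auto
    show ?thesis
    proof (cases "u = u'")
      case False
      then show ?thesis
        using term_val_p_orth[OF w\<tau> assms(2)] idl_left[OF idl_J] eqv_0_iff by blast
    next
      case True
      then have "w \<noteq> w'" using neg w' unfolding vertex_ge_def by blast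
      then have "p w * (S \<alpha> * p v) \<in> J" using p_S_orth[OF w'(1) assms(3)] eqv_0_iff by blast
      then have "\<kappa> k * (p w * (S \<alpha> * p v)) * (T \<beta> * p u) \<in> J" using idl_mid[OF idl_J] by blast
      moreover have "p w * (term_val \<tau> * p u) = \<kappa> k * (p w * (S \<alpha> * p v)) * (T \<beta> * p u)"
        unfolding \<tau> term_val_def by (simp add: mult.assoc \<kappa>_pull)
      ultimately show ?thesis by simp
    qed
  qed
  have "p w * (eval us * p u) \<in> J" if "\<And>\<tau>. \<tau> \<in> set us \<Longrightarrow> \<exists>u. walk_term u \<tau>" for us
    using that
  proof (induction us)
    case (Cons \<tau> us)
    from Cons.prems[of \<tau>] obtain u' where "walk_term u' \<tau>" by auto
    moreover have "p w * (eval us * p u) \<in> J" using Cons by simp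
    ultimately show ?case using trm idl_add[OF idl_J] by (simp add: distrib_right distrib_left)
  qed (simp add: idl_zero[OF idl_J])
  then have "p w * eval ts * p u \<in> J" using ts(1) by (simp add: mult.assoc)
  moreover have "p w * x * p u \<approx> p w * eval ts * p u" by (intro eqv_mid ts(2))
  ultimately show False using assms(4) eqv_mem by blast
qed

text \<open>The cycle is a parameter, and the definitions of \<open>X\<close>, \<open>Y\<close>,
  \<open>ev\<close> and \<open>cofinal\<close> do not mention \<open>J\<close>. They denote the same
  objects in interpretations over different ideals, which the final proofs exploit.\<close>

locale no_exit_cycle = ck_family G J \<kappa> C p s t
  for G :: "('v, 'e) pre_digraph" and J :: "'a::ring_1 set" and \<kappa> :: "'k::field \<Rightarrow> 'a"
    and C p and s t :: "'e \<Rightarrow> 'a" +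
  fixes w :: 'v and c :: "'e list"
  assumes c_walk: "awalk w c w" and c_ne: "c \<noteq> []"
    and c_det: "\<And>e. e \<in> set c \<Longrightarrow> out_arcs G (tail G e) = {e}"
    and c_sub: "\<And>d x. awalk w d x \<Longrightarrow> set d \<subseteq> set c"
    and c_ret: "\<And>d x. awalk w d x \<Longrightarrow> \<exists>b. awalk x b w"
    and c_pow: "\<And>d. awalk w d w \<Longrightarrow> \<exists>n. d = concat (replicate n c)"

lemma (in ck_family) no_exit_cycleI:
  assumes "rigid w"
  obtains c where "no_exit_cycle G J \<kappa> C p s t w c"
proof -
  obtain c where "c \<noteq> []" "awalk w c w" "\<And>e. e \<in> set c \<Longrightarrow> out_arcs G (tail G e) = {e}"
    "\<And>d x. awalk w d x \<Longrightarrow> set d \<subseteq> set c"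
    "\<And>d x. awalk w d x \<Longrightarrow> \<exists>b. awalk x b w"
    "\<And>d. awalk w d w \<Longrightarrow> \<exists>n. d = concat (replicate n c)"
    using rigidE[OF assms] by metis
  then have "no_exit_cycle G J \<kappa> C p s t w c" by unfold_locales auto
  then show thesis by (rule that)
qed

section \<open>Laurent polynomials in the cycle\<close>

context no_exit_cycle
begin

lemma w_verts: "w \<in> verts G" using c_walk by auto

definition X :: 'a where "X = S c * p w"
definition Y :: 'a where "Y = p w * T c"

lemma pw_pw: "p w * p w \<approx> p w" by (rule p_idem[OF w_verts])

lemma pX: "p w * X \<approx> X" unfolding X_def by (rule p_S[OF c_walk])
lemma Xp: "X * p w \<approx> X" unfolding X_def by (simp add: mult.assoc) (intro eqv_left pw_pw)
lemma Yp: "Y * p w \<approx> Y" unfolding Y_def by (rule p_T[OF c_walk])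

lemma YX: "Y * X \<approx> p w" unfolding X_def Y_def by (rule T_S_self[OF c_walk])

text \<open>Here the absence of exits enters: each source on \<open>c\<close> emits one edge, so
  \<open>S c * p w * T c\<close> is the vertex itself. Thus \<open>Y\<close> inverts
  \<open>X\<close> in the corner.\<close>

lemma XY: "X * Y \<approx> p w"
proof -
  have "X * Y = S c * (p w * p w) * T c" unfolding X_def Y_def by (simp add: mult.assoc)
  also have "\<dots> \<approx> S c * p w * T c" by (intro eqv_mid pw_pw)
  also have "\<dots> \<approx> p w" by (rule S_T_deterministic[OF c_walk c_det])
  finally show ?thesis .
qed

text \<open>Horner evaluation at \<open>X\<close>, with \<open>p w\<close> as the unit. Negative
  powers are kept outside as a factor \<open>Y ^ n\<close>, so that a corner element is a fraction
  \<open>ev q * Y ^ n\<close> and only ordinary polynomials occur.\<close>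

definition ev :: "'k poly \<Rightarrow> 'a" where
  "ev q = fold_coeffs (\<lambda>a y. \<kappa> a * p w + X * y) q 0"

lemma ev_0 [simp]: "ev 0 = 0" by (simp add: ev_def)

lemma ev_pCons [simp]: "ev (pCons a q) = \<kappa> a * p w + X * ev q"
  by (cases "a = 0 \<and> q = 0") (auto simp: ev_def fold_coeffs_pCons_eq)

lemma ev_1 [simp]: "ev 1 = p w"
  by (simp add: one_pCons)

lemma ev_add: "ev (q + r) = ev q + ev r"
  by (induction q r rule: poly_induct2) (simp_all add: \<kappa>_add algebra_simps)

lemma ev_smult: "ev (smult a q) = \<kappa> a * ev q"
  by (induction q) (simp_all add: \<kappa>_mult distrib_left mult.assoc \<kappa>_pull[of X])

lemma ev_diff: "ev (q - r) = ev q - ev r"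
  using ev_add[of "q - r" r] by simp

lemma p_ev: "p w * ev q \<approx> ev q"
proof (induction q)
  case (pCons a q)
  have "p w * ev (pCons a q) = \<kappa> a * (p w * p w) + (p w * X) * ev q"
    by (simp add: distrib_left mult.assoc \<kappa>_pull)
  also have "\<dots> \<approx> \<kappa> a * p w + X * ev q" by (intro eqv_add eqv_left eqv_right pw_pw pX)
  finally show ?case by simp
qed simp

lemma ev_p: "ev q * p w \<approx> ev q"
proof (induction q)
  case (pCons a q)
  have "ev (pCons a q) * p w = \<kappa> a * (p w * p w) + X * (ev q * p w)"
    by (simp add: distrib_right mult.assoc)
  also have "\<dots> \<approx> \<kappa> a * p w + X * ev q" by (intro eqv_add eqv_left pw_pw pCons)
  finally show ?case by simp
qed simp

lemma ev_mult: "ev (q * r) \<approx> ev q * ev r"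
proof (induction q)
  case (pCons a q)
  have "ev (pCons a q * r) = \<kappa> a * ev r + X * ev (q * r)"
    by (simp add: mult_pCons_left ev_add ev_smult)
  also have "\<dots> \<approx> \<kappa> a * (p w * ev r) + X * (ev q * ev r)"
    by (intro eqv_add eqv_left pCons eqv_sym[OF p_ev])
  also have "\<dots> = ev (pCons a q) * ev r" by (simp add: distrib_right mult.assoc)
  finally show ?case .
qed simp

lemma ev_commute: "ev q * ev r \<approx> ev r * ev q"
proof -
  have "ev q * ev r \<approx> ev (q * r)" by (rule eqv_sym[OF ev_mult])
  also have "ev (q * r) = ev (r * q)" by (simp add: mult.commute)
  also have "\<dots> \<approx> ev r * ev q" by (rule ev_mult)
  finally show ?thesis .
qed

lemma ev_monom: "ev (monom 1 n) = X ^ n * p w"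
  by (induction n) (simp_all add: monom_0 monom_Suc mult.assoc)

lemma ev_X: "ev [:0, 1:] \<approx> X"
  using Xp by simp

lemma pXp: "p w * X ^ n * p w \<approx> p w * X ^ n"
proof (cases n)
  case 0
  then show ?thesis using pw_pw by simp
next
  case (Suc m)
  have "(p w * X ^ m) * (X * p w) \<approx> (p w * X ^ m) * X" by (intro eqv_left Xp)
  then show ?thesis unfolding Suc power_Suc2 by (simp add: mult.assoc)
qed

lemma pYp: "p w * Y ^ n * p w \<approx> p w * Y ^ n"
proof (cases n)
  case 0
  then show ?thesis using pw_pw by simp
next
  case (Suc m)
  have "(p w * Y ^ m) * (Y * p w) \<approx> (p w * Y ^ m) * Y" by (intro eqv_left Yp)
  then show ?thesis unfolding Suc power_Suc2 by (simp add: mult.assoc)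
qed

lemma pYX: "p w * Y ^ n * X ^ n \<approx> p w"
proof (induction n)
  case (Suc n)
  have "p w * Y ^ Suc n * X ^ Suc n = p w * Y ^ n * (Y * X) * X ^ n"
    by (simp add: power_Suc2[of Y] power_Suc[of X] mult.assoc del: power_Suc)
  also have "\<dots> \<approx> p w * Y ^ n * p w * X ^ n" by (intro eqv_mid YX)
  also have "\<dots> \<approx> p w * Y ^ n * X ^ n" by (intro eqv_right pYp)
  also note Suc
  finally show ?case .
qed simp

lemma pXY: "p w * X ^ n * Y ^ n \<approx> p w"
proof (induction n)
  case (Suc n)
  have "p w * X ^ Suc n * Y ^ Suc n = p w * X ^ n * (X * Y) * Y ^ n"
    by (simp add: power_Suc2[of X] power_Suc[of Y] mult.assoc del: power_Suc)
  also have "\<dots> \<approx> p w * X ^ n * p w * Y ^ n" by (intro eqv_mid XY)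
  also have "\<dots> \<approx> p w * X ^ n * Y ^ n" by (intro eqv_right pXp)
  also note Suc
  finally show ?case .
qed simp

lemma ev_YX: "ev q * Y ^ n * X ^ n \<approx> ev q"
proof -
  have "ev q * Y ^ n * X ^ n = ev q * (Y ^ n * X ^ n)" by (simp add: mult.assoc)
  also have "\<dots> \<approx> ev q * p w * (Y ^ n * X ^ n)" by (intro eqv_right eqv_sym[OF ev_p])
  also have "\<dots> = ev q * (p w * Y ^ n * X ^ n)" by (simp add: mult.assoc)
  also have "\<dots> \<approx> ev q * p w" by (intro eqv_left pYX)
  also have "\<dots> \<approx> ev q" by (rule ev_p)
  finally show ?thesis .
qed

lemma ev_X_power: "ev q * X ^ n \<approx> ev (q * monom 1 n)"
proof -
  have "ev q * X ^ n \<approx> ev q * p w * X ^ n" by (intro eqv_right eqv_sym[OF ev_p])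
  also have "\<dots> = ev q * (p w * X ^ n)" by (simp add: mult.assoc)
  also have "\<dots> \<approx> ev q * (p w * X ^ n * p w)" by (intro eqv_left eqv_sym[OF pXp])
  also have "\<dots> = ev q * p w * ev (monom 1 n)" unfolding ev_monom by (simp add: mult.assoc)
  also have "\<dots> \<approx> ev q * ev (monom 1 n)" by (intro eqv_right ev_p)
  also have "\<dots> \<approx> ev (q * monom 1 n)" by (rule eqv_sym[OF ev_mult])
  finally show ?thesis .
qed

text \<open>Cancelling \<open>X ^ m\<close> in a fraction; read backwards it provides the common
  denominator in \<open>ev_Y_sum\<close>.\<close>

lemma ev_X_Y: "ev (q * monom 1 m) * Y ^ (m + n) \<approx> ev q * Y ^ n"
proof -
  have "ev (q * monom 1 m) * Y ^ (m + n) \<approx> ev q * X ^ m * Y ^ (m + n)"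
    by (intro eqv_right eqv_sym[OF ev_X_power])
  also have "\<dots> \<approx> ev q * p w * X ^ m * Y ^ (m + n)" by (intro eqv_right eqv_sym[OF ev_p])
  also have "\<dots> = ev q * (p w * X ^ m * Y ^ m) * Y ^ n" by (simp add: power_add mult.assoc)
  also have "\<dots> \<approx> ev q * p w * Y ^ n" by (intro eqv_mid pXY)
  also have "\<dots> \<approx> ev q * Y ^ n" by (intro eqv_right ev_p)
  finally show ?thesis .
qed

text \<open>\<open>X * Y\<close> is inserted on the right and \<open>X\<close> is moved to the left
  past the polynomial, where it meets \<open>Y\<close>.\<close>

lemma ev_Y_commute: "Y * ev q \<approx> ev q * Y"
proof -
  have comm: "X * ev q \<approx> ev q * X"
  proof -
    have "X * ev q \<approx> ev [:0, 1:] * ev q" by (intro eqv_right eqv_sym[OF ev_X])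
    also have "\<dots> \<approx> ev q * ev [:0, 1:]" by (rule ev_commute)
    also have "\<dots> \<approx> ev q * X" by (intro eqv_left ev_X)
    finally show ?thesis .
  qed
  have "Y * ev q \<approx> Y * (ev q * p w)" by (intro eqv_left eqv_sym[OF ev_p])
  also have "\<dots> \<approx> Y * (ev q * (X * Y))" by (intro eqv_left eqv_sym[OF XY])
  also have "\<dots> = Y * (ev q * X) * Y" by (simp add: mult.assoc)
  also have "\<dots> \<approx> Y * (X * ev q) * Y" by (intro eqv_mid eqv_sym[OF comm])
  also have "\<dots> = (Y * X) * (ev q * Y)" by (simp add: mult.assoc)
  also have "\<dots> \<approx> p w * (ev q * Y)" by (intro eqv_right YX)
  also have "\<dots> = p w * ev q * Y" by (simp add: mult.assoc)
  also have "\<dots> \<approx> ev q * Y" by (intro eqv_right p_ev)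
  finally show ?thesis .
qed

lemma ev_Y_power_commute: "Y ^ n * ev q \<approx> ev q * Y ^ n"
proof (induction n)
  case (Suc n)
  have "Y ^ Suc n * ev q = Y * (Y ^ n * ev q)" by (simp add: mult.assoc)
  also have "\<dots> \<approx> Y * (ev q * Y ^ n)" by (intro eqv_left Suc)
  also have "\<dots> = (Y * ev q) * Y ^ n" by (simp add: mult.assoc)
  also have "\<dots> \<approx> ev q * Y * Y ^ n" by (intro eqv_right ev_Y_commute)
  finally show ?case by (simp add: mult.assoc)
qed simp

lemma ev_C: "ev q \<in> C"
proof (induction q)
  case 0
  show ?case using idl_zero[OF idl_C] by simp
next
  case (pCons a q)
  show ?case unfolding ev_pCons
    by (intro idl_add[OF idl_C] idl_left[OF idl_C] p_C[OF w_verts] pCons)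
qed

lemma ev_Y_mem_iff: "idl J' \<Longrightarrow> J \<subseteq> J' \<Longrightarrow> ev q * Y ^ n \<in> J' \<longleftrightarrow> ev q \<in> J'"
proof
  assume a: "idl J'" "J \<subseteq> J'"
  show "ev q \<in> J'" if "ev q * Y ^ n \<in> J'"
    using eqv_ideal_mem[OF ev_YX[of q n] a] idl_right[OF a(1) that] by blast
  show "ev q * Y ^ n \<in> J'" if "ev q \<in> J'"
    by (rule idl_right[OF a(1) that])
qed

lemma kernel_cancel: "idl J' \<Longrightarrow> J \<subseteq> J' \<Longrightarrow> ev (monom 1 n * q) \<in> J' \<Longrightarrow> ev q \<in> J'"
proof -
  assume a: "idl J'" "J \<subseteq> J'" "ev (monom 1 n * q) \<in> J'"
  have "ev (q * monom 1 n) * Y ^ (n + 0) \<in> J'" using a by (simp add: idl_right mult.commute)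
  then show ?thesis using eqv_ideal_mem[OF ev_X_Y[of q n 0] a(1,2)] by simp
qed

lemma kernel_idl: "idl J' \<Longrightarrow> J \<subseteq> J' \<Longrightarrow> idl {q. ev q \<in> J'}"
proof (rule idlI)
  assume a: "idl J'" "J \<subseteq> J'"
  show m: "c * q \<in> {q. ev q \<in> J'}" if "q \<in> {q. ev q \<in> J'}" for q c
    using that idl_left[OF a(1)] eqv_ideal_mem[OF ev_mult a] by simp
  show "q * c \<in> {q. ev q \<in> J'}" if "q \<in> {q. ev q \<in> J'}" for q c
    using m[OF that] by (simp add: mult.commute)
qed (auto simp: ev_add idl_zero idl_add)

lemma S_c_power: "S (concat (replicate n c)) * p w \<approx> X ^ n * p w"
proof (induction n)
  case (Suc n)
  have "S (concat (replicate (Suc n) c)) * p w = S c * (S (concat (replicate n c)) * p w)"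
    by (simp add: mult.assoc)
  also have "\<dots> \<approx> S c * ev (monom 1 n)" unfolding ev_monom by (intro eqv_left Suc)
  also have "\<dots> \<approx> S c * (p w * ev (monom 1 n))" by (intro eqv_left eqv_sym[OF p_ev])
  also have "\<dots> = X ^ Suc n * p w" unfolding ev_monom X_def by (simp add: mult.assoc)
  finally show ?case .
qed simp

lemma T_c_power: "p w * T (concat (replicate n c)) \<approx> p w * Y ^ n"
proof (induction n)
  case (Suc n)
  have "p w * T (concat (replicate (Suc n) c)) = p w * T (concat (replicate n c)) * T c"
    by (simp add: mult.assoc)
  also have "\<dots> \<approx> p w * Y ^ n * T c" by (intro eqv_right Suc)
  also have "\<dots> \<approx> p w * Y ^ n * p w * T c" by (intro eqv_right eqv_sym[OF pYp])
  also have "\<dots> = p w * Y ^ Suc n" unfolding power_Suc2 by (simp add: Y_def mult.assoc)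
  finally show ?case .
qed simp

lemma ev_Y_sum: "ev q * Y ^ m + ev r * Y ^ n \<approx> ev (q * monom 1 n + r * monom 1 m) * Y ^ (n + m)"
  unfolding ev_add distrib_right
  by (intro eqv_add eqv_sym[OF ev_X_Y]) (use eqv_sym[OF ev_X_Y[of r m n]] in \<open>simp add: add.commute\<close>)

text \<open>Only terms with both paths starting at \<open>w\<close> count. Such paths stay on the
  cycle, so their range \<open>v\<close> is joined to \<open>w\<close> by a path \<open>b\<close>
  with \<open>p v \<approx> S b * p w * T b\<close>. Inserting this extends both paths to closed
  walks at \<open>w\<close>, which are powers of \<open>c\<close>.\<close>

lemma corner_span:
  "\<exists>q n. p w * x * p w \<approx> ev q * Y ^ n"
proof -
  define x' where "x' = p w * x"
  have "x' \<in> C" unfolding x'_def using idl_right[OF idl_C p_C[OF w_verts]] .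
  then obtain ts where ts: "\<And>\<tau>. \<tau> \<in> set ts \<Longrightarrow> \<exists>u. walk_term u \<tau>" "x' \<approx> eval ts"
    using span_eval by blast
  have trm: "\<exists>q n. p w * (term_val \<tau> * p w) \<approx> ev q * Y ^ n" if w\<tau>: "walk_term u' \<tau>" for \<tau> u'
  proof -
    obtain k \<alpha> v \<beta> where \<tau>: "\<tau> = (k, \<alpha>, v, \<beta>)" by (cases \<tau>)
    obtain w' where w': "awalk w' \<alpha> v" "awalk u' \<beta> v" using w\<tau> unfolding \<tau> walk_term_def by auto
    have eq: "p w * (term_val \<tau> * p w) = \<kappa> k * (p w * (S \<alpha> * p v)) * (T \<beta> * p w)"
      unfolding \<tau> term_val_def by (simp add: mult.assoc \<kappa>_pull)
    show ?thesis
    proof (cases "u' = w \<and> w' = w")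
      case False
      have "p w * (term_val \<tau> * p w) \<approx> 0"
      proof (cases "u' = w")
        case True
        then have "p w * (S \<alpha> * p v) \<in> J" using False p_S_orth[OF w'(1) w_verts] eqv_0_iff by blast
        then show ?thesis unfolding eq using idl_mid[OF idl_J] eqv_0_iff by blast
      next
        case False
        then show ?thesis
          using term_val_p_orth[OF w\<tau> w_verts] idl_left[OF idl_J] eqv_0_iff by blast
      qed
      then show ?thesis by (intro exI[of _ 0]) simp
    next
      case True
      then have w: "awalk w \<alpha> v" "awalk w \<beta> v" using w' by auto
      obtain b where b: "awalk v b w" using c_ret w(1) by blast
      have ab: "awalk w (\<alpha> @ b) w" "awalk w (\<beta> @ b) w" using w b awalk_append by blast+
      obtain i j where ij: "\<alpha> @ b = concat (replicate i c)" "\<beta> @ b = concat (replicate j c)"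
        using c_pow ab by meson
      have "set b \<subseteq> set c" using c_sub[OF ab(1)] by simp
      then have "S b * p w * T b \<approx> p v" using c_det by (intro S_T_deterministic[OF b]) auto
      then have 1: "S b * (p w * p w) * T b \<approx> p v"
        using eqv_mid[OF pw_pw, of "S b" "T b"] eqv_trans by (simp add: mult.assoc)
      have "p w * (term_val \<tau> * p w) = (p w * (\<kappa> k * S \<alpha>)) * p v * (T \<beta> * p w)"
        unfolding \<tau> term_val_def by (simp add: mult.assoc)
      also have "\<dots> \<approx> (p w * (\<kappa> k * S \<alpha>)) * (S b * (p w * p w) * T b) * (T \<beta> * p w)"
        by (intro eqv_mid eqv_sym[OF 1])
      also have "\<dots> = \<kappa> k * p w * (S (\<alpha> @ b) * p w) * (p w * T (\<beta> @ b)) * p w"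
        by (simp add: mult.assoc \<kappa>_pull)
      also have "\<dots> \<approx> \<kappa> k * p w * ev (monom 1 i) * (p w * Y ^ j) * p w"
        unfolding ij ev_monom by (intro eqv_right[of _ _ "p w"] eqv_mult eqv_left S_c_power T_c_power)
      also have "\<dots> = \<kappa> k * (p w * ev (monom 1 i)) * (p w * Y ^ j * p w)" by (simp add: mult.assoc)
      also have "\<dots> \<approx> \<kappa> k * ev (monom 1 i) * (p w * Y ^ j)"
        by (intro eqv_mult eqv_left p_ev pYp)
      also have "\<dots> = \<kappa> k * (ev (monom 1 i) * p w) * Y ^ j" by (simp add: mult.assoc)
      also have "\<dots> \<approx> \<kappa> k * ev (monom 1 i) * Y ^ j" by (intro eqv_mid ev_p)
      also have "\<dots> = ev (smult k (monom 1 i)) * Y ^ j" by (simp add: ev_smult)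
      finally show ?thesis by blast
    qed
  qed
  have "\<exists>q n. p w * (eval us * p w) \<approx> ev q * Y ^ n" if "\<And>\<tau>. \<tau> \<in> set us \<Longrightarrow> \<exists>u. walk_term u \<tau>" for us
    using that
  proof (induction us)
    case Nil
    then show ?case by (intro exI[of _ 0]) simp
  next
    case (Cons \<tau> us)
    from Cons.prems[of \<tau>] obtain u' where "walk_term u' \<tau>" by auto
    then obtain q m where 1: "p w * (term_val \<tau> * p w) \<approx> ev q * Y ^ m" using trm by blast
    obtain r n where 2: "p w * (eval us * p w) \<approx> ev r * Y ^ n" using Cons by auto
    have "p w * (eval (\<tau> # us) * p w) = p w * (term_val \<tau> * p w) + p w * (eval us * p w)"
      by (simp add: distrib_left distrib_right)
    also have "\<dots> \<approx> ev q * Y ^ m + ev r * Y ^ n" by (intro eqv_add 1 2)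
    also note ev_Y_sum
    finally show ?case by blast
  qed
  then obtain q n where qn: "p w * (eval ts * p w) \<approx> ev q * Y ^ n" using ts(1) by blast
  have "p w * x * p w \<approx> p w * p w * x * p w"
    using eqv_right[OF eqv_right[OF eqv_sym[OF pw_pw]]] by blast
  also have "\<dots> = p w * x' * p w" unfolding x'_def by (simp add: mult.assoc)
  also have "\<dots> \<approx> p w * eval ts * p w" by (intro eqv_mid ts(2))
  also have "\<dots> \<approx> ev q * Y ^ n" using qn by (simp add: mult.assoc)
  finally show ?thesis by blast
qed

text \<open>The corner is commutative, so whatever stands between two polynomials moves out as a
  fraction \<open>ev r * Y ^ n\<close>.\<close>

lemma ev_corner_ev: "\<exists>r n. ev q * l * ev q' \<approx> ev (q * q' * r) * Y ^ n"
proof -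
  obtain r n where r: "p w * l * p w \<approx> ev r * Y ^ n" using corner_span by blast
  have "ev q * l * ev q' \<approx> (ev q * p w) * l * (p w * ev q')"
    by (intro eqv_mult eqv_right eqv_sym[OF ev_p] eqv_sym[OF p_ev])
  also have "\<dots> = ev q * (p w * l * p w) * ev q'" by (simp add: mult.assoc)
  also have "\<dots> \<approx> ev q * (ev r * Y ^ n) * ev q'" by (intro eqv_mid r)
  also have "\<dots> = ev q * ev r * (Y ^ n * ev q')" by (simp add: mult.assoc)
  also have "\<dots> \<approx> ev q * ev r * (ev q' * Y ^ n)" by (intro eqv_left ev_Y_power_commute)
  also have "\<dots> = ev q * (ev r * ev q') * Y ^ n" by (simp add: mult.assoc)
  also have "\<dots> \<approx> ev q * ev (r * q') * Y ^ n" by (intro eqv_mid eqv_sym[OF ev_mult])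
  also have "\<dots> \<approx> ev (q * (r * q')) * Y ^ n" by (intro eqv_right eqv_sym[OF ev_mult])
  also have "q * (r * q') = q * q' * r" by (simp add: ac_simps)
  finally show ?thesis by blast
qed

lemma corner_of_generated:
  assumes "x \<in> idl_gen (insert (ev q) J)"
  shows "\<exists>r n. p w * x * p w \<approx> ev (q * r) * Y ^ n"
  using idl_J assms
proof (rule idl_gen_insert)
  show "\<exists>r n. p w * 0 * p w \<approx> ev (q * r) * Y ^ n" by (intro exI[of _ 0]) simp
next
  fix y z
  assume "\<exists>r n. p w * y * p w \<approx> ev (q * r) * Y ^ n" "\<exists>r n. p w * z * p w \<approx> ev (q * r) * Y ^ n"
  then obtain r n r' n' where 1: "p w * y * p w \<approx> ev (q * r) * Y ^ n" and 2: "p w * z * p w \<approx> ev (q * r') * Y ^ n'"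
    by blast
  have "p w * (y + z) * p w = p w * y * p w + p w * z * p w" by (simp add: distrib_left distrib_right)
  also have "\<dots> \<approx> ev (q * r) * Y ^ n + ev (q * r') * Y ^ n'" by (intro eqv_add 1 2)
  also have "\<dots> \<approx> ev (q * r * monom 1 n' + q * r' * monom 1 n) * Y ^ (n' + n)" by (rule ev_Y_sum)
  also have "q * r * monom 1 n' + q * r' * monom 1 n = q * (r * monom 1 n' + r' * monom 1 n)"
    by (simp add: algebra_simps)
  finally show "\<exists>r n. p w * (y + z) * p w \<approx> ev (q * r) * Y ^ n" by blast
next
  fix y assume "y \<in> J"
  then have "p w * y * p w \<approx> 0" using idl_mid[OF idl_J] eqv_0_iff by blast
  then show "\<exists>r n. p w * y * p w \<approx> ev (q * r) * Y ^ n" by (intro exI[of _ 0]) simp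
next
  fix l m
  obtain r n where 1: "ev 1 * l * ev q \<approx> ev (1 * q * r) * Y ^ n" using ev_corner_ev by blast
  obtain r' n' where 2: "ev (q * r) * (Y ^ n * m) * ev 1 \<approx> ev (q * r * 1 * r') * Y ^ n'" using ev_corner_ev by blast
  have "p w * (l * ev q * m) * p w = (ev 1 * l * ev q) * (m * p w)" by (simp add: mult.assoc)
  also have "\<dots> \<approx> (ev (1 * q * r) * Y ^ n) * (m * p w)" by (intro eqv_right 1)
  also have "\<dots> = ev (q * r) * (Y ^ n * m) * ev 1" by (simp add: mult.assoc)
  also note 2
  also have "ev (q * r * 1 * r') = ev (q * (r * r'))" by (simp add: mult.assoc)
  finally show "\<exists>r n. p w * (l * ev q * m) * p w \<approx> ev (q * r) * Y ^ n" by blast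
qed

text \<open>The factor \<open>monom 1 n\<close> clears the denominator in
  \<open>corner_of_generated\<close>.\<close>

lemma ev_mem_generated:
  assumes "ev q' \<in> idl_gen (insert (ev q) J)"
  shows "\<exists>r n. monom 1 n * q' - q * r \<in> {q. ev q \<in> J}"
proof -
  obtain r n where rn: "p w * ev q' * p w \<approx> ev (q * r) * Y ^ n" using corner_of_generated[OF assms] by blast
  have "ev (q' * monom 1 n) \<approx> ev q' * X ^ n" by (rule eqv_sym[OF ev_X_power])
  also have "\<dots> \<approx> p w * ev q' * p w * X ^ n"
    by (intro eqv_right eqv_trans[OF eqv_sym[OF ev_p] eqv_right[OF eqv_sym[OF p_ev]]])
  also have "\<dots> \<approx> ev (q * r) * Y ^ n * X ^ n" by (intro eqv_right rn)
  also have "\<dots> \<approx> ev (q * r)" by (rule ev_YX)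
  finally have "ev (q' * monom 1 n - q * r) \<in> J" unfolding ev_diff eqv_def .
  then show ?thesis by (metis mem_Collect_eq mult.commute)
qed

end

section \<open>Prime and monolithic ideals\<close>

text \<open>The smallest ideal properly above \<open>J\<close> is represented by an element:
  \<open>z\<close> together with \<open>J\<close> generates it.\<close>

definition monolithic :: "'a::ring_1 set \<Rightarrow> 'a set \<Rightarrow> 'a \<Rightarrow> bool" where
  "monolithic C J z \<longleftrightarrow> z \<in> C \<and> z \<notin> J \<and> (\<forall>J'. idl J' \<and> J \<subset> J' \<and> J' \<subseteq> C \<longrightarrow> z \<in> J')"

text \<open>Reduces a product of two generated ideals to the elements \<open>a * l * b\<close>; it
  serves both for primeness and for the powers of \<open>P\<close>.\<close>

lemma idl_gen_insert_mult:
  assumes J: "idl J" and K: "idl K" "J \<subseteq> K" and ab: "\<And>l. a * l * b \<in> K"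
    and x: "x \<in> idl_gen (insert a J)" and y: "y \<in> idl_gen (insert b J)"
  shows "x * y \<in> K"
proof -
  have 1: "l * a * m * y' \<in> K" if y': "y' \<in> idl_gen (insert b J)" for l m y'
    using J y'
  proof (rule idl_gen_insert)
    fix l' m'
    have "l * (a * (m * l') * b) * m' \<in> K" by (rule idl_mid[OF K(1) ab])
    then show "l * a * m * (l' * b * m') \<in> K" by (simp add: mult.assoc)
  next
    show "l * a * m * (y + z) \<in> K" if "l * a * m * y \<in> K" "l * a * m * z \<in> K" for y z
      using idl_add[OF K(1) that] by (simp add: distrib_left)
    show "l * a * m * y \<in> K" if "y \<in> J" for y
      using that K(2) by (intro idl_left[OF K(1)]) blast
  qed (simp add: idl_zero[OF K(1)])
  show ?thesis using J x
  proof (rule idl_gen_insert)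
    show "l * a * m * y \<in> K" for l m by (rule 1[OF y])
    show "(u + z) * y \<in> K" if "u * y \<in> K" "z * y \<in> K" for u z
      using idl_add[OF K(1) that] by (simp add: distrib_right)
    show "z * y \<in> K" if "z \<in> J" for z
      using that K(2) by (intro idl_right[OF K(1)]) blast
  qed (simp add: idl_zero[OF K(1)])
qed

lemma idl_gen_insert_bounds:
  assumes "idl C" "J \<subseteq> C" "a \<in> C"
  shows "idl_gen (insert a J) \<subseteq> C" "J \<subseteq> idl_gen (insert a J)" "a \<in> idl_gen (insert a J)"
  using idl_gen_least[OF assms(1), of "insert a J"] idl_gen_superset[of "insert a J"] assms by auto

lemma idl_gen_insert_strict:
  assumes "a \<notin> J"
  shows "J \<subset> idl_gen (insert a J)"
  using idl_gen_superset[of "insert a J"] assms by blast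

lemma idl_gen_insert_absorb: "idl J \<Longrightarrow> a \<in> J \<Longrightarrow> idl_gen (insert a J) = J"
  using idl_gen_least[of J "insert a J"] idl_gen_superset[of "insert a J"] by blast

context ck_family
begin

lemma vertex_transport:
  assumes "vertex_ge G u v"
  obtains a b where "a * p u * b \<approx> p v"
proof -
  obtain \<delta> where \<delta>: "awalk u \<delta> v" using assms unfolding vertex_ge_def by blast
  have "(p v * T \<delta>) * p u * (S \<delta> * p v) = (p v * T \<delta>) * (p u * (S \<delta> * p v))" by (simp add: mult.assoc)
  also have "\<dots> \<approx> (p v * T \<delta>) * (S \<delta> * p v)" by (intro eqv_left p_S[OF \<delta>])
  also have "\<dots> \<approx> p v" by (rule T_S_self[OF \<delta>])
  finally show thesis by (rule that)
qed

lemma vertex_ge_mem: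
  assumes "idl J'" "J \<subseteq> J'" "p u \<in> J'" "vertex_ge G u v"
  shows "p v \<in> J'"
proof -
  obtain a b where "a * p u * b \<approx> p v" using vertex_transport[OF assms(4)] .
  from eqv_ideal_mem[OF this assms(1,2)] show ?thesis using idl_mid[OF assms(1,3)] by blast
qed

lemma vertices_hereditary_saturated:
  assumes J': "idl J'" "J \<subseteq> J'"
  shows "hereditary G {v \<in> verts G. p v \<in> J'}" "saturated G {v \<in> verts G. p v \<in> J'}"
proof -
  show "hereditary G {v \<in> verts G. p v \<in> J'}"
    unfolding hereditary_def using vertex_ge_mem[OF J'] vertex_ge_verts by blast
  show "saturated G {v \<in> verts G. p v \<in> J'}"
    unfolding saturated_def
  proof (intro conjI allI impI, blast)
    fix v assume v: "regular_vertex G v \<and> head G ` out_arcs G v \<subseteq> {v \<in> verts G. p v \<in> J'}"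
    have "s e * t e \<in> J'" if e: "e \<in> out_arcs G v" for e
    proof -
      have "s e * p (head G e) * t e \<in> J'" by (rule idl_mid[OF J'(1)]) (use v e in blast)
      moreover have "s e * p (head G e) * t e \<approx> s e * t e" by (intro eqv_right s_p) (use e in auto)
      ultimately show ?thesis using eqv_ideal_mem[OF _ J'] by blast
    qed
    then have "(\<Sum>e\<in>out_arcs G v. s e * t e) \<in> J'" by (rule idl_sum[OF J'(1)])
    then have "p v \<in> J'" using p_regular v eqv_ideal_mem[OF _ J'] by blast
    then show "v \<in> {v \<in> verts G. p v \<in> J'}" using v unfolding regular_vertex_def by blast
  qed
qed

section \<open>Families over graphs with condition (L)\<close>

lemma reduction_condition_L:
  assumes "condition_L G" "x \<in> C" "x \<notin> J"
  obtains a b u where "u \<in> verts G" "a * x * b \<approx> p u"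
  using reduction[OF assms(2,3)] assms(1) unfolding condition_L_iff reducible_def by blast

lemma condition_L_monolithic_vertex:
  assumes "condition_L G" "monolithic C J z"
  obtains u where "u \<in> verts G" "\<And>J'. idl J' \<Longrightarrow> J \<subset> J' \<Longrightarrow> J' \<subseteq> C \<Longrightarrow> p u \<in> J'"
proof -
  have z: "z \<in> C" "z \<notin> J" using assms(2) unfolding monolithic_def by auto
  obtain a b u where u: "u \<in> verts G" "a * z * b \<approx> p u" using reduction_condition_L[OF assms(1) z] .
  have "p u \<in> J'" if J': "idl J'" "J \<subset> J'" "J' \<subseteq> C" for J'
  proof -
    have "z \<in> J'" using assms(2) J' unfolding monolithic_def by blast
    then show ?thesis using eqv_ideal_mem[OF u(2) J'(1)] J'(2) idl_mid[OF J'(1)] by blast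
  qed
  then show thesis using that u(1) by blast
qed

text \<open>By the reduction, a larger ideal \<open>J'\<close> contains a vertex. The vertices in
  \<open>J'\<close> form a hereditary saturated set, so \<open>u\<close> is among them.\<close>

lemma condition_L_monolithicI:
  assumes L: "condition_L G" and u: "u \<in> verts G"
    and min: "\<And>Y. Y \<noteq> {} \<Longrightarrow> Y \<subseteq> verts G \<Longrightarrow> hereditary G Y \<Longrightarrow> saturated G Y \<Longrightarrow> u \<in> Y"
  shows "monolithic C J (p u)"
  unfolding monolithic_def
proof (intro conjI allI impI)
  show "p u \<in> C" "p u \<notin> J" using u p_C p_nonzero by auto
  fix J' assume J': "idl J' \<and> J \<subset> J' \<and> J' \<subseteq> C"
  then obtain x where x: "x \<in> J'" "x \<in> C" "x \<notin> J" by blast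
  obtain a b v where v: "v \<in> verts G" "a * x * b \<approx> p v" using reduction_condition_L[OF L x(2,3)] .
  have "p v \<in> J'" using eqv_ideal_mem[OF v(2)] J' idl_mid x(1) by blast
  then have "u \<in> {v \<in> verts G. p v \<in> J'}"
    using J' v(1) vertices_hereditary_saturated[of J'] by (intro min) auto
  then show "p u \<in> J'" by blast
qed

text \<open>Elements of the two ideals outside \<open>J\<close> are reduced to vertices modulo
  \<open>J\<close>. Moving both down to a common vertex \<open>w\<close> makes \<open>p w\<close>
  congruent to a product that lies in \<open>J\<close>.\<close>

lemma condition_L_prime:
  assumes L: "condition_L G" and dd: "downward_directed G (verts G)"
    and J12: "idl J1" "idl J2" "J1 \<subseteq> C" "J2 \<subseteq> C" and prod: "\<And>x y. x \<in> J1 \<Longrightarrow> y \<in> J2 \<Longrightarrow> x * y \<in> J"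
  shows "J1 \<subseteq> J \<or> J2 \<subseteq> J"
proof (rule ccontr)
  assume "\<not> ?thesis"
  then obtain x y where xy: "x \<in> J1" "x \<notin> J" "y \<in> J2" "y \<notin> J" by blast
  obtain a b u where u: "u \<in> verts G" "a * x * b \<approx> p u"
    using reduction_condition_L[OF L subsetD[OF J12(3) xy(1)] xy(2)] .
  obtain a' b' v where v: "v \<in> verts G" "a' * y * b' \<approx> p v"
    using reduction_condition_L[OF L subsetD[OF J12(4) xy(3)] xy(4)] .
  obtain w where w: "w \<in> verts G" "vertex_ge G u w" "vertex_ge G v w"
    using dd u(1) v(1) unfolding downward_directed_def by blast
  obtain c d where cd: "c * p u * d \<approx> p w" using vertex_transport[OF w(2)] .
  obtain c' d' where cd': "c' * p v * d' \<approx> p w" using vertex_transport[OF w(3)] .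
  have 1: "c * (a * x * b) * d \<approx> p w" by (rule eqv_trans[OF eqv_mid[OF u(2)] cd])
  have 2: "c' * (a' * y * b') * d' \<approx> p w" by (rule eqv_trans[OF eqv_mid[OF v(2)] cd'])
  have "c * (a * x * b) * d * (c' * (a' * y * b') * d') \<in> J"
    by (intro prod idl_mid[OF J12(1)] idl_mid[OF J12(2)] xy)
  moreover have "c * (a * x * b) * d * (c' * (a' * y * b') * d') \<approx> p w"
    by (rule eqv_trans[OF eqv_mult[OF 1 2] p_idem[OF w(1)]])
  ultimately show False using p_nonzero[OF w(1)] eqv_mem by blast
qed

section \<open>Vertices connected to a cycle without exits\<close>

lemma rigid_vertex_ge_back:
  assumes "rigid w" "vertex_ge G w v"
  shows "vertex_ge G v w"
proof -
  obtain d where d: "awalk w d v" using assms(2) unfolding vertex_ge_def by blast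
  show ?thesis
  proof (rule rigidE[OF assms(1)])
    assume "\<And>d x. awalk w d x \<Longrightarrow> \<exists>b. awalk x b w"
    from this[OF d] show ?thesis unfolding vertex_ge_def .
  qed
qed

lemma corner_nonzero_connected:
  assumes "rigid w" "u \<in> verts G" "p w * l * p u \<notin> J"
  shows "vertex_ge G u w"
proof -
  have w: "w \<in> verts G" using assms(1) unfolding rigid_def by auto
  have "p w * (p w * l) * p u \<approx> p w * l * p u"
    using eqv_right[OF eqv_right[OF p_idem[OF w]], of l "p u"] by (simp add: mult.assoc)
  then have "p w * (p w * l) * p u \<notin> J" using assms(3) eqv_mem by blast
  then obtain v where "vertex_ge G w v" "vertex_ge G u v"
    using connected_of_corner[OF idl_right[OF idl_C p_C[OF w]] assms(2) w] by blast
  then show ?thesis using rigid_vertex_ge_back[OF assms(1)] vertex_ge_trans by blast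
qed

text \<open>Moves the witness \<open>z\<close> into the corner at a vertex on a cycle without exits.
  If the reduction of \<open>z\<close> yields a vertex \<open>u\<close> instead, any such
  \<open>w\<close> will do: the ideal generated by \<open>p w\<close> over \<open>J\<close> contains
  \<open>p u\<close>, so \<open>u\<close> reaches \<open>w\<close>, and \<open>p w\<close> itself
  lies in every larger ideal.\<close>

lemma monolithic_rigid_corner:
  assumes mono: "monolithic C J z" and L: "\<not> condition_L G"
  obtains w y where "rigid w" "p w * y * p w \<notin> J"
    "\<And>J'. idl J' \<Longrightarrow> J \<subset> J' \<Longrightarrow> J' \<subseteq> C \<Longrightarrow> p w * y * p w \<in> J'"
proof -
  have z: "z \<in> C" "z \<notin> J" and zJ': "\<And>J'. idl J' \<Longrightarrow> J \<subset> J' \<Longrightarrow> J' \<subseteq> C \<Longrightarrow> z \<in> J'"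
    using mono unfolding monolithic_def by auto
  from reduction[OF z] consider
    (vertex) a b u where "u \<in> verts G" "a * z * b \<approx> p u"
    | (corner) w a b where "rigid w" "p w * (a * z * b) * p w \<notin> J"
    unfolding reducible_def by blast
  then show thesis
  proof cases
    case corner
    show thesis
    proof (rule that[OF corner(1,2)])
      fix J' assume J': "idl J'" "J \<subset> J'" "J' \<subseteq> C"
      show "p w * (a * z * b) * p w \<in> J'" by (rule idl_mid[OF J'(1) idl_mid[OF J'(1) zJ'[OF J']]])
    qed
  next
    case vertex
    obtain w where w: "rigid w" using L unfolding condition_L_iff by blast
    then have wv: "w \<in> verts G" unfolding rigid_def by auto
    have pu: "p u \<in> J'" if J': "idl J'" "J \<subset> J'" "J' \<subseteq> C" for J'
    proof -
      have "J \<subseteq> J'" using J'(2) by blast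
      from eqv_ideal_mem[OF vertex(2) J'(1) this] show ?thesis using idl_mid[OF J'(1) zJ'[OF J']] by blast
    qed
    have "p u \<in> idl_gen (insert (p w) J)"
      by (rule pu[OF idl_idl_gen idl_gen_insert_strict idl_gen_insert_bounds(1)])
        (use idl_C J_sub_C p_C[OF wv] p_nonzero[OF wv] in auto)
    \<comment> \<open>The predicate says that \<open>x * p u\<close> can be nonzero only through
      some nonzero \<open>p w * l * p u\<close>; this is additive in \<open>x\<close>.\<close>
    with idl_J have "p u * p u \<notin> J \<longrightarrow> (\<exists>l. p w * l * p u \<notin> J)"
    proof (rule idl_gen_insert[where Q = "\<lambda>x. x * p u \<notin> J \<longrightarrow> (\<exists>l. p w * l * p u \<notin> J)"])
      show "l * p w * m * p u \<notin> J \<longrightarrow> (\<exists>l. p w * l * p u \<notin> J)" for l m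
        using idl_left[OF idl_J, of "p w * m * p u" l] by (auto simp: mult.assoc)
      show "(y + z) * p u \<notin> J \<longrightarrow> (\<exists>l. p w * l * p u \<notin> J)"
        if "y * p u \<notin> J \<longrightarrow> (\<exists>l. p w * l * p u \<notin> J)" "z * p u \<notin> J \<longrightarrow> (\<exists>l. p w * l * p u \<notin> J)" for y z
        using that idl_add[OF idl_J, of "y * p u" "z * p u"] by (auto simp: distrib_right)
      show "y * p u \<notin> J \<longrightarrow> (\<exists>l. p w * l * p u \<notin> J)" if "y \<in> J" for y
        using idl_right[OF idl_J that] by blast
    qed (simp add: idl_zero[OF idl_J])
    moreover have "p u * p u \<notin> J" using eqv_mem[OF p_idem[OF vertex(1)]] p_nonzero[OF vertex(1)] by blast
    ultimately have uw: "vertex_ge G u w" using corner_nonzero_connected[OF w vertex(1)] by blast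
    have pw: "p w \<in> J'" if "idl J'" "J \<subset> J'" "J' \<subseteq> C" for J'
      using vertex_ge_mem[OF that(1) _ pu[OF that] uw] that(2) by blast
    have 1: "p w * 1 * p w \<approx> p w" using p_idem[OF wv] by simp
    have "p w * 1 * p w \<notin> J" using p_nonzero[OF wv] eqv_mem[OF 1] by blast
    moreover have "p w * 1 * p w \<in> J'" if "idl J'" "J \<subset> J'" "J' \<subseteq> C" for J'
      using pw[OF that] idl_right[OF that(1)] by simp
    ultimately show thesis by (rule that[OF w])
  qed
qed

end

section \<open>Ideals seen from the corner at a cycle without exits\<close>

context no_exit_cycle
begin

lemma rigid_w: "rigid w"
  unfolding rigid_def
proof (intro conjI allI impI)
  show "\<exists>c. c \<noteq> [] \<and> awalk w c w" using c_ne c_walk by blast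
  fix d f assume d: "d \<noteq> [] \<and> awalk w d w"
  show "\<not> exit_of G d f"
  proof
    assume "exit_of G d f"
    then obtain e where e: "f \<in> arcs G" "f \<notin> set d" "e \<in> set d" "tail G f = tail G e"
      unfolding exit_of_def by blast
    have "f \<in> out_arcs G (tail G e)" using e by auto
    moreover have "e \<in> set c" using c_sub[of d w] d e by blast
    ultimately have "f \<in> {e}" using c_det[of e] by simp
    then show False using e by simp
  qed
qed

lemma enlarge_cycle:
  assumes "idl J'" "J \<subseteq> J'" "J' \<subseteq> C" "\<And>v. v \<in> verts G \<Longrightarrow> p v \<notin> J'"
  shows "no_exit_cycle G J' \<kappa> C p s t w c"
proof -
  interpret A: ck_family G J' \<kappa> C p s t by (rule enlarge[OF assms])
  show ?thesis by unfold_locales (use c_walk c_ne c_det c_sub c_ret c_pow in auto)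
qed

text \<open>Makes the corner at \<open>w\<close> full: every element outside \<open>J\<close> then
  has a multiple with nonzero compression to it, by \<open>cofinal_corner\<close>.\<close>

definition cofinal :: bool where
  "cofinal \<longleftrightarrow> (\<forall>u\<in>verts G. vertex_ge G u w)"

lemma cofinal_corner:
  assumes "cofinal" "x \<in> C" "x \<notin> J"
  obtains a b where "p w * (a * x * b) * p w \<notin> J"
proof -
  from reduction[OF assms(2,3)] consider
    (vertex) a b u where "u \<in> verts G" "a * x * b \<approx> p u"
    | (corner) w' a b where "rigid w'" "p w' * (a * x * b) * p w' \<notin> J"
    unfolding reducible_def by blast
  then show thesis
  proof cases
    case vertex
    obtain c d where cd: "c * p u * d \<approx> p w"
      using vertex_transport assms(1) vertex(1) unfolding cofinal_def by blast
    have "p w * (c * (a * x * b) * d) * p w \<approx> p w * (c * p u * d) * p w" by (intro eqv_mid vertex)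
    also have "\<dots> \<approx> p w * p w * p w" by (intro eqv_mid cd)
    also have "\<dots> \<approx> p w * p w" by (intro eqv_right pw_pw)
    also note pw_pw
    finally have "p w * ((c * a) * x * (b * d)) * p w \<notin> J"
      using p_nonzero[OF w_verts] eqv_mem by (simp add: mult.assoc)
    then show thesis by (rule that)
  next
    case corner
    \<comment> \<open>A second cycle without exits, based at \<open>w'\<close>, also reaches
      \<open>w\<close>. The path \<delta> runs along that cycle, so
      \<open>S \<delta> * p w * T \<delta>\<close> is \<open>p w'\<close>, and conjugation by
      \<delta> loses nothing.\<close>
    obtain c' where "no_exit_cycle G J \<kappa> C p s t w' c'" using no_exit_cycleI[OF corner(1)] .
    then interpret c': no_exit_cycle G J \<kappa> C p s t w' c' .
    obtain \<delta> where \<delta>: "awalk w' \<delta> w"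
      using assms(1) c'.w_verts unfolding cofinal_def vertex_ge_def by blast
    have S\<delta>: "S \<delta> * p w * T \<delta> \<approx> p w'"
      using c'.c_det c'.c_sub[OF \<delta>] by (intro S_T_deterministic[OF \<delta>]) auto
    define y where "y = a * x * b"
    have "p w * (T \<delta> * y * S \<delta>) * p w \<notin> J"
    proof
      assume "p w * (T \<delta> * y * S \<delta>) * p w \<in> J"
      then have "S \<delta> * (p w * (T \<delta> * y * S \<delta>) * p w) * T \<delta> \<in> J" by (rule idl_mid[OF idl_J])
      moreover have "S \<delta> * (p w * (T \<delta> * y * S \<delta>) * p w) * T \<delta> = (S \<delta> * p w * T \<delta>) * y * (S \<delta> * p w * T \<delta>)"
        by (simp add: mult.assoc)
      moreover have "\<dots> \<approx> p w' * y * p w'" by (intro eqv_mult eqv_right S\<delta>)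
      ultimately show False using corner(2) eqv_mem unfolding y_def by auto
    qed
    then have "p w * ((T \<delta> * a) * x * (b * S \<delta>)) * p w \<notin> J" unfolding y_def by (simp add: mult.assoc)
    then show thesis by (rule that)
  qed
qed

lemma cofinal_polynomial:
  assumes "cofinal" "x \<in> C" "x \<notin> J"
  obtains q a b where "a * x * b \<approx> ev q" "ev q \<notin> J"
proof -
  obtain a b where ab: "p w * (a * x * b) * p w \<notin> J" using cofinal_corner[OF assms] .
  obtain q n where q: "p w * (a * x * b) * p w \<approx> ev q * Y ^ n" using corner_span by blast
  have "(p w * a) * x * (b * p w * X ^ n) = p w * (a * x * b) * p w * X ^ n" by (simp add: mult.assoc)
  also have "\<dots> \<approx> ev q * Y ^ n * X ^ n" by (intro eqv_right q)
  also have "\<dots> \<approx> ev q" by (rule ev_YX)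
  finally have "(p w * a) * x * (b * p w * X ^ n) \<approx> ev q" .
  moreover have "ev q \<notin> J" using ab eqv_mem[OF q] idl_right[OF idl_J] by blast
  ultimately show thesis by (rule that)
qed

text \<open>The reduction is applied over \<open>Q\<close> and not over \<open>J\<close>: an element
  of \<open>J'\<close> outside \<open>Q\<close> would yield a polynomial in \<open>J'\<close>
  outside \<open>Q\<close>.\<close>

lemma cofinal_ideal_eq:
  assumes cof: "cofinal" and Q: "idl Q" "J \<subseteq> Q" "Q \<subseteq> J'" and J': "idl J'" "J' \<subseteq> C"
    and nz: "\<And>v. v \<in> verts G \<Longrightarrow> p v \<notin> J'" and ker: "\<And>q. ev q \<in> J' \<Longrightarrow> ev q \<in> Q"
  shows "Q = J'"
proof (rule ccontr)
  assume "Q \<noteq> J'"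
  then obtain x where x: "x \<in> J'" "x \<notin> Q" "x \<in> C" using Q J' by blast
  interpret Q: no_exit_cycle G Q \<kappa> C p s t w c
    using Q J' nz by (intro enlarge_cycle) auto
  have "Q.cofinal" using cof unfolding cofinal_def Q.cofinal_def .
  from Q.cofinal_polynomial[OF this x(3,2)] obtain q a b where q: "Q.eqv (a * x * b) (ev q)" "ev q \<notin> Q" .
  have "ev q \<in> J'" using Q.eqv_ideal_mem[OF q(1) J'(1) Q(3)] idl_mid[OF J'(1) x(1)] by blast
  then show False using ker q(2) by blast
qed

lemma one_notin_kernel: "ev 1 \<notin> J" using p_nonzero[OF w_verts] by simp

text \<open>The witness is the last power of \<open>f\<close> outside \<open>J\<close>; by
  \<open>irreducible_power_ideal\<close> every polynomial outside the trace of \<open>J\<close>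
  generates it modulo \<open>J\<close>.\<close>

lemma monolithicI:
  assumes cof: "cofinal" and f: "irreducible f" "ev (f ^ n) \<in> J"
  shows "\<exists>z. monolithic C J z"
proof -
  note K = kernel_idl[OF idl_J subset_refl]
  define m where "m = (LEAST m. ev (f ^ m) \<in> J)"
  have m: "ev (f ^ m) \<in> J" unfolding m_def using f(2) by (rule LeastI)
  then have "m \<noteq> 0" using one_notin_kernel by (metis power_0)
  then obtain m' where m': "m = Suc m'" by (cases m) auto
  have "ev (f ^ m') \<notin> J" using not_less_Least[of m' "\<lambda>m. ev (f ^ m) \<in> J"] m' unfolding m_def by simp
  moreover have "ev (f ^ m') \<in> J'" if J': "idl J'" "J \<subset> J'" "J' \<subseteq> C" for J'
  proof -
    obtain x where x: "x \<in> J'" "x \<in> C" "x \<notin> J" using J' by blast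
    obtain q a b where q: "a * x * b \<approx> ev q" "ev q \<notin> J" using cofinal_polynomial[OF cof x(2,3)] .
    have qJ': "ev q \<in> J'" using eqv_ideal_mem[OF q(1) J'(1)] J'(2) idl_mid[OF J'(1) x(1)] by blast
    obtain r where "f ^ m' - q * r \<in> {q. ev q \<in> J}"
      using irreducible_power_ideal[OF K f(1), of n q m'] f(2) q(2) m m' by auto
    then have 1: "ev (f ^ m') \<approx> ev (q * r)" unfolding eqv_def ev_diff[symmetric] by simp
    have "ev (q * r) \<in> J'" using eqv_ideal_mem[OF ev_mult J'(1)] J'(2) idl_right[OF J'(1) qJ'] by blast
    then show ?thesis using eqv_ideal_mem[OF 1 J'(1)] J'(2) by blast
  qed
  ultimately show ?thesis unfolding monolithic_def using ev_C by blast
qed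

lemma ev_generated_mult:
  assumes "x \<in> idl_gen (insert (ev q) J)" "y \<in> idl_gen (insert (ev q') J)"
  shows "x * y \<in> idl_gen (insert (ev (q * q')) J)" (is "_ \<in> ?K")
proof (rule idl_gen_insert_mult[OF idl_J idl_idl_gen _ _ assms])
  note K = idl_gen_insert_bounds[OF idl_C J_sub_C ev_C, of "q * q'"]
  show "J \<subseteq> ?K" by (rule K)
  fix l
  obtain r n where r: "ev q * l * ev q' \<approx> ev (q * q' * r) * Y ^ n" using ev_corner_ev by blast
  have "ev (q * q') * ev r \<in> ?K" by (rule idl_right[OF idl_idl_gen K(3)])
  then have "ev (q * q' * r) \<in> ?K" using eqv_ideal_mem[OF ev_mult idl_idl_gen K(2)] by blast
  then have "ev (q * q' * r) * Y ^ n \<in> ?K" by (rule idl_right[OF idl_idl_gen])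
  then show "ev q * l * ev q' \<in> ?K" using eqv_ideal_mem[OF r idl_idl_gen K(2)] by blast
qed

text \<open>Every vertex \<open>u\<close> generates the given corner element over \<open>J\<close>,
  which forces a nonzero \<open>p w * l * p u\<close> and hence a path from \<open>u\<close> to
  \<open>w\<close>. For the trace, the numerator \<open>q0\<close> of the corner element is what
  every polynomial outside the trace generates up to powers of \<open>X\<close>, as
  \<open>monolithic_poly_ideal\<close> requires.\<close>

lemma monolithic_kernel:
  assumes mono: "monolithic C J z" and y: "p w * y * p w \<notin> J"
    and yJ': "\<And>J'. idl J' \<Longrightarrow> J \<subset> J' \<Longrightarrow> J' \<subseteq> C \<Longrightarrow> p w * y * p w \<in> J'"
  shows "cofinal" "\<exists>f n. irreducible f \<and> 0 < n \<and> {q. ev q \<in> J} = {q. f ^ n dvd q}"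
proof -
  show "cofinal" unfolding cofinal_def
  proof
    fix u assume u: "u \<in> verts G"
    have "p w * y * p w \<in> idl_gen (insert (p u) J)"
      by (rule yJ'[OF idl_idl_gen idl_gen_insert_strict idl_gen_insert_bounds(1)])
        (use idl_C J_sub_C p_C[OF u] p_nonzero[OF u] in auto)
    with idl_J have "p w * (p w * y * p w) \<notin> J \<longrightarrow> (\<exists>l. p w * l * p u \<notin> J)"
    proof (rule idl_gen_insert[where Q = "\<lambda>x. p w * x \<notin> J \<longrightarrow> (\<exists>l. p w * l * p u \<notin> J)"])
      show "p w * (l * p u * m) \<notin> J \<longrightarrow> (\<exists>l. p w * l * p u \<notin> J)" for l m
        using idl_right[OF idl_J, of "p w * l * p u" m] by (auto simp: mult.assoc)
      show "p w * (y + z) \<notin> J \<longrightarrow> (\<exists>l. p w * l * p u \<notin> J)"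
        if "p w * y \<notin> J \<longrightarrow> (\<exists>l. p w * l * p u \<notin> J)" "p w * z \<notin> J \<longrightarrow> (\<exists>l. p w * l * p u \<notin> J)" for y z
        using that idl_add[OF idl_J, of "p w * y" "p w * z"] by (auto simp: distrib_left)
      show "p w * y \<notin> J \<longrightarrow> (\<exists>l. p w * l * p u \<notin> J)" if "y \<in> J" for y
        using idl_left[OF idl_J that] by blast
    qed (simp add: idl_zero[OF idl_J])
    moreover have "p w * (p w * y * p w) \<approx> p w * y * p w"
      using eqv_right[OF pw_pw, of "y * p w"] by (simp add: mult.assoc)
    ultimately show "vertex_ge G u w" using y eqv_mem corner_nonzero_connected[OF rigid_w u] by blast
  qed
  obtain q0 n0 where q0: "p w * y * p w \<approx> ev q0 * Y ^ n0" using corner_span by blast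
  have q0J: "ev q0 \<notin> J" using y eqv_mem[OF q0] idl_right[OF idl_J] by blast
  have q0J': "ev q0 \<in> J'" if J': "idl J'" "J \<subset> J'" "J' \<subseteq> C" for J'
    using yJ'[OF J'] eqv_ideal_mem[OF q0 J'(1)] ev_Y_mem_iff[OF J'(1)] J'(2) by blast
  have "\<exists>r n. monom 1 n * q0 - q * r \<in> {q. ev q \<in> J}" if "q \<notin> {q. ev q \<in> J}" for q
  proof (rule ev_mem_generated)
    show "ev q0 \<in> idl_gen (insert (ev q) J)"
      by (rule q0J'[OF idl_idl_gen idl_gen_insert_strict idl_gen_insert_bounds(1)])
        (use idl_C J_sub_C ev_C that in auto)
  qed
  moreover have "q \<in> {q. ev q \<in> J}" if "monom 1 n * q \<in> {q. ev q \<in> J}" for n q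
    using kernel_cancel[OF idl_J subset_refl, of n q] that by simp
  ultimately show "\<exists>f n. irreducible f \<and> 0 < n \<and> {q. ev q \<in> J} = {q. f ^ n dvd q}"
    using one_notin_kernel q0J by (intro monolithic_poly_ideal[OF kernel_idl[OF idl_J subset_refl], of q0]) auto
qed

text \<open>Primeness in terms of elements: if all \<open>a * l * b\<close> lie in \<open>J\<close>,
  then so does \<open>a\<close> or \<open>b\<close>. The vertices \<open>p w\<close> and
  \<open>p u\<close> give the connection, two polynomials give a prime trace.\<close>

lemma prime_kernel:
  assumes prime: "\<And>J1 J2. \<lbrakk>idl J1; idl J2; J \<subseteq> J1; J \<subseteq> J2; J1 \<subseteq> C; J2 \<subseteq> C;
      \<And>x y. x \<in> J1 \<Longrightarrow> y \<in> J2 \<Longrightarrow> x * y \<in> J\<rbrakk> \<Longrightarrow> J1 \<subseteq> J \<or> J2 \<subseteq> J"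
  shows "cofinal" "ev (q * r) \<in> J \<Longrightarrow> ev q \<in> J \<or> ev r \<in> J"
proof -
  have gen: "a \<in> J \<or> b \<in> J" if ab: "a \<in> C" "b \<in> C" "\<And>l. a * l * b \<in> J" for a b
  proof -
    note A = idl_gen_insert_bounds[OF idl_C J_sub_C ab(1)] and B = idl_gen_insert_bounds[OF idl_C J_sub_C ab(2)]
    have "idl_gen (insert a J) \<subseteq> J \<or> idl_gen (insert b J) \<subseteq> J"
      by (rule prime[OF idl_idl_gen idl_idl_gen A(2) B(2) A(1) B(1)])
        (rule idl_gen_insert_mult[OF idl_J idl_J subset_refl ab(3)])
    then show ?thesis using A(3) B(3) by blast
  qed
  show "cofinal" unfolding cofinal_def
  proof
    fix u assume u: "u \<in> verts G"
    have "\<exists>l. p w * l * p u \<notin> J" using gen[OF p_C[OF w_verts] p_C[OF u]] p_nonzero u w_verts by blast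
    then show "vertex_ge G u w" using corner_nonzero_connected[OF rigid_w u] by blast
  qed
  assume qr: "ev (q * r) \<in> J"
  show "ev q \<in> J \<or> ev r \<in> J"
  proof (rule gen[OF ev_C ev_C])
    fix l
    obtain r' n where 1: "ev q * l * ev r \<approx> ev (q * r * r') * Y ^ n" using ev_corner_ev by blast
    have "ev (q * r * r') \<in> J" using eqv_mem[OF ev_mult] idl_right[OF idl_J qr] by blast
    then show "ev q * l * ev r \<in> J" using eqv_mem[OF 1] idl_right[OF idl_J] by blast
  qed
qed

text \<open>Modulo \<open>P\<close> the corner becomes a field, as \<open>f\<close> is irreducible.
  An element outside \<open>P\<close> thus generates \<open>p w\<close> modulo \<open>P\<close>, so
  two ideals not inside \<open>P\<close> have a product that is not inside \<open>P\<close>.\<close>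

lemma irreducible_generated:
  assumes cof: "cofinal" and f: "irreducible f" "0 < n" and ker: "{q. ev q \<in> J} = {q. f ^ n dvd q}"
  defines "P \<equiv> idl_gen (insert (ev f) J)"
  shows "\<And>v. v \<in> verts G \<Longrightarrow> p v \<notin> P"
    and "\<And>J1 J2. \<lbrakk>idl J1; idl J2; J1 \<subseteq> C; J2 \<subseteq> C;
      \<And>x y. x \<in> J1 \<Longrightarrow> y \<in> J2 \<Longrightarrow> x * y \<in> P\<rbrakk> \<Longrightarrow> J1 \<subseteq> P \<or> J2 \<subseteq> P"
proof -
  note P = idl_idl_gen[of "insert (ev f) J", folded P_def]
    idl_gen_insert_bounds[OF idl_C J_sub_C ev_C, of f, folded P_def]
  have kerD: "f ^ n dvd q" if "ev q \<in> J" for q using ker that by blast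
  have pw: "p w \<notin> P"
  proof
    assume "p w \<in> P"
    then have "ev 1 \<in> P" by simp
    then obtain r m where "monom 1 m * 1 - f * r \<in> {q. ev q \<in> J}"
      using ev_mem_generated unfolding P_def by blast
    then have "f ^ n dvd monom 1 m - f * r" using kerD by simp
    then have "f dvd monom 1 m - f * r" using f(2) by (meson dvd_power dvd_trans)
    then have "f dvd monom 1 m" using dvd_add[of f "monom 1 m - f * r" "f * r"] by simp
    then have "f dvd [:0, 1:] ^ m" by (simp add: monom_altdef)
    then have "f dvd [:0, 1:]"
      using field_poly_irreducible_imp_prime[OF f(1)] prime_elem_dvd_power by blast
    \<comment> \<open>\<open>f\<close> cannot divide \<open>X\<close>, which is invertible in the
      corner: this would put a power of \<open>X\<close>, and with it \<open>w\<close>, into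
      \<open>J\<close>.\<close>
    then have "f ^ n dvd [:0, 1:] ^ n" by (rule dvd_power_same)
    then have "ev (monom 1 n * 1) \<in> J" using ker by (auto simp: monom_altdef)
    then show False using kernel_cancel[OF idl_J subset_refl] one_notin_kernel by blast
  qed
  show pv: "p v \<notin> P" if "v \<in> verts G" for v
    using pw vertex_ge_mem[OF P(1,3)] cof that unfolding cofinal_def by blast
  interpret P: no_exit_cycle G P \<kappa> C p s t w c
    by (rule enlarge_cycle[OF P(1,3,2) pv])
  have unit: "\<exists>a b. P.eqv (a * x * b) (p w)" if x: "x \<in> C" "x \<notin> P" for x
  proof -
    have "P.cofinal" using cof unfolding cofinal_def P.cofinal_def .
    from P.cofinal_polynomial[OF this x] obtain q a b where q: "P.eqv (a * x * b) (ev q)" "ev q \<notin> P" .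
    have "\<not> f dvd q"
    proof
      assume "f dvd q"
      then obtain r where "q = f * r" by (auto simp: dvd_def)
      then have "ev q \<in> P" using P.eqv_mem[OF P.ev_mult[of f r]] idl_right[OF P(1,4)] by simp
      then show False using q(2) by simp
    qed
    then obtain a' b' where ab: "a' * q + b' * f ^ 1 = 1" using poly_bezout[OF f(1)] by blast
    have "ev (b' * f) \<in> P" using P.eqv_mem[OF P.ev_mult[of b' f]] idl_left[OF P(1,4)] by simp
    have "P.eqv (ev a' * (a * x * b)) (ev a' * ev q)" by (intro P.eqv_left q(1))
    also have "P.eqv \<dots> (ev (a' * q))" by (rule P.eqv_sym[OF P.ev_mult])
    also have "P.eqv \<dots> (ev (a' * q) + ev (b' * f))"
      using \<open>ev (b' * f) \<in> P\<close> idl_uminus[OF P(1)] unfolding P.eqv_def by simp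
    also have "\<dots> = p w" unfolding ev_add[symmetric] using ab by simp
    finally have "P.eqv ((ev a' * a) * x * b) (p w)" by (simp add: mult.assoc)
    then show ?thesis by blast
  qed
  fix J1 J2 assume J12: "idl J1" "idl J2" "J1 \<subseteq> C" "J2 \<subseteq> C" "\<And>x y. x \<in> J1 \<Longrightarrow> y \<in> J2 \<Longrightarrow> x * y \<in> P"
  show "J1 \<subseteq> P \<or> J2 \<subseteq> P"
  proof (rule ccontr)
    assume "\<not> ?thesis"
    then obtain x y where xy: "x \<in> J1" "x \<notin> P" "y \<in> J2" "y \<notin> P" by blast
    obtain a b where 1: "P.eqv (a * x * b) (p w)" using unit xy J12 by blast
    obtain a' b' where 2: "P.eqv (a' * y * b') (p w)" using unit xy J12 by blast
    have "a * x * b * (a' * y * b') \<in> P"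
      by (intro J12(5) idl_mid[OF J12(1)] idl_mid[OF J12(2)] xy)
    moreover have "P.eqv (a * x * b * (a' * y * b')) (p w)"
      by (rule P.eqv_trans[OF P.eqv_mult[OF 1 2] P.pw_pw])
    ultimately show False using pw P.eqv_mem by blast
  qed
qed

end

section \<open>The free algebra\<close>

lemma poly_mapping_single_induct [case_names zero single add]:
  fixes x :: "'a \<Rightarrow>\<^sub>0 'b::comm_monoid_add"
  assumes "P 0" "\<And>w k. P (Poly_Mapping.single w k)" "\<And>x y. P x \<Longrightarrow> P y \<Longrightarrow> P (x + y)"
  shows "P x"
proof -
  have "x = (\<Sum>w\<in>Poly_Mapping.keys x. Poly_Mapping.single w (Poly_Mapping.lookup x w))"
    by (rule poly_mapping_eqI) (auto simp: lookup_sum lookup_single when_def not_in_keys_iff_lookup_eq_zero)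
  moreover have "P (sum f W)" if "\<And>w. P (f w)" for f and W :: "'a set"
    by (induction W rule: infinite_finite_induct) (auto intro: assms that)
  ultimately show ?thesis using assms(2) by metis
qed

definition const :: "'k::field \<Rightarrow> ('v, 'e, 'k) lpa_free" where
  "const k = Poly_Mapping.single 0 k"

lemma const_add: "const (a + b) = const a + const b"
  by (simp add: const_def single_add)

lemma const_mult: "const (a * b) = const a * const b"
  by (simp add: const_def mult_single)

lemma const_1: "const 1 = 1"
  by (simp add: const_def)

lemma const_central: "const a * x = x * const a"
  by (induction x rule: poly_mapping_single_induct)
    (simp_all add: const_def mult_single distrib_left distrib_right mult.commute)

lemma scale_const: "scale c x = const c * x"
  by (simp add: scale_def const_def)

lemma single_Cons: "Poly_Mapping.single (g # w) k = gen g * Poly_Mapping.single w k"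
  by (simp add: gen_def mult_single plus_list_def)

lemma single_Nil: "Poly_Mapping.single [] k = const k"
  by (simp add: const_def zero_list_def)

text \<open>A concatenation is empty only if both words are.\<close>

lemma lookup_mult_zero:
  fixes x y :: "'a list \<Rightarrow>\<^sub>0 'k::semiring_0"
  shows "Poly_Mapping.lookup (x * y) 0 = Poly_Mapping.lookup x 0 * Poly_Mapping.lookup y 0"
proof (induction x rule: poly_mapping_single_induct)
  case (single w k)
  show ?case
    by (induction y rule: poly_mapping_single_induct)
      (auto simp: mult_single lookup_single when_def distrib_left lookup_add plus_list_def zero_list_def)
qed (simp_all add: distrib_right lookup_add)

definition aug :: "('v, 'e, 'k::field) lpa_free set" where
  "aug = {x. Poly_Mapping.lookup x 0 = 0}"

lemma idl_aug: "idl aug"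
  unfolding aug_def by (rule idlI) (auto simp: lookup_add lookup_mult_zero)

lemma gen_aug: "gen g \<in> aug"
  by (simp add: aug_def gen_def lookup_single zero_list_def)

text \<open>Words are built up from the left, so among products only left multiplication by a
  generator or a scalar has to be considered.\<close>

lemma aug_induct [consumes 1, case_names zero gen add const left]:
  fixes x :: "('v, 'e, 'k::field) lpa_free"
  assumes x: "x \<in> aug"
    and zero: "P 0" and gen: "\<And>g. P (gen g)" and add: "\<And>x y. P x \<Longrightarrow> P y \<Longrightarrow> P (x + y)"
    and const: "\<And>x k. P x \<Longrightarrow> P (const k * x)" and left: "\<And>x g. P x \<Longrightarrow> P (gen g * x)"
  shows "P x"
proof -
  have 1: "P (Poly_Mapping.single w k)" if "w \<noteq> []" for w k
    using that
  proof (induction w)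
    case (Cons g w)
    show ?case
    proof (cases "w = []")
      case True
      have "Poly_Mapping.single (g # w) k = const k * gen g"
        unfolding True single_Cons single_Nil by (rule const_central[symmetric])
      then show ?thesis using const[OF gen] by simp
    next
      case False
      then show ?thesis unfolding single_Cons using Cons.IH left by blast
    qed
  qed simp
  define y where "y = x - const (Poly_Mapping.lookup x 0)"
  have "P (x - const (Poly_Mapping.lookup x 0))"
  proof (induction x rule: poly_mapping_single_induct)
    case (single w k)
    show ?case
    proof (cases "w = []")
      case True
      then show ?thesis using zero by (simp add: const_def zero_list_def)
    next
      case False
      then show ?thesis using 1[OF False] by (simp add: lookup_single const_def zero_list_def)
    qed
  next
    case (add x y)
    have "x + y - const (Poly_Mapping.lookup (x + y) 0) =
      (x - const (Poly_Mapping.lookup x 0)) + (y - const (Poly_Mapping.lookup y 0))"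
      by (simp add: lookup_add const_add)
    then show ?case using assms(4)[OF add] by (simp only:)
  qed (use zero in \<open>simp add: const_def\<close>)
  then show ?thesis using x by (simp add: aug_def const_def)
qed

text \<open>
  Ideals of the Leavitt path algebra correspond to the ideals of the free unital algebra between
  the one generated by \<open>base_relations E\<close> and \<open>aug\<close>. Generators that do not belong to \<open>E\<close> are killed.
\<close>
definition base_relations :: "('v, 'e) pre_digraph \<Rightarrow> ('v, 'e, 'k::field) lpa_free set" where
  "base_relations E = lpa_relations E \<union> {gen g | g. g \<notin> lpa_gens E}"

lemma base_relations_aug: "base_relations E \<subseteq> (aug :: ('v, 'e, 'k::field) lpa_free set)"
proof -
  have d: "x \<in> aug \<Longrightarrow> y \<in> aug \<Longrightarrow> x - y \<in> aug" for x y :: "('v, 'e, 'k) lpa_free"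
    by (rule idl_diff[OF idl_aug])
  have m: "gen g * x \<in> aug" for g and x :: "('v, 'e, 'k) lpa_free"
    using idl_right[OF idl_aug gen_aug] .
  show ?thesis
    unfolding base_relations_def lpa_relations_def
    by (auto intro!: d m gen_aug idl_sum[OF idl_aug] idl_zero[OF idl_aug])
qed

section \<open>Closure properties of the span of the path terms\<close>

context ck_relations
begin

lemma spanned_0: "spanned 0"
  unfolding spanned_def by (intro exI[of _ "[]"]) simp

lemma spanned_cong: "x \<approx> y \<Longrightarrow> spanned y \<Longrightarrow> spanned x"
  unfolding spanned_def using eqv_trans by blast

lemma spanned_J: "x \<in> J \<Longrightarrow> spanned x"
  using spanned_cong[OF _ spanned_0] eqv_0_iff by blast

lemma spanned_add: "spanned x \<Longrightarrow> spanned y \<Longrightarrow> spanned (x + y)"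
proof -
  assume "spanned x" "spanned y"
  then obtain ts us where "\<forall>\<tau>\<in>set ts. \<exists>u. walk_term u \<tau>" "x \<approx> eval ts"
    "\<forall>\<tau>\<in>set us. \<exists>u. walk_term u \<tau>" "y \<approx> eval us" unfolding spanned_def by blast
  then have "\<forall>\<tau>\<in>set (ts @ us). \<exists>u. walk_term u \<tau>" "x + y \<approx> eval (ts @ us)"
    by (auto intro: eqv_add)
  then show ?thesis unfolding spanned_def by blast
qed

lemma spanned_term:
  assumes "awalk w \<alpha> v" "awalk u \<beta> v"
  shows "spanned (\<kappa> k * (S \<alpha> * (p v * T \<beta>)))"
proof -
  have "walk_term u (k, \<alpha>, v, \<beta>)" using assms unfolding walk_term_def by auto
  moreover have "\<kappa> k * (S \<alpha> * (p v * T \<beta>)) = eval [(k, \<alpha>, v, \<beta>)]" by (simp add: term_val_def)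
  ultimately show ?thesis unfolding spanned_def by (intro exI[of _ "[(k, \<alpha>, v, \<beta>)]"]) auto
qed

lemma spanned_map:
  assumes f_add: "\<And>x y. f (x + y) = f x + f y" and f0: "f 0 = 0"
    and f_cong: "\<And>x y. x \<approx> y \<Longrightarrow> f x \<approx> f y"
    and f_term: "\<And>k \<alpha> v \<beta> w u. awalk w \<alpha> v \<Longrightarrow> awalk u \<beta> v \<Longrightarrow> spanned (f (\<kappa> k * (S \<alpha> * (p v * T \<beta>))))"
    and x: "spanned x"
  shows "spanned (f x)"
proof -
  obtain ts where ts: "\<forall>\<tau>\<in>set ts. \<exists>u. walk_term u \<tau>" "x \<approx> eval ts"
    using x unfolding spanned_def by blast
  from ts(1) have "spanned (f (eval ts))"
  proof (induction ts)
    case (Cons \<tau> ts)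
    obtain k \<alpha> v \<beta> where \<tau>: "\<tau> = (k, \<alpha>, v, \<beta>)" by (cases \<tau>)
    have "spanned (f (term_val \<tau>))"
      using Cons.prems f_term unfolding \<tau> walk_term_def term_val_def by auto
    then show ?case using Cons spanned_add f_add by simp
  qed (simp add: f0 spanned_0)
  then show ?thesis using spanned_cong f_cong ts(2) by blast
qed

lemma spanned_const: "spanned x \<Longrightarrow> spanned (\<kappa> k * x)"
proof (rule spanned_map[of "\<lambda>x. \<kappa> k * x"])
  fix k' \<alpha> v \<beta> w u
  assume w: "awalk w \<alpha> v" "awalk u \<beta> v"
  show "spanned (\<kappa> k * (\<kappa> k' * (S \<alpha> * (p v * T \<beta>))))"
    using spanned_term[OF w, of "k * k'"] by (simp add: \<kappa>_mult mult.assoc)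
qed (auto simp: distrib_left intro: eqv_left)

lemma spanned_left:
  assumes z: "\<And>\<alpha> v \<beta> w u. awalk w \<alpha> v \<Longrightarrow> awalk u \<beta> v \<Longrightarrow> spanned (z * (S \<alpha> * (p v * T \<beta>)))"
    and x: "spanned x"
  shows "spanned (z * x)"
proof (rule spanned_map[OF _ _ _ _ x, of "\<lambda>x. z * x"])
  fix k \<alpha> v \<beta> w u
  assume w: "awalk w \<alpha> v" "awalk u \<beta> v"
  show "spanned (z * (\<kappa> k * (S \<alpha> * (p v * T \<beta>))))"
    using spanned_const[OF z[OF w], of k] by (simp only: \<kappa>_pull[of z])
qed (auto simp: distrib_left intro: eqv_left)

lemma term_zero: "z * (S \<alpha> * p v) \<approx> 0 \<Longrightarrow> spanned (z * (S \<alpha> * (p v * y)))"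
proof -
  assume "z * (S \<alpha> * p v) \<approx> 0"
  then have "z * (S \<alpha> * p v) * y \<in> J" using eqv_0_iff idl_right[OF idl_J] by blast
  then show ?thesis using spanned_J by (simp add: mult.assoc)
qed

lemma term_cong: "z * (S \<alpha> * p v) \<approx> S \<alpha>' * p v \<Longrightarrow> awalk w \<alpha>' v \<Longrightarrow> awalk u \<beta> v \<Longrightarrow>
  spanned (z * (S \<alpha> * (p v * T \<beta>)))"
proof -
  assume a: "z * (S \<alpha> * p v) \<approx> S \<alpha>' * p v" "awalk w \<alpha>' v" "awalk u \<beta> v"
  have "z * (S \<alpha> * p v) * T \<beta> \<approx> S \<alpha>' * p v * T \<beta>" by (rule eqv_right[OF a(1)])
  then show ?thesis using spanned_cong spanned_term[OF a(2,3), of 1] by (simp add: mult.assoc)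
qed

lemma spanned_p: "v \<in> verts G \<Longrightarrow> spanned (p v)"
  using spanned_term[of v "[]" v v "[]" 1] by (simp add: awalk_Nil_iff)

lemma spanned_p_mult: "v \<in> verts G \<Longrightarrow> spanned x \<Longrightarrow> spanned (p v * x)"
proof (rule spanned_left)
  fix \<alpha> v' \<beta> w u
  assume v: "v \<in> verts G" and w: "awalk w \<alpha> v'" "awalk u \<beta> v'"
  show "spanned (p v * (S \<alpha> * (p v' * T \<beta>)))"
  proof (cases "v = w")
    case True
    then show ?thesis using term_cong[OF p_S[OF w(1)] w] by simp
  next
    case False
    then show ?thesis using term_zero[OF p_S_orth[OF w(1) v]] by simp
  qed
qed

lemma spanned_s_mult:
  assumes e: "e \<in> arcs G" and x: "spanned x"
  shows "spanned (s e * x)"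
proof (rule spanned_left[OF _ x])
  fix \<alpha> v \<beta> w u
  assume w: "awalk w \<alpha> v" "awalk u \<beta> v"
  show "spanned (s e * (S \<alpha> * (p v * T \<beta>)))"
  proof (cases "head G e = w")
    case True
    then have "awalk (tail G e) (e # \<alpha>) v" using w(1) e by (simp add: awalk_Cons_iff)
    then show ?thesis using term_cong[of "s e" \<alpha> v "e # \<alpha>"] w(2) by (simp add: mult.assoc)
  next
    case False
    have "s e * (S \<alpha> * p v) \<approx> s e * p (head G e) * (S \<alpha> * p v)"
      by (intro eqv_right eqv_sym[OF s_p[OF e]])
    also have "\<dots> = s e * (p (head G e) * (S \<alpha> * p v))" by (simp add: mult.assoc)
    also have "\<dots> \<approx> s e * 0" by (intro eqv_left p_S_orth[OF w(1)] head_in_verts e False)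
    finally show ?thesis by (intro term_zero) simp
  qed
qed

lemma spanned_t_mult:
  assumes e: "e \<in> arcs G" and x: "spanned x"
  shows "spanned (t e * x)"
proof (rule spanned_left[OF _ x])
  fix \<alpha> v \<beta> w u
  assume w: "awalk w \<alpha> v" "awalk u \<beta> v"
  show "spanned (t e * (S \<alpha> * (p v * T \<beta>)))"
  proof (cases \<alpha>)
    case Nil
    then have v: "v \<in> verts G" using w by auto
    show ?thesis
    proof (cases "v = tail G e")
      case True
      have "awalk u (\<beta> @ [e]) (head G e)"
        unfolding awalk_append using w(2) e True arc_implies_awalk by blast
      then have 1: "spanned (\<kappa> 1 * (S [] * (p (head G e) * T (\<beta> @ [e]))))"
        using e by (intro spanned_term[of "head G e" "[]" "head G e" u]) (simp_all only: awalk_Nil_iff head_in_verts simp_thms)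
      have "t e * p v * T \<beta> \<approx> t e * T \<beta>" unfolding True by (intro eqv_right t_p e)
      also have "\<dots> \<approx> p (head G e) * t e * T \<beta>" by (intro eqv_right eqv_sym[OF p_t[OF e]])
      finally show ?thesis using spanned_cong 1 unfolding Nil by (simp add: mult.assoc)
    next
      case False
      have "t e * p v \<approx> t e * p (tail G e) * p v" by (intro eqv_right eqv_sym[OF t_p[OF e]])
      also have "\<dots> = t e * (p (tail G e) * p v)" by (simp add: mult.assoc)
      also have "\<dots> \<approx> t e * 0" by (intro eqv_left p_orth tail_in_verts e v) (use False in auto)
      finally show ?thesis unfolding Nil by (intro term_zero) simp
    qed
  next
    case (Cons f \<alpha>')
    have f: "f \<in> arcs G" "awalk (head G f) \<alpha>' v" using w(1) unfolding Cons by (auto simp: awalk_simps)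
    have eq: "t e * (S \<alpha> * p v) = t e * s f * (S \<alpha>' * p v)" unfolding Cons by (simp add: mult.assoc)
    show ?thesis
    proof (cases "f = e")
      case True
      have "t e * s f * (S \<alpha>' * p v) \<approx> p (head G f) * (S \<alpha>' * p v)"
        unfolding True by (intro eqv_right t_s e)
      also have "\<dots> \<approx> S \<alpha>' * p v" by (rule p_S[OF f(2)])
      finally show ?thesis unfolding eq[symmetric] by (rule term_cong[OF _ f(2) w(2)])
    next
      case False
      have "t e * s f * (S \<alpha>' * p v) \<approx> 0 * (S \<alpha>' * p v)"
        by (intro eqv_right t_s_orth e f) (use False in auto)
      then show ?thesis by (intro term_zero) (simp add: eq)
    qed
  qed
qed

lemma spanned_s: "e \<in> arcs G \<Longrightarrow> spanned (s e)"
  using spanned_cong[OF eqv_sym[OF s_p]] spanned_s_mult[OF _ spanned_p] head_in_verts by blast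

lemma spanned_t: "e \<in> arcs G \<Longrightarrow> spanned (t e)"
  using spanned_cong[OF eqv_sym[OF t_p]] spanned_t_mult[OF _ spanned_p] tail_in_verts by blast

end

section \<open>The quotient graph family\<close>

definition live_arcs :: "('v, 'e) pre_digraph \<Rightarrow> 'v set \<Rightarrow> 'v \<Rightarrow> 'e set" where
  "live_arcs E H v = {e \<in> out_arcs E v. head E e \<notin> H}"

definition live_sum :: "('v, 'e) pre_digraph \<Rightarrow> 'v set \<Rightarrow> 'v \<Rightarrow> ('v, 'e, 'k::field) lpa_free" where
  "live_sum E H v = (\<Sum>e\<in>live_arcs E H v. gen (Edg e) * gen (Ghost e))"

definition break_free :: "('v, 'e) pre_digraph \<Rightarrow> 'v set \<Rightarrow> 'v \<Rightarrow> ('v, 'e, 'k::field) lpa_free" where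
  "break_free E H v = gen (Vtx v) - live_sum E H v"

text \<open>
  The isomorphism \<open>L\<^sub>K(E\(H,S)) \<cong> L\<^sub>K(E) / I(H,S)\<close>: for a breaking vertex \<open>v\<close> outside \<open>S\<close>, the vertex \<open>v\<close>
  of the quotient graph corresponds to \<open>v - v\<^sup>H\<close> and the new vertex \<open>v'\<close> to \<open>v\<^sup>H\<close>.
\<close>
definition quot_vertex :: "('v, 'e) pre_digraph \<Rightarrow> 'v set \<Rightarrow> 'v set \<Rightarrow> 'v + 'v \<Rightarrow> ('v, 'e, 'k::field) lpa_free" where
  "quot_vertex E H S = case_sum
     (\<lambda>v. if v \<in> breaking_vertices E H - S then live_sum E H v else gen (Vtx v)) (break_free E H)"

text \<open>An edge whose range carries two orthogonal idempotents is cut by them into two pieces;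
  these are \<open>e\<close> and \<open>e'\<close>.\<close>

definition quot_edge :: "('v, 'e) pre_digraph \<Rightarrow> 'v set \<Rightarrow> 'v set \<Rightarrow> 'e + 'e \<Rightarrow> ('v, 'e, 'k::field) lpa_free" where
  "quot_edge E H S f = gen (Edg (case_sum id id f)) * quot_vertex E H S (head (quotient_graph E H S) f)"

definition quot_ghost :: "('v, 'e) pre_digraph \<Rightarrow> 'v set \<Rightarrow> 'v set \<Rightarrow> 'e + 'e \<Rightarrow> ('v, 'e, 'k::field) lpa_free" where
  "quot_ghost E H S f = quot_vertex E H S (head (quotient_graph E H S) f) * gen (Ghost (case_sum id id f))"

definition admissible_relations :: "('v, 'e) pre_digraph \<Rightarrow> 'v set \<Rightarrow> 'v set \<Rightarrow> ('v, 'e, 'k::field) lpa_free set" where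
  "admissible_relations E H S = base_relations E \<union> (\<lambda>v. gen (Vtx v)) ` H \<union> break_free E H ` S"

locale lpa_ideal = wf_digraph E + ring_ideal J
  for E :: "('v, 'e) pre_digraph" and J :: "('v, 'e, 'k::field) lpa_free set" +
  assumes base: "base_relations E \<subseteq> J"
begin

abbreviation V :: "'v \<Rightarrow> ('v, 'e, 'k) lpa_free" where "V v \<equiv> gen (Vtx v)"
abbreviation A :: "'e \<Rightarrow> ('v, 'e, 'k) lpa_free" where "A e \<equiv> gen (Edg e)"
abbreviation B :: "'e \<Rightarrow> ('v, 'e, 'k) lpa_free" where "B e \<equiv> gen (Ghost e)"

lemma relI: "x - y \<in> lpa_relations E \<Longrightarrow> x \<approx> y"
  using base unfolding eqv_def base_relations_def by blast

lemma V_V: "v \<in> verts E \<Longrightarrow> w \<in> verts E \<Longrightarrow> V v * V w \<approx> (if v = w then V v else 0)"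
  by (rule relI, unfold lpa_relations_def) blast

lemma V_A: "e \<in> arcs E \<Longrightarrow> V (tail E e) * A e \<approx> A e"
  by (rule relI, unfold lpa_relations_def) blast

lemma A_V: "e \<in> arcs E \<Longrightarrow> A e * V (head E e) \<approx> A e"
  by (rule relI, unfold lpa_relations_def) blast

lemma V_B: "e \<in> arcs E \<Longrightarrow> V (head E e) * B e \<approx> B e"
  by (rule relI, unfold lpa_relations_def) blast

lemma B_V: "e \<in> arcs E \<Longrightarrow> B e * V (tail E e) \<approx> B e"
  by (rule relI, unfold lpa_relations_def) blast

lemma B_A: "e \<in> arcs E \<Longrightarrow> f \<in> arcs E \<Longrightarrow> B e * A f \<approx> (if e = f then V (head E e) else 0)"
  by (rule relI, unfold lpa_relations_def) blast

lemma V_regular: "regular_vertex E v \<Longrightarrow> V v \<approx> (\<Sum>e\<in>out_arcs E v. A e * B e)"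
  by (rule relI, unfold lpa_relations_def) blast

lemma outside: "g \<notin> lpa_gens E \<Longrightarrow> gen g \<in> J"
  using base unfolding base_relations_def by blast

end

text \<open>\<open>J\<close> may contain vertices of the quotient graph, and \<open>UNIV\<close> is
  taken for \<open>J\<close> when only the combinatorics is wanted; nonzero vertices are demanded in
  \<open>quotient_ck_family\<close>.\<close>

locale quotient_family = lpa_ideal E J
  for E :: "('v, 'e) pre_digraph" and J :: "('v, 'e, 'k::field) lpa_free set" +
  fixes H S :: "'v set"
  assumes adm: "admissible_pair E H S" and adm_J: "admissible_relations E H S \<subseteq> J"
begin

abbreviation F where "F \<equiv> quotient_graph E H S"
abbreviation D where "D \<equiv> breaking_vertices E H - S"
abbreviation N where "N \<equiv> live_arcs E H"
abbreviation W :: "'v \<Rightarrow> ('v, 'e, 'k) lpa_free" where "W \<equiv> live_sum E H"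
abbreviation q :: "'v + 'v \<Rightarrow> ('v, 'e, 'k) lpa_free" where "q \<equiv> quot_vertex E H S"
abbreviation base_of :: "'x + 'x \<Rightarrow> 'x" where "base_of \<equiv> case_sum id id"

lemma H_J:
  assumes "v \<in> H"
  shows "V v \<in> J"
proof -
  have "V v \<in> admissible_relations E H S" using assms unfolding admissible_relations_def by simp
  then show ?thesis using adm_J by (rule subsetD[rotated])
qed

lemma S_J:
  assumes "v \<in> S"
  shows "V v \<approx> W v"
proof -
  have "break_free E H v \<in> admissible_relations E H S" using assms unfolding admissible_relations_def by simp
  then have "break_free E H v \<in> J" using adm_J by (rule subsetD[rotated])
  then show ?thesis unfolding eqv_def break_free_def .
qed

lemma tail_notin_H: "e \<in> arcs E \<Longrightarrow> head E e \<notin> H \<Longrightarrow> tail E e \<notin> H"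
  using adm hereditary_arcD unfolding admissible_pair_def by blast

lemma N_D: "e \<in> N v \<longleftrightarrow> e \<in> arcs E \<and> tail E e = v \<and> head E e \<notin> H"
  unfolding live_arcs_def by auto

lemma breaking: "v \<in> breaking_vertices E H \<Longrightarrow> v \<in> verts E \<and> v \<notin> H \<and> finite (N v) \<and> N v \<noteq> {}"
  unfolding breaking_vertices_def live_arcs_def by auto

lemma verts_F: "verts F = Inl ` (verts E - H) \<union> Inr ` D"
  and arcs_F: "arcs F = Inl ` {e \<in> arcs E. head E e \<notin> H} \<union> Inr ` {e \<in> arcs E. head E e \<in> D}"
  and tail_F: "tail F f = Inl (tail E (base_of f))"
  and head_F: "head F (Inl e) = Inl (head E e)" "head F (Inr e) = Inr (head E e)"
  unfolding quotient_graph_def by (auto split: sum.split)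

lemma arcs_F_base:
  assumes "f \<in> arcs F"
  shows "base_of f \<in> arcs E" "head E (base_of f) \<notin> H" "base_of (head F f) = head E (base_of f)"
    "head F f \<in> verts F"
  using assms breaking unfolding arcs_F verts_F by (auto simp: head_F)

lemma F_wf: "wf_digraph F"
proof
  show "head F f \<in> verts F" if "f \<in> arcs F" for f using arcs_F_base(4)[OF that] .
  show "tail F f \<in> verts F" if "f \<in> arcs F" for f
    using arcs_F_base(1,2)[OF that] tail_notin_H unfolding tail_F verts_F by auto
qed

lemma W_V: "v \<in> verts E \<Longrightarrow> W v * V v \<approx> W v" "v \<in> verts E \<Longrightarrow> V v * W v \<approx> W v"
proof -
  have "W v * V v = (\<Sum>e\<in>N v. A e * (B e * V v))"
    unfolding live_sum_def by (simp add: sum_distrib_right mult.assoc)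
  also have "\<dots> \<approx> W v" unfolding live_sum_def
    by (intro eqv_sum eqv_left) (auto simp: N_D intro: B_V)
  finally show "W v * V v \<approx> W v" .
  have "V v * W v = (\<Sum>e\<in>N v. (V v * A e) * B e)"
    unfolding live_sum_def by (simp add: sum_distrib_left mult.assoc)
  also have "\<dots> \<approx> W v" unfolding live_sum_def
    by (intro eqv_sum eqv_right) (auto simp: N_D intro: V_A)
  finally show "V v * W v \<approx> W v" .
qed

lemma W_A:
  assumes "finite (N v)" "e \<in> N v"
  shows "W v * A e \<approx> A e" "B e * W v \<approx> B e"
proof -
  have e: "e \<in> arcs E" using assms by (simp add: N_D)
  have "W v * A e = (\<Sum>f\<in>N v. A f * (B f * A e))"
    unfolding live_sum_def by (simp add: sum_distrib_right mult.assoc)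
  also have "\<dots> \<approx> (\<Sum>f\<in>N v. A f * (if f = e then V (head E f) else 0))"
    by (intro eqv_sum eqv_left B_A) (auto simp: N_D e)
  also have "\<dots> = A e * V (head E e)"
    using assms by (simp add: if_distrib[of "\<lambda>x. _ * x"] sum.delta cong: if_cong)
  also have "\<dots> \<approx> A e" by (rule A_V[OF e])
  finally show "W v * A e \<approx> A e" .
  have "B e * W v = (\<Sum>f\<in>N v. (B e * A f) * B f)"
    unfolding live_sum_def by (simp add: sum_distrib_left mult.assoc)
  also have "\<dots> \<approx> (\<Sum>f\<in>N v. (if e = f then V (head E e) else 0) * B f)"
    by (intro eqv_sum eqv_right B_A) (auto simp: N_D e)
  also have "\<dots> = V (head E e) * B e"
    using assms by (simp add: if_distrib[of "\<lambda>x. x * _"] sum.delta cong: if_cong)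
  also have "\<dots> \<approx> B e" by (rule V_B[OF e])
  finally show "B e * W v \<approx> B e" .
qed

lemma W_W: "finite (N v) \<Longrightarrow> W v * W v \<approx> W v"
proof -
  assume f: "finite (N v)"
  have "W v * W v = (\<Sum>e\<in>N v. (W v * A e) * B e)"
    by (subst (2) live_sum_def) (simp add: sum_distrib_left mult.assoc)
  also have "\<dots> \<approx> (\<Sum>e\<in>N v. A e * B e)" by (intro eqv_sum eqv_right W_A f)
  finally show ?thesis by (simp add: live_sum_def)
qed

lemma q_simps: "v \<in> D \<Longrightarrow> q (Inl v) = W v" "v \<notin> D \<Longrightarrow> q (Inl v) = V v" "q (Inr v) = V v - W v"
  unfolding quot_vertex_def break_free_def by auto

lemma q_V:
  assumes "x \<in> verts F"
  shows "q x * V (base_of x) \<approx> q x" "V (base_of x) * q x \<approx> q x"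
proof -
  have VV: "V v * V v \<approx> V v" if "v \<in> verts E" for v using V_V[OF that that] by simp
  have "q x * V (base_of x) \<approx> q x \<and> V (base_of x) * q x \<approx> q x"
  proof (cases x)
    case (Inl v)
    then have v: "v \<in> verts E" using assms verts_F by auto
    show ?thesis using W_V[OF v] VV[OF v] Inl by (cases "v \<in> D") (simp_all add: q_simps del: Diff_iff)
  next
    case (Inr v)
    then have v: "v \<in> verts E" using assms verts_F breaking by auto
    show ?thesis using W_V[OF v] VV[OF v] Inr eqv_diff
      by (simp add: q_simps left_diff_distrib right_diff_distrib)
  qed
  then show "q x * V (base_of x) \<approx> q x" "V (base_of x) * q x \<approx> q x" by auto
qed

lemma q_same_base:
  assumes "x \<in> verts F" "y \<in> verts F" "base_of x = base_of y"
  shows "q x * q y \<approx> (if x = y then q x else 0)"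
proof -
  have D: "finite (N v)" "v \<in> verts E" if "v \<in> D" for v using that breaking by auto
  have VV: "V v * V v \<approx> V v" if "v \<in> verts E" for v using V_V[OF that that] by simp
  have comp: "W v * (V v - W v) \<approx> 0" "(V v - W v) * W v \<approx> 0" "(V v - W v) * (V v - W v) \<approx> V v - W v"
    if v: "v \<in> D" for v
  proof -
    have 1: "W v * (V v - W v) \<approx> W v - W v"
      unfolding right_diff_distrib by (intro eqv_diff W_V W_W D v)
    then show "W v * (V v - W v) \<approx> 0" by simp
    have 2: "(V v - W v) * W v \<approx> W v - W v"
      unfolding left_diff_distrib by (intro eqv_diff W_V W_W D v)
    then show "(V v - W v) * W v \<approx> 0" by simp
    have "(V v - W v) * (V v - W v) = (V v * V v - W v * V v) - (V v - W v) * W v"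
      by (simp add: algebra_simps)
    also have "\<dots> \<approx> (V v - W v) - (W v - W v)" by (intro eqv_diff VV W_V D v 2)
    finally show "(V v - W v) * (V v - W v) \<approx> V v - W v" by simp
  qed
  show ?thesis
  proof (cases "base_of x \<in> D")
    case True
    then show ?thesis using comp[OF True] W_W[OF D(1)[OF True]] assms(3)
      by (cases x; cases y) (auto simp: q_simps simp del: Diff_iff)
  next
    case False
    then obtain v where v: "x = Inl v" "y = Inl v" "v \<in> verts E"
      using assms by (cases x; cases y) (auto simp: verts_F)
    then show ?thesis using False VV by (simp add: q_simps del: Diff_iff)
  qed
qed

lemma q_q:
  assumes "x \<in> verts F" "y \<in> verts F"
  shows "q x * q y \<approx> (if x = y then q x else 0)"
proof (cases "base_of x = base_of y")
  case True
  then show ?thesis using q_same_base assms by blast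
next
  case False
  have v: "base_of x \<in> verts E" "base_of y \<in> verts E" using assms breaking by (auto simp: verts_F)
  have "q x * q y \<approx> (q x * V (base_of x)) * (V (base_of y) * q y)"
    by (intro eqv_mult eqv_sym[OF q_V(1)] eqv_sym[OF q_V(2)] assms)
  also have "\<dots> = q x * (V (base_of x) * V (base_of y)) * q y" by (simp add: mult.assoc)
  also have "\<dots> \<approx> q x * 0 * q y" using V_V[OF v] False by (intro eqv_mid) simp
  finally show ?thesis using False by auto
qed

lemma q_A:
  assumes "e \<in> arcs E" "head E e \<notin> H"
  shows "q (Inl (tail E e)) * A e \<approx> A e" "B e * q (Inl (tail E e)) \<approx> B e"
proof -
  have e: "e \<in> N (tail E e)" using assms by (simp add: N_D)
  have "q (Inl (tail E e)) * A e \<approx> A e \<and> B e * q (Inl (tail E e)) \<approx> B e"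
  proof (cases "tail E e \<in> D")
    case True
    then have "finite (N (tail E e))" using breaking by blast
    then show ?thesis using W_A[OF _ e] True by (simp add: q_simps del: Diff_iff)
  next
    case False
    then show ?thesis using V_A B_V assms by (simp add: q_simps del: Diff_iff)
  qed
  then show "q (Inl (tail E e)) * A e \<approx> A e" "B e * q (Inl (tail E e)) \<approx> B e" by auto
qed

lemma A_dead: "e \<in> arcs E \<Longrightarrow> head E e \<in> H \<Longrightarrow> A e \<in> J" "e \<in> arcs E \<Longrightarrow> head E e \<in> H \<Longrightarrow> B e \<in> J"
  using eqv_mem[OF A_V] eqv_mem[OF V_B] H_J idl_left[OF idl_J] idl_right[OF idl_J] by blast+

text \<open>Three reasons for one relation: by definition if \<open>u\<close> is a breaking vertex
  outside \<open>S\<close>, by the summation relation with the edges into \<open>H\<close> removed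
  if \<open>u\<close> is regular, and because \<open>J\<close> contains the breaking element if
  \<open>u\<close> is in \<open>S\<close>.\<close>

lemma q_regular:
  assumes "u \<in> verts E" "u \<notin> H" "finite (N u)" "N u \<noteq> {}"
  shows "q (Inl u) \<approx> W u"
proof (cases "u \<in> D")
  case True
  then show ?thesis by (simp add: q_simps del: Diff_iff)
next
  case False
  show ?thesis
  proof (cases "finite (out_arcs E u)")
    case True
    have "regular_vertex E u" unfolding regular_vertex_def using assms True by (auto simp: live_arcs_def)
    then have "V u \<approx> (\<Sum>e\<in>out_arcs E u. A e * B e)" by (rule V_regular)
    also have "\<dots> \<approx> (\<Sum>e\<in>out_arcs E u. if e \<in> N u then A e * B e else 0)"
    proof (intro eqv_sum)
      fix e assume e: "e \<in> out_arcs E u"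
      show "A e * B e \<approx> (if e \<in> N u then A e * B e else 0)"
        using A_dead(1)[of e] e idl_right[OF idl_J] by (auto simp: N_D eqv_0_iff)
    qed
    also have "\<dots> = W u"
      unfolding live_sum_def using True by (subst sum.inter_filter[symmetric]) (auto simp: live_arcs_def intro: sum.cong)
    finally show ?thesis using False by (simp add: q_simps del: Diff_iff)
  next
    case inf: False
    then have "u \<in> breaking_vertices E H"
      unfolding breaking_vertices_def infinite_emitter_def using assms by (auto simp: live_arcs_def)
    then have "u \<in> S" using False by blast
    then show ?thesis using S_J False by (simp add: q_simps del: Diff_iff)
  qed
qed

lemma out_arcs_F: "out_arcs F (Inl u) = Inl ` N u \<union> Inr ` {e \<in> N u. head E e \<in> D}"
  using breaking by (auto simp: arcs_F tail_F N_D)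

lemma out_arcs_F_Inr: "out_arcs F (Inr u) = {}"
  by (auto simp: arcs_F tail_F)

lemma quot_edge_ghost:
  assumes "f \<in> arcs F"
  shows "quot_edge E H S f * quot_ghost E H S f \<approx> A (base_of f) * q (head F f) * B (base_of f)"
proof -
  have "quot_edge E H S f * quot_ghost E H S f = A (base_of f) * (q (head F f) * q (head F f)) * B (base_of f)"
    unfolding quot_edge_def quot_ghost_def by (simp add: mult.assoc)
  also have "\<dots> \<approx> A (base_of f) * q (head F f) * B (base_of f)"
    using q_q[of "head F f" "head F f"] arcs_F_base(4)[OF assms] by (intro eqv_mid) simp
  finally show ?thesis .
qed

text \<open>For each edge into a vertex of \<open>D\<close> the summands of \<open>e\<close> and
  \<open>e'\<close> recombine, since the two idempotents at its range add up to the vertex.\<close>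

lemma regular_sum:
  assumes "regular_vertex F x"
  shows "q x \<approx> (\<Sum>f\<in>out_arcs F x. quot_edge E H S f * quot_ghost E H S f)"
proof -
  have fin: "finite (out_arcs F x)" "out_arcs F x \<noteq> {}" "x \<in> verts F"
    using assms unfolding regular_vertex_def by auto
  then obtain u where x: "x = Inl u" using out_arcs_F_Inr by (cases x) auto
  have N: "finite (N u)" "N u \<noteq> {}"
    using fin unfolding x out_arcs_F by (auto dest: finite_imageD)
  have u: "u \<in> verts E" "u \<notin> H" using fin(3) unfolding x verts_F by auto
  have "(\<Sum>f\<in>out_arcs F x. quot_edge E H S f * quot_ghost E H S f) \<approx>
     (\<Sum>f\<in>out_arcs F x. A (base_of f) * q (head F f) * B (base_of f))"
    by (intro eqv_sum quot_edge_ghost) auto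
  also have "\<dots> = (\<Sum>f\<in>Inl ` N u. A (base_of f) * q (head F f) * B (base_of f)) +
      (\<Sum>f\<in>Inr ` {e \<in> N u. head E e \<in> D}. A (base_of f) * q (head F f) * B (base_of f))"
    unfolding x out_arcs_F using N by (intro sum.union_disjoint) auto
  also have "(\<Sum>f\<in>Inl ` N u. A (base_of f) * q (head F f) * B (base_of f)) =
      (\<Sum>e\<in>N u. A e * q (Inl (head E e)) * B e)"
    by (subst sum.reindex) (auto simp: head_F)
  also have "(\<Sum>f\<in>Inr ` {e \<in> N u. head E e \<in> D}. A (base_of f) * q (head F f) * B (base_of f)) =
      (\<Sum>e\<in>{e \<in> N u. head E e \<in> D}. A e * q (Inr (head E e)) * B e)"
    by (subst sum.reindex) (auto simp: head_F)
  also have "\<dots> = (\<Sum>e\<in>N u. if head E e \<in> D then A e * q (Inr (head E e)) * B e else 0)"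
    using N(1) by (rule sum.inter_filter)
  also have "(\<Sum>e\<in>N u. A e * q (Inl (head E e)) * B e) + \<dots> =
     (\<Sum>e\<in>N u. A e * V (head E e) * B e)"
    unfolding sum.distrib[symmetric]
    by (rule sum.cong) (auto simp: q_simps algebra_simps simp del: Diff_iff)
  also have "\<dots> \<approx> W u" unfolding live_sum_def by (intro eqv_sum eqv_right A_V) (simp add: N_D)
  also have "\<dots> \<approx> q x" unfolding x using q_regular[OF u N] by (rule eqv_sym)
  finally show ?thesis by (rule eqv_sym)
qed

sublocale quot: ck_relations F J const q "quot_edge E H S" "quot_ghost E H S"
proof (intro ck_relations.intro ck_relations_axioms.intro)
  show "wf_digraph F" by (rule F_wf)
  show "ring_ideal J" by unfold_locales
  show "const (a + b) = const a + const b" for a b by (rule const_add)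
  show "const (a * b) = const a * const b" for a b by (rule const_mult)
  show "const 1 = 1" by (rule const_1)
  show "const a * x = x * const a" for a x by (rule const_central)
  show "q v * q v \<approx> q v" if "v \<in> verts F" for v using q_q[OF that that] by simp
  show "q v * q w \<approx> 0" if "v \<in> verts F" "w \<in> verts F" "v \<noteq> w" for v w
    using q_q[OF that(1,2)] that(3) by simp
  show "q v \<approx> (\<Sum>e\<in>out_arcs F v. quot_edge E H S e * quot_ghost E H S e)" if "regular_vertex F v" for v
    using regular_sum[OF that] .
  fix f assume f: "f \<in> arcs F"
  note b = arcs_F_base[OF f]
  have qq: "q (head F f) * q (head F f) \<approx> q (head F f)" using q_q[OF b(4) b(4)] by simp
  show "q (tail F f) * quot_edge E H S f \<approx> quot_edge E H S f"
    unfolding quot_edge_def tail_F mult.assoc[symmetric] by (intro eqv_right q_A b)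
  show "quot_edge E H S f * q (head F f) \<approx> quot_edge E H S f"
    unfolding quot_edge_def mult.assoc by (intro eqv_left qq)
  show "q (head F f) * quot_ghost E H S f \<approx> quot_ghost E H S f"
    unfolding quot_ghost_def mult.assoc[symmetric] by (intro eqv_right qq)
  show "quot_ghost E H S f * q (tail F f) \<approx> quot_ghost E H S f"
    unfolding quot_ghost_def tail_F mult.assoc by (intro eqv_left q_A b)
  \<comment> \<open>\<open>e\<close> and \<open>e'\<close> have the same underlying edge and are
    told apart only by the orthogonality of the idempotents at their ranges.\<close>
  have t_s: "quot_ghost E H S f * quot_edge E H S g \<approx> (if f = g then q (head F f) else 0)" if g: "g \<in> arcs F" for g
  proof -
    note c = arcs_F_base[OF g]
    have "quot_ghost E H S f * quot_edge E H S g = q (head F f) * (B (base_of f) * A (base_of g)) * q (head F g)"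
      unfolding quot_ghost_def quot_edge_def by (simp add: mult.assoc)
    also have "\<dots> \<approx> q (head F f) * (if base_of f = base_of g then V (head E (base_of f)) else 0) * q (head F g)"
      by (intro eqv_mid B_A b c)
    also have "\<dots> \<approx> (if base_of f = base_of g then q (head F f) * q (head F g) else 0)"
    proof (cases "base_of f = base_of g")
      case True
      show ?thesis unfolding if_P[OF True] using eqv_right[OF q_V(1)[OF b(4)]] unfolding b(3) .
    next
      case False
      show ?thesis unfolding if_not_P[OF False] by simp
    qed
    also have "\<dots> \<approx> (if f = g then q (head F f) else 0)"
    proof (cases "base_of f = base_of g")
      case True
      then have "f = g \<longleftrightarrow> head F f = head F g" by (cases f; cases g) (auto simp: head_F)
      then show ?thesis using q_q[OF b(4) c(4)] True by simp
    qed auto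
    finally show ?thesis .
  qed
  show "quot_ghost E H S f * quot_edge E H S f \<approx> q (head F f)" using t_s[OF f] by simp
  show "quot_ghost E H S f * quot_edge E H S g \<approx> 0" if "g \<in> arcs F" "f \<noteq> g" for g
    using t_s[OF that(1)] that(2) by simp
qed

text \<open>Modulo \<open>J\<close>, a generator vanishes, or is a member of the family, or splits
  into its two copies.\<close>

lemma spanned_gen: "quot.spanned (gen g) \<and> (\<forall>x. quot.spanned x \<longrightarrow> quot.spanned (gen g * x))"
proof (cases "gen g \<in> J")
  case True
  then show ?thesis using quot.spanned_J idl_right[OF idl_J] by blast
next
  case False
  then have "g \<in> lpa_gens E" using outside by blast
  then consider v where "g = Vtx v" "v \<in> verts E" | e where "g = Edg e" "e \<in> arcs E"
    | e where "g = Ghost e" "e \<in> arcs E" unfolding lpa_gens_def by blast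
  then show ?thesis
  proof cases
    case 1
    then have "v \<notin> H" using False H_J by blast
    then have l: "Inl v \<in> verts F" using 1 by (simp add: verts_F)
    show ?thesis
    proof (cases "v \<in> D")
      case True
      then have r: "Inr v \<in> verts F" by (simp add: verts_F)
      have "gen g = q (Inl v) + q (Inr v)" using 1 True by (simp add: q_simps del: Diff_iff)
      then show ?thesis using l r by (auto simp: distrib_right intro!: quot.spanned_add quot.spanned_p quot.spanned_p_mult)
    next
      case False
      then have "gen g = q (Inl v)" using 1 by (simp add: q_simps del: Diff_iff)
      then show ?thesis using l by (auto intro!: quot.spanned_p quot.spanned_p_mult)
    qed
  next
    case 2
    then have h: "head E e \<notin> H" using False A_dead by blast
    then have l: "Inl e \<in> arcs F" using 2 by (simp add: arcs_F)
    show ?thesis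
    proof (cases "head E e \<in> D")
      case True
      then have r: "Inr e \<in> arcs F" using 2 by (simp add: arcs_F)
      have "quot_edge E H S (Inl e) + quot_edge E H S (Inr e) = A e * V (head E e)"
        unfolding quot_edge_def using True by (simp add: head_F q_simps algebra_simps del: Diff_iff)
      then have eq: "gen g \<approx> quot_edge E H S (Inl e) + quot_edge E H S (Inr e)"
        using A_V 2 eqv_sym by simp
      have "quot.spanned (quot_edge E H S (Inl e) + quot_edge E H S (Inr e))"
        by (intro quot.spanned_add quot.spanned_s l r)
      moreover have "quot.spanned ((quot_edge E H S (Inl e) + quot_edge E H S (Inr e)) * x)" if "quot.spanned x" for x
        unfolding distrib_right by (intro quot.spanned_add quot.spanned_s_mult l r that)
      ultimately show ?thesis using quot.spanned_cong[OF eq] quot.spanned_cong[OF eqv_right[OF eq]] by blast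
    next
      case nD: False
      have "quot_edge E H S (Inl e) = A e * V (head E e)"
        unfolding quot_edge_def using nD by (simp add: head_F q_simps del: Diff_iff)
      then have eq: "gen g \<approx> quot_edge E H S (Inl e)" using A_V 2 eqv_sym by simp
      then show ?thesis using quot.spanned_cong[OF eq quot.spanned_s[OF l]]
        quot.spanned_cong[OF eqv_right[OF eq] quot.spanned_s_mult[OF l]] by blast
    qed
  next
    case 3
    then have h: "head E e \<notin> H" using False A_dead by blast
    then have l: "Inl e \<in> arcs F" using 3 by (simp add: arcs_F)
    show ?thesis
    proof (cases "head E e \<in> D")
      case True
      then have r: "Inr e \<in> arcs F" using 3 by (simp add: arcs_F)
      have "quot_ghost E H S (Inl e) + quot_ghost E H S (Inr e) = V (head E e) * B e"
        unfolding quot_ghost_def using True by (simp add: head_F q_simps algebra_simps del: Diff_iff)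
      then have eq: "gen g \<approx> quot_ghost E H S (Inl e) + quot_ghost E H S (Inr e)"
        using V_B 3 eqv_sym by simp
      have "quot.spanned (quot_ghost E H S (Inl e) + quot_ghost E H S (Inr e))"
        by (intro quot.spanned_add quot.spanned_t l r)
      moreover have "quot.spanned ((quot_ghost E H S (Inl e) + quot_ghost E H S (Inr e)) * x)" if "quot.spanned x" for x
        unfolding distrib_right by (intro quot.spanned_add quot.spanned_t_mult l r that)
      ultimately show ?thesis using quot.spanned_cong[OF eq] quot.spanned_cong[OF eqv_right[OF eq]] by blast
    next
      case nD: False
      have "quot_ghost E H S (Inl e) = V (head E e) * B e"
        unfolding quot_ghost_def using nD by (simp add: head_F q_simps del: Diff_iff)
      then have eq: "gen g \<approx> quot_ghost E H S (Inl e)" using V_B 3 eqv_sym by simp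
      then show ?thesis using quot.spanned_cong[OF eq quot.spanned_t[OF l]]
        quot.spanned_cong[OF eqv_right[OF eq] quot.spanned_t_mult[OF l]] by blast
    qed
  qed
qed

lemma spanned_aug: "x \<in> aug \<Longrightarrow> quot.spanned x"
  by (induction x rule: aug_induct)
    (use quot.spanned_0 quot.spanned_add quot.spanned_const spanned_gen in blast)+

lemma q_aug: "q x \<in> aug"
proof -
  have "W v \<in> aug" for v
    unfolding live_sum_def by (intro idl_sum[OF idl_aug] idl_left[OF idl_aug] gen_aug)
  then show ?thesis
    unfolding quot_vertex_def break_free_def by (auto split: sum.split intro!: gen_aug idl_diff[OF idl_aug])
qed

lemma quotient_ck_family:
  assumes "J \<subseteq> aug" "\<And>x. x \<in> verts F \<Longrightarrow> q x \<notin> J"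
  shows "ck_family F J const aug q (quot_edge E H S) (quot_ghost E H S)"
  using assms by unfold_locales (auto intro: idl_aug q_aug spanned_aug)

end

section \<open>The admissible pair of an ideal\<close>

context lpa_ideal
begin

definition HJ :: "'v set" where "HJ = {v \<in> verts E. V v \<in> J}"
definition SJ :: "'v set" where "SJ = {v \<in> breaking_vertices E HJ. break_free E HJ v \<in> J}"

lemma HJ_admissible: "admissible_pair E HJ SJ"
proof -
  have "hereditary E HJ"
  proof (rule hereditary_arcI)
    show "HJ \<subseteq> verts E" unfolding HJ_def by blast
    fix e assume e: "e \<in> arcs E" "tail E e \<in> HJ"
    then have "V (tail E e) * A e \<in> J" using idl_right[OF idl_J] unfolding HJ_def by blast
    then have "A e \<in> J" using eqv_mem[OF V_A[OF e(1)]] by blast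
    then have "B e * A e \<in> J" using idl_left[OF idl_J] by blast
    then have "V (head E e) \<in> J" using eqv_mem[OF B_A[OF e(1) e(1)]] by simp
    then show "head E e \<in> HJ" using e unfolding HJ_def by simp
  qed
  moreover have "saturated E HJ"
    unfolding saturated_def
  proof (intro conjI allI impI)
    show "HJ \<subseteq> verts E" unfolding HJ_def by blast
    fix v assume v: "regular_vertex E v \<and> head E ` out_arcs E v \<subseteq> HJ"
    have "A e * B e \<in> J" if e: "e \<in> out_arcs E v" for e
    proof -
      have "head E e \<in> HJ" using v e by blast
      then have "A e * V (head E e) \<in> J" using idl_left[OF idl_J] unfolding HJ_def by blast
      then have "A e \<in> J" using eqv_mem[OF A_V] e by simp
      then show ?thesis using idl_right[OF idl_J] by blast
    qed
    then have "(\<Sum>e\<in>out_arcs E v. A e * B e) \<in> J" by (rule idl_sum[OF idl_J])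
    then have "V v \<in> J" using eqv_mem[OF V_regular] v by blast
    then show "v \<in> HJ" using v unfolding HJ_def regular_vertex_def by blast
  qed
  ultimately show ?thesis unfolding admissible_pair_def SJ_def by blast
qed

lemma quotient_family_HJ: "quotient_family E J HJ SJ"
proof
  show "admissible_pair E HJ SJ" by (rule HJ_admissible)
  show "admissible_relations E HJ SJ \<subseteq> J"
    unfolding admissible_relations_def using base by (auto simp: HJ_def SJ_def)
qed

text \<open>Only the case of \<open>live_sum\<close> at a breaking vertex is not built into
  \<open>HJ\<close> and \<open>SJ\<close>: if it were in \<open>J\<close>, so would be a live edge
  \<open>e\<close>, which it fixes from the left, and with \<open>e\<close> its range.\<close>

lemma quot_vertex_notin:
  assumes "x \<in> verts (quotient_graph E HJ SJ)"
  shows "quot_vertex E HJ SJ x \<notin> J"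
proof -
  interpret Q: quotient_family E J HJ SJ by (rule quotient_family_HJ)
  show ?thesis
  proof (cases x)
    case (Inr v)
    then show ?thesis using assms unfolding Q.verts_F by (auto simp: quot_vertex_def SJ_def)
  next
    case (Inl v)
    then have v: "v \<in> verts E" "v \<notin> HJ" using assms unfolding Q.verts_F by auto
    show ?thesis
    proof (cases "v \<in> Q.D")
      case False
      show ?thesis unfolding Inl Q.q_simps(2)[OF False] using v by (simp add: HJ_def)
    next
      case True
      then obtain e where e: "e \<in> Q.N v" "finite (Q.N v)" using Q.breaking by blast
      have "live_sum E HJ v \<notin> J"
      proof
        assume "live_sum E HJ v \<in> J"
        then have "live_sum E HJ v * A e \<in> J" by (rule idl_right[OF idl_J])
        then have "A e \<in> J" using eqv_mem[OF Q.W_A(1)[OF e(2,1)]] by blast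
        then have "B e * A e \<in> J" by (rule idl_left[OF idl_J])
        moreover have a: "e \<in> arcs E" "head E e \<notin> HJ" using e(1) by (auto simp: Q.N_D)
        ultimately have "V (head E e) \<in> J" using eqv_mem[OF B_A[OF a(1) a(1)]] by simp
        then show False using a unfolding HJ_def by simp
      qed
      then show ?thesis using True unfolding Inl by (simp add: Q.q_simps del: Diff_iff)
    qed
  qed
qed

end

section \<open>The boundary path representation\<close>

text \<open>
  A point is a vertex \<open>u\<close> of the quotient graph with a finite or infinite path starting at \<open>u\<close>,
  coded as \<open>\<xi> :: nat \<Rightarrow> _ option\<close>; the path avoids \<open>Y\<close> and may stop only at vertices that are not regular,
  and the values of \<open>\<xi>\<close> after the first \<open>None\<close> are irrelevant.
\<close>
coinductive boundary_path :: "('w, 'f) pre_digraph \<Rightarrow> 'w set \<Rightarrow> 'w \<Rightarrow> (nat \<Rightarrow> 'f option) \<Rightarrow> bool"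
  for F Y where
  stop: "\<lbrakk>u \<in> verts F; u \<notin> Y; \<not> regular_vertex F u; \<xi> 0 = None\<rbrakk> \<Longrightarrow> boundary_path F Y u \<xi>"
| step: "\<lbrakk>f \<in> arcs F; tail F f = u; u \<in> verts F; u \<notin> Y; \<xi> 0 = Some f; boundary_path F Y (head F f) (\<lambda>n. \<xi> (Suc n))\<rbrakk>
    \<Longrightarrow> boundary_path F Y u \<xi>"

type_synonym ('v, 'e, 'k) path_function = "('v + 'v) \<Rightarrow> (nat \<Rightarrow> ('e + 'e) option) \<Rightarrow> 'k"

text \<open>Arbitrary functions on points are acted on: an edge evaluates at the shifted path, its
  ghost at the path with the edge put in front, and values at pairs that are not points become 0.
  The ghost of \<open>e\<close> uses \<open>e\<close> or \<open>e'\<close> according to the vertex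
  where the path starts. Symbols foreign to \<open>E\<close> act as 0.\<close>

definition gen_action :: "('v, 'e) pre_digraph \<Rightarrow> 'v set \<Rightarrow> 'v set \<Rightarrow> ('v + 'v) set \<Rightarrow>
    ('v, 'e) lpa_gen \<Rightarrow> ('v, 'e, 'k::field) path_function \<Rightarrow> ('v, 'e, 'k) path_function" where
  "gen_action E H S Y g \<phi> u \<xi> = (let F = quotient_graph E H S in
     if boundary_path F Y u \<xi> \<and> g \<in> lpa_gens E then
       (case g of
         Vtx v \<Rightarrow> if case_sum id id u = v then \<phi> u \<xi> else 0
       | Edg e \<Rightarrow> (case \<xi> 0 of None \<Rightarrow> 0
           | Some f \<Rightarrow> if case_sum id id f = e then \<phi> (head F f) (\<lambda>n. \<xi> (Suc n)) else 0)
       | Ghost e \<Rightarrow> if case_sum id id u = head E e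
           then \<phi> (Inl (tail E e)) (case_nat (Some (case u of Inl _ \<Rightarrow> Inl e | Inr _ \<Rightarrow> Inr e)) \<xi>) else 0)
     else 0)"

definition word_action :: "('v, 'e) pre_digraph \<Rightarrow> 'v set \<Rightarrow> 'v set \<Rightarrow> ('v + 'v) set \<Rightarrow>
    ('v, 'e) lpa_gen list \<Rightarrow> ('v, 'e, 'k::field) path_function \<Rightarrow> ('v, 'e, 'k) path_function" where
  "word_action E H S Y w = foldr (gen_action E H S Y) w"

definition action :: "('v, 'e) pre_digraph \<Rightarrow> 'v set \<Rightarrow> 'v set \<Rightarrow> ('v + 'v) set \<Rightarrow>
    ('v, 'e, 'k::field) lpa_free \<Rightarrow> ('v, 'e, 'k) path_function \<Rightarrow> ('v, 'e, 'k) path_function" where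
  "action E H S Y x \<phi> u \<xi> =
     (\<Sum>w\<in>Poly_Mapping.keys x. Poly_Mapping.lookup x w * word_action E H S Y w \<phi> u \<xi>)"

text \<open>The vertices in \<open>Y\<close> are to act as 0. That \<open>Y\<close> is hereditary
  keeps paths off \<open>Y\<close> when an edge is put in front; that it is saturated lets a path
  continue off \<open>Y\<close> at a regular vertex outside \<open>Y\<close>. \<open>ty\<close>
  fixes the field.\<close>

locale boundary_action = wf_digraph E for E :: "('v, 'e) pre_digraph" +
  fixes H S :: "'v set" and Y :: "('v + 'v) set" and ty :: "'k::field itself"
  assumes adm: "admissible_pair E H S"
    and Y_her: "hereditary (quotient_graph E H S) Y" and Y_sat: "saturated (quotient_graph E H S) Y"
begin

sublocale Q: quotient_family E "UNIV :: ('v, 'e, 'k) lpa_free set" H S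
  by unfold_locales (auto simp: idl_UNIV adm)

abbreviation gact :: "('v, 'e) lpa_gen \<Rightarrow> ('v, 'e, 'k) path_function \<Rightarrow> ('v, 'e, 'k) path_function" where
  "gact \<equiv> gen_action E H S Y"
abbreviation wact :: "('v, 'e) lpa_gen list \<Rightarrow> ('v, 'e, 'k) path_function \<Rightarrow> ('v, 'e, 'k) path_function" where
  "wact \<equiv> word_action E H S Y"
abbreviation act :: "('v, 'e, 'k) lpa_free \<Rightarrow> ('v, 'e, 'k) path_function \<Rightarrow> ('v, 'e, 'k) path_function" where
  "act \<equiv> action E H S Y"
abbreviation valid where "valid \<equiv> boundary_path Q.F Y"

lemma gact_add: "gact g (\<lambda>u \<xi>. \<phi> u \<xi> + \<psi> u \<xi>) = (\<lambda>u \<xi>. gact g \<phi> u \<xi> + gact g \<psi> u \<xi>)"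
  by (intro ext) (auto simp: gen_action_def Let_def split: lpa_gen.split option.split)

lemma gact_scale: "gact g (\<lambda>u \<xi>. k * \<phi> u \<xi>) = (\<lambda>u \<xi>. k * gact g \<phi> u \<xi>)"
  by (intro ext) (auto simp: gen_action_def Let_def split: lpa_gen.split option.split)

lemma wact_add: "wact w (\<lambda>u \<xi>. \<phi> u \<xi> + \<psi> u \<xi>) = (\<lambda>u \<xi>. wact w \<phi> u \<xi> + wact w \<psi> u \<xi>)"
  unfolding word_action_def by (induction w) (simp_all add: gact_add)

lemma wact_scale: "wact w (\<lambda>u \<xi>. k * \<phi> u \<xi>) = (\<lambda>u \<xi>. k * wact w \<phi> u \<xi>)"
  unfolding word_action_def by (induction w) (simp_all add: gact_scale)

lemma wact_zero: "wact w (\<lambda>u \<xi>. 0) = (\<lambda>u \<xi>. 0)"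
  using wact_scale[of w 0 "\<lambda>u \<xi>. 0"] by simp

lemma act_superset:
  assumes "finite W" "Poly_Mapping.keys x \<subseteq> W"
  shows "act x \<phi> u \<xi> = (\<Sum>w\<in>W. Poly_Mapping.lookup x w * wact w \<phi> u \<xi>)"
  unfolding action_def using assms
  by (intro sum.mono_neutral_left) (auto simp: in_keys_iff)

lemma act_add: "act (x + y) \<phi> u \<xi> = act x \<phi> u \<xi> + act y \<phi> u \<xi>"
proof -
  let ?W = "Poly_Mapping.keys x \<union> Poly_Mapping.keys y"
  have "Poly_Mapping.keys (x + y) \<subseteq> ?W" by (rule keys_add)
  then show ?thesis
    using act_superset[of ?W x] act_superset[of ?W y] act_superset[of ?W "x + y"]
    by (simp add: lookup_add distrib_right sum.distrib)
qed

lemma act_zero: "act 0 \<phi> u \<xi> = 0"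
  by (simp add: action_def)

lemma act_single: "act (Poly_Mapping.single w k) \<phi> u \<xi> = k * wact w \<phi> u \<xi>"
  using act_superset[of "{w}" "Poly_Mapping.single w k"] by simp

lemma act_mult: "act (x * y) \<phi> = act x (act y \<phi>)"
proof (induction x rule: poly_mapping_single_induct)
  case (single w k)
  have "wact w (act y \<phi>) u \<xi> * k = act (Poly_Mapping.single w k * y) \<phi> u \<xi>" for u \<xi>
  proof (induction y rule: poly_mapping_single_induct)
    case zero
    have "act 0 \<phi> = (\<lambda>u \<xi>. 0)" by (intro ext) (rule act_zero)
    then show ?case by (simp add: wact_zero act_zero)
  next
    case (single w' k')
    have "act (Poly_Mapping.single w' k') \<phi> = (\<lambda>u \<xi>. k' * wact w' \<phi> u \<xi>)"
      by (intro ext) (rule act_single)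
    moreover have "wact w (wact w' \<phi>) = wact (w + w') \<phi>"
      unfolding word_action_def plus_list_def by simp
    moreover have "(\<lambda>u \<xi>. wact w' \<phi> u \<xi>) = wact w' \<phi>" by simp
    ultimately show ?case by (simp only: wact_scale mult_single act_single) simp
  next
    case (add y z)
    have "act (y + z) \<phi> = (\<lambda>u \<xi>. act y \<phi> u \<xi> + act z \<phi> u \<xi>)" by (intro ext) (rule act_add)
    then show ?case using add by (simp add: wact_add act_add distrib_left distrib_right)
  qed
  then show ?case by (intro ext) (simp add: act_single mult.commute)
qed (intro ext, simp add: act_zero, intro ext, simp add: distrib_right act_add)

lemma act_diff: "act (x - y) \<phi> u \<xi> = act x \<phi> u \<xi> - act y \<phi> u \<xi>"
  using act_add[of "x - y" y \<phi> u \<xi>] by simp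

lemma act_sum: "act (sum f X) \<phi> u \<xi> = (\<Sum>i\<in>X. act (f i) \<phi> u \<xi>)"
  by (induction X rule: infinite_finite_induct) (simp_all add: act_zero act_add)

lemma act_gen: "act (gen g) \<phi> = gact g \<phi>"
  unfolding gen_def by (intro ext) (simp add: act_single word_action_def)

definition ann :: "('v, 'e, 'k) lpa_free set" where
  "ann = {x. \<forall>\<phi> u \<xi>. act x \<phi> u \<xi> = 0}"

lemma idl_ann: "idl ann"
proof (rule idlI)
  show "0 \<in> ann" unfolding ann_def by (simp add: act_zero)
  show "x + y \<in> ann" if "x \<in> ann" "y \<in> ann" for x y
    using that unfolding ann_def by (simp add: act_add)
  show "x * a \<in> ann" if "x \<in> ann" for x a
    using that unfolding ann_def by (simp add: act_mult)
  show "a * x \<in> ann" if "x \<in> ann" for x a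
  proof -
    have "act x \<phi> = (\<lambda>u \<xi>. 0)" for \<phi> using that unfolding ann_def by (intro ext) simp
    then have "act (a * x) \<phi> u \<xi> = 0" for \<phi> u \<xi>
      by (simp add: act_mult action_def[of _ _ _ _ a] wact_zero)
    then show ?thesis unfolding ann_def by simp
  qed
qed

lemma valid_verts: "valid u \<xi> \<Longrightarrow> u \<in> verts Q.F \<and> u \<notin> Y"
  by (erule boundary_path.cases) auto

lemma valid_None: "valid u \<xi> \<Longrightarrow> \<xi> 0 = None \<Longrightarrow> \<not> regular_vertex Q.F u"
  by (erule boundary_path.cases) auto

lemma valid_Some: "valid u \<xi> \<Longrightarrow> \<xi> 0 = Some f \<Longrightarrow>
    f \<in> arcs Q.F \<and> u = Inl (tail E (Q.base_of f)) \<and> valid (head Q.F f) (\<lambda>n. \<xi> (Suc n))"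
  by (erule boundary_path.cases) (auto simp: Q.tail_F)

lemma valid_prepend:
  assumes "f \<in> arcs Q.F" "valid (head Q.F f) \<xi>"
  shows "valid (Inl (tail E (Q.base_of f))) (case_nat (Some f) \<xi>)"
proof (rule boundary_path.step[of f])
  show "Inl (tail E (Q.base_of f)) \<in> verts Q.F" using Q.quot.tail_in_verts[OF assms(1)] by (simp add: Q.tail_F)
  show "Inl (tail E (Q.base_of f)) \<notin> Y"
    using Q.quot.hereditary_arcD[OF Y_her assms(1)] valid_verts[OF assms(2)] by (auto simp: Q.tail_F)
qed (use assms in \<open>simp_all add: Q.tail_F\<close>)

lemma gact_V: "gact (Vtx v) \<phi> u \<xi> = (if valid u \<xi> \<and> v \<in> verts E \<and> Q.base_of u = v then \<phi> u \<xi> else 0)"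
  by (auto simp: gen_action_def Let_def lpa_gens_def)

lemma gact_A: "gact (Edg e) \<phi> u \<xi> = (case \<xi> 0 of None \<Rightarrow> 0
    | Some f \<Rightarrow> if valid u \<xi> \<and> Q.base_of f = e then \<phi> (head Q.F f) (\<lambda>n. \<xi> (Suc n)) else 0)"
  using Q.arcs_F_base(1) valid_Some
  by (auto simp: gen_action_def Let_def lpa_gens_def split: option.split)

definition lift_arc :: "'e \<Rightarrow> 'v + 'v \<Rightarrow> 'e + 'e" where
  "lift_arc e u = (case u of Inl _ \<Rightarrow> Inl e | Inr _ \<Rightarrow> Inr e)"

lemma lift_arc:
  assumes "valid u \<xi>" "e \<in> arcs E" "Q.base_of u = head E e"
  shows "lift_arc e u \<in> arcs Q.F" "Q.base_of (lift_arc e u) = e" "head Q.F (lift_arc e u) = u"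
    "valid (Inl (tail E e)) (case_nat (Some (lift_arc e u)) \<xi>)"
proof -
  show 1: "lift_arc e u \<in> arcs Q.F" "Q.base_of (lift_arc e u) = e" "head Q.F (lift_arc e u) = u"
    using assms valid_verts[OF assms(1)]
    by (cases u; auto simp: lift_arc_def Q.verts_F Q.arcs_F Q.head_F)+
  show "valid (Inl (tail E e)) (case_nat (Some (lift_arc e u)) \<xi>)"
    using valid_prepend[OF 1(1), of \<xi>] 1 assms(1) by simp
qed

lemma lift_arc_head: "f \<in> arcs Q.F \<Longrightarrow> lift_arc (Q.base_of f) (head Q.F f) = f"
  by (cases f) (auto simp: lift_arc_def Q.head_F)

lemma gact_B: "gact (Ghost e) \<phi> u \<xi> = (if valid u \<xi> \<and> e \<in> arcs E \<and> Q.base_of u = head E e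
    then \<phi> (Inl (tail E e)) (case_nat (Some (lift_arc e u)) \<xi>) else 0)"
  by (auto simp: gen_action_def Let_def lpa_gens_def lift_arc_def)

lemma act_AB:
  assumes "e \<in> arcs E"
  shows "act (gen (Edg e) * gen (Ghost e)) \<phi> u \<xi> =
    (if valid u \<xi> \<and> (\<exists>f. \<xi> 0 = Some f \<and> Q.base_of f = e) then \<phi> u \<xi> else 0)"
proof (cases "valid u \<xi> \<and> (\<exists>f. \<xi> 0 = Some f \<and> Q.base_of f = e)")
  case False
  then show ?thesis by (auto simp: act_mult act_gen gact_A split: option.split)
next
  case True
  then obtain f where f: "\<xi> 0 = Some f" "Q.base_of f = e" "valid u \<xi>" by blast
  note s = valid_Some[OF f(3,1)]
  have eq: "case_nat (Some f) (\<lambda>n. \<xi> (Suc n)) = \<xi>" using f(1) by (auto simp: fun_eq_iff split: nat.split)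
  show ?thesis using True f s lift_arc_head[of f] Q.arcs_F_base(3)[of f] assms eq
    by (simp add: act_mult act_gen gact_A gact_B)
qed

lemma act_live_sum:
  assumes "finite (Q.N v)"
  shows "act (live_sum E H v) \<phi> u \<xi> = (if valid u \<xi> \<and> u = Inl v \<and> \<xi> 0 \<noteq> None then \<phi> u \<xi> else 0)"
proof -
  have "act (live_sum E H v) \<phi> u \<xi> =
     (\<Sum>e\<in>Q.N v. if valid u \<xi> \<and> (\<exists>f. \<xi> 0 = Some f \<and> Q.base_of f = e) then \<phi> u \<xi> else 0)"
    unfolding live_sum_def act_sum by (rule sum.cong) (auto simp: Q.N_D act_AB)
  also have "\<dots> = (if valid u \<xi> \<and> u = Inl v \<and> \<xi> 0 \<noteq> None then \<phi> u \<xi> else 0)"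
  proof (cases "valid u \<xi> \<and> \<xi> 0 \<noteq> None")
    case True
    then obtain f where f: "\<xi> 0 = Some f" "valid u \<xi>" by auto
    note s = valid_Some[OF f(2,1)]
    have "(\<Sum>e\<in>Q.N v. if valid u \<xi> \<and> (\<exists>f. \<xi> 0 = Some f \<and> Q.base_of f = e) then \<phi> u \<xi> else 0) =
       (\<Sum>e\<in>Q.N v. if e = Q.base_of f then \<phi> u \<xi> else 0)"
      using f by (intro sum.cong) auto
    also have "\<dots> = (if Q.base_of f \<in> Q.N v then \<phi> u \<xi> else 0)" using assms by simp
    finally show ?thesis using s f Q.arcs_F_base(1,2)[of f] by (auto simp: Q.N_D)
  qed auto
  finally show ?thesis .
qed

lemma regular_F: "v \<in> verts E \<Longrightarrow> v \<notin> H \<Longrightarrow> finite (Q.N v) \<Longrightarrow> Q.N v \<noteq> {} \<Longrightarrow> regular_vertex Q.F (Inl v)"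
  unfolding regular_vertex_def Q.out_arcs_F by (auto simp: Q.verts_F)

text \<open>Each vertex acts by restriction to the points based at it. For \<open>v\<close> in
  \<open>D\<close>, \<open>Inl v\<close> is regular in the quotient graph, so no path stops there;
  hence the live edges account for all points at \<open>Inl v\<close>, and the breaking element is
  left with those at \<open>Inr v\<close>.\<close>

lemma act_quot_vertex:
  assumes x: "x \<in> verts Q.F"
  shows "act (quot_vertex E H S x) \<phi> u \<xi> = (if valid u \<xi> \<and> u = x then \<phi> u \<xi> else 0)"
proof (cases x)
  case (Inl v)
  then have v: "v \<in> verts E" "v \<notin> H" using x by (auto simp: Q.verts_F)
  show ?thesis
  proof (cases "v \<in> Q.D")
    case True
    then have N: "finite (Q.N v)" "Q.N v \<noteq> {}" using Q.breaking by blast+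
    have "\<xi> 0 \<noteq> None" if "valid (Inl v) \<xi>" using valid_None[OF that] regular_F[OF v N] by blast
    then show ?thesis unfolding Inl Q.q_simps(1)[OF True] act_live_sum[OF N(1)] by auto
  next
    case False
    have "valid u \<xi> \<and> Q.base_of u = v \<longleftrightarrow> valid u \<xi> \<and> u = Inl v"
      using valid_verts[of u \<xi>] False by (cases u) (auto simp: Q.verts_F)
    then show ?thesis unfolding Inl Q.q_simps(2)[OF False] act_gen gact_V using v(1) by simp
  qed
next
  case (Inr v)
  then have v: "v \<in> Q.D" using x by (auto simp: Q.verts_F)
  then have N: "v \<in> verts E" "v \<notin> H" "finite (Q.N v)" "Q.N v \<noteq> {}" using Q.breaking by blast+
  have ne: "\<xi> 0 \<noteq> None" if "valid (Inl v) \<xi>" using valid_None[OF that] regular_F[OF N] by blast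
  have eq: "act (quot_vertex E H S x) \<phi> u \<xi> = (if valid u \<xi> \<and> Q.base_of u = v then \<phi> u \<xi> else 0) -
      (if valid u \<xi> \<and> u = Inl v \<and> \<xi> 0 \<noteq> None then \<phi> u \<xi> else 0)"
    unfolding Inr Q.q_simps(3) act_diff act_gen gact_V act_live_sum[OF N(3)] using N(1) by simp
  show ?thesis
  proof (cases u)
    case (Inl u')
    then show ?thesis using ne Inr unfolding eq by (cases "u' = v") auto
  next
    case (Inr u')
    then show ?thesis unfolding eq using \<open>x = Inr v\<close> by simp
  qed
qed

text \<open>Two relations need more than a direct check: summation at a regular vertex, and the
  breaking element at \<open>v\<close> in \<open>S\<close>. In both cases all points over
  \<open>v\<close> sit at \<open>Inl v\<close>, which is then regular in the quotient graph, so that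
  their paths begin with a live edge.\<close>

lemma relations_ann: "admissible_relations E H S \<subseteq> ann"
proof -
  have VV: "act (gen (Vtx v) * gen (Vtx w) - (if v = w then gen (Vtx v) else 0)) \<phi> u \<xi> = 0"
    if "v \<in> verts E" "w \<in> verts E" for v w \<phi> u \<xi>
    using that by (auto simp: act_diff act_mult act_gen gact_V act_zero)
  have VA: "act (gen (Vtx (tail E e)) * gen (Edg e) - gen (Edg e)) \<phi> u \<xi> = 0" if "e \<in> arcs E" for e \<phi> u \<xi>
    using that valid_Some[of u \<xi>] by (auto simp: act_diff act_mult act_gen gact_V gact_A split: option.split)
  have AV: "act (gen (Edg e) * gen (Vtx (head E e)) - gen (Edg e)) \<phi> u \<xi> = 0" if "e \<in> arcs E" for e \<phi> u \<xi>
    using that valid_Some[of u \<xi>] Q.arcs_F_base(3)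
    by (auto simp: act_diff act_mult act_gen gact_V gact_A split: option.split)
  have VB: "act (gen (Vtx (head E e)) * gen (Ghost e) - gen (Ghost e)) \<phi> u \<xi> = 0" if "e \<in> arcs E" for e \<phi> u \<xi>
    using that by (auto simp: act_diff act_mult act_gen gact_V gact_B)
  have BV: "act (gen (Ghost e) * gen (Vtx (tail E e)) - gen (Ghost e)) \<phi> u \<xi> = 0" if "e \<in> arcs E" for e \<phi> u \<xi>
    using that lift_arc(4)[of u \<xi> e] by (auto simp: act_diff act_mult act_gen gact_V gact_B)
  have BA: "act (gen (Ghost e) * gen (Edg f) - (if e = f then gen (Vtx (head E e)) else 0)) \<phi> u \<xi> = 0"
    if "e \<in> arcs E" "f \<in> arcs E" for e f \<phi> u \<xi>
    using that lift_arc[of u \<xi> e] by (auto simp: act_diff act_mult act_gen gact_V gact_B gact_A act_zero)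
  have REG: "act (gen (Vtx v) - (\<Sum>e\<in>out_arcs E v. gen (Edg e) * gen (Ghost e))) \<phi> u \<xi> = 0"
    if v: "regular_vertex E v" for v \<phi> u \<xi>
  proof -
    have fin: "finite (out_arcs E v)" "v \<in> verts E" using v unfolding regular_vertex_def by auto
    have Nfin: "finite (Q.N v)" using fin(1) by (rule finite_subset[rotated]) (auto simp: Q.N_D)
    have sum: "act (\<Sum>e\<in>out_arcs E v. gen (Edg e) * gen (Ghost e)) \<phi> u \<xi> = act (live_sum E H v) \<phi> u \<xi>"
      unfolding live_sum_def act_sum
    proof (rule sum.mono_neutral_right)
      show "\<forall>e\<in>out_arcs E v - Q.N v. act (gen (Edg e) * gen (Ghost e)) \<phi> u \<xi> = 0"
      proof
        fix e assume e: "e \<in> out_arcs E v - Q.N v"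
        have "\<not> (valid u \<xi> \<and> (\<exists>f. \<xi> 0 = Some f \<and> Q.base_of f = e))"
          using valid_Some[of u \<xi>] Q.arcs_F_base(2) e by (auto simp: Q.N_D)
        then show "act (gen (Edg e) * gen (Ghost e)) \<phi> u \<xi> = 0" using e by (subst act_AB) auto
      qed
    qed (use fin in \<open>auto simp: Q.N_D\<close>)
    have imp: "u = Inl v \<and> \<xi> 0 \<noteq> None" if u: "valid u \<xi>" "Q.base_of u = v"
    proof -
      have "v \<notin> breaking_vertices E H"
        using fin(1) unfolding breaking_vertices_def infinite_emitter_def by auto
      then have ul: "u = Inl v" "v \<notin> H" using valid_verts[OF u(1)] u(2) by (cases u; auto simp: Q.verts_F)+
      have "Q.N v \<noteq> {}"
      proof
        assume "Q.N v = {}"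
        then have "head E ` out_arcs E v \<subseteq> H" by (auto simp: live_arcs_def)
        then show False using adm v ul(2) unfolding admissible_pair_def saturated_def by blast
      qed
      then show ?thesis using valid_None[OF u(1)] regular_F[OF fin(2) ul(2) Nfin] ul by blast
    qed
    have iff: "valid u \<xi> \<and> v \<in> verts E \<and> Q.base_of u = v \<longleftrightarrow> valid u \<xi> \<and> u = Inl v \<and> \<xi> 0 \<noteq> None"
    proof (intro iffI; elim conjE)
      assume u: "valid u \<xi>" "Q.base_of u = v"
      show "valid u \<xi> \<and> u = Inl v \<and> \<xi> 0 \<noteq> None" by (intro conjI u(1)) (use imp[OF u] in auto)
    next
      assume "valid u \<xi>" "u = Inl v"
      then show "valid u \<xi> \<and> v \<in> verts E \<and> Q.base_of u = v" using fin(2) by simp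
    qed
    show ?thesis unfolding act_diff sum act_live_sum[OF Nfin] act_gen gact_V iff by simp
  qed
  have annI: "x \<in> ann" if "\<And>\<phi> u \<xi>. act x \<phi> u \<xi> = 0" for x
    using that unfolding ann_def by simp
  have "x \<in> ann" if "x \<in> lpa_relations E" for x
  proof -
    have *: "\<lbrakk>x = y; \<And>\<phi> u \<xi>. act y \<phi> u \<xi> = 0\<rbrakk> \<Longrightarrow> x \<in> ann" for y using annI by blast
    from that show ?thesis unfolding lpa_relations_def
      by (elim UnE CollectE exE conjE) (erule *, rule VV VA AV VB BV BA REG, assumption+)+
  qed
  moreover have "gen g \<in> ann" if "g \<notin> lpa_gens E" for g
    using that unfolding ann_def by (simp add: act_gen gen_action_def)
  moreover have "gen (Vtx v) \<in> ann" if "v \<in> H" for v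
  proof -
    have nv: "\<not> (valid u \<xi> \<and> Q.base_of u = v)" for u \<xi>
      using valid_verts[of u \<xi>] that Q.breaking by (cases u) (auto simp: Q.verts_F)
    show ?thesis
    proof (rule annI)
      show "act (gen (Vtx v)) \<phi> u \<xi> = 0" for \<phi> u \<xi>
      proof -
        have "\<not> (valid u \<xi> \<and> v \<in> verts E \<and> Q.base_of u = v)"
          using nv[of u \<xi>] by (rule contrapos_nn) (elim conjE, intro conjI)
        then show ?thesis unfolding act_gen gact_V by (rule if_not_P)
      qed
    qed
  qed
  moreover have "break_free E H v \<in> ann" if vS: "v \<in> S" for v
  proof -
    have "v \<in> breaking_vertices E H" using adm vS unfolding admissible_pair_def by blast
    then have N: "v \<in> verts E" "v \<notin> H" "finite (Q.N v)" "Q.N v \<noteq> {}" using Q.breaking by blast+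
    have imp: "u = Inl v \<and> \<xi> 0 \<noteq> None" if u: "valid u \<xi>" "Q.base_of u = v" for u \<xi>
    proof -
      have "u = Inl v" using valid_verts[OF u(1)] u(2) vS by (cases u) (auto simp: Q.verts_F)
      then show ?thesis using valid_None[OF u(1)] regular_F[OF N] by blast
    qed
    have iff: "valid u \<xi> \<and> v \<in> verts E \<and> Q.base_of u = v \<longleftrightarrow> valid u \<xi> \<and> u = Inl v \<and> \<xi> 0 \<noteq> None" for u \<xi>
    proof (intro iffI; elim conjE)
      assume u: "valid u \<xi>" "Q.base_of u = v"
      show "valid u \<xi> \<and> u = Inl v \<and> \<xi> 0 \<noteq> None" by (intro conjI u(1)) (use imp[OF u] in auto)
    next
      assume "valid u \<xi>" "u = Inl v"
      then show "valid u \<xi> \<and> v \<in> verts E \<and> Q.base_of u = v" using N(1) by simp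
    qed
    show ?thesis
    proof (rule annI)
      show "act (break_free E H v) \<phi> u \<xi> = 0" for \<phi> u \<xi>
        unfolding break_free_def act_diff act_live_sum[OF N(3)] act_gen gact_V iff by simp
    qed
  qed
  ultimately show ?thesis
    unfolding admissible_relations_def base_relations_def
    by (intro Un_least subsetI) auto
qed

text \<open>Continues a path greedily: at a regular vertex outside \<open>Y\<close> there is an edge
  into the complement of \<open>Y\<close> since \<open>Y\<close> is saturated, and elsewhere the
  path may stop.\<close>

definition next_arc :: "'v + 'v \<Rightarrow> ('e + 'e) option" where
  "next_arc u = (if regular_vertex Q.F u then Some (SOME f. f \<in> out_arcs Q.F u \<and> head Q.F f \<notin> Y) else None)"

primrec some_path :: "nat \<Rightarrow> 'v + 'v \<Rightarrow> ('e + 'e) option" where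
  "some_path 0 u = next_arc u"
| "some_path (Suc n) u = (case next_arc u of None \<Rightarrow> None | Some f \<Rightarrow> some_path n (head Q.F f))"

lemma next_arc_Some:
  assumes "next_arc u = Some f" "u \<in> verts Q.F" "u \<notin> Y"
  shows "f \<in> arcs Q.F" "tail Q.F f = u" "head Q.F f \<in> verts Q.F" "head Q.F f \<notin> Y"
proof -
  have r: "regular_vertex Q.F u" using assms(1) unfolding next_arc_def by (auto split: if_splits)
  then have "\<exists>f. f \<in> out_arcs Q.F u \<and> head Q.F f \<notin> Y"
    using Y_sat assms(3) unfolding saturated_def by blast
  then have "(SOME f. f \<in> out_arcs Q.F u \<and> head Q.F f \<notin> Y) \<in> out_arcs Q.F u \<and>
      head Q.F (SOME f. f \<in> out_arcs Q.F u \<and> head Q.F f \<notin> Y) \<notin> Y"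
    by (rule someI_ex)
  then have "f \<in> out_arcs Q.F u" "head Q.F f \<notin> Y" using assms(1) r unfolding next_arc_def by auto
  then show "f \<in> arcs Q.F" "tail Q.F f = u" "head Q.F f \<in> verts Q.F" "head Q.F f \<notin> Y"
    using Q.arcs_F_base(4) by auto
qed

lemma valid_exists:
  assumes "u \<in> verts Q.F" "u \<notin> Y"
  shows "valid u (\<lambda>n. some_path n u)"
proof -
  have "\<exists>u'. \<xi> = (\<lambda>n. some_path n u') \<and> u = u' \<and> u' \<in> verts Q.F \<and> u' \<notin> Y \<Longrightarrow> valid u \<xi>" for u \<xi>
  proof (coinduction arbitrary: u \<xi> rule: boundary_path.coinduct)
    case (boundary_path u \<xi>)
    then have u: "\<xi> = (\<lambda>n. some_path n u)" "u \<in> verts Q.F" "u \<notin> Y" by auto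
    show ?case
    proof (cases "next_arc u")
      case None
      then have "\<not> regular_vertex Q.F u" unfolding next_arc_def by (auto split: if_splits)
      then show ?thesis using u None by auto
    next
      case (Some f)
      note f = next_arc_Some[OF Some u(2,3)]
      have "\<xi> 0 = Some f" "(\<lambda>n. \<xi> (Suc n)) = (\<lambda>n. some_path n (head Q.F f))"
        unfolding u(1) using Some by auto
      then show ?thesis using u f by auto
    qed
  qed
  then show ?thesis using assms by blast
qed

text \<open>The relations and \<open>Y\<close> act as 0, but \<open>x\<close> preserves the value of
  the constant function 1 at a point based at \<open>x\<close>.\<close>

theorem vertex_outside:
  assumes "x \<in> verts Q.F" "x \<notin> Y"
  shows "quot_vertex E H S x \<notin> idl_gen (admissible_relations E H S \<union> quot_vertex E H S ` Y :: ('v, 'e, 'k) lpa_free set)"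
proof
  assume mem: "quot_vertex E H S x \<in> idl_gen (admissible_relations E H S \<union> quot_vertex E H S ` Y :: ('v, 'e, 'k) lpa_free set)"
  have "quot_vertex E H S y \<in> ann" if "y \<in> Y" for y
  proof -
    have "y \<in> verts Q.F" using that Y_her unfolding hereditary_def by blast
    then show ?thesis using valid_verts that unfolding ann_def by (auto simp: act_quot_vertex)
  qed
  then have "idl_gen (admissible_relations E H S \<union> quot_vertex E H S ` Y) \<subseteq> ann"
    using relations_ann by (intro idl_gen_least[OF idl_ann]) auto
  then have "act (quot_vertex E H S x) (\<lambda>u \<xi>. 1) x (\<lambda>n. some_path n x) = 0"
    using mem unfolding ann_def by blast
  then show False using valid_exists[OF assms] by (simp add: act_quot_vertex[OF assms(1)])
qed

end

section \<open>Ideals of the Leavitt path algebra and of the free algebra\<close>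

text \<open>Used with two predicates: words over the generators of the graph for
  \<open>trunc\<close>, words of a given degree for \<open>hom\<close>.\<close>

definition restrict_words :: "('a list \<Rightarrow> bool) \<Rightarrow> ('a list \<Rightarrow>\<^sub>0 'k::ab_group_add) \<Rightarrow> ('a list \<Rightarrow>\<^sub>0 'k)" where
  "restrict_words Q x = (\<Sum>w\<in>Poly_Mapping.keys x. if Q w then Poly_Mapping.single w (Poly_Mapping.lookup x w) else 0)"

lemma lookup_restrict_words: "Poly_Mapping.lookup (restrict_words Q x) w = (if Q w then Poly_Mapping.lookup x w else 0)"
proof -
  have "Poly_Mapping.lookup (restrict_words Q x) w =
     (\<Sum>v\<in>Poly_Mapping.keys x. if v = w then (if Q w then Poly_Mapping.lookup x w else 0) else 0)"
    unfolding restrict_words_def lookup_sum by (intro sum.cong) (auto simp: lookup_single when_def)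
  also have "\<dots> = (if Q w then Poly_Mapping.lookup x w else 0)"
    by (auto simp: not_in_keys_iff_lookup_eq_zero)
  finally show ?thesis .
qed

lemma restrict_words_add: "restrict_words Q (x + y) = restrict_words Q x + restrict_words Q y"
  by (rule poly_mapping_eqI) (simp add: lookup_restrict_words lookup_add)

lemma restrict_words_diff: "restrict_words Q (x - y) = restrict_words Q x - restrict_words Q y"
  by (rule poly_mapping_eqI) (simp add: lookup_restrict_words lookup_minus)

lemma restrict_words_0 [simp]: "restrict_words Q 0 = 0"
  by (rule poly_mapping_eqI) (simp add: lookup_restrict_words)

lemma restrict_words_sum: "restrict_words Q (sum f A) = (\<Sum>i\<in>A. restrict_words Q (f i))"
  by (induction A rule: infinite_finite_induct) (simp_all add: restrict_words_add)

lemma restrict_words_single: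
  "restrict_words Q (Poly_Mapping.single w k) = (if Q w then Poly_Mapping.single w k else 0)"
  by (rule poly_mapping_eqI) (auto simp: lookup_restrict_words lookup_single when_def)

lemma restrict_words_id: "(\<And>w. w \<in> Poly_Mapping.keys x \<Longrightarrow> Q w) \<Longrightarrow> restrict_words Q x = x"
  by (rule poly_mapping_eqI) (auto simp: lookup_restrict_words in_keys_iff)

lemma keys_restrict_words: "Poly_Mapping.keys (restrict_words Q x) = {w \<in> Poly_Mapping.keys x. Q w}"
  by (auto simp: in_keys_iff lookup_restrict_words split: if_splits)

abbreviation fcarrier :: "('v, 'e) pre_digraph \<Rightarrow> ('v, 'e, 'k::field) lpa_free set" where
  "fcarrier E \<equiv> carrier (free_alg E)"

text \<open>A multiplicative retraction of the ambient algebra onto the words over \<open>E\<close>,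
  since a concatenation is over \<open>E\<close> exactly when both parts are.\<close>

definition trunc :: "('v, 'e) pre_digraph \<Rightarrow> ('v, 'e, 'k::field) lpa_free \<Rightarrow> ('v, 'e, 'k) lpa_free" where
  "trunc E = restrict_words (\<lambda>w. w \<in> lists (lpa_gens E))"

lemma trunc_add: "trunc E (x + y) = trunc E x + trunc E y"
  and trunc_diff: "trunc E (x - y) = trunc E x - trunc E y"
  and trunc_0 [simp]: "trunc E 0 = 0"
  and trunc_single: "trunc E (Poly_Mapping.single w k) = (if w \<in> lists (lpa_gens E) then Poly_Mapping.single w k else 0)"
  unfolding trunc_def by (simp_all add: restrict_words_add restrict_words_diff restrict_words_single)

lemma trunc_mult: "trunc E (x * y) = trunc E x * trunc E y"
proof (induction x rule: poly_mapping_single_induct)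
  case (single w k)
  show ?case
    by (induction y rule: poly_mapping_single_induct)
      (auto simp: mult_single trunc_single distrib_left trunc_add plus_list_def)
qed (simp_all add: distrib_right trunc_add)

lemma free_alg_simps:
  "x \<in> fcarrier E \<longleftrightarrow> Poly_Mapping.keys x \<subseteq> lists (lpa_gens E) - {[]}"
  "x \<otimes>\<^bsub>free_alg E\<^esub> y = x * y" "x \<oplus>\<^bsub>free_alg E\<^esub> y = x + y" "\<zero>\<^bsub>free_alg E\<^esub> = 0"
  unfolding free_alg_def by auto

lemma fcarrier_aug: "x \<in> fcarrier E \<Longrightarrow> x \<in> aug"
  unfolding free_alg_simps aug_def zero_list_def by (auto simp: in_keys_iff)

lemma trunc_id: "x \<in> fcarrier E \<Longrightarrow> trunc E x = x"
  unfolding free_alg_simps trunc_def by (rule restrict_words_id) auto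

lemma trunc_fcarrier: "x \<in> aug \<Longrightarrow> trunc E x \<in> fcarrier E"
  unfolding free_alg_simps trunc_def keys_restrict_words aug_def zero_list_def by (auto simp: in_keys_iff)

lemma fcarrier_iff: "x \<in> fcarrier E \<longleftrightarrow> x \<in> aug \<and> trunc E x = x"
  using fcarrier_aug trunc_id trunc_fcarrier by metis

lemma fcarrier_closed:
  "0 \<in> fcarrier E" "x \<in> fcarrier E \<Longrightarrow> y \<in> fcarrier E \<Longrightarrow> x + y \<in> fcarrier E"
  "x \<in> fcarrier E \<Longrightarrow> y \<in> fcarrier E \<Longrightarrow> x - y \<in> fcarrier E"
  "x \<in> fcarrier E \<Longrightarrow> y \<in> fcarrier E \<Longrightarrow> x * y \<in> fcarrier E"
  "x \<in> fcarrier E \<Longrightarrow> const k * x \<in> fcarrier E"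
  "g \<in> lpa_gens E \<Longrightarrow> gen g \<in> fcarrier E"
proof -
  have c: "trunc E (const k) = const k" for k by (simp add: const_def trunc_single zero_list_def)
  show "0 \<in> fcarrier E" by (simp add: fcarrier_iff idl_zero[OF idl_aug])
  show "x \<in> fcarrier E \<Longrightarrow> y \<in> fcarrier E \<Longrightarrow> x + y \<in> fcarrier E"
    by (simp add: fcarrier_iff trunc_add idl_add[OF idl_aug])
  show "x \<in> fcarrier E \<Longrightarrow> y \<in> fcarrier E \<Longrightarrow> x - y \<in> fcarrier E"
    by (simp add: fcarrier_iff trunc_diff idl_diff[OF idl_aug])
  show "x \<in> fcarrier E \<Longrightarrow> y \<in> fcarrier E \<Longrightarrow> x * y \<in> fcarrier E"
    by (simp add: fcarrier_iff trunc_mult idl_left[OF idl_aug])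
  show "x \<in> fcarrier E \<Longrightarrow> const k * x \<in> fcarrier E"
    by (simp add: fcarrier_iff trunc_mult c idl_left[OF idl_aug])
  show "g \<in> lpa_gens E \<Longrightarrow> gen g \<in> fcarrier E"
    unfolding fcarrier_iff by (simp add: gen_aug) (simp add: gen_def trunc_single)
qed

lemma fcarrier_uminus: "x \<in> fcarrier E \<Longrightarrow> - x \<in> fcarrier E"
  using fcarrier_closed(3)[OF fcarrier_closed(1)] by simp

lemma fcarrier_sum: "(\<And>i. i \<in> A \<Longrightarrow> f i \<in> fcarrier E) \<Longrightarrow> sum f A \<in> fcarrier E"
  by (induction A rule: infinite_finite_induct) (auto intro: fcarrier_closed)

lemma trunc_const: "trunc E (const k) = const k"
  by (simp add: const_def trunc_single zero_list_def)

lemma free_decompose: "\<exists>k. \<exists>y\<in>aug. x = const k + y"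
proof -
  have "x - const (Poly_Mapping.lookup x 0) \<in> aug"
    by (simp add: aug_def lookup_minus const_def)
  then show ?thesis by (intro exI bexI[of _ "x - const (Poly_Mapping.lookup x 0)"]) auto
qed

context wf_digraph
begin

abbreviation (input) "R \<equiv> lpa_rel_ideal G"

lemma lpa_relations_fcarrier: "lpa_relations G \<subseteq> (fcarrier G :: ('a, 'b, 'k::field) lpa_free set)"
proof -
  have V: "v \<in> verts G \<Longrightarrow> gen (Vtx v) \<in> (fcarrier G :: ('a, 'b, 'k) lpa_free set)" for v
    by (rule fcarrier_closed) (simp add: lpa_gens_def)
  have A: "e \<in> arcs G \<Longrightarrow> gen (Edg e) \<in> (fcarrier G :: ('a, 'b, 'k) lpa_free set)" for e
    by (rule fcarrier_closed) (simp add: lpa_gens_def)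
  have B: "e \<in> arcs G \<Longrightarrow> gen (Ghost e) \<in> (fcarrier G :: ('a, 'b, 'k) lpa_free set)" for e
    by (rule fcarrier_closed) (simp add: lpa_gens_def)
  show ?thesis
    unfolding lpa_relations_def
    by (intro Un_least subsetI; elim CollectE exE conjE)
      (auto intro!: fcarrier_closed(1-4) V A B fcarrier_sum simp: regular_vertex_def)
qed

lemma R_fcarrier: "x \<in> R \<Longrightarrow> x \<in> (fcarrier G :: ('a, 'b, 'k::field) lpa_free set)"
  by (induction rule: lpa_rel_ideal.induct)
    (use lpa_relations_fcarrier in \<open>auto simp: scale_const intro: fcarrier_closed\<close>)

lemma R_const: "x \<in> R \<Longrightarrow> const k * x \<in> R"
  using lpa_rel_ideal.scale by (simp add: scale_const)

lemma R_uminus: "x \<in> R \<Longrightarrow> - x \<in> (R :: ('a, 'b, 'k::field) lpa_free set)"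
proof -
  have "const (-1) = (- 1 :: ('a, 'b, 'k) lpa_free)" by (simp add: const_def single_uminus)
  then show "x \<in> R \<Longrightarrow> - x \<in> R" using R_const[of x "-1"] by simp
qed

text \<open>The relation ideal absorbs only elements of the free algebra over the graph; its
  preimage under \<open>trunc\<close> is an ideal of the whole unital algebra.\<close>

definition rel_free :: "('a, 'b, 'k::field) lpa_free set" where
  "rel_free = {x. trunc G x \<in> R}"

lemma idl_rel_free: "idl (rel_free :: ('a, 'b, 'k::field) lpa_free set)"
proof (rule idlI)
  show "0 \<in> (rel_free :: ('a, 'b, 'k) lpa_free set)" unfolding rel_free_def by (simp add: lpa_rel_ideal.zero)
  show "x + y \<in> rel_free" if "x \<in> rel_free" "y \<in> rel_free" for x y :: "('a, 'b, 'k) lpa_free"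
    using that unfolding rel_free_def by (simp add: trunc_add lpa_rel_ideal.add)
  fix x a :: "('a, 'b, 'k) lpa_free"
  assume x: "x \<in> rel_free"
  obtain k y where a: "a = const k + y" "y \<in> aug" using free_decompose by blast
  have "const k * trunc G x + trunc G y * trunc G x \<in> R"
    using x unfolding rel_free_def
    by (intro lpa_rel_ideal.add R_const lpa_rel_ideal.mult_left trunc_fcarrier a) auto
  then show "a * x \<in> rel_free"
    unfolding rel_free_def a by (simp add: trunc_mult trunc_add trunc_const distrib_right)
  have "const k * trunc G x + trunc G x * trunc G y \<in> R"
    using x unfolding rel_free_def
    by (intro lpa_rel_ideal.add R_const lpa_rel_ideal.mult_right trunc_fcarrier a) auto
  then show "x * a \<in> rel_free"
    unfolding rel_free_def a by (simp add: trunc_mult trunc_add trunc_const distrib_left const_central[of k "trunc G x"])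
qed

lemma base_rel_free: "base_relations G \<subseteq> (rel_free :: ('a, 'b, 'k::field) lpa_free set)"
proof -
  have "x \<in> rel_free" if "x \<in> lpa_relations G" for x :: "('a, 'b, 'k) lpa_free"
    using that lpa_relations_fcarrier unfolding rel_free_def by (auto simp: trunc_id lpa_rel_ideal.rel)
  moreover have "gen g \<in> (rel_free :: ('a, 'b, 'k) lpa_free set)" if "g \<notin> lpa_gens G" for g
    using that unfolding rel_free_def gen_def by (simp add: trunc_single lpa_rel_ideal.zero)
  ultimately show ?thesis unfolding base_relations_def by blast
qed

text \<open>A word that \<open>trunc\<close> removes contains a symbol foreign to the graph, which
  lies in \<open>J\<close>.\<close>

lemma trunc_idl:
  assumes J: "idl J" "base_relations G \<subseteq> (J :: ('a, 'b, 'k::field) lpa_free set)"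
  shows "x - trunc G x \<in> J"
proof (induction x rule: poly_mapping_single_induct)
  case zero
  show ?case using idl_zero[OF J(1)] by simp
next
  case (single w k)
  show ?case
  proof (cases "w \<in> lists (lpa_gens G)")
    case True
    then show ?thesis using idl_zero[OF J(1)] by (simp add: trunc_single)
  next
    case False
    then obtain g where g: "g \<in> set w" "g \<notin> lpa_gens G" by blast
    then obtain u v where w: "w = u @ g # v" by (meson split_list)
    have "gen g \<in> J" using g J(2) unfolding base_relations_def by blast
    then have "Poly_Mapping.single u 1 * gen g * Poly_Mapping.single v k \<in> J" by (rule idl_mid[OF J(1)])
    moreover have "Poly_Mapping.single w k = Poly_Mapping.single u 1 * gen g * Poly_Mapping.single v k"
      unfolding w by (simp add: gen_def mult_single plus_list_def)
    moreover have "trunc G (Poly_Mapping.single w k) = 0" using False by (simp add: trunc_single)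
    ultimately show ?thesis by (simp only: diff_zero)
  qed
next
  case (add x y)
  have "x + y - trunc G (x + y) = (x - trunc G x) + (y - trunc G y)" by (simp add: trunc_add)
  then show ?case using idl_add[OF J(1) add] by (simp only:)
qed

lemma rel_free_least:
  assumes J: "idl J" "base_relations G \<subseteq> (J :: ('a, 'b, 'k::field) lpa_free set)"
  shows "rel_free \<subseteq> J"
proof
  fix x :: "('a, 'b, 'k) lpa_free"
  assume "x \<in> rel_free"
  then have "trunc G x \<in> R" unfolding rel_free_def by simp
  then have "trunc G x \<in> J"
  proof (induction rule: lpa_rel_ideal.induct)
    case (rel x)
    then show ?case using J(2) unfolding base_relations_def by blast
  qed (use J(1) in \<open>auto simp: scale_const intro: idl_zero idl_add idl_left idl_right\<close>)
  then have "x - trunc G x + trunc G x \<in> J" using trunc_idl[OF J] idl_add[OF J(1)] by blast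
  then show "x \<in> J" by simp
qed

lemma R_iff: "x \<in> fcarrier G \<Longrightarrow> x \<in> R \<longleftrightarrow> x \<in> rel_free"
  unfolding rel_free_def by (simp add: trunc_id)

section \<open>Operations of the Leavitt path algebra on residue classes\<close>

lemma class_mem: "z \<in> lpa_class G x \<longleftrightarrow> (\<exists>r\<in>R. z = r + x)"
  unfolding lpa_class_def a_r_coset_def' free_alg_simps by auto

lemma class_self: "x \<in> lpa_class G x"
  unfolding class_mem by (rule bexI[of _ 0]) (simp_all add: lpa_rel_ideal.zero)

lemma class_memI: "r \<in> R \<Longrightarrow> r + x \<in> lpa_class G x"
  unfolding class_mem by blast

lemma class_memE:
  assumes "z \<in> lpa_class G x"
  obtains r where "r \<in> R" "z = r + x"
  using assms unfolding class_mem by blast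

lemma class_eq_iff: "lpa_class G x = lpa_class G y \<longleftrightarrow> x - y \<in> (R :: ('a, 'b, 'k::field) lpa_free set)"
proof
  assume "lpa_class G x = lpa_class G y"
  then have "x \<in> lpa_class G y" using class_self by blast
  then show "x - y \<in> R" by (elim class_memE) simp
next
  assume xy: "x - y \<in> R"
  have "lpa_class G a \<subseteq> lpa_class G b" if ab: "a - b \<in> R" for a b :: "('a, 'b, 'k) lpa_free"
  proof
    fix z assume "z \<in> lpa_class G a"
    then obtain r where r: "r \<in> R" "z = r + a" by (rule class_memE)
    have "r + (a - b) \<in> R" by (rule lpa_rel_ideal.add[OF r(1) ab])
    from class_memI[OF this, of b] show "z \<in> lpa_class G b" unfolding r(2) by simp
  qed
  moreover have "y - x \<in> R" using R_uminus[OF xy] by simp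
  ultimately show "lpa_class G x = lpa_class G y" using xy by blast
qed

lemma LPA_carrier: "carrier (LPA G) = lpa_class G ` fcarrier G"
  unfolding LPA_def lpa_class_def by (auto simp: FactRing_def A_RCOSETS_def')

lemma LPA_zero: "\<zero>\<^bsub>LPA G\<^esub> = lpa_class G (0 :: ('a, 'b, 'k::field) lpa_free)"
proof -
  have "lpa_class G 0 = (lpa_rel_ideal G :: ('a, 'b, 'k) lpa_free set)" by (auto simp: class_mem)
  then show ?thesis unfolding LPA_def by (simp add: FactRing_def)
qed

lemma LPA_add: "lpa_class G x \<oplus>\<^bsub>LPA G\<^esub> lpa_class G y = lpa_class G (x + y :: ('a, 'b, 'k::field) lpa_free)"
proof -
  have "lpa_class G x \<oplus>\<^bsub>LPA G\<^esub> lpa_class G y = (\<Union>h\<in>lpa_class G x. \<Union>k\<in>lpa_class G y. {h + k})"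
    unfolding LPA_def by (simp add: FactRing_def set_add_def' free_alg_simps)
  also have "\<dots> = lpa_class G (x + y)"
  proof (intro equalityI subsetI)
    fix z assume "z \<in> (\<Union>h\<in>lpa_class G x. \<Union>k\<in>lpa_class G y. {h + k})"
    then obtain a b where ab: "a \<in> lpa_class G x" "b \<in> lpa_class G y" "z = a + b" by blast
    obtain r where r: "r \<in> R" "a = r + x" using ab(1) by (rule class_memE)
    obtain r' where r': "r' \<in> R" "b = r' + y" using ab(2) by (rule class_memE)
    from class_memI[OF lpa_rel_ideal.add[OF r(1) r'(1)], of "x + y"]
    show "z \<in> lpa_class G (x + y)" unfolding ab(3) r(2) r'(2) by (simp add: algebra_simps)
  next
    fix z assume "z \<in> lpa_class G (x + y)"
    then obtain r where r: "r \<in> R" "z = r + (x + y)" by (rule class_memE)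
    then have "z = (r + x) + y" by (simp add: add.assoc)
    then show "z \<in> (\<Union>h\<in>lpa_class G x. \<Union>k\<in>lpa_class G y. {h + k})"
      using class_memI[OF r(1), of x] class_self[of y] by blast
  qed
  finally show ?thesis .
qed

lemma LPA_mult:
  assumes "x \<in> fcarrier G" "y \<in> fcarrier G"
  shows "lpa_class G x \<otimes>\<^bsub>LPA G\<^esub> lpa_class G y = lpa_class G (x * y :: ('a, 'b, 'k::field) lpa_free)"
proof -
  have "lpa_class G x \<otimes>\<^bsub>LPA G\<^esub> lpa_class G y = (\<Union>a\<in>lpa_class G x. \<Union>b\<in>lpa_class G y. lpa_class G (a * b))"
    unfolding LPA_def by (simp add: FactRing_def rcoset_mult_def free_alg_simps lpa_class_def)
  also have "\<dots> = lpa_class G (x * y)"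
  proof -
    have eq: "lpa_class G (a * b) = lpa_class G (x * y)" if ab: "a \<in> lpa_class G x" "b \<in> lpa_class G y" for a b
    proof -
      obtain r where r1: "r \<in> R" "a = r + x" using ab(1) by (rule class_memE)
      obtain r' where r2: "r' \<in> R" "b = r' + y" using ab(2) by (rule class_memE)
      note r = r1(1) r2(1) r1(2) r2(2)
      have "a * b - x * y = r * (r' + y) + x * r'" unfolding r by (simp add: algebra_simps)
      also have "\<dots> \<in> R"
        using r(1,2) assms R_fcarrier
        by (intro lpa_rel_ideal.add lpa_rel_ideal.mult_right lpa_rel_ideal.mult_left fcarrier_closed) auto
      finally show ?thesis unfolding class_eq_iff .
    qed
    then show ?thesis using class_self[of x] class_self[of y] by blast
  qed
  finally show ?thesis .
qed

lemma LPA_smult: "c \<odot>\<^bsub>LPA G\<^esub> lpa_class G x = lpa_class G (const c * x :: ('a, 'b, 'k::field) lpa_free)"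
proof -
  have eq: "lpa_class G (const c * a) = lpa_class G (const c * x)" if a: "a \<in> lpa_class G x" for a
  proof -
    obtain r where r: "r \<in> R" "a = r + x" using a by (rule class_memE)
    have "const c * a - const c * x = const c * r" unfolding r by (simp add: algebra_simps)
    then show ?thesis unfolding class_eq_iff using R_const r by simp
  qed
  have "c \<odot>\<^bsub>LPA G\<^esub> lpa_class G x = (\<Union>a\<in>lpa_class G x. lpa_class G (const c * a))"
    unfolding LPA_def by (simp add: scale_const)
  also have "\<dots> = lpa_class G (const c * x)" using eq class_self[of x] by blast
  finally show ?thesis .
qed

lemma LPA_abelian: "abelian_group (LPA G :: ('k::field, ('a, 'b, 'k) lpa_elem) module)"
proof (rule abelian_groupI)
  fix X Y Z :: "('a, 'b, 'k) lpa_elem"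
  assume "X \<in> carrier (LPA G)" "Y \<in> carrier (LPA G)"
  then obtain x y where xy: "x \<in> fcarrier G" "y \<in> fcarrier G" "X = lpa_class G x" "Y = lpa_class G y"
    unfolding LPA_carrier by blast
  show "X \<oplus>\<^bsub>LPA G\<^esub> Y \<in> carrier (LPA G)"
    using fcarrier_closed(2)[OF xy(1,2)] unfolding xy(3,4) LPA_add LPA_carrier by blast
  show "X \<oplus>\<^bsub>LPA G\<^esub> Y = Y \<oplus>\<^bsub>LPA G\<^esub> X" unfolding xy(3,4) LPA_add by (simp add: add.commute)
  assume "Z \<in> carrier (LPA G)"
  then obtain z where z: "Z = lpa_class G z" unfolding LPA_carrier by blast
  show "X \<oplus>\<^bsub>LPA G\<^esub> Y \<oplus>\<^bsub>LPA G\<^esub> Z = X \<oplus>\<^bsub>LPA G\<^esub> (Y \<oplus>\<^bsub>LPA G\<^esub> Z)"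
    unfolding xy(3,4) z LPA_add by (simp add: add.assoc)
next
  show "\<zero>\<^bsub>LPA G\<^esub> \<in> carrier (LPA G)" unfolding LPA_zero LPA_carrier using fcarrier_closed(1) by blast
  fix X :: "('a, 'b, 'k) lpa_elem"
  assume "X \<in> carrier (LPA G)"
  then obtain x where x: "x \<in> fcarrier G" "X = lpa_class G x" unfolding LPA_carrier by blast
  show "\<zero>\<^bsub>LPA G\<^esub> \<oplus>\<^bsub>LPA G\<^esub> X = X" unfolding x(2) LPA_zero LPA_add by simp
  have "lpa_class G (- x) \<in> carrier (LPA G)" unfolding LPA_carrier using fcarrier_uminus[OF x(1)] by blast
  moreover have "lpa_class G (- x) \<oplus>\<^bsub>LPA G\<^esub> X = \<zero>\<^bsub>LPA G\<^esub>" unfolding x(2) LPA_add LPA_zero by simp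
  ultimately show "\<exists>Y\<in>carrier (LPA G). Y \<oplus>\<^bsub>LPA G\<^esub> X = \<zero>\<^bsub>LPA G\<^esub>" by blast
qed

lemma LPA_a_inv: "x \<in> fcarrier G \<Longrightarrow> \<ominus>\<^bsub>LPA G\<^esub> lpa_class G x = lpa_class G (- x :: ('a, 'b, 'k::field) lpa_free)"
proof -
  assume x: "x \<in> fcarrier G"
  interpret L: abelian_group "LPA G :: ('k, ('a, 'b, 'k) lpa_elem) module" by (rule LPA_abelian)
  show ?thesis
    by (rule L.minus_equality) (use x fcarrier_uminus in \<open>auto simp: LPA_add LPA_zero LPA_carrier\<close>)
qed

lemma two_sided_idealI:
  fixes I :: "('a, 'b, 'k::field) lpa_elem set"
  assumes sub: "I \<subseteq> carrier (LPA G)" and zero: "\<zero>\<^bsub>LPA G\<^esub> \<in> I"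
    and add: "\<And>X Y. X \<in> I \<Longrightarrow> Y \<in> I \<Longrightarrow> X \<oplus>\<^bsub>LPA G\<^esub> Y \<in> I"
    and left: "\<And>X Y. X \<in> I \<Longrightarrow> Y \<in> carrier (LPA G) \<Longrightarrow> Y \<otimes>\<^bsub>LPA G\<^esub> X \<in> I"
    and right: "\<And>X Y. X \<in> I \<Longrightarrow> Y \<in> carrier (LPA G) \<Longrightarrow> X \<otimes>\<^bsub>LPA G\<^esub> Y \<in> I"
    and minus: "\<And>X. X \<in> I \<Longrightarrow> \<ominus>\<^bsub>LPA G\<^esub> X \<in> I"
  shows "two_sided_ideal (LPA G) I"
proof -
  have "additive_subgroup I (LPA G)"
    by (rule additive_subgroupI, unfold_locales)
      (use assms in \<open>auto simp: a_inv_def\<close>)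
  then show ?thesis unfolding two_sided_ideal_def using left right by blast
qed

lemma two_sided_idealD:
  fixes I :: "('a, 'b, 'k::field) lpa_elem set"
  assumes "two_sided_ideal (LPA G) I"
  shows "I \<subseteq> carrier (LPA G)" "\<zero>\<^bsub>LPA G\<^esub> \<in> I" "\<And>X Y. X \<in> I \<Longrightarrow> Y \<in> I \<Longrightarrow> X \<oplus>\<^bsub>LPA G\<^esub> Y \<in> I"
    "\<And>X Y. X \<in> I \<Longrightarrow> Y \<in> carrier (LPA G) \<Longrightarrow> Y \<otimes>\<^bsub>LPA G\<^esub> X \<in> I"
    "\<And>X Y. X \<in> I \<Longrightarrow> Y \<in> carrier (LPA G) \<Longrightarrow> X \<otimes>\<^bsub>LPA G\<^esub> Y \<in> I"
proof -
  interpret additive_subgroup I "LPA G" using assms unfolding two_sided_ideal_def by blast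
  show "I \<subseteq> carrier (LPA G)" by (rule a_subset)
  show "\<zero>\<^bsub>LPA G\<^esub> \<in> I" by (rule zero_closed)
  show "\<And>X Y. X \<in> I \<Longrightarrow> Y \<in> I \<Longrightarrow> X \<oplus>\<^bsub>LPA G\<^esub> Y \<in> I" by (rule a_closed)
qed (use assms in \<open>auto simp: two_sided_ideal_def\<close>)

lemma local_unit:
  fixes x :: "('a, 'b, 'k::field) lpa_free"
  assumes "x \<in> aug"
  obtains u where "u \<in> aug" "u * x - x \<in> rel_free"
proof -
  interpret B: lpa_ideal G "rel_free :: ('a, 'b, 'k) lpa_free set"
    by unfold_locales (rule idl_rel_free, rule base_rel_free)
  \<comment> \<open>The sum is a unit for all finite vertex sets containing \<open>U0\<close>, and
    not just for one, so that two elements have a common unit.\<close>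
  let ?P = "\<lambda>x. \<exists>U0. finite U0 \<and> U0 \<subseteq> verts G \<and> (\<forall>U. finite U \<and> U0 \<subseteq> U \<and> U \<subseteq> verts G \<longrightarrow> B.eqv ((\<Sum>v\<in>U. B.V v) * x) x)"
  have g: "?P (gen g)" for g
  proof (cases "(gen g :: ('a, 'b, 'k) lpa_free) \<in> rel_free")
    case True
    have "B.eqv (a * gen g) (gen g)" for a
      unfolding B.eqv_def by (intro idl_diff[OF idl_rel_free] idl_left[OF idl_rel_free] True)
    then show ?thesis by (intro exI[of _ "{}"]) simp
  next
    case False
    then have "g \<in> lpa_gens G" using B.outside by blast
    then have "\<exists>v\<in>verts G. B.eqv (B.V v * gen g) (gen g)"
    proof (unfold lpa_gens_def, elim UnE imageE)
      fix v assume v: "g = Vtx v" "v \<in> verts G"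
      show ?thesis unfolding v(1) by (rule bexI[OF _ v(2)]) (use B.V_V[OF v(2) v(2)] in simp)
    next
      fix e assume e: "g = Edg e" "e \<in> arcs G"
      show ?thesis unfolding e(1) by (rule bexI[OF _ tail_in_verts[OF e(2)]]) (rule B.V_A[OF e(2)])
    next
      fix e assume e: "g = Ghost e" "e \<in> arcs G"
      show ?thesis unfolding e(1) by (rule bexI[OF _ head_in_verts[OF e(2)]]) (rule B.V_B[OF e(2)])
    qed
    then obtain v where v: "v \<in> verts G" "B.eqv (B.V v * gen g) (gen g)" by blast
    have "B.eqv ((\<Sum>u\<in>U. B.V u) * gen g) (gen g)" if U: "finite U" "{v} \<subseteq> U" "U \<subseteq> verts G" for U
    proof -
      have "B.eqv ((\<Sum>u\<in>U. B.V u) * gen g) ((\<Sum>u\<in>U. B.V u) * (B.V v * gen g))"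
        by (rule B.eqv_left[OF B.eqv_sym[OF v(2)]])
      also have "\<dots> = (\<Sum>u\<in>U. (B.V u * B.V v)) * gen g" by (simp add: sum_distrib_right mult.assoc)
      also have "B.eqv \<dots> ((\<Sum>u\<in>U. if u = v then B.V u else 0) * gen g)"
        by (intro B.eqv_right B.eqv_sum B.V_V) (use U v in auto)
      also have "\<dots> = B.V v * gen g" using U by simp
      also note v(2)
      finally show ?thesis .
    qed
    then show ?thesis using v(1) by (intro exI[of _ "{v}"]) simp
  qed
  have "?P x" using assms
  proof (induction x rule: aug_induct)
    case zero
    show ?case by (intro exI[of _ "{}"]) simp
  next
    case (gen g)
    show ?case by (rule g)
  next
    case (add x y)
    from add(1) obtain U1 where 1: "finite U1" "U1 \<subseteq> verts G"
      "\<forall>U. finite U \<and> U1 \<subseteq> U \<and> U \<subseteq> verts G \<longrightarrow> B.eqv ((\<Sum>v\<in>U. B.V v) * x) x"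
      by (elim exE conjE) (rule that)
    from add(2) obtain U2 where 2: "finite U2" "U2 \<subseteq> verts G"
      "\<forall>U. finite U \<and> U2 \<subseteq> U \<and> U \<subseteq> verts G \<longrightarrow> B.eqv ((\<Sum>v\<in>U. B.V v) * y) y"
      by (elim exE conjE) (rule that)
    have "B.eqv ((\<Sum>v\<in>U. B.V v) * (x + y)) (x + y)" if "finite U" "U1 \<union> U2 \<subseteq> U" "U \<subseteq> verts G" for U
      unfolding distrib_left
      by (intro B.eqv_add 1(3)[rule_format] 2(3)[rule_format] conjI that(1,3)) (use that(2) in simp_all)
    then show ?case using 1(1,2) 2(1,2) by (intro exI[of _ "U1 \<union> U2"]) simp
  next
    case (const x k)
    then obtain U1 where 1: "finite U1" "U1 \<subseteq> verts G"
      "\<forall>U. finite U \<and> U1 \<subseteq> U \<and> U \<subseteq> verts G \<longrightarrow> B.eqv ((\<Sum>v\<in>U. B.V v) * x) x"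
      by (elim exE conjE) (rule that)
    have "B.eqv ((\<Sum>v\<in>U. B.V v) * (const k * x)) (const k * x)" if "finite U" "U1 \<subseteq> U" "U \<subseteq> verts G" for U
    proof -
      have "(\<Sum>v\<in>U. B.V v) * (const k * x) = const k * ((\<Sum>v\<in>U. B.V v) * x)"
        unfolding mult.assoc[symmetric] const_central[of k "\<Sum>v\<in>U. B.V v"] ..
      moreover have "B.eqv (const k * ((\<Sum>v\<in>U. B.V v) * x)) (const k * x)"
        by (intro B.eqv_left 1(3)[rule_format] conjI that)
      ultimately show ?thesis by simp
    qed
    then show ?case using 1(1,2) by (intro exI[of _ U1]) simp
  next
    case (left x h)
    from g[of h] obtain U0 where U0: "finite U0" "U0 \<subseteq> verts G"
      "\<forall>U. finite U \<and> U0 \<subseteq> U \<and> U \<subseteq> verts G \<longrightarrow> B.eqv ((\<Sum>v\<in>U. B.V v) * gen h) (gen h)"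
      by (elim exE conjE) (rule that)
    have "B.eqv ((\<Sum>v\<in>U. B.V v) * (gen h * x)) (gen h * x)" if "finite U \<and> U0 \<subseteq> U \<and> U \<subseteq> verts G" for U
      unfolding mult.assoc[symmetric] by (rule B.eqv_right[OF U0(3)[rule_format, OF that]])
    then show ?case using U0(1,2) by (intro exI[of _ U0]) simp
  qed
  then obtain U where U: "finite U" "U \<subseteq> verts G"
    "\<forall>U'. finite U' \<and> U \<subseteq> U' \<and> U' \<subseteq> verts G \<longrightarrow> B.eqv ((\<Sum>v\<in>U'. B.V v) * x) x"
    by (elim exE conjE) (rule that)
  show thesis
  proof (rule that)
    show "(\<Sum>v\<in>U. B.V v) \<in> aug" by (rule idl_sum[OF idl_aug gen_aug])
    show "(\<Sum>v\<in>U. B.V v) * x - x \<in> rel_free" using U unfolding B.eqv_def by simp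
  qed
qed


section \<open>The correspondence of ideals\<close>

definition pre :: "('a, 'b, 'k::field) lpa_elem set \<Rightarrow> ('a, 'b, 'k) lpa_free set" where
  "pre I = {x \<in> aug. lpa_class G (trunc G x) \<in> I}"

definition lpa_of :: "('a, 'b, 'k::field) lpa_free set \<Rightarrow> ('a, 'b, 'k) lpa_elem set" where
  "lpa_of J = lpa_class G ` (J \<inter> fcarrier G)"

lemma class_trunc_eq: "x - y \<in> rel_free \<Longrightarrow> lpa_class G (trunc G x) = lpa_class G (trunc G y)"
  unfolding class_eq_iff rel_free_def by (simp add: trunc_diff)

lemma pre_aug: "pre I \<subseteq> aug"
  unfolding pre_def by blast

lemma base_pre:
  fixes I :: "('a, 'b, 'k::field) lpa_elem set"
  assumes I: "two_sided_ideal (LPA G) I"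
  shows "base_relations G \<subseteq> pre I"
proof
  fix x :: "('a, 'b, 'k) lpa_free"
  assume x: "x \<in> base_relations G"
  have "lpa_class G (trunc G x) = lpa_class G (trunc G 0)"
    by (rule class_trunc_eq) (use x base_rel_free in auto)
  then have "lpa_class G (trunc G x) = \<zero>\<^bsub>LPA G\<^esub>" by (simp add: LPA_zero)
  then show "x \<in> pre I" using two_sided_idealD(2)[OF I] base_relations_aug x unfolding pre_def by auto
qed

lemma pre_left_aug:
  assumes I: "two_sided_ideal (LPA G) I" and x: "x \<in> pre I" and a: "a \<in> aug"
  shows "a * x \<in> pre I" "x * a \<in> pre I"
proof -
  have xa: "x \<in> aug" "lpa_class G (trunc G x) \<in> I" using x unfolding pre_def by auto
  have c: "trunc G x \<in> fcarrier G" "trunc G a \<in> fcarrier G" using trunc_fcarrier xa(1) a by blast+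
  have "lpa_class G (trunc G a) \<in> carrier (LPA G)" unfolding LPA_carrier using c(2) by blast
  from two_sided_idealD(4,5)[OF I xa(2) this]
  show "a * x \<in> pre I" "x * a \<in> pre I"
    unfolding pre_def LPA_mult[OF c] LPA_mult[OF c(2,1)]
    by (simp_all add: trunc_mult idl_left[OF idl_aug] idl_right[OF idl_aug] xa(1))
qed

text \<open>Ring ideals of the Leavitt path algebra are subspaces because of the local units.\<close>
lemma pre_const:
  assumes I: "two_sided_ideal (LPA G) I" and x: "x \<in> pre I"
  shows "const k * x \<in> pre I"
proof -
  have xa: "x \<in> aug" using x pre_aug by blast
  obtain u where u: "u \<in> aug" "u * x - x \<in> rel_free" using local_unit[OF xa] .
  have "const k * u * x \<in> pre I"
    by (rule pre_left_aug[OF I x]) (rule idl_left[OF idl_aug u(1)])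
  moreover have "const k * u * x - const k * x \<in> rel_free"
    using idl_left[OF idl_rel_free u(2), of "const k"] by (simp add: right_diff_distrib mult.assoc)
  ultimately show ?thesis
    using class_trunc_eq[of "const k * u * x" "const k * x"] idl_left[OF idl_aug xa]
    unfolding pre_def by simp
qed

lemma idl_pre:
  assumes I: "two_sided_ideal (LPA G) (I :: ('a, 'b, 'k::field) lpa_elem set)"
  shows "idl (pre I)"
proof (rule idlI)
  show "0 \<in> pre I"
    using two_sided_idealD(2)[OF I] unfolding pre_def by (simp add: LPA_zero idl_zero[OF idl_aug])
  show add: "x + y \<in> pre I" if "x \<in> pre I" "y \<in> pre I" for x y
    using two_sided_idealD(3)[OF I, of "lpa_class G (trunc G x)" "lpa_class G (trunc G y)"] that
    unfolding pre_def LPA_add by (simp add: trunc_add idl_add[OF idl_aug])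
  fix x a :: "('a, 'b, 'k) lpa_free"
  assume x: "x \<in> pre I"
  obtain k y where a: "y \<in> aug" "a = const k + y" using free_decompose by blast
  show "a * x \<in> pre I" unfolding a(2) distrib_right
    by (intro add pre_const[OF I x] pre_left_aug[OF I x a(1)])
  show "x * a \<in> pre I" unfolding a(2) distrib_left const_central[of k x, symmetric]
    by (intro add pre_const[OF I x] pre_left_aug[OF I x a(1)])
qed

lemma lpa_of_pre:
  assumes I: "two_sided_ideal (LPA G) I"
  shows "lpa_of (pre I) = I"
proof (intro equalityI subsetI)
  fix X assume "X \<in> lpa_of (pre I)"
  then show "X \<in> I" unfolding lpa_of_def pre_def by (auto simp: trunc_id)
next
  fix X assume X: "X \<in> I"
  then obtain x where x: "x \<in> fcarrier G" "X = lpa_class G x"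
    using two_sided_idealD(1)[OF I] unfolding LPA_carrier by blast
  then have "x \<in> pre I" using X unfolding pre_def by (simp add: trunc_id fcarrier_aug)
  then show "X \<in> lpa_of (pre I)" using x unfolding lpa_of_def by blast
qed

lemma lpa_of_mem:
  assumes J: "idl J" "base_relations G \<subseteq> J" and x: "x \<in> fcarrier G"
  shows "lpa_class G x \<in> lpa_of J \<longleftrightarrow> x \<in> J"
proof
  assume "lpa_class G x \<in> lpa_of J"
  then obtain y where y: "y \<in> J" "y \<in> fcarrier G" "lpa_class G x = lpa_class G y" unfolding lpa_of_def by blast
  then have "x - y \<in> rel_free" using R_iff fcarrier_closed(3)[OF x y(2)] unfolding class_eq_iff by blast
  then have "x - y \<in> J" using rel_free_least[OF J] by blast
  then have "x - y + y \<in> J" using y(1) by (rule idl_add[OF J(1)])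
  then show "x \<in> J" by simp
next
  assume "x \<in> J"
  then show "lpa_class G x \<in> lpa_of J" using x unfolding lpa_of_def by blast
qed

lemma pre_lpa_of:
  assumes J: "idl J" "base_relations G \<subseteq> J" "J \<subseteq> aug"
  shows "pre (lpa_of J) = J"
proof -
  have "x \<in> pre (lpa_of J) \<longleftrightarrow> x \<in> J" if x: "x \<in> aug" for x
  proof -
    have "x \<in> pre (lpa_of J) \<longleftrightarrow> trunc G x \<in> J"
      unfolding pre_def using lpa_of_mem[OF J(1,2) trunc_fcarrier[OF x]] x by simp
    also have "\<dots> \<longleftrightarrow> x \<in> J"
      using idl_add[OF J(1) trunc_idl[OF J(1,2), of x], of "trunc G x"] idl_diff[OF J(1), of x "x - trunc G x"]
        trunc_idl[OF J(1,2), of x] by auto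
    finally show ?thesis .
  qed
  then show ?thesis using pre_aug[of "lpa_of J"] J(3) by blast
qed

lemma lpa_of_ideal:
  fixes J :: "('a, 'b, 'k::field) lpa_free set"
  assumes J: "idl J"
  shows "two_sided_ideal (LPA G) (lpa_of J)"
proof (rule two_sided_idealI)
  show "lpa_of J \<subseteq> carrier (LPA G)" unfolding lpa_of_def LPA_carrier by blast
  show "\<zero>\<^bsub>LPA G\<^esub> \<in> lpa_of J"
    unfolding lpa_of_def LPA_zero using idl_zero[OF J] fcarrier_closed(1) by blast
  fix X Y :: "('a, 'b, 'k) lpa_elem"
  assume X: "X \<in> lpa_of J"
  then obtain x where x: "x \<in> J" "x \<in> fcarrier G" "X = lpa_class G x" unfolding lpa_of_def by blast
  show "\<ominus>\<^bsub>LPA G\<^esub> X \<in> lpa_of J"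
    unfolding x(3) LPA_a_inv[OF x(2)] lpa_of_def using idl_uminus[OF J x(1)] fcarrier_uminus[OF x(2)] by blast
  {
    assume "Y \<in> lpa_of J"
    then obtain y where y: "y \<in> J" "y \<in> fcarrier G" "Y = lpa_class G y" unfolding lpa_of_def by blast
    show "X \<oplus>\<^bsub>LPA G\<^esub> Y \<in> lpa_of J"
      unfolding x(3) y(3) LPA_add lpa_of_def using idl_add[OF J x(1) y(1)] fcarrier_closed(2)[OF x(2) y(2)] by blast
  next
    assume "Y \<in> carrier (LPA G)"
    then obtain y where y: "y \<in> fcarrier G" "Y = lpa_class G y" unfolding LPA_carrier by blast
    show "Y \<otimes>\<^bsub>LPA G\<^esub> X \<in> lpa_of J"
      unfolding x(3) y(2) LPA_mult[OF y(1) x(2)] lpa_of_def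
      using idl_left[OF J x(1)] fcarrier_closed(4)[OF y(1) x(2)] by blast
    show "X \<otimes>\<^bsub>LPA G\<^esub> Y \<in> lpa_of J"
      unfolding x(3) y(2) LPA_mult[OF x(2) y(1)] lpa_of_def
      using idl_right[OF J x(1)] fcarrier_closed(4)[OF x(2) y(1)] by blast
  }
qed

lemma pre_mono: "I \<subseteq> I' \<Longrightarrow> pre I \<subseteq> pre I'"
  unfolding pre_def by blast

lemma lpa_of_mono: "J \<subseteq> J' \<Longrightarrow> lpa_of J \<subseteq> lpa_of J'"
  unfolding lpa_of_def by blast

lemma lpa_of_aug: "lpa_of aug = carrier (LPA G)"
  unfolding lpa_of_def LPA_carrier using fcarrier_aug by blast

lemma proper_pre:
  assumes "two_sided_ideal (LPA G) I"
  shows "proper_ideal (LPA G) I \<longleftrightarrow> pre I \<noteq> aug"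
proof -
  have "pre (carrier (LPA G)) = aug" unfolding pre_def LPA_carrier using trunc_fcarrier by blast
  then show ?thesis using assms lpa_of_pre[OF assms] lpa_of_aug unfolding proper_ideal_def by metis
qed

text \<open>The set of all ideals properly above \<open>I\<close> is decisive: an element of its
  intersection outside \<open>I\<close> obstructs every other set of larger ideals as well, the
  empty one included.\<close>

lemma completely_irreducible_iff:
  assumes I: "proper_ideal (LPA G) (I :: ('a, 'b, 'k::field) lpa_elem set)"
  shows "completely_irreducible (LPA G) I \<longleftrightarrow>
    (\<exists>z. z \<in> aug \<and> z \<notin> pre I \<and> (\<forall>J. idl J \<and> pre I \<subset> J \<and> J \<subseteq> aug \<longrightarrow> z \<in> J))"
proof
  have tI: "two_sided_ideal (LPA G) I" using I unfolding proper_ideal_def by blast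
  {
    assume ci: "completely_irreducible (LPA G) I"
    define \<J> where "\<J> = {J. two_sided_ideal (LPA G) J \<and> I \<subset> J}"
    have "carrier (LPA G) \<inter> \<Inter>\<J> \<noteq> I" 
    proof -
      have "\<forall>J\<in>\<J>. two_sided_ideal (LPA G) J \<and> I \<subset> J" unfolding \<J>_def by simp
      with ci[unfolded completely_irreducible_def, THEN conjunct2, rule_format, of \<J>] show ?thesis by simp
    qed
    moreover have "I \<subseteq> carrier (LPA G) \<inter> \<Inter>\<J>" using two_sided_idealD(1)[OF tI] unfolding \<J>_def by blast
    ultimately obtain Z where Z: "Z \<in> carrier (LPA G)" "Z \<in> \<Inter>\<J>" "Z \<notin> I" by blast
    obtain z where z: "z \<in> fcarrier G" "Z = lpa_class G z" using Z(1) unfolding LPA_carrier by blast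
    have nz: "z \<notin> pre I" using Z(3) z unfolding pre_def by (simp add: trunc_id)
    have zJ: "z \<in> J" if J: "idl J" "pre I \<subset> J" "J \<subseteq> aug" for J
    proof -
      have b: "base_relations G \<subseteq> J" using base_pre[OF tI] J(2) by blast
      have "I \<subset> lpa_of J"
      proof (rule psubsetI)
        have "pre I \<subseteq> J" using J(2) by (rule psubset_imp_subset)
        from lpa_of_mono[OF this] show "I \<subseteq> lpa_of J" unfolding lpa_of_pre[OF tI] .
        show "I \<noteq> lpa_of J"
        proof
          assume "I = lpa_of J"
          from arg_cong[OF this, of pre] have "pre I = J" unfolding pre_lpa_of[OF J(1) b J(3)] .
          then show False using J(2) by simp
        qed
      qed
      then have "lpa_of J \<in> \<J>" using lpa_of_ideal[OF J(1)] unfolding \<J>_def by simp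
      then have "Z \<in> lpa_of J" using Z(2) by (rule InterD[rotated])
      then show ?thesis using lpa_of_mem[OF J(1) b z(1)] z(2) by simp
    qed
    show "\<exists>z. z \<in> aug \<and> z \<notin> pre I \<and> (\<forall>J. idl J \<and> pre I \<subset> J \<and> J \<subseteq> aug \<longrightarrow> z \<in> J)"
      by (intro exI[of _ z] conjI allI impI fcarrier_aug[OF z(1)] nz) (elim conjE, rule zJ)
  next
    assume "\<exists>z. z \<in> aug \<and> z \<notin> pre I \<and> (\<forall>J. idl J \<and> pre I \<subset> J \<and> J \<subseteq> aug \<longrightarrow> z \<in> J)"
    then obtain z where z: "z \<in> aug" "z \<notin> pre I" "\<And>J. idl J \<Longrightarrow> pre I \<subset> J \<Longrightarrow> J \<subseteq> aug \<Longrightarrow> z \<in> J" by blast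
    show "completely_irreducible (LPA G) I"
      unfolding completely_irreducible_def
    proof (intro conjI allI impI I)
      fix \<J> assume \<J>: "\<forall>J\<in>\<J>. two_sided_ideal (LPA G) J \<and> I \<subset> J"
      have "lpa_class G (trunc G z) \<in> J" if J: "J \<in> \<J>" for J
      proof -
        have tJ: "two_sided_ideal (LPA G) J" "I \<subset> J" using \<J> J by auto
        have "pre I \<subseteq> pre J" using tJ(2) by (intro pre_mono) blast
        moreover have "pre I \<noteq> pre J" 
        proof
          assume "pre I = pre J"
          from arg_cong[OF this, of lpa_of] have "I = J" unfolding lpa_of_pre[OF tI] lpa_of_pre[OF tJ(1)] .
          then show False using tJ(2) by simp
        qed
        ultimately have "z \<in> pre J" by (intro z(3)[OF idl_pre[OF tJ(1)] _ pre_aug]) (rule psubsetI)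
        then show ?thesis unfolding pre_def by simp
      qed
      moreover have "lpa_class G (trunc G z) \<in> carrier (LPA G)"
        unfolding LPA_carrier using trunc_fcarrier[OF z(1)] by blast
      moreover have "lpa_class G (trunc G z) \<notin> I" using z(1,2) unfolding pre_def by simp
      ultimately have "lpa_class G (trunc G z) \<in> carrier (LPA G) \<inter> \<Inter>\<J>" "lpa_class G (trunc G z) \<notin> I" by simp_all
      then show "carrier (LPA G) \<inter> \<Inter>\<J> \<noteq> I" by metis
    qed
  }
qed

section \<open>Products, prime ideals and powers\<close>

lemma ideal_prod_pre:
  assumes I: "two_sided_ideal (LPA G) I1" "two_sided_ideal (LPA G) I2"
    and x: "x \<in> pre I1" "y \<in> pre I2" and sub: "ideal_prod (LPA G) I1 I2 \<subseteq> P"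
  shows "x * y \<in> pre P"
proof -
  have xy: "x \<in> aug" "y \<in> aug" "lpa_class G (trunc G x) \<in> I1" "lpa_class G (trunc G y) \<in> I2"
    using x unfolding pre_def by auto
  have "lpa_class G (trunc G x) \<otimes>\<^bsub>LPA G\<^esub> lpa_class G (trunc G y) \<in> P"
    using ideal_prod.prod[OF xy(3,4)] sub by blast
  then show ?thesis
    unfolding pre_def LPA_mult[OF trunc_fcarrier[OF xy(1)] trunc_fcarrier[OF xy(2)]]
    using idl_left[OF idl_aug xy(2)] by (simp add: trunc_mult)
qed

lemma ideal_prod_lpa_of:
  assumes I: "two_sided_ideal (LPA G) I1" "two_sided_ideal (LPA G) I2" and J: "idl J"
    and prod: "\<And>x y. x \<in> pre I1 \<Longrightarrow> y \<in> pre I2 \<Longrightarrow> x * y \<in> J"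
  shows "ideal_prod (LPA G) I1 I2 \<subseteq> lpa_of J"
proof
  fix Z assume "Z \<in> ideal_prod (LPA G) I1 I2"
  then show "Z \<in> lpa_of J"
  proof (induction rule: ideal_prod.induct)
    case (prod X Y)
    obtain x where x: "x \<in> fcarrier G" "X = lpa_class G x"
      using two_sided_idealD(1)[OF I(1)] prod(1) unfolding LPA_carrier by blast
    obtain y where y: "y \<in> fcarrier G" "Y = lpa_class G y"
      using two_sided_idealD(1)[OF I(2)] prod(2) unfolding LPA_carrier by blast
    have "x \<in> pre I1" "y \<in> pre I2" using x y prod unfolding pre_def by (simp_all add: trunc_id fcarrier_aug)
    then have "x * y \<in> J" by (rule assms(4))
    then show ?case unfolding x(2) y(2) LPA_mult[OF x(1) y(1)] lpa_of_def
      using fcarrier_closed(4)[OF x(1) y(1)] by blast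
  next
    case (sum X Y)
    then show ?case using two_sided_idealD(3)[OF lpa_of_ideal[OF J]] by blast
  qed
qed

lemma prime_idealI:
  assumes P: "proper_ideal (LPA G) P"
    and prime: "\<And>J1 J2. \<lbrakk>idl J1; idl J2; J1 \<subseteq> aug; J2 \<subseteq> aug;
      \<And>x y. x \<in> J1 \<Longrightarrow> y \<in> J2 \<Longrightarrow> x * y \<in> pre P\<rbrakk> \<Longrightarrow> J1 \<subseteq> pre P \<or> J2 \<subseteq> pre P"
  shows "prime_ideal (LPA G) P"
  unfolding prime_ideal_def
proof (intro conjI allI impI P)
  have tP: "two_sided_ideal (LPA G) P" using P unfolding proper_ideal_def by blast
  fix I1 I2 assume "two_sided_ideal (LPA G) I1 \<and> two_sided_ideal (LPA G) I2 \<and> ideal_prod (LPA G) I1 I2 \<subseteq> P"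
  then have I: "two_sided_ideal (LPA G) I1" "two_sided_ideal (LPA G) I2" "ideal_prod (LPA G) I1 I2 \<subseteq> P" by auto
  have "pre I1 \<subseteq> pre P \<or> pre I2 \<subseteq> pre P"
    by (rule prime[OF idl_pre[OF I(1)] idl_pre[OF I(2)] pre_aug pre_aug ideal_prod_pre[OF I(1,2) _ _ I(3)]])
  then show "I1 \<subseteq> P \<or> I2 \<subseteq> P"
    using lpa_of_mono[of "pre I1" "pre P"] lpa_of_mono[of "pre I2" "pre P"]
    unfolding lpa_of_pre[OF I(1)] lpa_of_pre[OF I(2)] lpa_of_pre[OF tP] by (elim disjE) simp_all
qed

lemma prime_idealD:
  assumes P: "prime_ideal (LPA G) P"
    and J: "idl J1" "idl J2" "pre P \<subseteq> J1" "pre P \<subseteq> J2" "J1 \<subseteq> aug" "J2 \<subseteq> aug"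
    and prod: "\<And>x y. x \<in> J1 \<Longrightarrow> y \<in> J2 \<Longrightarrow> x * y \<in> pre P"
  shows "J1 \<subseteq> pre P \<or> J2 \<subseteq> pre P"
proof -
  have tP: "two_sided_ideal (LPA G) P" using P unfolding prime_ideal_def proper_ideal_def by blast
  have b: "base_relations G \<subseteq> J1" "base_relations G \<subseteq> J2" using base_pre[OF tP] J by auto
  note e = pre_lpa_of[OF J(1) b(1) J(5)] pre_lpa_of[OF J(2) b(2) J(6)]
  have "ideal_prod (LPA G) (lpa_of J1) (lpa_of J2) \<subseteq> lpa_of (pre P)"
  proof (rule ideal_prod_lpa_of[OF lpa_of_ideal[OF J(1)] lpa_of_ideal[OF J(2)] idl_pre[OF tP]])
    show "x * y \<in> pre P" if "x \<in> pre (lpa_of J1)" "y \<in> pre (lpa_of J2)" for x y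
      using that unfolding e by (rule prod)
  qed
  then have "ideal_prod (LPA G) (lpa_of J1) (lpa_of J2) \<subseteq> P" unfolding lpa_of_pre[OF tP] .
  moreover note P[unfolded prime_ideal_def, THEN conjunct2, rule_format, of "lpa_of J1" "lpa_of J2"]
  ultimately have "lpa_of J1 \<subseteq> P \<or> lpa_of J2 \<subseteq> P" using lpa_of_ideal[OF J(1)] lpa_of_ideal[OF J(2)] by simp
  then show ?thesis
    using pre_mono[of "lpa_of J1" P] pre_mono[of "lpa_of J2" P] unfolding e by (elim disjE) simp_all
qed

lemma LPA_cases:
  fixes X :: "('a, 'b, 'k::field) lpa_elem"
  assumes "X \<in> carrier (LPA G)"
  obtains x where "x \<in> fcarrier G" "X = lpa_class G x"
  using assms unfolding LPA_carrier by blast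

lemma LPA_ring:
  fixes X Y Z :: "('a, 'b, 'k::field) lpa_elem"
  assumes "X \<in> carrier (LPA G)" "Y \<in> carrier (LPA G)" "Z \<in> carrier (LPA G)"
  shows "X \<otimes>\<^bsub>LPA G\<^esub> (Y \<otimes>\<^bsub>LPA G\<^esub> Z) = X \<otimes>\<^bsub>LPA G\<^esub> Y \<otimes>\<^bsub>LPA G\<^esub> Z"
    "X \<otimes>\<^bsub>LPA G\<^esub> (Y \<oplus>\<^bsub>LPA G\<^esub> Z) = X \<otimes>\<^bsub>LPA G\<^esub> Y \<oplus>\<^bsub>LPA G\<^esub> X \<otimes>\<^bsub>LPA G\<^esub> Z"
    "(X \<oplus>\<^bsub>LPA G\<^esub> Y) \<otimes>\<^bsub>LPA G\<^esub> Z = X \<otimes>\<^bsub>LPA G\<^esub> Z \<oplus>\<^bsub>LPA G\<^esub> Y \<otimes>\<^bsub>LPA G\<^esub> Z"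
    "\<ominus>\<^bsub>LPA G\<^esub> (X \<otimes>\<^bsub>LPA G\<^esub> Y) = (\<ominus>\<^bsub>LPA G\<^esub> X) \<otimes>\<^bsub>LPA G\<^esub> Y"
    "\<ominus>\<^bsub>LPA G\<^esub> (X \<oplus>\<^bsub>LPA G\<^esub> Y) = \<ominus>\<^bsub>LPA G\<^esub> X \<oplus>\<^bsub>LPA G\<^esub> \<ominus>\<^bsub>LPA G\<^esub> Y"
proof -
  obtain x where x: "x \<in> fcarrier G" "X = lpa_class G x" using assms(1) by (rule LPA_cases)
  obtain y where y: "y \<in> fcarrier G" "Y = lpa_class G y" using assms(2) by (rule LPA_cases)
  obtain z where z: "z \<in> fcarrier G" "Z = lpa_class G z" using assms(3) by (rule LPA_cases)
  note c = x(1) y(1) z(1) fcarrier_closed(2,4) fcarrier_uminus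
  show "X \<otimes>\<^bsub>LPA G\<^esub> (Y \<otimes>\<^bsub>LPA G\<^esub> Z) = X \<otimes>\<^bsub>LPA G\<^esub> Y \<otimes>\<^bsub>LPA G\<^esub> Z"
    "X \<otimes>\<^bsub>LPA G\<^esub> (Y \<oplus>\<^bsub>LPA G\<^esub> Z) = X \<otimes>\<^bsub>LPA G\<^esub> Y \<oplus>\<^bsub>LPA G\<^esub> X \<otimes>\<^bsub>LPA G\<^esub> Z"
    "(X \<oplus>\<^bsub>LPA G\<^esub> Y) \<otimes>\<^bsub>LPA G\<^esub> Z = X \<otimes>\<^bsub>LPA G\<^esub> Z \<oplus>\<^bsub>LPA G\<^esub> Y \<otimes>\<^bsub>LPA G\<^esub> Z"
    "\<ominus>\<^bsub>LPA G\<^esub> (X \<otimes>\<^bsub>LPA G\<^esub> Y) = (\<ominus>\<^bsub>LPA G\<^esub> X) \<otimes>\<^bsub>LPA G\<^esub> Y"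
    "\<ominus>\<^bsub>LPA G\<^esub> (X \<oplus>\<^bsub>LPA G\<^esub> Y) = \<ominus>\<^bsub>LPA G\<^esub> X \<oplus>\<^bsub>LPA G\<^esub> \<ominus>\<^bsub>LPA G\<^esub> Y"
    unfolding x(2) y(2) z(2)
    by (simp_all add: LPA_mult LPA_add LPA_a_inv c mult.assoc distrib_left distrib_right)
qed

lemma ideal_prod_two_sided:
  fixes I1 I2 :: "('a, 'b, 'k::field) lpa_elem set"
  assumes I: "two_sided_ideal (LPA G) I1" "two_sided_ideal (LPA G) I2"
  shows "two_sided_ideal (LPA G) (ideal_prod (LPA G) I1 I2)"
proof (rule two_sided_idealI)
  note c1 = subsetD[OF two_sided_idealD(1)[OF I(1)]] and c2 = subsetD[OF two_sided_idealD(1)[OF I(2)]]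
  have x_aug: "x * y \<in> aug" if "x \<in> pre I1" "y \<in> pre I2" for x y
    by (rule idl_left[OF idl_aug subsetD[OF pre_aug that(2)]])
  show sub: "ideal_prod (LPA G) I1 I2 \<subseteq> carrier (LPA G)"
    using ideal_prod_lpa_of[OF I idl_aug x_aug] unfolding lpa_of_aug .
  show "\<zero>\<^bsub>LPA G\<^esub> \<in> ideal_prod (LPA G) I1 I2"
  proof -
    have "\<zero>\<^bsub>LPA G\<^esub> \<otimes>\<^bsub>LPA G\<^esub> \<zero>\<^bsub>LPA G\<^esub> \<in> ideal_prod (LPA G) I1 I2"
      by (rule ideal_prod.prod[OF two_sided_idealD(2)[OF I(1)] two_sided_idealD(2)[OF I(2)]])
    then show ?thesis unfolding LPA_zero LPA_mult[OF fcarrier_closed(1) fcarrier_closed(1)] by simp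
  qed
  show "X \<oplus>\<^bsub>LPA G\<^esub> Y \<in> ideal_prod (LPA G) I1 I2"
    if "X \<in> ideal_prod (LPA G) I1 I2" "Y \<in> ideal_prod (LPA G) I1 I2" for X Y
    using that by (rule ideal_prod.sum)
  fix X assume X: "X \<in> ideal_prod (LPA G) I1 I2"
  show "Y \<otimes>\<^bsub>LPA G\<^esub> X \<in> ideal_prod (LPA G) I1 I2" if Y: "Y \<in> carrier (LPA G)" for Y
    using X
  proof (induction rule: ideal_prod.induct)
    case (prod i j)
    show ?case unfolding LPA_ring(1)[OF Y c1[OF prod(1)] c2[OF prod(2)]]
      by (rule ideal_prod.prod[OF two_sided_idealD(4)[OF I(1) prod(1) Y] prod(2)])
  next
    case (sum s1 s2)
    show ?case unfolding LPA_ring(2)[OF Y subsetD[OF sub sum(1)] subsetD[OF sub sum(2)]]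
      by (rule ideal_prod.sum[OF sum(3,4)])
  qed
  show "X \<otimes>\<^bsub>LPA G\<^esub> Y \<in> ideal_prod (LPA G) I1 I2" if Y: "Y \<in> carrier (LPA G)" for Y
    using X
  proof (induction rule: ideal_prod.induct)
    case (prod i j)
    show ?case unfolding LPA_ring(1)[OF c1[OF prod(1)] c2[OF prod(2)] Y, symmetric]
      by (rule ideal_prod.prod[OF prod(1) two_sided_idealD(5)[OF I(2) prod(2) Y]])
  next
    case (sum s1 s2)
    show ?case unfolding LPA_ring(3)[OF subsetD[OF sub sum(1)] subsetD[OF sub sum(2)] Y]
      by (rule ideal_prod.sum[OF sum(3,4)])
  qed
  show "\<ominus>\<^bsub>LPA G\<^esub> X \<in> ideal_prod (LPA G) I1 I2"
    using X
  proof (induction rule: ideal_prod.induct)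
    case (prod i j)
    interpret I1: additive_subgroup I1 "LPA G" using I(1) unfolding two_sided_ideal_def by blast
    interpret L: abelian_group "LPA G :: ('k, ('a, 'b, 'k) lpa_elem) module" by (rule LPA_abelian)
    have "\<ominus>\<^bsub>LPA G\<^esub> i \<in> I1"
      using I1.a_subgroup prod(1) unfolding a_inv_def by (simp add: subgroup.m_inv_closed)
    then show ?case unfolding LPA_ring(4)[OF c1[OF prod(1)] c2[OF prod(2)] c2[OF prod(2)]]
      by (rule ideal_prod.prod[OF _ prod(2)])
  next
    case (sum s1 s2)
    show ?case unfolding LPA_ring(5)[OF subsetD[OF sub sum(1)] subsetD[OF sub sum(2)] subsetD[OF sub sum(2)]]
      by (rule ideal_prod.sum[OF sum(3,4)])
  qed
qed

lemma ideal_power_two_sided: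
  fixes P :: "('a, 'b, 'k::field) lpa_elem set"
  assumes "two_sided_ideal (LPA G) P"
  shows "two_sided_ideal (LPA G) (ideal_power (LPA G) P n)"
proof (induction n)
  case 0
  have "two_sided_ideal (LPA G) (lpa_of aug :: ('a, 'b, 'k) lpa_elem set)" by (rule lpa_of_ideal[OF idl_aug])
  then show ?case by (simp add: lpa_of_aug)
next
  case (Suc n)
  show ?case using ideal_prod_two_sided[OF Suc.IH assms] assms by (cases "n = 0") simp_all
qed

end

section \<open>The grading\<close>

definition word_degree :: "('v, 'e) lpa_gen list \<Rightarrow> int" where
  "word_degree w = (\<Sum>g\<leftarrow>w. case g of Vtx _ \<Rightarrow> 0 | Edg _ \<Rightarrow> 1 | Ghost _ \<Rightarrow> -1)"

lemma word_degree_append [simp]: "word_degree (u @ v) = word_degree u + word_degree v"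
  by (simp add: word_degree_def)

definition hom :: "int \<Rightarrow> ('v, 'e, 'k::field) lpa_free \<Rightarrow> ('v, 'e, 'k) lpa_free" where
  "hom n = restrict_words (\<lambda>w. word_degree w = n)"

definition homogeneous :: "int \<Rightarrow> ('v, 'e, 'k::field) lpa_free \<Rightarrow> bool" where
  "homogeneous n x \<longleftrightarrow> (\<forall>w\<in>Poly_Mapping.keys x. word_degree w = n)"

lemma hom_simps:
  "hom n (x + y) = hom n x + hom n y" "hom n (x - y) = hom n x - hom n y" "hom n 0 = 0"
  "hom n (sum f A) = (\<Sum>i\<in>A. hom n (f i))"
  "hom n (Poly_Mapping.single w k) = (if word_degree w = n then Poly_Mapping.single w k else 0)"
  unfolding hom_def
  by (simp_all add: restrict_words_add restrict_words_diff restrict_words_sum restrict_words_single)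

lemma homogeneous_hom: "homogeneous d x \<Longrightarrow> hom n x = (if n = d then x else 0)"
  by (rule poly_mapping_eqI) (auto simp: homogeneous_def hom_def lookup_restrict_words in_keys_iff)

lemma hom_homogeneous: "homogeneous n (hom n x)"
  unfolding homogeneous_def hom_def keys_restrict_words by simp

lemma homogeneous_0: "homogeneous n 0"
  by (simp add: homogeneous_def)

lemma homogeneous_add: "homogeneous n x \<Longrightarrow> homogeneous n y \<Longrightarrow> homogeneous n (x + y)"
  unfolding homogeneous_def using keys_add[of x y] by blast

lemma homogeneous_diff: "homogeneous n x \<Longrightarrow> homogeneous n y \<Longrightarrow> homogeneous n (x - y)"
  unfolding homogeneous_def by (auto simp: in_keys_iff lookup_minus)

lemma homogeneous_sum: "(\<And>i. i \<in> A \<Longrightarrow> homogeneous n (f i)) \<Longrightarrow> homogeneous n (sum f A)"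
  by (induction A rule: infinite_finite_induct) (auto intro: homogeneous_0 homogeneous_add)

lemma homogeneous_mult: "homogeneous m x \<Longrightarrow> homogeneous n y \<Longrightarrow> homogeneous (m + n) (x * y)"
  unfolding homogeneous_def
proof
  fix w assume x: "\<forall>w\<in>Poly_Mapping.keys x. word_degree w = m" and y: "\<forall>w\<in>Poly_Mapping.keys y. word_degree w = n"
    and "w \<in> Poly_Mapping.keys (x * y)"
  then obtain u v where "w = u + v" "u \<in> Poly_Mapping.keys x" "v \<in> Poly_Mapping.keys y"
    using keys_mult[of x y] by blast
  then show "word_degree w = m + n" using x y by (simp add: plus_list_def)
qed

lemma homogeneous_gen:
  "homogeneous 0 (gen (Vtx v))" "homogeneous 1 (gen (Edg e))" "homogeneous (-1) (gen (Ghost e))"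
  by (simp_all add: homogeneous_def gen_def word_degree_def)

lemma homogeneous_const: "homogeneous 0 (const k)"
  by (simp add: homogeneous_def const_def zero_list_def word_degree_def)

lemma homogeneous_const_mult: "homogeneous n x \<Longrightarrow> homogeneous n (const k * x)"
  using homogeneous_mult[OF homogeneous_const] by fastforce

lemma hom_single_mult: "hom n (Poly_Mapping.single w k * x) = Poly_Mapping.single w k * hom (n - word_degree w) x"
  by (induction x rule: poly_mapping_single_induct)
    (auto simp: hom_simps mult_single distrib_left plus_list_def)

lemma hom_mult_single: "hom n (x * Poly_Mapping.single w k) = hom (n - word_degree w) x * Poly_Mapping.single w k"
  by (induction x rule: poly_mapping_single_induct)
    (auto simp: hom_simps mult_single distrib_right plus_list_def)

lemma sum_hom:
  assumes "finite M" "word_degree ` Poly_Mapping.keys x \<subseteq> M"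
  shows "(\<Sum>n\<in>M. hom n x) = x"
proof (rule poly_mapping_eqI)
  fix w
  have "Poly_Mapping.lookup (\<Sum>n\<in>M. hom n x) w = (\<Sum>n\<in>M. if word_degree w = n then Poly_Mapping.lookup x w else 0)"
    unfolding lookup_sum hom_def lookup_restrict_words ..
  also have "\<dots> = (if word_degree w \<in> M then Poly_Mapping.lookup x w else 0)" using assms(1) by simp
  also have "\<dots> = Poly_Mapping.lookup x w"
  proof -
    have "w \<in> Poly_Mapping.keys x \<Longrightarrow> word_degree w \<in> M" using assms(2) by blast
    then show ?thesis by (auto simp: in_keys_iff)
  qed
  finally show "Poly_Mapping.lookup (\<Sum>n\<in>M. hom n x) w = Poly_Mapping.lookup x w" .
qed

text \<open>Multiplying by a word shifts degrees. The set is the largest graded ideal inside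
  \<open>J\<close>, so it is all of \<open>J\<close> once it contains homogeneous
  generators.\<close>

lemma idl_hom_closed:
  assumes J: "idl J"
  shows "idl {x. \<forall>n. hom n x \<in> J}"
proof (rule idlI)
  show "0 \<in> {x. \<forall>n. hom n x \<in> J}" using idl_zero[OF J] by (simp add: hom_simps)
  show "x + y \<in> {x. \<forall>n. hom n x \<in> J}" if "x \<in> {x. \<forall>n. hom n x \<in> J}" "y \<in> {x. \<forall>n. hom n x \<in> J}" for x y
    using that idl_add[OF J] by (simp add: hom_simps)
  fix x a assume x: "x \<in> {x. \<forall>n. hom n x \<in> J}"
  have "hom n (a * x) \<in> J \<and> hom n (x * a) \<in> J" for n
  proof (induction a rule: poly_mapping_single_induct)
    case zero
    then show ?case using idl_zero[OF J] by (simp add: hom_simps)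
  next
    case (single w k)
    have "hom (n - word_degree w) x \<in> J" using x by simp
    then show ?case unfolding hom_single_mult hom_mult_single using idl_left[OF J] idl_right[OF J] by simp
  next
    case (add a b)
    then show ?case using idl_add[OF J] by (simp add: hom_simps distrib_left distrib_right)
  qed
  then show "a * x \<in> {x. \<forall>n. hom n x \<in> J}" "x * a \<in> {x. \<forall>n. hom n x \<in> J}" by simp_all
qed

lemma hom_idl_gen:
  assumes X: "\<And>x. x \<in> X \<Longrightarrow> \<exists>d. homogeneous d x" and x: "x \<in> idl_gen X"
  shows "hom n x \<in> idl_gen X"
proof -
  have "X \<subseteq> {x. \<forall>n. hom n x \<in> idl_gen X}"
  proof
    fix x assume x: "x \<in> X"
    then obtain d where "homogeneous d x" using X by blast
    then show "x \<in> {x. \<forall>n. hom n x \<in> idl_gen X}"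
      using x idl_gen_superset[of X] idl_zero[OF idl_idl_gen] by (auto simp: homogeneous_hom)
  qed
  then have "idl_gen X \<subseteq> {x. \<forall>n. hom n x \<in> idl_gen X}"
    by (rule idl_gen_least[OF idl_hom_closed[OF idl_idl_gen]])
  then show ?thesis using x by blast
qed

lemma homogeneous_base:
  assumes "x \<in> base_relations E"
  shows "\<exists>d. homogeneous d (x :: ('v, 'e, 'k::field) lpa_free)"
proof -
  note m = homogeneous_mult[OF homogeneous_gen(1) homogeneous_gen(1), simplified]
    homogeneous_mult[OF homogeneous_gen(1) homogeneous_gen(2), simplified]
    homogeneous_mult[OF homogeneous_gen(2) homogeneous_gen(1), simplified]
    homogeneous_mult[OF homogeneous_gen(1) homogeneous_gen(3), simplified]
    homogeneous_mult[OF homogeneous_gen(3) homogeneous_gen(1), simplified]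
    homogeneous_mult[OF homogeneous_gen(3) homogeneous_gen(2), simplified]
    homogeneous_mult[OF homogeneous_gen(2) homogeneous_gen(3), simplified]
  have 1: "homogeneous 0 (gen (Vtx v) * gen (Vtx w) - (if v = w then gen (Vtx v) else 0) :: ('v, 'e, 'k) lpa_free)" for v w
    by (intro homogeneous_diff m) (simp add: homogeneous_gen homogeneous_0)
  have 2: "homogeneous 1 (gen (Vtx v) * gen (Edg e) - gen (Edg e) :: ('v, 'e, 'k) lpa_free)" for v e
    by (intro homogeneous_diff m homogeneous_gen)
  have 3: "homogeneous 1 (gen (Edg e) * gen (Vtx v) - gen (Edg e) :: ('v, 'e, 'k) lpa_free)" for v e
    by (intro homogeneous_diff m homogeneous_gen)
  have 4: "homogeneous (-1) (gen (Vtx v) * gen (Ghost e) - gen (Ghost e) :: ('v, 'e, 'k) lpa_free)" for v e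
    by (intro homogeneous_diff m homogeneous_gen)
  have 5: "homogeneous (-1) (gen (Ghost e) * gen (Vtx v) - gen (Ghost e) :: ('v, 'e, 'k) lpa_free)" for v e
    by (intro homogeneous_diff m homogeneous_gen)
  have 6: "homogeneous 0 (gen (Ghost e) * gen (Edg f) - (if e = f then gen (Vtx v) else 0) :: ('v, 'e, 'k) lpa_free)" for v e f
    by (intro homogeneous_diff m) (simp add: homogeneous_gen homogeneous_0)
  have 7: "homogeneous 0 (gen (Vtx v) - (\<Sum>e\<in>A. gen (Edg e) * gen (Ghost e)) :: ('v, 'e, 'k) lpa_free)" for v A
    by (intro homogeneous_diff homogeneous_sum m homogeneous_gen)
  have 8: "\<exists>d. homogeneous d (gen g :: ('v, 'e, 'k) lpa_free)" for g
    by (cases g) (simp_all only:, rule exI, rule homogeneous_gen, rule exI, rule homogeneous_gen, rule exI, rule homogeneous_gen)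
  have *: "x = y \<Longrightarrow> homogeneous d y \<Longrightarrow> ?thesis" for y d by blast
  have **: "x = y \<Longrightarrow> \<exists>d. homogeneous d y \<Longrightarrow> ?thesis" for y by simp
  from assms show ?thesis
    unfolding base_relations_def lpa_relations_def
    by (elim UnE CollectE exE conjE)
      (erule * ** , rule 1 2 3 4 5 6 7 8)+
qed

lemma homogeneous_admissible:
  assumes "x \<in> admissible_relations E H S"
  shows "\<exists>d. homogeneous d (x :: ('v, 'e, 'k::field) lpa_free)"
proof -
  have 1: "homogeneous 0 (gen (Edg e) * gen (Ghost e) :: ('v, 'e, 'k) lpa_free)" for e
    using homogeneous_mult[OF homogeneous_gen(2) homogeneous_gen(3)] by simp
  have 2: "homogeneous 0 (break_free E H v :: ('v, 'e, 'k) lpa_free)" for v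
    unfolding break_free_def live_sum_def by (intro homogeneous_diff homogeneous_sum 1 homogeneous_gen)
  from assms consider "x \<in> base_relations E" | v where "x = gen (Vtx v)" | v where "x = break_free E H v"
    unfolding admissible_relations_def by (elim UnE imageE)
  then show ?thesis
  proof cases
    case 1
    then show ?thesis by (rule homogeneous_base)
  next
    case 2
    then show ?thesis using homogeneous_gen(1) by (intro exI[of _ 0]) simp
  next
    case 3
    then show ?thesis using 2 by (intro exI[of _ 0]) simp
  qed
qed

section \<open>Homogeneous components of the Leavitt path algebra\<close>

context wf_digraph
begin

lemma rel_free_eq: "rel_free = idl_gen (base_relations G :: ('a, 'b, 'k::field) lpa_free set)"
proof
  show "rel_free \<subseteq> idl_gen (base_relations G :: ('a, 'b, 'k::field) lpa_free set)"
    by (rule rel_free_least[OF idl_idl_gen idl_gen_superset])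
  show "idl_gen (base_relations G) \<subseteq> (rel_free :: ('a, 'b, 'k::field) lpa_free set)"
    by (rule idl_gen_least[OF idl_rel_free base_rel_free])
qed

lemma hom_rel_free: "x \<in> rel_free \<Longrightarrow> hom n x \<in> (rel_free :: ('a, 'b, 'k::field) lpa_free set)"
  unfolding rel_free_eq by (rule hom_idl_gen[OF homogeneous_base])

lemma trunc_hom: "trunc G (hom n x) = hom n (trunc G x)"
  by (rule poly_mapping_eqI) (simp add: trunc_def hom_def lookup_restrict_words)

lemma hom_fcarrier: "x \<in> fcarrier G \<Longrightarrow> hom n x \<in> fcarrier G"
  unfolding free_alg_simps hom_def keys_restrict_words by blast

lemma hom_aug: "x \<in> aug \<Longrightarrow> hom n x \<in> aug"
  unfolding aug_def hom_def by (simp add: lookup_restrict_words)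

lemma gen_fcarrier:
  "v \<in> verts G \<Longrightarrow> gen (Vtx v) \<in> fcarrier G" "e \<in> arcs G \<Longrightarrow> gen (Edg e) \<in> fcarrier G"
  "e \<in> arcs G \<Longrightarrow> gen (Ghost e) \<in> fcarrier G"
  by (rule fcarrier_closed(6), simp add: lpa_gens_def)+

lemma path_elem_class:
  assumes "u \<in> verts G" "set p \<subseteq> arcs G"
  shows "path_elem G u p = lpa_class G (gen (Vtx u) * prod_list (map (\<lambda>e. gen (Edg e)) p) :: ('a, 'b, 'k::field) lpa_free)"
    and "gen (Vtx u) * prod_list (map (\<lambda>e. gen (Edg e)) p) \<in> (fcarrier G :: ('a, 'b, 'k) lpa_free set)"
    and "homogeneous (int (length p)) (gen (Vtx u) * prod_list (map (\<lambda>e. gen (Edg e)) p) :: ('a, 'b, 'k) lpa_free)"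
proof -
  have "path_elem G u p = lpa_class G (gen (Vtx u) * prod_list (map (\<lambda>e. gen (Edg e)) p) :: ('a, 'b, 'k) lpa_free) \<and>
    gen (Vtx u) * prod_list (map (\<lambda>e. gen (Edg e)) p) \<in> (fcarrier G :: ('a, 'b, 'k) lpa_free set) \<and>
    homogeneous (int (length p)) (gen (Vtx u) * prod_list (map (\<lambda>e. gen (Edg e)) p) :: ('a, 'b, 'k) lpa_free)"
    using assms(2)
  proof (induction p rule: rev_induct)
    case Nil
    then show ?case using gen_fcarrier(1)[OF assms(1)]
      by (simp add: path_elem_def lpa_vertex_def homogeneous_gen)
  next
    case (snoc e p)
    let ?x = "gen (Vtx u) * prod_list (map (\<lambda>e. gen (Edg e)) p) :: ('a, 'b, 'k) lpa_free"
    have e: "gen (Edg e) \<in> (fcarrier G :: ('a, 'b, 'k) lpa_free set)" using snoc.prems by (intro gen_fcarrier(2)) simp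
    have IH: "path_elem G u p = lpa_class G ?x" "?x \<in> fcarrier G" "homogeneous (int (length p)) ?x"
      using snoc by auto
    have "(path_elem G u (p @ [e]) :: ('a, 'b, 'k) lpa_elem) = path_elem G u p \<otimes>\<^bsub>LPA G\<^esub> lpa_edge G e" by (simp add: path_elem_def)
    then show ?case
      using LPA_mult[OF IH(2) e] fcarrier_closed(4)[OF IH(2) e] homogeneous_mult[OF IH(3) homogeneous_gen(2)]
      by (simp add: IH(1) lpa_edge_def mult.assoc add.commute)
  qed
  then show "path_elem G u p = lpa_class G (gen (Vtx u) * prod_list (map (\<lambda>e. gen (Edg e)) p) :: ('a, 'b, 'k) lpa_free)"
    "gen (Vtx u) * prod_list (map (\<lambda>e. gen (Edg e)) p) \<in> (fcarrier G :: ('a, 'b, 'k) lpa_free set)"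
    "homogeneous (int (length p)) (gen (Vtx u) * prod_list (map (\<lambda>e. gen (Edg e)) p) :: ('a, 'b, 'k) lpa_free)" by auto
qed

lemma ghost_path_elem_class:
  assumes "u \<in> verts G" "set p \<subseteq> arcs G"
  shows "ghost_path_elem G u p = lpa_class G (prod_list (rev (map (\<lambda>e. gen (Ghost e)) p)) * gen (Vtx u) :: ('a, 'b, 'k::field) lpa_free)"
    and "prod_list (rev (map (\<lambda>e. gen (Ghost e)) p)) * gen (Vtx u) \<in> (fcarrier G :: ('a, 'b, 'k) lpa_free set)"
    and "homogeneous (- int (length p)) (prod_list (rev (map (\<lambda>e. gen (Ghost e)) p)) * gen (Vtx u) :: ('a, 'b, 'k) lpa_free)"
proof -
  have "ghost_path_elem G u p = lpa_class G (prod_list (rev (map (\<lambda>e. gen (Ghost e)) p)) * gen (Vtx u) :: ('a, 'b, 'k) lpa_free) \<and>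
    prod_list (rev (map (\<lambda>e. gen (Ghost e)) p)) * gen (Vtx u) \<in> (fcarrier G :: ('a, 'b, 'k) lpa_free set) \<and>
    homogeneous (- int (length p)) (prod_list (rev (map (\<lambda>e. gen (Ghost e)) p)) * gen (Vtx u) :: ('a, 'b, 'k) lpa_free)"
    using assms(2)
  proof (induction p rule: rev_induct)
    case Nil
    then show ?case using gen_fcarrier(1)[OF assms(1)]
      by (simp add: ghost_path_elem_def lpa_vertex_def homogeneous_gen)
  next
    case (snoc e p)
    let ?x = "prod_list (rev (map (\<lambda>e. gen (Ghost e)) p)) * gen (Vtx u) :: ('a, 'b, 'k) lpa_free"
    have e: "gen (Ghost e) \<in> (fcarrier G :: ('a, 'b, 'k) lpa_free set)" using snoc.prems by (intro gen_fcarrier(3)) simp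
    have IH: "ghost_path_elem G u p = lpa_class G ?x" "?x \<in> fcarrier G" "homogeneous (- int (length p)) ?x"
      using snoc by auto
    have "(ghost_path_elem G u (p @ [e]) :: ('a, 'b, 'k) lpa_elem) = lpa_ghost G e \<otimes>\<^bsub>LPA G\<^esub> ghost_path_elem G u p" by (simp add: ghost_path_elem_def)
    then show ?case
      using LPA_mult[OF e IH(2)] fcarrier_closed(4)[OF e IH(2)] homogeneous_mult[OF homogeneous_gen(3) IH(3)]
      by (simp add: IH(1) lpa_ghost_def mult.assoc)
  qed
  then show "ghost_path_elem G u p = lpa_class G (prod_list (rev (map (\<lambda>e. gen (Ghost e)) p)) * gen (Vtx u) :: ('a, 'b, 'k::field) lpa_free)"
    "prod_list (rev (map (\<lambda>e. gen (Ghost e)) p)) * gen (Vtx u) \<in> (fcarrier G :: ('a, 'b, 'k) lpa_free set)"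
    "homogeneous (- int (length p)) (prod_list (rev (map (\<lambda>e. gen (Ghost e)) p)) * gen (Vtx u) :: ('a, 'b, 'k) lpa_free)" by auto
qed

lemma component_homogeneous:
  fixes Z :: "('a, 'b, 'k::field) lpa_elem"
  assumes "Z \<in> lpa_component G n"
  shows "\<exists>h\<in>fcarrier G. homogeneous n h \<and> Z = lpa_class G h"
  using assms unfolding lpa_component_def
proof (induction rule: linear_span.induct)
  case zero
  show ?case using fcarrier_closed(1) homogeneous_0 LPA_zero by blast
next
  case (step X Y c)
  from step(1) obtain u p w q v v' where X: "X = path_elem G u p \<otimes>\<^bsub>LPA G\<^esub> ghost_path_elem G w q"
    "awalk u p v" "awalk w q v'" "int (length p) - int (length q) = n" by blast
  have uw: "u \<in> verts G" "set p \<subseteq> arcs G" "w \<in> verts G" "set q \<subseteq> arcs G"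
    using X(2,3) by (auto simp: awalk_def)
  note P = path_elem_class[OF uw(1,2), where ?'k = 'k] and Q = ghost_path_elem_class[OF uw(3,4), where ?'k = 'k]
  obtain h where h: "h \<in> fcarrier G" "homogeneous n h" "Y = lpa_class G h" using step(3) by blast
  let ?x = "gen (Vtx u) * prod_list (map (\<lambda>e. gen (Edg e)) p) * (prod_list (rev (map (\<lambda>e. gen (Ghost e)) q)) * gen (Vtx w)) :: ('a, 'b, 'k) lpa_free"
  have x: "?x \<in> fcarrier G" "X = lpa_class G ?x" "homogeneous n ?x"
    using fcarrier_closed(4)[OF P(2) Q(2)] LPA_mult[OF P(2) Q(2)] homogeneous_mult[OF P(3) Q(3)] X(1,4)
    by (simp_all add: P(1) Q(1))
  have "c \<odot>\<^bsub>LPA G\<^esub> X \<oplus>\<^bsub>LPA G\<^esub> Y = lpa_class G (const c * ?x + h)"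
    unfolding x(2) h(3) LPA_smult LPA_add ..
  moreover have "const c * ?x + h \<in> fcarrier G" by (intro fcarrier_closed(2,5) x h)
  moreover have "homogeneous n (const c * ?x + h)" by (intro homogeneous_add homogeneous_const_mult x h)
  ultimately show ?case by blast
qed

lemma self_relations:
  "ck_relations G (rel_free :: ('a, 'b, 'k::field) lpa_free set) const (\<lambda>v. gen (Vtx v)) (\<lambda>e. gen (Edg e)) (\<lambda>e. gen (Ghost e))"
proof -
  interpret B: lpa_ideal G "rel_free :: ('a, 'b, 'k) lpa_free set"
    by unfold_locales (rule idl_rel_free, rule base_rel_free)
  show ?thesis
  proof (intro ck_relations.intro ck_relations_axioms.intro)
    show "wf_digraph G" by (rule wf_digraph)
    show "ring_ideal (rel_free :: ('a, 'b, 'k) lpa_free set)" by unfold_locales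
    show "B.eqv (B.V v * B.V v) (B.V v)" if "v \<in> verts G" for v using B.V_V[OF that that] by simp
    show "B.eqv (B.V v * B.V w) 0" if "v \<in> verts G" "w \<in> verts G" "v \<noteq> w" for v w
      using B.V_V[OF that(1,2)] that(3) by simp
    show "B.eqv (B.B e * B.A e) (B.V (head G e))" if "e \<in> arcs G" for e using B.B_A[OF that that] by simp
    show "B.eqv (B.B e * B.A f) 0" if "e \<in> arcs G" "f \<in> arcs G" "e \<noteq> f" for e f
      using B.B_A[OF that(1,2)] that(3) by simp
  qed (rule const_add const_mult const_1 const_central B.V_A B.A_V B.V_B B.B_V B.V_regular; assumption?)+
qed

text \<open>The converse of \<open>component_homogeneous\<close>. Modulo the relations
  \<open>h\<close> is a sum of path terms; taking degree \<open>n\<close> on both sides keeps the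
  terms with the right difference of lengths, because the relation ideal is graded.\<close>

lemma homogeneous_component:
  fixes h :: "('a, 'b, 'k::field) lpa_free"
  assumes h: "h \<in> fcarrier G" "homogeneous n h"
  shows "lpa_class G h \<in> lpa_component G n"
proof -
  interpret B: lpa_ideal G "rel_free :: ('a, 'b, 'k) lpa_free set"
    by unfold_locales (rule idl_rel_free, rule base_rel_free)
  interpret C: ck_relations G "rel_free :: ('a, 'b, 'k) lpa_free set" const B.V B.A B.B
    by (rule self_relations)
  let ?M = "{path_elem G u p \<otimes>\<^bsub>LPA G\<^esub> ghost_path_elem G w q | u p w q.
          (\<exists>v. awalk u p v) \<and> (\<exists>v. awalk w q v) \<and> int (length p) - int (length q) = n} :: ('a, 'b, 'k) lpa_elem set"
  have g: "C.spanned (gen g) \<and> (\<forall>x. C.spanned x \<longrightarrow> C.spanned (gen g * x))" for g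
  proof (cases "g \<in> lpa_gens G")
    case False
    then show ?thesis using B.outside C.spanned_J idl_right[OF idl_rel_free] by blast
  next
    case True
    then show ?thesis unfolding lpa_gens_def
      by (elim UnE imageE)
        (simp_all add: C.spanned_p C.spanned_s C.spanned_t C.spanned_p_mult C.spanned_s_mult C.spanned_t_mult)
  qed
  have "C.spanned h"
    using fcarrier_aug[OF h(1)]
  proof (induction h rule: aug_induct)
    case zero show ?case by (rule C.spanned_0)
  next
    case (gen g) show ?case using g by simp
  next
    case (add x y) then show ?case by (intro C.spanned_add)
  next
    case (const x k) then show ?case by (intro C.spanned_const)
  next
    case (left x g) then show ?case using g by simp
  qed
  then obtain ts where ts: "\<forall>\<tau>\<in>set ts. \<exists>u. C.walk_term u \<tau>" "B.eqv h (C.eval ts)"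
    unfolding C.spanned_def by blast
  have deg: "homogeneous (int (length \<alpha>) - int (length \<beta>)) (C.term_val (k, \<alpha>, v, \<beta>))" for k \<alpha> v \<beta>
  proof -
    have S: "homogeneous (int (length \<alpha>)) (C.S \<alpha>)" for \<alpha>
    proof (induction \<alpha>)
      case Nil
      show ?case using homogeneous_const[of 1] by (simp add: const_1)
    next
      case (Cons e \<alpha>)
      then show ?case using homogeneous_mult[OF homogeneous_gen(2) Cons] by simp
    qed
    have T: "homogeneous (- int (length \<beta>)) (C.T \<beta>)" for \<beta>
    proof (induction \<beta>)
      case Nil
      show ?case using homogeneous_const[of 1] by (simp add: const_1)
    next
      case (Cons e \<beta>)
      have "- int (length (e # \<beta>)) = - int (length \<beta>) + -1" by simp
      then show ?case unfolding C.T_simps(2) using homogeneous_mult[OF Cons homogeneous_gen(3)] by (simp only:)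
    qed
    have "homogeneous (int (length \<alpha>) + (0 + - int (length \<beta>))) (C.S \<alpha> * (B.V v * C.T \<beta>))"
      by (intro homogeneous_mult S T homogeneous_gen)
    then show ?thesis unfolding C.term_val_def by (simp add: homogeneous_const_mult)
  qed
  have trm: "hom n (C.term_val \<tau>) = 0 \<or>
      (\<exists>k. \<exists>X\<in>?M. lpa_class G (trunc G (hom n (C.term_val \<tau>))) = k \<odot>\<^bsub>LPA G\<^esub> X)" if wt: "C.walk_term u \<tau>" for \<tau> u
  proof -
    obtain k \<alpha> v \<beta> where \<tau>: "\<tau> = (k, \<alpha>, v, \<beta>)" by (cases \<tau>)
    obtain w where w: "awalk w \<alpha> v" "awalk u \<beta> v" using wt unfolding \<tau> C.walk_term_def by auto
    show ?thesis
    proof (cases "int (length \<alpha>) - int (length \<beta>) = n")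
      case False
      then have "hom n (C.term_val \<tau>) = 0" unfolding \<tau> using homogeneous_hom[OF deg, of n] by auto
      then show ?thesis by (rule disjI1)
    next
      case True
      then have hom: "hom n (C.term_val \<tau>) = C.term_val \<tau>" unfolding \<tau> using homogeneous_hom[OF deg, of n] by auto
      have aw: "w \<in> verts G" "set \<alpha> \<subseteq> arcs G" "u \<in> verts G" "set \<beta> \<subseteq> arcs G"
        using w by (auto simp: awalk_def)
      note P = path_elem_class[OF aw(1,2), where ?'k = 'k] and Q = ghost_path_elem_class[OF aw(3,4), where ?'k = 'k]
      \<comment> \<open>\<open>path_elem\<close> carries the vertex at the source of the path,
        \<open>term_val\<close> the one at the range.\<close>
      have pS: "B.eqv (B.V w * C.S \<alpha>) (C.S \<alpha> * B.V v)"
        using w(1)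
      proof (induction \<alpha> arbitrary: w)
        case Nil
        then show ?case by (simp add: awalk_simps)
      next
        case (Cons e \<alpha>)
        then have e: "e \<in> arcs G" "w = tail G e" "awalk (head G e) \<alpha> v" by (auto simp: awalk_simps)
        have "B.eqv (B.V w * B.A e * C.S \<alpha>) (B.A e * C.S \<alpha>)"
          unfolding e(2) by (intro B.eqv_right C.p_s e)
        also have "B.eqv \<dots> (B.A e * B.V (head G e) * C.S \<alpha>)"
          by (intro B.eqv_right B.eqv_sym[OF C.s_p] e)
        also have "\<dots> = B.A e * (B.V (head G e) * C.S \<alpha>)" by (simp add: mult.assoc)
        also have "B.eqv \<dots> (B.A e * (C.S \<alpha> * B.V v))" by (intro B.eqv_left Cons.IH e)
        finally show ?case by (simp add: mult.assoc)
      qed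
      let ?x = "B.V w * C.S \<alpha> * (C.T \<beta> * B.V u)"
      have "B.eqv ?x (C.S \<alpha> * B.V v * (C.T \<beta> * B.V u))" by (intro B.eqv_right pS)
      also have "\<dots> = C.S \<alpha> * (B.V v * C.T \<beta> * B.V u)" by (simp add: mult.assoc)
      also have "B.eqv \<dots> (C.S \<alpha> * (B.V v * C.T \<beta>))" by (intro B.eqv_left C.p_T w)
      finally have "B.eqv (const k * ?x) (C.term_val \<tau>)"
        unfolding C.term_val_def \<tau> using B.eqv_left by simp
      then have "lpa_class G (trunc G (const k * ?x)) = lpa_class G (trunc G (C.term_val \<tau>))"
        unfolding B.eqv_def by (rule class_trunc_eq)
      moreover have x: "?x \<in> fcarrier G"
        using fcarrier_closed(4)[OF P(2) Q(2)] unfolding C.S_def C.T_def .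
      ultimately have "lpa_class G (trunc G (C.term_val \<tau>)) = k \<odot>\<^bsub>LPA G\<^esub> lpa_class G ?x"
        unfolding LPA_smult by (simp add: trunc_id[OF fcarrier_closed(5)[OF x]])
      moreover have "lpa_class G ?x = path_elem G w \<alpha> \<otimes>\<^bsub>LPA G\<^esub> ghost_path_elem G u \<beta>"
        unfolding P(1) Q(1) LPA_mult[OF P(2) Q(2)] C.S_def C.T_def ..
      moreover have "path_elem G w \<alpha> \<otimes>\<^bsub>LPA G\<^esub> ghost_path_elem G u \<beta> \<in> ?M" using w True by blast
      ultimately show ?thesis unfolding hom by (intro disjI2 exI[of _ k] bexI) (simp_all only:)
    qed
  qed
  have ev: "lpa_class G (trunc G (hom n (C.eval ts))) \<in> lpa_component G n" if "\<forall>\<tau>\<in>set ts. \<exists>u. C.walk_term u \<tau>" for ts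
    using that
  proof (induction ts)
    case Nil
    then show ?case using linear_span.zero[of "LPA G" ?M] unfolding lpa_component_def by (simp add: hom_simps LPA_zero)
  next
    case (Cons \<tau> ts)
    obtain u where u: "C.walk_term u \<tau>" using bspec[OF Cons.prems, of \<tau>] by auto
    have IH: "lpa_class G (trunc G (hom n (C.eval ts))) \<in> linear_span (LPA G) ?M"
      using Cons unfolding lpa_component_def by simp
    have eq: "lpa_class G (trunc G (hom n (C.eval (\<tau> # ts)))) =
      lpa_class G (trunc G (hom n (C.term_val \<tau>))) \<oplus>\<^bsub>LPA G\<^esub> lpa_class G (trunc G (hom n (C.eval ts)))"
      unfolding LPA_add by (simp add: hom_simps trunc_add)
    show ?case
    proof (cases "hom n (C.term_val \<tau>) = 0")
      case True
      then have "hom n (C.eval (\<tau> # ts)) = hom n (C.eval ts)" by (simp add: hom_simps)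
      then show ?thesis using IH unfolding lpa_component_def by simp
    next
      case False
      then obtain k X where "X \<in> ?M" "lpa_class G (trunc G (hom n (C.term_val \<tau>))) = k \<odot>\<^bsub>LPA G\<^esub> X"
        using trm[OF u] by blast
      then show ?thesis unfolding eq lpa_component_def using linear_span.step[OF _ IH] by simp
    qed
  qed
  have "h - hom n (C.eval ts) \<in> rel_free"
    using hom_rel_free[of "h - C.eval ts" n] ts(2) homogeneous_hom[OF h(2), of n]
    unfolding B.eqv_def by (simp add: hom_simps)
  then have "lpa_class G (trunc G h) = lpa_class G (trunc G (hom n (C.eval ts)))" by (rule class_trunc_eq)
  then show ?thesis using ev[OF ts(1)] by (simp add: trunc_id[OF h(1)])
qed

lemma finsum_class:
  fixes f :: "'i \<Rightarrow> ('a, 'b, 'k::field) lpa_free"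
  assumes "finite A" "\<And>i. i \<in> A \<Longrightarrow> f i \<in> fcarrier G"
  shows "finsum (LPA G) (\<lambda>i. lpa_class G (f i)) A = lpa_class G (\<Sum>i\<in>A. f i)"
proof -
  interpret L: abelian_group "LPA G :: ('k, ('a, 'b, 'k) lpa_elem) module" by (rule LPA_abelian)
  show ?thesis using assms
  proof (induction A)
    case empty
    show ?case by (simp add: LPA_zero)
  next
    case (insert i A)
    have c: "lpa_class G (f j) \<in> carrier (LPA G)" if "j \<in> insert i A" for j
      unfolding LPA_carrier using insert.prems that by blast
    have "finsum (LPA G) (\<lambda>i. lpa_class G (f i)) (insert i A) =
      lpa_class G (f i) \<oplus>\<^bsub>LPA G\<^esub> finsum (LPA G) (\<lambda>i. lpa_class G (f i)) A"
      using insert.hyps c by (intro L.finsum_insert) auto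
    then show ?case using insert by (simp add: LPA_add)
  qed
qed

text \<open>The relation ideal is graded, so a congruence may be compared degree by degree; this
  gives the uniqueness in \<open>graded_ideal\<close>.\<close>

lemma component_decomposition:
  fixes y :: "int \<Rightarrow> ('a, 'b, 'k::field) lpa_elem"
  assumes y: "\<And>n. y n \<in> lpa_component G n" and fin: "finite {n. y n \<noteq> \<zero>\<^bsub>LPA G\<^esub>}"
    and x: "x \<in> fcarrier G" "lpa_class G x = finsum (LPA G) y {n. y n \<noteq> \<zero>\<^bsub>LPA G\<^esub>}"
  shows "y m = lpa_class G (hom m x)"
proof -
  let ?N = "{n. y n \<noteq> \<zero>\<^bsub>LPA G\<^esub>}"
  have "\<forall>n. \<exists>h. h \<in> fcarrier G \<and> homogeneous n h \<and> y n = lpa_class G h"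
  proof
    fix n
    obtain h where "h \<in> fcarrier G" "homogeneous n h" "y n = lpa_class G h" using component_homogeneous[OF y[of n]] by (elim bexE conjE) (rule that)
    then show "\<exists>h. h \<in> fcarrier G \<and> homogeneous n h \<and> y n = lpa_class G h" by (intro exI conjI)
  qed
  from choice[OF this] obtain h where
    hh: "\<forall>n. h n \<in> fcarrier G \<and> homogeneous n (h n) \<and> y n = lpa_class G (h n)" by (elim exE) (rule that)
  have h: "h n \<in> fcarrier G" "homogeneous n (h n)" "y n = lpa_class G (h n)" for n
    using hh[THEN spec, of n] by (simp_all only:)
  have "y = (\<lambda>n. lpa_class G (h n))" by (rule ext) (rule h(3))
  then have "lpa_class G x = finsum (LPA G) (\<lambda>n. lpa_class G (h n)) ?N" using x(2) by (simp only:)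
  also have "\<dots> = lpa_class G (\<Sum>n\<in>?N. h n)" by (rule finsum_class[OF fin h(1)])
  finally have "x - (\<Sum>n\<in>?N. h n) \<in> rel_free"
    unfolding class_eq_iff R_iff[OF fcarrier_closed(3)[OF x(1) fcarrier_sum[OF h(1)]]] .
  then have "hom m (x - (\<Sum>n\<in>?N. h n)) \<in> rel_free" by (rule hom_rel_free)
  moreover have "hom m (x - (\<Sum>n\<in>?N. h n)) = hom m x - (\<Sum>n\<in>?N. if n = m then h n else 0)"
    unfolding hom_simps by (intro arg_cong2[where f = minus] sum.cong refl) (auto simp: homogeneous_hom[OF h(2)])
  moreover have "(\<Sum>n\<in>?N. if n = m then h n else 0) = (if m \<in> ?N then h m else 0)" using fin by simp
  ultimately have d: "hom m x - (if m \<in> ?N then h m else 0) \<in> rel_free" by simp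
  have hm: "(if m \<in> ?N then h m else 0) \<in> fcarrier G" by (cases "m \<in> ?N") (simp_all only: if_True if_False h(1) fcarrier_closed(1))
  have "lpa_class G (hom m x) = lpa_class G (if m \<in> ?N then h m else 0)"
    unfolding class_eq_iff R_iff[OF fcarrier_closed(3)[OF hom_fcarrier[OF x(1)] hm]] by (rule d)
  also have "\<dots> = y m" using h(3)[of m] by (auto simp: LPA_zero)
  finally show ?thesis by simp
qed

lemma graded_ideal_iff:
  fixes I :: "('a, 'b, 'k::field) lpa_elem set"
  assumes I: "two_sided_ideal (LPA G) I"
  shows "graded_ideal G I \<longleftrightarrow> (\<forall>x\<in>pre I. \<forall>n. hom n x \<in> pre I)"
proof
  assume gr: "graded_ideal G I"
  show "\<forall>x\<in>pre I. \<forall>n. hom n x \<in> pre I"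
  proof (intro ballI allI)
    fix x n assume x: "x \<in> pre I"
    then have xa: "x \<in> aug" "lpa_class G (trunc G x) \<in> I" unfolding pre_def by auto
    have "\<exists>!y. (\<forall>n. y n \<in> I \<inter> lpa_component G n) \<and> finite {n. y n \<noteq> \<zero>\<^bsub>LPA G\<^esub>} \<and>
        lpa_class G (trunc G x) = finsum (LPA G) y {n. y n \<noteq> \<zero>\<^bsub>LPA G\<^esub>}"
      using conjunct2[OF gr[unfolded graded_ideal_def]] xa(2) by (rule bspec)
    from ex1_implies_ex[OF this] obtain y where y: "\<And>n. y n \<in> I \<inter> lpa_component G n" "finite {n. y n \<noteq> \<zero>\<^bsub>LPA G\<^esub>}"
      "lpa_class G (trunc G x) = finsum (LPA G) y {n. y n \<noteq> \<zero>\<^bsub>LPA G\<^esub>}"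
      by (elim exE conjE) (rule that, erule spec, assumption+)
    have "y n = lpa_class G (hom n (trunc G x))"
      using y(1) by (intro component_decomposition[OF _ y(2) trunc_fcarrier[OF xa(1)] y(3)]) auto
    then show "hom n x \<in> pre I" using y(1)[of n] hom_aug[OF xa(1)] unfolding pre_def by (simp add: trunc_hom)
  qed
next
  assume cl: "\<forall>x\<in>pre I. \<forall>n. hom n x \<in> pre I"
  show "graded_ideal G I" unfolding graded_ideal_def
  proof (intro conjI I ballI)
    fix X assume X: "X \<in> I"
    obtain x where x: "x \<in> fcarrier G" "X = lpa_class G x"
      using subsetD[OF two_sided_idealD(1)[OF I] X] by (rule LPA_cases)
    have xp: "x \<in> pre I" using X x unfolding pre_def by (simp add: trunc_id fcarrier_aug)
    define y where "y = (\<lambda>n. lpa_class G (hom n x))"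
    define M where "M = word_degree ` Poly_Mapping.keys x"
    have M: "finite M" unfolding M_def by simp
    have sub: "{n. y n \<noteq> \<zero>\<^bsub>LPA G\<^esub>} \<subseteq> M"
    proof
      fix n assume n: "n \<in> {n. y n \<noteq> \<zero>\<^bsub>LPA G\<^esub>}"
      have "hom n x = 0" if "n \<notin> M"
        using that unfolding M_def hom_def by (intro poly_mapping_eqI) (auto simp: lookup_restrict_words in_keys_iff)
      then show "n \<in> M" using n unfolding y_def by (auto simp: LPA_zero)
    qed
    have hx: "hom n x \<in> fcarrier G" for n by (rule hom_fcarrier[OF x(1)])
    have yn: "y n \<in> I \<inter> lpa_component G n" for n
    proof -
      have "hom n x \<in> pre I" using cl xp by blast
      then have "y n \<in> I" unfolding y_def pre_def using trunc_id[OF hx] by simp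
      moreover have "y n \<in> lpa_component G n" unfolding y_def by (rule homogeneous_component[OF hx hom_homogeneous])
      ultimately show ?thesis by blast
    qed
    have fin: "finite {n. y n \<noteq> \<zero>\<^bsub>LPA G\<^esub>}" using finite_subset[OF sub M] .
    have "finsum (LPA G) y {n. y n \<noteq> \<zero>\<^bsub>LPA G\<^esub>} = lpa_class G (\<Sum>n\<in>{n. y n \<noteq> \<zero>\<^bsub>LPA G\<^esub>}. hom n x)"
      using finsum_class[OF fin hx] unfolding y_def .
    \<comment> \<open>The support of \<open>y\<close> omits the components that vanish in
      \<open>L\<close> without vanishing in the free algebra; these lie in the relation
      ideal.\<close>
    also have "\<dots> = lpa_class G (\<Sum>n\<in>M. hom n x)"
    proof -
      have "(\<Sum>n\<in>{n. y n \<noteq> \<zero>\<^bsub>LPA G\<^esub>}. hom n x) - (\<Sum>n\<in>M. hom n x) = - (\<Sum>n\<in>M - {n. y n \<noteq> \<zero>\<^bsub>LPA G\<^esub>}. hom n x)"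
        using sum_diff[OF M sub, of "\<lambda>n. hom n x"] by simp
      also have "\<dots> \<in> rel_free"
      proof (rule idl_uminus[OF idl_rel_free idl_sum[OF idl_rel_free]])
        fix n assume "n \<in> M - {n. y n \<noteq> \<zero>\<^bsub>LPA G\<^esub>}"
        then have "lpa_class G (hom n x) = lpa_class G 0" unfolding y_def LPA_zero by simp
        then show "hom n x \<in> rel_free" unfolding class_eq_iff using R_iff[OF hx] by simp
      qed
      finally show ?thesis
        unfolding class_eq_iff R_iff[OF fcarrier_closed(3)[OF fcarrier_sum[OF hx] fcarrier_sum[OF hx]]] .
    qed
    also have "\<dots> = X" unfolding x(2) using sum_hom[OF M, of x] unfolding M_def by simp
    finally have Xy: "X = finsum (LPA G) y {n. y n \<noteq> \<zero>\<^bsub>LPA G\<^esub>}" by (rule sym)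
    show "\<exists>!y. (\<forall>n. y n \<in> I \<inter> lpa_component G n) \<and> finite {n. y n \<noteq> \<zero>\<^bsub>LPA G\<^esub>} \<and>
        X = finsum (LPA G) y {n. y n \<noteq> \<zero>\<^bsub>LPA G\<^esub>}"
    proof (rule ex1I[of _ y])
      show "(\<forall>n. y n \<in> I \<inter> lpa_component G n) \<and> finite {n. y n \<noteq> \<zero>\<^bsub>LPA G\<^esub>} \<and>
        X = finsum (LPA G) y {n. y n \<noteq> \<zero>\<^bsub>LPA G\<^esub>}" by (intro conjI allI yn fin Xy)
    next
      fix y' assume y': "(\<forall>n. y' n \<in> I \<inter> lpa_component G n) \<and> finite {n. y' n \<noteq> \<zero>\<^bsub>LPA G\<^esub>} \<and>
        X = finsum (LPA G) y' {n. y' n \<noteq> \<zero>\<^bsub>LPA G\<^esub>}"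
      show "y' = y"
      proof
        fix m
        have "y' m = lpa_class G (hom m x)"
        proof (rule component_decomposition[OF _ _ x(1)])
          show "y' n \<in> lpa_component G n" for n using conjunct1[OF y'] by blast
          show "finite {n. y' n \<noteq> \<zero>\<^bsub>LPA G\<^esub>}" by (rule conjunct1[OF conjunct2[OF y']])
          show "lpa_class G x = finsum (LPA G) y' {n. y' n \<noteq> \<zero>\<^bsub>LPA G\<^esub>}"
            unfolding x(2)[symmetric] by (rule conjunct2[OF conjunct2[OF y']])
        qed
        then show "y' m = y m" unfolding y_def .
      qed
    qed
  qed
qed

end

section \<open>Completely irreducible ideals\<close>

context wf_digraph
begin

subsection \<open>Graphs with a smallest hereditary saturated set\<close>

text \<open>The least hereditary saturated set containing \<open>v\<close>. The inductive form lets
  \<open>saturation_reach\<close> follow a derivation down to the tree of \<open>v\<close>.\<close>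

inductive_set saturation :: "'a \<Rightarrow> 'a set" for v where
  tree: "vertex_ge G v x \<Longrightarrow> x \<in> saturation v"
| regular: "regular_vertex G x \<Longrightarrow> (\<And>e. e \<in> out_arcs G x \<Longrightarrow> head G e \<in> saturation v) \<Longrightarrow> x \<in> saturation v"

lemma saturation_verts: "x \<in> saturation v \<Longrightarrow> x \<in> verts G"
proof (induction rule: saturation.induct)
  case (tree x)
  then show ?case by (rule conjunct2[OF vertex_ge_verts])
next
  case (regular x)
  then show ?case unfolding regular_vertex_def by (elim conjE)
qed

lemma saturation_hereditary: "hereditary G (saturation v)"
proof (rule hereditary_arcI)
  show "saturation v \<subseteq> verts G" using saturation_verts by blast
  fix e assume e: "e \<in> arcs G" "tail G e \<in> saturation v"
  from e(2) show "head G e \<in> saturation v"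
  proof cases
    case tree
    show ?thesis by (rule saturation.tree[OF vertex_ge_trans[OF tree vertex_ge_arc[OF e(1)]]])
  next
    case regular
    from this(2) show ?thesis using e(1) by simp
  qed
qed

lemma saturation_saturated: "saturated G (saturation v)"
  unfolding saturated_def
proof (intro conjI allI impI)
  show "saturation v \<subseteq> verts G" using saturation_verts by blast
  fix x assume "regular_vertex G x \<and> head G ` out_arcs G x \<subseteq> saturation v"
  then show "x \<in> saturation v" by (elim conjE) (rule saturation.regular, assumption, blast)
qed

text \<open>Sorted by length: regular vertices emit finitely many edges, so each of these sets is
  finite and their union is countable.\<close>

definition regular_reach :: "nat \<Rightarrow> 'a \<Rightarrow> 'a set" where
  "regular_reach n u = {x. \<exists>p. awalk u p x \<and> length p = n \<and> (\<forall>e\<in>set p. regular_vertex G (tail G e))}"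

lemma finite_regular_reach: "finite (regular_reach n u)"
proof (induction n arbitrary: u)
  case 0
  have "regular_reach 0 u \<subseteq> {u}" unfolding regular_reach_def by (auto simp: awalk_simps)
  then show ?case by (rule finite_subset) simp
next
  case (Suc n)
  have "regular_reach (Suc n) u \<subseteq> (if regular_vertex G u then \<Union>e\<in>out_arcs G u. regular_reach n (head G e) else {})"
  proof
    fix x assume "x \<in> regular_reach (Suc n) u"
    then obtain p where p: "awalk u p x" "length p = Suc n" "\<forall>e\<in>set p. regular_vertex G (tail G e)"
      unfolding regular_reach_def by blast
    obtain e q where q: "p = e # q" using p(2) by (cases p) auto
    then have "e \<in> arcs G" "tail G e = u" "awalk (head G e) q x" using p(1) by (auto simp: awalk_simps)
    moreover from this have "x \<in> regular_reach n (head G e)" using p q unfolding regular_reach_def by auto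
    ultimately show "x \<in> (if regular_vertex G u then \<Union>e\<in>out_arcs G u. regular_reach n (head G e) else {})"
      using p(3) q by auto
  qed
  moreover have "finite (if regular_vertex G u then \<Union>e\<in>out_arcs G u. regular_reach n (head G e) else {})"
    using Suc by (auto simp: regular_vertex_def)
  ultimately show ?case by (rule finite_subset)
qed

lemma saturation_reach:
  assumes "x \<in> saturation v"
  shows "\<exists>n y. y \<in> regular_reach n x \<and> vertex_ge G v y"
  using assms
proof (induction rule: saturation.induct)
  case (tree x)
  then have "x \<in> regular_reach 0 x" unfolding regular_reach_def using vertex_ge_verts by (auto simp: awalk_simps)
  then show ?case using tree by blast
next
  case (regular x)
  then obtain e where e: "e \<in> out_arcs G x" unfolding regular_vertex_def by blast
  then obtain n y where y: "y \<in> regular_reach n (head G e)" "vertex_ge G v y" using regular.IH by blast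
  then obtain p where p: "awalk (head G e) p y" "length p = n" "\<forall>e\<in>set p. regular_vertex G (tail G e)"
    unfolding regular_reach_def by blast
  have "awalk x (e # p) y" using e p(1) by (auto simp: awalk_simps)
  then have "y \<in> regular_reach (Suc n) x"
    unfolding regular_reach_def using p e regular.hyps(1) by (intro CollectI exI[of _ "e # p"]) auto
  then show ?case using y(2) by blast
qed

text \<open>
  A vertex in the saturation of \<open>v\<close> reaches the tree of \<open>v\<close> through regular vertices only, and only
  countably many vertices can be reached in this way.
\<close>
lemma strong_CSP_of_minimal:
  assumes u: "u \<in> verts G"
    and min: "\<And>Y. Y \<noteq> {} \<Longrightarrow> Y \<subseteq> verts G \<Longrightarrow> hereditary G Y \<Longrightarrow> saturated G Y \<Longrightarrow> u \<in> Y"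
  shows "downward_directed G (verts G)" "strong_CSP G (verts G)"
proof -
  have sat: "u' \<in> saturation v" if v: "v \<in> verts G" and u': "vertex_ge G u u'" for u' v
  proof -
    have "u \<in> saturation v"
    proof (rule min[OF _ _ saturation_hereditary saturation_saturated])
      show "saturation v \<noteq> {}" using saturation.tree[OF vertex_ge_refl[OF v]] by blast
      show "saturation v \<subseteq> verts G" using saturation_verts by blast
    qed
    then show ?thesis using saturation_hereditary u' unfolding hereditary_def by blast
  qed
  have ge: "vertex_ge G x y" if "y \<in> regular_reach n x" for n x y
    using that unfolding regular_reach_def vertex_ge_def by blast
  show "downward_directed G (verts G)" unfolding downward_directed_def
  proof (intro conjI ballI)
    show "verts G \<noteq> {}" using u by blast
    fix v1 v2 assume v: "v1 \<in> verts G" "v2 \<in> verts G"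
    \<comment> \<open>\<open>y\<close> lies below \<open>u\<close> and \<open>v1\<close>. Every
      vertex below \<open>u\<close> is in the saturation of \<open>v2\<close>, so the argument is
      repeated from \<open>y\<close> and not from \<open>u\<close>.\<close>
    obtain n y where y: "y \<in> regular_reach n u" "vertex_ge G v1 y"
      using saturation_reach[OF sat[OF v(1) vertex_ge_refl[OF u]]] by blast
    obtain m x where x: "x \<in> regular_reach m y" "vertex_ge G v2 x"
      using saturation_reach[OF sat[OF v(2) ge[OF y(1)]]] by blast
    have "vertex_ge G v1 x" using vertex_ge_trans[OF y(2) ge[OF x(1)]] .
    then show "\<exists>w\<in>verts G. vertex_ge G v1 w \<and> vertex_ge G v2 w" using x(2) vertex_ge_verts by blast
  qed
  define T where "T = (\<Union>n. regular_reach n u)"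
  have "CSP_wrt G (verts G) T" unfolding CSP_wrt_def
  proof (intro conjI ballI)
    show "T \<subseteq> verts G" unfolding T_def using ge vertex_ge_verts by blast
    show "countable T" unfolding T_def by (rule countable_UN) (simp_all add: countable_finite finite_regular_reach)
    fix v assume "v \<in> verts G"
    from saturation_reach[OF sat[OF this vertex_ge_refl[OF u]]]
    show "\<exists>t\<in>T. vertex_ge G v t" unfolding T_def by blast
  qed
  moreover have "T \<subseteq> Y" if Y: "Y \<noteq> {} \<and> Y \<subseteq> verts G \<and> hereditary G Y \<and> saturated G Y" for Y
  proof -
    have "u \<in> Y" using min Y by blast
    then show ?thesis using Y ge unfolding T_def hereditary_def by blast
  qed
  ultimately show "strong_CSP G (verts G)" unfolding strong_CSP_def using u by blast
qed

subsection \<open>Admissible pairs and ideals\<close>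

abbreviation quotient_ck :: "'a set \<Rightarrow> 'a set \<Rightarrow> ('a, 'b, 'k::field) lpa_free set \<Rightarrow> bool" where
  "quotient_ck H S J \<equiv> ck_family (quotient_graph G H S) J const aug
     (quot_vertex G H S) (quot_edge G H S) (quot_ghost G H S)"

abbreviation adm_idl :: "'a set \<Rightarrow> 'a set \<Rightarrow> ('a, 'b, 'k::field) lpa_free set" where
  "adm_idl H S \<equiv> idl_gen (admissible_relations G H S)"

lemma break_free_aug: "break_free G H v \<in> aug"
  unfolding break_free_def live_sum_def
  by (intro idl_diff[OF idl_aug] gen_aug idl_sum[OF idl_aug] idl_left[OF idl_aug])

lemma adm_idl_aug: "adm_idl H S \<subseteq> aug"
  by (rule idl_gen_least[OF idl_aug])
    (auto simp: admissible_relations_def gen_aug break_free_aug intro: subsetD[OF base_relations_aug])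

lemma adm_idl_base: "base_relations G \<subseteq> adm_idl H S"
  using idl_gen_superset[of "admissible_relations G H S"] unfolding admissible_relations_def by blast

lemma quotient_family:
  assumes "admissible_pair G H S" "idl J" "admissible_relations G H S \<subseteq> J"
  shows "quotient_family G J H S"
  using assms by unfold_locales (auto simp: admissible_relations_def)

lemma quotient_ckI:
  assumes "admissible_pair G H S" "idl J" "admissible_relations G H S \<subseteq> J" "J \<subseteq> aug"
    "\<And>x. x \<in> verts (quotient_graph G H S) \<Longrightarrow> quot_vertex G H S x \<notin> J"
  shows "quotient_ck H S J"
  using quotient_family.quotient_ck_family[OF quotient_family[OF assms(1-3)] assms(4,5)] .

lemma vertex_notin_generated:
  assumes "admissible_pair G H S"
    and "hereditary (quotient_graph G H S) Y" "saturated (quotient_graph G H S) Y"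
    and "x \<in> verts (quotient_graph G H S)" "x \<notin> Y"
  shows "quot_vertex G H S x \<notin> idl_gen (admissible_relations G H S \<union> quot_vertex G H S ` Y :: ('a, 'b, 'k::field) lpa_free set)"
proof -
  interpret boundary_action G H S Y "TYPE('k)" by unfold_locales (rule assms)+
  show ?thesis by (rule vertex_outside[OF assms(4,5)])
qed

text \<open>The case of empty \<open>Y\<close>: no vertex of the quotient graph lies in
  I(H,S).\<close>

lemma quotient_ck_adm_idl:
  assumes "admissible_pair G H S"
  shows "quotient_ck H S (adm_idl H S :: ('a, 'b, 'k::field) lpa_free set)"
proof (rule quotient_ckI[OF assms idl_idl_gen idl_gen_superset adm_idl_aug])
  fix x assume x: "x \<in> verts (quotient_graph G H S)"
  have "hereditary (quotient_graph G H S) {}" "saturated (quotient_graph G H S) {}"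
    unfolding hereditary_def saturated_def regular_vertex_def by auto
  from vertex_notin_generated[OF assms this x, where ?'k = 'k]
  show "quot_vertex G H S x \<notin> (adm_idl H S :: ('a, 'b, 'k) lpa_free set)" by simp
qed

lemma obtain_admissible:
  fixes J :: "('a, 'b, 'k::field) lpa_free set"
  assumes J: "idl J" "base_relations G \<subseteq> J"
  obtains H S where "admissible_pair G H S" "admissible_relations G H S \<subseteq> J"
    "\<And>x. x \<in> verts (quotient_graph G H S) \<Longrightarrow> quot_vertex G H S x \<notin> J"
proof -
  interpret J: lpa_ideal G J by unfold_locales (rule J)+
  interpret Q: quotient_family G J J.HJ J.SJ by (rule J.quotient_family_HJ)
  show thesis by (rule that[OF J.HJ_admissible Q.adm_J J.quot_vertex_notin])
qed

text \<open>An element of \<open>J\<close> outside I(H,S) would generate a vertex modulo I(H,S), and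
  this vertex would be in \<open>J\<close>.\<close>

lemma condition_L_determined:
  assumes adm: "admissible_pair G H S" and L: "condition_L (quotient_graph G H S)"
    and J: "idl J" "admissible_relations G H S \<subseteq> J" "J \<subseteq> aug"
    and nz: "\<And>x. x \<in> verts (quotient_graph G H S) \<Longrightarrow> quot_vertex G H S x \<notin> J"
  shows "J = adm_idl H S"
proof (rule ccontr)
  assume ne: "J \<noteq> adm_idl H S"
  have sub: "adm_idl H S \<subseteq> J" by (rule idl_gen_least[OF J(1,2)])
  then obtain x where x: "x \<in> J" "x \<notin> adm_idl H S" using ne by blast
  interpret C: ck_family "quotient_graph G H S" "adm_idl H S" const aug
    "quot_vertex G H S" "quot_edge G H S" "quot_ghost G H S" by (rule quotient_ck_adm_idl[OF adm])
  obtain a b u where u: "u \<in> verts (quotient_graph G H S)" "C.eqv (a * x * b) (quot_vertex G H S u)"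
    using C.reduction_condition_L[OF L subsetD[OF J(3) x(1)] x(2)] .
  have "quot_vertex G H S u \<in> J" using C.eqv_ideal_mem[OF u(2) J(1) sub] idl_mid[OF J(1) x(1)] by simp
  then show False using nz[OF u(1)] by simp
qed

text \<open>Identifies I(H,S), an intersection of ideals of \<open>L\<close>, with the ideal
  generated by the same elements in the free algebra, where the representation and the reduction are
  available.\<close>

lemma admissible_ideal_pre:
  assumes adm: "admissible_pair G H S"
  shows "two_sided_ideal (LPA G) (admissible_ideal G H S :: ('a, 'b, 'k::field) lpa_elem set)"
    and "pre (admissible_ideal G H S) = (adm_idl H S :: ('a, 'b, 'k) lpa_free set)"
proof -
  have Hv: "H \<subseteq> verts G" and Sv: "S \<subseteq> breaking_vertices G H"
    using adm unfolding admissible_pair_def hereditary_def by auto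
  have Sfin: "v \<in> verts G \<and> finite (live_arcs G H v)" if "v \<in> S" for v
    using that Sv unfolding breaking_vertices_def live_arcs_def by auto
  have live: "live_sum G H v \<in> (fcarrier G :: ('a, 'b, 'k) lpa_free set)" for v
    unfolding live_sum_def by (intro fcarrier_sum fcarrier_closed(4) gen_fcarrier) (auto simp: live_arcs_def)
  have bf: "break_free G H v \<in> (fcarrier G :: ('a, 'b, 'k) lpa_free set)" if "v \<in> S" for v
    unfolding break_free_def by (intro fcarrier_closed(3) live gen_fcarrier) (use Sfin[OF that] in blast)
  have be: "breaking_elem G H v = lpa_class G (break_free G H v :: ('a, 'b, 'k) lpa_free)" if v: "v \<in> S" for v
  proof -
    have "finsum (LPA G) (\<lambda>e. lpa_edge G e \<otimes>\<^bsub>LPA G\<^esub> lpa_ghost G e) (live_arcs G H v) =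
      finsum (LPA G) (\<lambda>e. lpa_class G (gen (Edg e) * gen (Ghost e) :: ('a, 'b, 'k) lpa_free)) (live_arcs G H v)"
    proof -
      interpret L: abelian_group "LPA G :: ('k, ('a, 'b, 'k) lpa_elem) module" by (rule LPA_abelian)
      show ?thesis
      proof (rule L.finsum_cong'[OF refl])
        have e: "gen (Edg e) * gen (Ghost e) \<in> (fcarrier G :: ('a, 'b, 'k) lpa_free set)" if "e \<in> live_arcs G H v" for e
          using that by (intro fcarrier_closed(4) gen_fcarrier) (auto simp: live_arcs_def)
        show "(\<lambda>e. lpa_class G (gen (Edg e) * gen (Ghost e) :: ('a, 'b, 'k) lpa_free)) \<in> live_arcs G H v \<rightarrow> carrier (LPA G)"
          unfolding LPA_carrier using e by blast
        show "lpa_edge G e \<otimes>\<^bsub>LPA G\<^esub> lpa_ghost G e = lpa_class G (gen (Edg e) * gen (Ghost e) :: ('a, 'b, 'k) lpa_free)"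
          if "e \<in> live_arcs G H v" for e
          unfolding lpa_edge_def lpa_ghost_def using that
          by (intro LPA_mult gen_fcarrier) (auto simp: live_arcs_def)
      qed
    qed
    also have "\<dots> = lpa_class G (live_sum G H v)"
      unfolding live_sum_def using Sfin[OF v]
      by (intro finsum_class fcarrier_closed(4) gen_fcarrier) (auto simp: live_arcs_def)
    finally have fs: "finsum (LPA G) (\<lambda>e. lpa_edge G e \<otimes>\<^bsub>LPA G\<^esub> lpa_ghost G e) (live_arcs G H v) =
      lpa_class G (live_sum G H v :: ('a, 'b, 'k) lpa_free)" .
    have "breaking_elem G H v = lpa_class G (gen (Vtx v) :: ('a, 'b, 'k) lpa_free) \<oplus>\<^bsub>LPA G\<^esub>
       (\<ominus>\<^bsub>LPA G\<^esub> lpa_class G (live_sum G H v))"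
      unfolding breaking_elem_def a_minus_def lpa_vertex_def fs[unfolded live_arcs_def] ..
    then show ?thesis unfolding LPA_a_inv[OF live] LPA_add break_free_def by simp
  qed
  have two: "two_sided_ideal (LPA G) (admissible_ideal G H S :: ('a, 'b, 'k) lpa_elem set)"
  proof -
    let ?X = "lpa_vertex G ` H \<union> breaking_elem G H ` S :: ('a, 'b, 'k) lpa_elem set"
    have car: "two_sided_ideal (LPA G) (carrier (LPA G) :: ('a, 'b, 'k) lpa_elem set)"
      using lpa_of_ideal[OF idl_aug] unfolding lpa_of_aug .
    have "?X \<subseteq> carrier (LPA G)"
      unfolding LPA_carrier
    proof (intro Un_least image_subsetI)
      fix v
      show "lpa_vertex G v \<in> lpa_class G ` (fcarrier G :: ('a, 'b, 'k) lpa_free set)" if "v \<in> H"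
        unfolding lpa_vertex_def by (intro imageI gen_fcarrier(1) subsetD[OF Hv that])
      show "breaking_elem G H v \<in> lpa_class G ` (fcarrier G :: ('a, 'b, 'k) lpa_free set)" if "v \<in> S"
        unfolding be[OF that] by (intro imageI bf[OF that])
    qed
    then have cin: "carrier (LPA G) \<in> {I. two_sided_ideal (LPA G) I \<and> ?X \<subseteq> I}" using car by simp
    have mem: "\<And>I. I \<in> {I. two_sided_ideal (LPA G) I \<and> ?X \<subseteq> I} \<Longrightarrow> two_sided_ideal (LPA G) I" by simp
    show ?thesis unfolding admissible_ideal_def generated_ideal_def
    proof (rule two_sided_idealI)
      show "\<Inter> {I. two_sided_ideal (LPA G) I \<and> ?X \<subseteq> I} \<subseteq> carrier (LPA G)" by (rule Inter_lower[OF cin])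
      show "\<zero>\<^bsub>LPA G\<^esub> \<in> \<Inter> {I. two_sided_ideal (LPA G) I \<and> ?X \<subseteq> I}"
        by (rule InterI) (rule two_sided_idealD(2)[OF mem])
      fix X assume X: "X \<in> \<Inter> {I. two_sided_ideal (LPA G) I \<and> ?X \<subseteq> I}"
      show "X \<oplus>\<^bsub>LPA G\<^esub> Y \<in> \<Inter> {I. two_sided_ideal (LPA G) I \<and> ?X \<subseteq> I}"
        if Y: "Y \<in> \<Inter> {I. two_sided_ideal (LPA G) I \<and> ?X \<subseteq> I}" for Y
        by (rule InterI) (rule two_sided_idealD(3)[OF mem InterD[OF X] InterD[OF Y]])
      show "Y \<otimes>\<^bsub>LPA G\<^esub> X \<in> \<Inter> {I. two_sided_ideal (LPA G) I \<and> ?X \<subseteq> I}" if Y: "Y \<in> carrier (LPA G)" for Y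
        by (rule InterI) (rule two_sided_idealD(4)[OF mem InterD[OF X] Y])
      show "X \<otimes>\<^bsub>LPA G\<^esub> Y \<in> \<Inter> {I. two_sided_ideal (LPA G) I \<and> ?X \<subseteq> I}" if Y: "Y \<in> carrier (LPA G)" for Y
        by (rule InterI) (rule two_sided_idealD(5)[OF mem InterD[OF X] Y])
      show "\<ominus>\<^bsub>LPA G\<^esub> X \<in> \<Inter> {I. two_sided_ideal (LPA G) I \<and> ?X \<subseteq> I}"
      proof (rule InterI)
        fix I assume I: "I \<in> {I. two_sided_ideal (LPA G) I \<and> ?X \<subseteq> I}"
        interpret I: additive_subgroup I "LPA G" using mem[OF I] unfolding two_sided_ideal_def by blast
        show "\<ominus>\<^bsub>LPA G\<^esub> X \<in> I"
          using I.a_subgroup InterD[OF X I] unfolding a_inv_def by (simp add: subgroup.m_inv_closed)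
      qed
    qed
  qed
  then show "two_sided_ideal (LPA G) (admissible_ideal G H S :: ('a, 'b, 'k) lpa_elem set)" .
  have gens: "lpa_vertex G v \<in> (admissible_ideal G H S :: ('a, 'b, 'k) lpa_elem set)" if "v \<in> H" for v
    unfolding admissible_ideal_def generated_ideal_def using that by blast
  have gens': "breaking_elem G H v \<in> (admissible_ideal G H S :: ('a, 'b, 'k) lpa_elem set)" if "v \<in> S" for v
    unfolding admissible_ideal_def generated_ideal_def using that by blast
  have "admissible_relations G H S \<subseteq> pre (admissible_ideal G H S :: ('a, 'b, 'k) lpa_elem set)"
    unfolding admissible_relations_def
  proof (intro Un_least base_pre[OF two] image_subsetI)
    fix v assume v: "v \<in> H"
    have c: "gen (Vtx v) \<in> (fcarrier G :: ('a, 'b, 'k) lpa_free set)" by (rule gen_fcarrier) (use v Hv in blast)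
    show "gen (Vtx v) \<in> pre (admissible_ideal G H S :: ('a, 'b, 'k) lpa_elem set)"
      unfolding pre_def using gens[OF v] by (simp add: trunc_id[OF c] gen_aug lpa_vertex_def)
  next
    fix v assume v: "v \<in> S"
    show "break_free G H v \<in> pre (admissible_ideal G H S :: ('a, 'b, 'k) lpa_elem set)"
      unfolding pre_def using gens'[OF v] by (simp add: trunc_id[OF bf[OF v]] break_free_aug be[OF v])
  qed
  then have 1: "adm_idl H S \<subseteq> pre (admissible_ideal G H S :: ('a, 'b, 'k) lpa_elem set)"
    by (rule idl_gen_least[OF idl_pre[OF two]])
  have J0: "admissible_relations G H S \<subseteq> (adm_idl H S :: ('a, 'b, 'k) lpa_free set)" by (rule idl_gen_superset)
  have "(admissible_ideal G H S :: ('a, 'b, 'k) lpa_elem set) \<subseteq> lpa_of (adm_idl H S)"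
    unfolding admissible_ideal_def generated_ideal_def
  proof (rule Inter_lower, intro CollectI conjI Un_least image_subsetI)
    show "two_sided_ideal (LPA G) (lpa_of (adm_idl H S) :: ('a, 'b, 'k) lpa_elem set)" by (rule lpa_of_ideal[OF idl_idl_gen])
    show "lpa_vertex G v \<in> (lpa_of (adm_idl H S) :: ('a, 'b, 'k) lpa_elem set)" if v: "v \<in> H" for v
    proof -
      have "gen (Vtx v) \<in> (adm_idl H S :: ('a, 'b, 'k) lpa_free set)" by (rule subsetD[OF J0]) (simp add: admissible_relations_def v)
      moreover have "gen (Vtx v) \<in> (fcarrier G :: ('a, 'b, 'k) lpa_free set)" by (rule gen_fcarrier) (use v Hv in blast)
      ultimately show ?thesis unfolding lpa_of_def lpa_vertex_def by simp
    qed
    show "breaking_elem G H v \<in> (lpa_of (adm_idl H S) :: ('a, 'b, 'k) lpa_elem set)" if v: "v \<in> S" for v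
    proof -
      have "break_free G H v \<in> (adm_idl H S :: ('a, 'b, 'k) lpa_free set)" by (rule subsetD[OF J0]) (simp add: admissible_relations_def v)
      then show ?thesis unfolding lpa_of_def be[OF v] using bf[OF v] by simp
    qed
  qed
  from pre_mono[OF this] have 2: "pre (admissible_ideal G H S :: ('a, 'b, 'k) lpa_elem set) \<subseteq> adm_idl H S"
    unfolding pre_lpa_of[OF idl_idl_gen adm_idl_base adm_idl_aug] .
  show "pre (admissible_ideal G H S) = (adm_idl H S :: ('a, 'b, 'k) lpa_free set)" using 1 2 by (rule equalityI[rotated])
qed

lemma graded_of_adm_idl:
  assumes "two_sided_ideal (LPA G) I" "pre I = adm_idl H S"
  shows "graded_ideal G I"
  unfolding graded_ideal_iff[OF assms(1)] assms(2)
  by (intro ballI allI hom_idl_gen[OF homogeneous_admissible])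

end

section \<open>Powers of ideals and the main theorem\<close>

lemma hom_homogeneous_mult:
  assumes "homogeneous d x"
  shows "hom n (x * y) = x * hom (n - d) y"
proof (induction y rule: poly_mapping_single_induct)
  case (single u k)
  have "hom (n - word_degree u) x = (if word_degree u = n - d then x else 0)"
    unfolding homogeneous_hom[OF assms] by (rule if_cong) auto
  then show ?case unfolding hom_mult_single by (simp add: hom_simps)
qed (simp_all add: hom_simps distrib_left)

text \<open>The cycle over the graded ideal I(H,B), which all ideals in the final proofs contain.
  The second component is called \<open>B\<close> because \<open>S\<close> denotes path products
  here.\<close>

locale lpa_cycle = base: wf_digraph G +
  no_exit_cycle "quotient_graph G H B" J const aug "quot_vertex G H B" "quot_edge G H B" "quot_ghost G H B" w c
  for G :: "('v, 'e) pre_digraph" and H B and J :: "('v, 'e, 'k::field) lpa_free set" and w c +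
  assumes adm: "admissible_pair G H B" and J_eq: "J = idl_gen (admissible_relations G H B)"
begin

lemma homogeneous_vertex: "homogeneous 0 (quot_vertex G H B x :: ('v, 'e, 'k) lpa_free)"
proof -
  have 1: "homogeneous 0 (gen (Edg e) * gen (Ghost e) :: ('v, 'e, 'k) lpa_free)" for e
    using homogeneous_mult[OF homogeneous_gen(2) homogeneous_gen(3)] by simp
  have 2: "homogeneous 0 (live_sum G H v :: ('v, 'e, 'k) lpa_free)" for v
    unfolding live_sum_def by (intro homogeneous_sum 1)
  have 3: "homogeneous 0 (break_free G H v :: ('v, 'e, 'k) lpa_free)" for v
    unfolding break_free_def by (intro homogeneous_diff 2 homogeneous_gen)
  show ?thesis unfolding quot_vertex_def by (cases x) (simp_all add: 2 3 homogeneous_gen)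
qed

lemma homogeneous_X: "homogeneous (int (length c)) X"
proof -
  have e: "homogeneous 1 (quot_edge G H B f :: ('v, 'e, 'k) lpa_free)" for f
    using homogeneous_mult[OF homogeneous_gen(2) homogeneous_vertex] unfolding quot_edge_def by simp
  have "homogeneous (int (length d)) (S d)" for d
  proof (induction d)
    case Nil
    show ?case using homogeneous_const[of 1] by (simp add: const_1)
  next
    case (Cons f d)
    then show ?case using homogeneous_mult[OF e Cons] by simp
  qed
  from homogeneous_mult[OF this homogeneous_vertex] show ?thesis unfolding X_def by simp
qed

text \<open>\<open>X\<close> is homogeneous of degree \<open>length c\<close>, so distinct powers of
  \<open>X\<close> live in distinct degrees. The vanishing in negative degrees is for the induction,
  where degree 0 of \<open>X * ev q\<close> asks for degree \<open>- length c\<close> of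
  \<open>ev q\<close>.\<close>

lemma hom_ev:
  "(\<forall>n<0. hom n (ev q) = 0) \<and>
   (\<forall>d. hom (int (length c) * int d) (ev q) = const (coeff q d) * (X ^ d * quot_vertex G H B w))"
proof (induction q)
  case 0
  show ?case by (simp add: hom_simps)
next
  case (pCons a q)
  have l: "0 < int (length c)" using c_ne by simp
  have split: "hom n (ev (pCons a q)) =
      (if n = 0 then const a * quot_vertex G H B w else 0) + X * hom (n - int (length c)) (ev q)" for n
    unfolding ev_pCons hom_simps(1) homogeneous_hom[OF homogeneous_const_mult[OF homogeneous_vertex]]
      hom_homogeneous_mult[OF homogeneous_X] ..
  show ?case
  proof (intro conjI allI impI)
    fix n :: int assume "n < 0"
    then show "hom n (ev (pCons a q)) = 0" unfolding split using pCons.IH l by simp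
  next
    fix d
    show "hom (int (length c) * int d) (ev (pCons a q)) = const (coeff (pCons a q) d) * (X ^ d * quot_vertex G H B w)"
    proof (cases d)
      case 0
      then show ?thesis unfolding split using pCons.IH l by simp
    next
      case (Suc m)
      have "int (length c) * int (Suc m) - int (length c) = int (length c) * int m" by (simp add: algebra_simps)
      moreover have "int (length c) * int (Suc m) \<noteq> 0" using l by simp
      ultimately show ?thesis
        unfolding split Suc using pCons.IH
        by (simp only: if_False add_0_left coeff_pCons_Suc \<kappa>_pull power_Suc mult.assoc)
    qed
  qed
qed

text \<open>A graded ideal contains the leading term of \<open>ev f\<close>, and \<open>X\<close> is
  invertible in the corner. Hence an ideal with a nonzero polynomial but without \<open>w\<close> is
  not graded.\<close>

lemma homogeneous_kernel:
  assumes K: "idl K" "J \<subseteq> K" "\<forall>x\<in>K. \<forall>n. hom n x \<in> K" and f: "f \<noteq> 0" "ev f \<in> K"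
  shows "quot_vertex G H B w \<in> K"
proof -
  let ?d = "degree f"
  have lc: "lead_coeff f \<noteq> 0" using f(1) by simp
  have "hom (int (length c) * int ?d) (ev f) \<in> K" using K(3) f(2) by blast
  then have "const (lead_coeff f) * (X ^ ?d * quot_vertex G H B w) \<in> K" using hom_ev[of f] by simp
  then have "const (1 / lead_coeff f) * (const (lead_coeff f) * (X ^ ?d * quot_vertex G H B w)) \<in> K"
    by (rule idl_left[OF K(1)])
  then have "ev (monom 1 ?d * 1) \<in> K" unfolding \<kappa>_cancel[OF lc] by (simp add: ev_monom)
  from kernel_cancel[OF K(1,2) this] show ?thesis by simp
qed

lemma ev_power:
  assumes P: "two_sided_ideal (LPA G) P" and sub: "admissible_relations G H B \<subseteq> base.pre P"
    and pow: "\<And>n. admissible_relations G H B \<subseteq> base.pre (ideal_power (LPA G) P (Suc n))"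
    and f: "ev f \<in> base.pre P"
  shows "ev (f ^ Suc n) \<in> base.pre (ideal_power (LPA G) P (Suc n))"
proof (induction n)
  case 0
  show ?case using f by simp
next
  case (Suc n)
  let ?Q = "ideal_power (LPA G) P (Suc n)" and ?R = "ideal_power (LPA G) P (Suc (Suc n))"
  have Q: "two_sided_ideal (LPA G) ?Q" and R: "two_sided_ideal (LPA G) ?R"
    by (rule base.ideal_power_two_sided[OF P])+
  have prod: "ev (f ^ Suc n) * ev f \<in> base.pre ?R"
    by (rule base.ideal_prod_pre[OF Q P Suc.IH f]) simp
  have "J \<subseteq> base.pre ?R" unfolding J_eq by (rule idl_gen_least[OF base.idl_pre[OF R] pow])
  from iffD2[OF eqv_ideal_mem[OF ev_mult base.idl_pre[OF R] this] prod]
  show ?case unfolding power_Suc2[of f "Suc n"] .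
qed

text \<open>The upper bound complementary to \<open>ev_power\<close>: if the power of
  \<open>f\<close> is already in \<open>K\<close>, then the same power of \<open>P\<close> lies in
  \<open>K\<close>.\<close>

lemma power_generated:
  assumes K: "idl K" "J \<subseteq> K" "K \<subseteq> aug" "base_relations G \<subseteq> K"
    and nz: "\<And>v. v \<in> verts (quotient_graph G H B) \<Longrightarrow> quot_vertex G H B v \<notin> K"
    and P: "two_sided_ideal (LPA G) P" "base.pre P = idl_gen (insert (ev f) K)"
  shows "base.pre (ideal_power (LPA G) P (Suc n)) \<subseteq> idl_gen (insert (ev (f ^ Suc n)) K)"
proof (induction n)
  case 0
  show ?case using P(2) by simp
next
  case (Suc n)
  interpret N: no_exit_cycle "quotient_graph G H B" K const aug
    "quot_vertex G H B" "quot_edge G H B" "quot_ghost G H B" w c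
    by (rule enlarge_cycle[OF K(1,2,3) nz])
  let ?Q = "ideal_power (LPA G) P (Suc n)" and ?R = "ideal_power (LPA G) P (Suc (Suc n))"
  let ?M = "idl_gen (insert (ev (f ^ Suc (Suc n))) K)"
  note M = idl_idl_gen[of "insert (ev (f ^ Suc (Suc n))) K"]
    idl_gen_insert_bounds[OF idl_aug K(3) N.ev_C, of "f ^ Suc (Suc n)"]
  have Q: "two_sided_ideal (LPA G) ?Q" by (rule base.ideal_power_two_sided[OF P(1)])
  have "?R \<subseteq> base.lpa_of ?M"
    unfolding ideal_power.simps(2)[of _ _ "Suc n"] if_not_P[OF nat.distinct(2)]
  proof (rule base.ideal_prod_lpa_of[OF Q P(1) M(1)])
    fix x y assume x: "x \<in> base.pre ?Q" and y: "y \<in> base.pre P"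
    show "x * y \<in> ?M" unfolding power_Suc2[of f "Suc n"]
      by (rule N.ev_generated_mult[OF subsetD[OF Suc.IH x] y[unfolded P(2)]])
  qed
  from base.pre_mono[OF this] show ?case
    unfolding base.pre_lpa_of[OF M(1) subset_trans[OF K(4) M(3)] M(2)] .
qed

end

section \<open>The equivalence and the exclusion of both conditions at once\<close>

context wf_digraph
begin

lemma graded_condition_completely_irreducible:
  fixes I :: "('a, 'b, 'k::field) lpa_elem set"
  assumes I: "proper_ideal (LPA G) I" and gr: "graded_condition G I"
  shows "prime_ideal (LPA G) I" "completely_irreducible (LPA G) I"
proof -
  obtain H S where adm: "admissible_pair G H S" and IHS: "I = admissible_ideal G H S"
    and L: "condition_L (quotient_graph G H S)"
    and dd: "downward_directed (quotient_graph G H S) (verts (quotient_graph G H S))"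
    and csp: "strong_CSP (quotient_graph G H S) (verts (quotient_graph G H S))"
    using gr unfolding graded_condition_def by (elim conjE exE) (rule that)
  let ?F = "quotient_graph G H S"
  have pI: "pre I = adm_idl H S" unfolding IHS by (rule admissible_ideal_pre(2)[OF adm])
  interpret C: ck_family ?F "adm_idl H S :: ('a, 'b, 'k) lpa_free set" const aug
    "quot_vertex G H S" "quot_edge G H S" "quot_ghost G H S" by (rule quotient_ck_adm_idl[OF adm])
  obtain T where T: "CSP_wrt ?F (verts ?F) T" "verts ?F \<noteq> {}"
    "\<forall>Y. Y \<noteq> {} \<and> Y \<subseteq> verts ?F \<and> hereditary ?F Y \<and> saturated ?F Y \<longrightarrow> T \<subseteq> Y"
    using csp unfolding strong_CSP_def by (elim conjE exE) (rule that)
  \<comment> \<open>Any \<open>t\<close> in \<open>T\<close> lies in every nonempty hereditary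
    saturated set, so its vertex is the witness for the smallest larger ideal.\<close>
  obtain t where t: "t \<in> T" "t \<in> verts ?F" using T(1,2) unfolding CSP_wrt_def by blast
  have "t \<in> Y" if "Y \<noteq> {}" "Y \<subseteq> verts ?F" "hereditary ?F Y" "saturated ?F Y" for Y
  proof -
    have "Y \<noteq> {} \<and> Y \<subseteq> verts ?F \<and> hereditary ?F Y \<and> saturated ?F Y" by (intro conjI that)
    from subsetD[OF mp[OF spec[OF T(3)] this] t(1)] show ?thesis .
  qed
  from C.condition_L_monolithicI[OF L t(2) this]
  show "completely_irreducible (LPA G) I"
    unfolding completely_irreducible_iff[OF I] pI monolithic_def by (rule exI)
  show "prime_ideal (LPA G) I"
  proof (rule prime_idealI[OF I], unfold pI)
    fix J1 J2 :: "('a, 'b, 'k) lpa_free set"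
    assume J: "idl J1" "idl J2" "J1 \<subseteq> aug" "J2 \<subseteq> aug" "\<And>x y. x \<in> J1 \<Longrightarrow> y \<in> J2 \<Longrightarrow> x * y \<in> adm_idl H S"
    show "J1 \<subseteq> adm_idl H S \<or> J2 \<subseteq> adm_idl H S" by (rule C.condition_L_prime[OF L dd J])
  qed
qed

text \<open>The generators of I(H,S) are idempotent modulo the relations, hence they survive in all
  powers of an ideal containing them.\<close>

lemma admissible_power:
  fixes P :: "('a, 'b, 'k::field) lpa_elem set"
  assumes P: "two_sided_ideal (LPA G) P" and adm: "admissible_pair G H S"
    and sub: "admissible_relations G H S \<subseteq> pre P"
  shows "admissible_relations G H S \<subseteq> pre (ideal_power (LPA G) P (Suc n))"
proof (induction n)
  case 0
  show ?case using sub by simp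
next
  case (Suc n)
  let ?Q = "ideal_power (LPA G) P (Suc n)" and ?R = "ideal_power (LPA G) P (Suc (Suc n))"
  have Q: "two_sided_ideal (LPA G) ?Q" and R: "two_sided_ideal (LPA G) ?R"
    by (rule ideal_power_two_sided[OF P])+
  interpret R: lpa_ideal G "pre ?R" by unfold_locales (rule idl_pre[OF R], rule base_pre[OF R])
  have idem: "x \<in> pre ?R" if "x \<in> admissible_relations G H S" "R.eqv (x * x) x" for x
  proof (rule iffD1[OF R.eqv_mem[OF that(2)]])
    show "x * x \<in> pre ?R"
      by (rule ideal_prod_pre[OF Q P subsetD[OF Suc.IH that(1)] subsetD[OF sub that(1)]]) simp
  qed
  have V: "gen (Vtx v) \<in> pre ?R" if v: "v \<in> H" for v
  proof (rule idem)
    show "gen (Vtx v) \<in> admissible_relations G H S" using v by (simp add: admissible_relations_def)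
    have "v \<in> verts G" using v adm unfolding admissible_pair_def hereditary_def by blast
    from R.V_V[OF this this] show "R.eqv (R.V v * R.V v) (R.V v)" by simp
  qed
  \<comment> \<open>With the empty set in place of \<open>S\<close>, the breaking element at
    \<open>v\<close> is the new vertex \<open>v'\<close> of the quotient graph, so it is idempotent
    by \<open>q_q\<close> before it is known to lie in the ideal.\<close>
  have QF: "quotient_family G (pre ?R) H {}"
  proof (rule quotient_family)
    show "admissible_pair G H {}" using adm unfolding admissible_pair_def by simp
    show "idl (pre ?R)" by (rule idl_pre[OF R])
    show "admissible_relations G H {} \<subseteq> pre ?R"
      unfolding admissible_relations_def by (intro Un_least base_pre[OF R] image_subsetI V) simp_all
  qed
  have "break_free G H v \<in> pre ?R" if v: "v \<in> S" for v
  proof (rule idem)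
    show "break_free G H v \<in> admissible_relations G H S" using v by (simp add: admissible_relations_def)
    have "v \<in> breaking_vertices G H" using v adm unfolding admissible_pair_def by blast
    then have "Inr v \<in> verts (quotient_graph G H {})" by (simp add: quotient_graph_def)
    from quotient_family.q_q[OF QF this this]
    show "R.eqv (break_free G H v * break_free G H v) (break_free G H v)" by (simp add: quot_vertex_def)
  qed
  then show ?case
    unfolding admissible_relations_def by (intro Un_least base_pre[OF R] image_subsetI V)
qed

lemma ideal_power_le:
  assumes P: "two_sided_ideal (LPA G) (P :: ('a, 'b, 'k::field) lpa_elem set)"
  shows "ideal_power (LPA G) P (Suc n) \<subseteq> P"
proof (cases n)
  case (Suc m)
  have "ideal_prod (LPA G) (ideal_power (LPA G) P (Suc m)) P \<subseteq> lpa_of (pre P)"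
    by (rule ideal_prod_lpa_of[OF ideal_power_two_sided[OF P] P idl_pre[OF P]]) (rule idl_left[OF idl_pre[OF P]])
  then show ?thesis unfolding lpa_of_pre[OF P] Suc by simp
qed simp

lemma completely_irreducible_cases:
  fixes I :: "('a, 'b, 'k::field) lpa_elem set"
  assumes I: "proper_ideal (LPA G) I" and ci: "completely_irreducible (LPA G) I"
  shows "graded_condition G I \<or> prime_power_condition G I"
proof -
  have tI: "two_sided_ideal (LPA G) I" using I unfolding proper_ideal_def by (rule conjunct1)
  define J where "J = pre I"
  note J = idl_pre[OF tI, folded J_def] base_pre[OF tI, folded J_def] pre_aug[of I, folded J_def]
  have "\<exists>z. monolithic aug J z"
    using ci unfolding completely_irreducible_iff[OF I] J_def monolithic_def .
  then obtain z where z: "monolithic aug J z" by (rule exE)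
  obtain H S where adm: "admissible_pair G H S" and sub: "admissible_relations G H S \<subseteq> J"
    and nz: "\<And>x. x \<in> verts (quotient_graph G H S) \<Longrightarrow> quot_vertex G H S x \<notin> J"
    by (rule obtain_admissible[OF J(1,2)]) (rule that, simp_all)
  let ?F = "quotient_graph G H S"
  have J0: "adm_idl H S \<subseteq> J" by (rule idl_gen_least[OF J(1) sub])
  interpret C: ck_family ?F J const aug "quot_vertex G H S" "quot_edge G H S" "quot_ghost G H S"
    by (rule quotient_ckI[OF adm J(1) sub J(3) nz])
  show ?thesis
  proof (cases "condition_L ?F")
    case True
    have JJ0: "J = adm_idl H S" by (rule condition_L_determined[OF adm True J(1) sub J(3) nz])
    have "lpa_of (pre I) = lpa_of (pre (admissible_ideal G H S :: ('a, 'b, 'k) lpa_elem set))"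
      unfolding admissible_ideal_pre(2)[OF adm] JJ0[symmetric] J_def ..
    then have IHS: "I = admissible_ideal G H S"
      unfolding lpa_of_pre[OF tI] lpa_of_pre[OF admissible_ideal_pre(1)[OF adm]] .
    have gr: "graded_ideal G I" by (rule graded_of_adm_idl[OF tI JJ0[unfolded J_def]])
    obtain u where u: "u \<in> verts ?F" "\<And>J'. idl J' \<Longrightarrow> J \<subset> J' \<Longrightarrow> J' \<subseteq> aug \<Longrightarrow> quot_vertex G H S u \<in> J'"
      by (rule C.condition_L_monolithic_vertex[OF True z]) (rule that, simp_all)
    have min: "u \<in> Y" if Y: "Y \<noteq> {}" "Y \<subseteq> verts ?F" "hereditary ?F Y" "saturated ?F Y" for Y
    proof (rule ccontr)
      assume nu: "u \<notin> Y"
      \<comment> \<open>The ideal generated by \<open>Y\<close> over I(H,S) is properly larger than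
        \<open>J\<close>, so it contains \<open>u\<close>; the boundary paths avoiding
        \<open>Y\<close> exclude this.\<close>
      let ?J' = "idl_gen (admissible_relations G H S \<union> quot_vertex G H S ` Y) :: ('a, 'b, 'k) lpa_free set"
      obtain y where y: "y \<in> Y" using Y(1) by blast
      have qy: "quot_vertex G H S y \<in> ?J'" by (rule subsetD[OF idl_gen_superset]) (intro UnI2 imageI y)
      have nq: "quot_vertex G H S y \<notin> J" by (rule nz) (rule subsetD[OF Y(2) y])
      have JJ': "J \<subset> ?J'"
      proof (rule psubsetI)
        show "J \<subseteq> ?J'" unfolding JJ0
          by (rule idl_gen_least[OF idl_idl_gen]) (rule subset_trans[OF Un_upper1 idl_gen_superset])
        show "J \<noteq> ?J'"
        proof
          assume "J = ?J'"
          with qy have "quot_vertex G H S y \<in> J" by (simp only:)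
          with nq show False by (rule notE)
        qed
      qed
      have "?J' \<subseteq> aug"
      proof (rule idl_gen_least[OF idl_aug], rule Un_least)
        show "admissible_relations G H S \<subseteq> (aug :: ('a, 'b, 'k) lpa_free set)" by (rule subset_trans[OF sub J(3)])
        show "quot_vertex G H S ` Y \<subseteq> (aug :: ('a, 'b, 'k) lpa_free set)" by (rule image_subsetI) (rule C.p_C[OF subsetD[OF Y(2)]])
      qed
      from u(2)[OF idl_idl_gen JJ' this] vertex_notin_generated[OF adm Y(3,4) u(1) nu] show False by (rule notE[rotated])
    qed
    have wfF: "wf_digraph ?F" by (rule quotient_family.F_wf[OF quotient_family[OF adm J(1) sub]])
    have sc: "downward_directed ?F (verts ?F)" "strong_CSP ?F (verts ?F)"
      by (rule wf_digraph.strong_CSP_of_minimal[OF wfF u(1)], rule min, assumption+)+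
    show ?thesis unfolding graded_condition_def
      by (intro disjI1 conjI exI[of _ H] exI[of _ S] gr adm IHS True sc)
  next
    case False
    obtain w y where wy: "C.rigid w" "quot_vertex G H S w * y * quot_vertex G H S w \<notin> J"
      "\<And>J'. idl J' \<Longrightarrow> J \<subset> J' \<Longrightarrow> J' \<subseteq> aug \<Longrightarrow> quot_vertex G H S w * y * quot_vertex G H S w \<in> J'"
      by (rule C.monolithic_rigid_corner[OF z False]) (rule that, simp_all)
    \<comment> \<open>The cycle is set up over I(H,S), where degrees can be computed, and carried
      over to \<open>J\<close> afterwards.\<close>
    obtain c where c: "no_exit_cycle ?F (adm_idl H S :: ('a, 'b, 'k) lpa_free set) const aug
        (quot_vertex G H S) (quot_edge G H S) (quot_ghost G H S) w c"
      using ck_family.no_exit_cycleI[OF quotient_ck_adm_idl[OF adm] wy(1)] .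
    interpret Z: lpa_cycle G H S "adm_idl H S :: ('a, 'b, 'k) lpa_free set" w c
      by (intro lpa_cycle.intro lpa_cycle_axioms.intro wf_digraph c adm refl)
    interpret N: no_exit_cycle ?F J const aug "quot_vertex G H S" "quot_edge G H S" "quot_ghost G H S" w c
      by (rule Z.enlarge_cycle[OF J(1) J0 J(3) nz])
    have K: "N.cofinal" "\<exists>f n. irreducible f \<and> 0 < n \<and> {q. N.ev q \<in> J} = {q. f ^ n dvd q}"
      by (rule N.monolithic_kernel[OF z wy(2)], rule wy(3), assumption+)+
    obtain f n where f: "irreducible f" "0 < n" and ker: "{q. N.ev q \<in> J} = {q. f ^ n dvd q}"
      using K(2) by (elim exE conjE) (rule that)
    define P' where "P' = idl_gen (insert (N.ev f) J)"
    note P' = idl_idl_gen[of "insert (N.ev f) J", folded P'_def]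
      idl_gen_insert_bounds[OF idl_aug J(3) N.ev_C, of f, folded P'_def]
    define P where "P = lpa_of P'"
    have tP: "two_sided_ideal (LPA G) P" unfolding P_def by (rule lpa_of_ideal[OF P'(1)])
    have pP: "pre P = P'" unfolding P_def by (rule pre_lpa_of[OF P'(1) subset_trans[OF J(2) P'(3)] P'(2)])
    note ig = N.irreducible_generated[OF K(1) f ker, folded P'_def]
    have wV: "w \<in> verts ?F" by (rule Z.w_verts)
    have pw: "quot_vertex G H S w \<notin> P'" by (rule ig(1)[OF wV])
    have propP: "proper_ideal (LPA G) P" unfolding proper_pre[OF tP] pP using pw C.p_C[OF wV] by metis
    have primeP: "prime_ideal (LPA G) P"
    proof (rule prime_idealI[OF propP], unfold pP)
      fix J1 J2
      assume a: "idl J1" "idl J2" "J1 \<subseteq> aug" "J2 \<subseteq> aug" "\<And>x y. x \<in> J1 \<Longrightarrow> y \<in> J2 \<Longrightarrow> x * y \<in> P'"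
      show "J1 \<subseteq> P' \<or> J2 \<subseteq> P'" by (rule ig(2)[OF a(1-4)]) (rule a(5))
    qed
    have ngr: "\<not> graded_ideal G P"
    proof
      assume "graded_ideal G P"
      then have h: "\<forall>x\<in>P'. \<forall>n. hom n x \<in> P'" unfolding graded_ideal_iff[OF tP] pP .
      have "f \<noteq> 0" using f(1) by (rule contrapos_pn) simp
      from Z.homogeneous_kernel[OF P'(1) subset_trans[OF J0 P'(3)] h this P'(4)] pw show False by (rule notE[rotated])
    qed
    obtain m where n: "n = Suc m" using gr0_implies_Suc[OF f(2)] by (rule exE)
    have "f ^ n \<in> {q. N.ev q \<in> J}" unfolding ker by simp
    then have fn: "N.ev (f ^ n) \<in> J" by (rule CollectD)
    let ?R = "ideal_power (LPA G) P n"
    have tR: "two_sided_ideal (LPA G) ?R" by (rule ideal_power_two_sided[OF tP])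
    have "pre (ideal_power (LPA G) P (Suc m)) \<subseteq> idl_gen (insert (N.ev (f ^ Suc m)) J)"
      by (rule Z.power_generated[OF J(1) J0 J(3) J(2) _ tP pP[unfolded P'_def]]) (rule nz)
    then have up: "pre ?R \<subseteq> J" unfolding n[symmetric] idl_gen_insert_absorb[OF J(1) fn] .
    have sub': "admissible_relations G H S \<subseteq> pre P" unfolding pP by (rule subset_trans[OF sub P'(3)])
    note pow = admissible_power[OF tP adm sub']
    have R0: "adm_idl H S \<subseteq> pre ?R" unfolding n by (rule idl_gen_least[OF idl_pre[OF ideal_power_two_sided[OF tP]] pow])
    have evR: "N.ev (f ^ n) \<in> pre ?R" unfolding n
      by (rule Z.ev_power[OF tP sub' pow]) (unfold pP, rule P'(4))
    \<comment> \<open>\<open>P^n\<close> lies between I(H,S) and \<open>J\<close>, and it contains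
      all multiples of \<open>f^n\<close>, which are the polynomials in \<open>J\<close>; so
      \<open>cofinal_ideal_eq\<close> applies.\<close>
    have "pre ?R = J"
    proof (rule Z.cofinal_ideal_eq[OF K(1) idl_pre[OF tR] R0 up J(1,3) nz])
      fix q assume "Z.ev q \<in> J"
      then have "q \<in> {q. f ^ n dvd q}" unfolding ker[symmetric] by (rule CollectI)
      then obtain r where q: "q = f ^ n * r" by (auto elim: dvdE)
      show "Z.ev q \<in> pre ?R" unfolding q
        by (rule iffD2[OF Z.eqv_ideal_mem[OF Z.ev_mult idl_pre[OF tR] R0] idl_right[OF idl_pre[OF tR] evR]])
    qed
    then have "lpa_of (pre ?R) = lpa_of (pre I)" unfolding J_def by (rule arg_cong)
    then have IR: "I = ?R" unfolding lpa_of_pre[OF tR] lpa_of_pre[OF tI] by (rule sym)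
    show ?thesis unfolding prime_power_condition_def
      by (intro disjI2 exI[of _ P] exI[of _ n] conjI primeP ngr f(2) IR)
  qed
qed

text \<open>As \<open>P\<close> is not graded, condition (L) fails for its quotient graph. The trace
  of \<open>P\<close> on the polynomials is prime and contains an irreducible \<open>f\<close>; then
  \<open>f^n\<close> is in the trace of \<open>P^n\<close>, which is what \<open>monolithicI\<close>
  asks for.\<close>

lemma prime_power_completely_irreducible:
  fixes I :: "('a, 'b, 'k::field) lpa_elem set"
  assumes I: "proper_ideal (LPA G) I" and pp: "prime_power_condition G I"
  shows "completely_irreducible (LPA G) I"
proof -
  obtain P n where P: "prime_ideal (LPA G) P" "\<not> graded_ideal G P" "0 < n" "I = ideal_power (LPA G) P n"
    using pp unfolding prime_power_condition_def by (elim exE conjE) (rule that)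
  have tI: "two_sided_ideal (LPA G) I" using I unfolding proper_ideal_def by (rule conjunct1)
  have tP: "two_sided_ideal (LPA G) P" using P(1) unfolding prime_ideal_def proper_ideal_def by (elim conjE)
  obtain m where n: "n = Suc m" using gr0_implies_Suc[OF P(3)] by (rule exE)
  define J where "J = pre P"
  note J = idl_pre[OF tP, folded J_def] base_pre[OF tP, folded J_def] pre_aug[of P, folded J_def]
  obtain H S where adm: "admissible_pair G H S" and sub: "admissible_relations G H S \<subseteq> J"
    and nz: "\<And>x. x \<in> verts (quotient_graph G H S) \<Longrightarrow> quot_vertex G H S x \<notin> J"
    by (rule obtain_admissible[OF J(1,2)]) (rule that, simp_all)
  let ?F = "quotient_graph G H S"
  have J0: "adm_idl H S \<subseteq> J" by (rule idl_gen_least[OF J(1) sub])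
  have notgr: "J \<noteq> adm_idl H S"
    using graded_of_adm_idl[OF tP, of H S] P(2) unfolding J_def by (rule contrapos_nn[rotated])
  have wfF: "wf_digraph ?F" by (rule quotient_family.F_wf[OF quotient_family[OF adm J(1) sub]])
  have "\<not> condition_L ?F"
    using notgr by (rule contrapos_nn) (rule condition_L_determined[OF adm _ J(1) sub J(3) nz])
  then obtain w where w: "wf_digraph.rigid ?F w" unfolding wf_digraph.condition_L_iff[OF wfF] by blast
  obtain c where c: "no_exit_cycle ?F (adm_idl H S :: ('a, 'b, 'k) lpa_free set) const aug
      (quot_vertex G H S) (quot_edge G H S) (quot_ghost G H S) w c"
    using ck_family.no_exit_cycleI[OF quotient_ck_adm_idl[OF adm] w] .
  interpret Z: lpa_cycle G H S "adm_idl H S :: ('a, 'b, 'k) lpa_free set" w c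
    by (intro lpa_cycle.intro lpa_cycle_axioms.intro wf_digraph c adm refl)
  interpret N: no_exit_cycle ?F J const aug "quot_vertex G H S" "quot_edge G H S" "quot_ghost G H S" w c
    by (rule Z.enlarge_cycle[OF J(1) J0 J(3) nz])
  have prime: "J1 \<subseteq> J \<or> J2 \<subseteq> J"
    if p: "idl J1" "idl J2" "J \<subseteq> J1" "J \<subseteq> J2" "J1 \<subseteq> aug" "J2 \<subseteq> aug" "\<And>x y. x \<in> J1 \<Longrightarrow> y \<in> J2 \<Longrightarrow> x * y \<in> J"
    for J1 J2 by (rule prime_idealD[OF P(1), folded J_def, OF p(1-6)]) (rule p(7))
  have K1: "N.cofinal" by (rule N.prime_kernel(1), rule prime, simp_all)
  have K2: "N.ev q \<in> J \<or> N.ev r \<in> J" if qr: "N.ev (q * r) \<in> J" for q r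
    by (rule N.prime_kernel(2)[OF _ qr], rule prime, simp_all)
  have "\<exists>f. irreducible f \<and> N.ev f \<in> J"
  proof (rule ccontr)
    assume no: "\<not> (\<exists>f. irreducible f \<and> N.ev f \<in> J)"
    have kz: "{q. N.ev q \<in> J} \<subseteq> {0}"
    proof (rule ccontr)
      assume nz: "\<not> {q. N.ev q \<in> J} \<subseteq> {0}"
      have "\<exists>f. irreducible f \<and> f \<in> {q. N.ev q \<in> J}"
      proof (rule poly_ideal_prime_generator[OF N.kernel_idl[OF J(1) subset_refl] _ _ nz])
        show "1 \<notin> {q. N.ev q \<in> J}" unfolding mem_Collect_eq by (rule N.one_notin_kernel)
        show "q \<in> {q. N.ev q \<in> J} \<or> r \<in> {q. N.ev q \<in> J}" if "q * r \<in> {q. N.ev q \<in> J}" for q r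
          using that unfolding mem_Collect_eq by (rule K2)
      qed
      then show False using no by (simp only: mem_Collect_eq)
    qed
    \<comment> \<open>A zero trace would make \<open>P\<close> equal to I(H,S), which is
      graded.\<close>
    have "adm_idl H S = J"
    proof (rule Z.cofinal_ideal_eq[OF K1 idl_idl_gen subset_refl J0 J(1,3) nz])
      fix q assume "Z.ev q \<in> J"
      then have "q = 0" using kz by blast
      then show "Z.ev q \<in> adm_idl H S" by (simp add: idl_zero[OF idl_idl_gen])
    qed
    with notgr show False by simp
  qed
  then obtain f where f: "irreducible f" "N.ev f \<in> J" by (elim exE conjE) (rule that)
  have sub': "admissible_relations G H S \<subseteq> pre P" using sub unfolding J_def .
  note pow = admissible_power[OF tP adm sub']
  have R0: "adm_idl H S \<subseteq> pre I" unfolding P(4) n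
    by (rule idl_gen_least[OF idl_pre[OF ideal_power_two_sided[OF tP]] pow])
  have evR: "N.ev (f ^ n) \<in> pre I" unfolding P(4) n by (rule Z.ev_power[OF tP sub' pow f(2)[unfolded J_def]])
  have up: "pre I \<subseteq> J" unfolding P(4) n J_def by (rule pre_mono[OF ideal_power_le[OF tP]])
  have nzR: "quot_vertex G H S v \<notin> pre I" if "v \<in> verts ?F" for v using nz[OF that] up by blast
  interpret M: no_exit_cycle ?F "pre I" const aug "quot_vertex G H S" "quot_edge G H S" "quot_ghost G H S" w c
    by (rule Z.enlarge_cycle[OF idl_pre[OF tI] R0 pre_aug nzR])
  show ?thesis using M.monolithicI[OF K1 f(1) evR] unfolding completely_irreducible_iff[OF I] monolithic_def .
qed

text \<open>Under the graded condition \<open>I\<close> is prime, so a power of \<open>P\<close>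
  inside \<open>I\<close> forces \<open>P\<close> inside \<open>I\<close>. Then \<open>P\<close>
  equals \<open>I\<close>, which is graded.\<close>

lemma graded_condition_not_prime_power:
  fixes I :: "('a, 'b, 'k::field) lpa_elem set"
  assumes I: "proper_ideal (LPA G) I" and gr: "graded_condition G I"
  shows "\<not> prime_power_condition G I"
proof
  assume "prime_power_condition G I"
  then obtain P n where P: "prime_ideal (LPA G) P" "\<not> graded_ideal G P" "0 < n" "I = ideal_power (LPA G) P n"
    unfolding prime_power_condition_def by (elim exE conjE) (rule that)
  have tP: "two_sided_ideal (LPA G) P" using P(1) unfolding prime_ideal_def proper_ideal_def by (elim conjE)
  obtain m where n: "n = Suc m" using gr0_implies_Suc[OF P(3)] by (rule exE)
  have prime: "J1 \<subseteq> I \<or> J2 \<subseteq> I"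
    if "two_sided_ideal (LPA G) J1" "two_sided_ideal (LPA G) J2" "ideal_prod (LPA G) J1 J2 \<subseteq> I" for J1 J2
    using graded_condition_completely_irreducible(1)[OF I gr] that unfolding prime_ideal_def by blast
  have descent: "ideal_power (LPA G) P (Suc k) \<subseteq> I \<longrightarrow> P \<subseteq> I" for k
  proof (induction k)
    case (Suc k)
    show ?case
    proof
      assume "ideal_power (LPA G) P (Suc (Suc k)) \<subseteq> I"
      then have "ideal_prod (LPA G) (ideal_power (LPA G) P (Suc k)) P \<subseteq> I" by simp
      from prime[OF ideal_power_two_sided[OF tP] tP this] Suc.IH show "P \<subseteq> I" by (elim disjE) (erule mp)
    qed
  qed simp
  have "P \<subseteq> I" by (rule mp[OF descent[of m]]) (unfold P(4) n, rule subset_refl)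
  moreover have "I \<subseteq> P" unfolding P(4) n by (rule ideal_power_le[OF tP])
  ultimately have "P = I" by (rule equalityI)
  then show False using P(2) gr unfolding graded_condition_def by simp
qed

end

theorem theorem5p5:
  fixes E :: "('v, 'e) pre_digraph"
    and I :: "('v, 'e, 'k::field) lpa_elem set"
  assumes "wf_digraph E" and "verts E \<noteq> {}"
    and "proper_ideal (LPA E) I"
  shows "(completely_irreducible (LPA E) I \<longleftrightarrow>
            (graded_condition E I \<and> \<not> prime_power_condition E I) \<or>
            (\<not> graded_condition E I \<and> prime_power_condition E I)) \<and>
         (graded_condition E I \<longrightarrow> prime_ideal (LPA E) I)"
proof -
  interpret wf_digraph E by (rule assms(1))
  note r = graded_condition_completely_irreducible[OF assms(3)] completely_irreducible_cases[OF assms(3)]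
    prime_power_completely_irreducible[OF assms(3)] graded_condition_not_prime_power[OF assms(3)]
  from r show ?thesis by argo
qed

end
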